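(* Let $p$ be a prime, $n\ge 1$, let $K$ be a local field of characteristic $p$, and let $L/K$ (inside $K^{sep}$) be a totally ramified Galois extension with $\mathrm{Gal}(L/K)\cong C_{p^n}$, with lower ramification breaks $b_1<b_2<\cdots<b_n$ and upper ramification breaks $u_1<u_2<\cdots<u_n$. Let $\vec{\beta}=(\beta_0,\beta_1,\ldots,\beta_{n-1})\in W_n(K)$ be a reduced Witt vector which corresponds to $L/K$, and set $\beta=\beta_0$. Assume that there are $\omega_i,\delta_i\in K$ for $1\le i\le n-1$ such that $$\beta_i=\beta\,\omega_i^{p^{n-1}}+\delta_i,\qquad v_K(\delta_i)>v_K(\beta_i)\qquad(1\le i\le n-1),$$ and assume further that for $1\le i\le n-1$ $$b_{i+1}>p^nu_i\qquad\text{and}\qquad b_{i+1}>-p^{n-1}v_K(\delta_i).$$ Then there is a Galois scaffold $(\{\Psi_i\},\{\lambda_t\})$ for $L/K$ with precision $$\mathfrak{c}=\min\{b_{i+1}-p^nu_i:1\le i\le n-1\}\ge 1.$$ (For $n=1$ the set is empty, and the assertion is that $L/K$ has a Galois scaffold with precision $\mathfrak c$ for every integer $\mathfrak c\ge 1$.)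
   Context: Notation. $K^{sep}$ is a separable closure of $K$. For a finite subextension $F/K$ of $K^{sep}/K$, $v_F$ is the valuation on $K^{sep}$ normalized so that $v_F(F^\times)=\mathbb{Z}$ (with $v_F(0)=\infty$), $\mathcal{O}_F$ is the ring of integers of $F$ and $\mathcal{M}_F$ its maximal ideal. Ramification breaks are as in Serre's Local Fields. Witt vectors. $W_n(R)$ is the ring of ($p$-typical) Witt vectors of length $n$ over $R$, with coordinates indexed by $0,\ldots,n-1$, and $\oplus$ is Witt vector addition. Let $\phi(x)=x^p$ on $K^{sep}$, acting coordinatewise on vectors. A Witt vector $\vec\beta\in W_n(K)$ corresponds to $L/K$ (under Artin-Schreier-Witt theory) if $L$ is generated over $K$ by the coordinates of any solution $\vec{x}\in W_n(K^{sep})$ of $\phi(\vec{x})=\vec{x}\oplus\vec\beta$. The vector $\vec\beta$ is reduced if for each $0\le i\le n-1$ either $v_K(\beta_i)\ge 0$ or $p\nmid v_K(\beta_i)$. Galois scaffold. Let $L/K$ be a totally ramified Galois extension of degree $p^n$ with $G=\mathrm{Gal}(L/K)$ and lower ramification breaks $b_1\le\cdots\le b_n$ (counted with multiplicity), $p\nmid b_i$ for all $i$. Let $\mathbb{S}_{p^n}=\{0,1,\ldots,p^n-1\}$ and write $s\in\mathbb{S}_{p^n}$ in base $p$ as $s=\sum_{k=0}^{n-1}s_{(k)}p^k$ with $0\le s_{(k)}<p$. Define $\mathfrak{b}:\mathbb{S}_{p^n}\to\mathbb{Z}$ by $\mathfrak{b}(s)=s_{(0)}p^0b_n+s_{(1)}p^1b_{n-1}+\cdots+s_{(n-1)}p^{n-1}b_1$.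 Let $r:\mathbb{Z}\to\mathbb{S}_{p^n}$ send $t$ to its least nonnegative residue modulo $p^n$. The map $r\circ(-\mathfrak{b}):\mathbb{S}_{p^n}\to\mathbb{S}_{p^n}$ is a bijection; let $\mathfrak{a}$ be its inverse, extended to $\mathbb{Z}$ by $\mathfrak{a}(t)=\mathfrak{a}(r(t))$. For $\mathfrak{c}\ge1$, a Galois scaffold $(\{\Psi_i\},\{\lambda_t\})$ for $L/K$ with precision $\mathfrak{c}$ consists of elements $\Psi_i\in K[G]$ for $1\le i\le n$ and $\lambda_t\in L$ for all $t\in\mathbb{Z}$ such that: (i) $v_L(\lambda_t)=t$ for all $t\in\mathbb{Z}$; (ii) $\lambda_{t_1}\lambda_{t_2}^{-1}\in K$ whenever $t_1\equiv t_2\pmod{p^n}$; (iii) $\Psi_i(1)=0$ for $1\le i\le n$; (iv) for each $1\le i\le n$ and $t\in\mathbb{Z}$ there exists $u_{it}\in\mathcal{O}_K^\times$ such that, modulo $\lambda_{t+p^{n-i}b_i}\mathcal{M}_L^{\mathfrak{c}}$, $\Psi_i(\lambda_t)\equiv u_{it}\lambda_{t+p^{n-i}b_i}$ if $\mathfrak{a}(t)_{(n-i)}\ge1$, and $\Psi_i(\lambda_t)\equiv0$ if $\mathfrak{a}(t)_{(n-i)}=0$. Here $\Psi_i$ acts on $L$ through the natural action of $K[G]$. *)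

theory Defs
  imports
    "HOL-Analysis.Analysis"
    "HOL-Library.Poly_Mapping"
    "HOL-Algebra.Algebraic_Closure_Type"
    "HOL-Number_Theory.Cong"
    "HOL-Algebra.Generated_Fields"
    "HOL-Algebra.Elementary_Groups"
    "HOL-Algebra.Bij"
begin

text \<open>The separable closure of the base field is a whole type \<open>'a :: field\<close>; the base field \<open>K\<close> and
  its extensions are subfields of that type, given by their carriers.\<close>

abbreviation is_subfield :: "'a::field set \<Rightarrow> bool" where
  "is_subfield F \<equiv> subfield F (ring_of_type_algebra :: 'a ring)"

definition separable_poly :: "'a::field Polynomial.poly \<Rightarrow> bool" where
  "separable_poly f \<longleftrightarrow> coprime f (Polynomial.pderiv f)"

text \<open>Every element of \<open>'a\<close> is separable algebraic over \<open>K\<close> (that is, a root of a separable polynomial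
  over \<open>K\<close>), and \<open>'a\<close> has no proper separable algebraic extension.\<close>

definition UNIV_is_separable_closure :: "'a::field set \<Rightarrow> bool" where
  "UNIV_is_separable_closure K \<longleftrightarrow>
     (\<forall>x. \<exists>f. (\<forall>i. Polynomial.coeff f i \<in> K) \<and> separable_poly f \<and> Polynomial.poly f x = 0) \<and>
     (\<forall>f :: 'a Polynomial.poly. Polynomial.degree f > 0 \<and> separable_poly f \<longrightarrow>
        (\<exists>x. Polynomial.poly f x = 0))"


definition valuation :: "('a::field \<Rightarrow> ereal) \<Rightarrow> bool" where
  "valuation v \<longleftrightarrow>
     (\<forall>x. v x = \<infinity> \<longleftrightarrow> x = 0) \<and> (\<forall>x. v x \<noteq> -\<infinity>) \<and>
     (\<forall>x y. v (x * y) = v x + v y) \<and> (\<forall>x y. min (v x) (v y) \<le> v (x + y))"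

definition normalized_on :: "('a::field \<Rightarrow> ereal) \<Rightarrow> 'a set \<Rightarrow> bool" where
  "normalized_on v F \<longleftrightarrow> valuation v \<and> v ` (F - {0}) = range (\<lambda>k::int. ereal (of_int k))"

text \<open>\<open>normalized_val v F\<close> is \<open>v\<^sub>F\<close>: the positive multiple of \<open>v\<close> with \<open>v\<^sub>F(F\<^sup>\<times>) = \<int>\<close>.\<close>

definition normalized_val :: "('a::field \<Rightarrow> ereal) \<Rightarrow> 'a set \<Rightarrow> 'a \<Rightarrow> ereal" where
  "normalized_val v F =
     (THE w. normalized_on w F \<and> (\<exists>c::real. c > 0 \<and> (\<forall>x. w x = ereal c * v x)))"

definition int_ring :: "('a::field \<Rightarrow> ereal) \<Rightarrow> 'a set \<Rightarrow> 'a set" where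
  "int_ring v F = {x \<in> F. v x \<ge> 0}"

definition max_ideal :: "('a::field \<Rightarrow> ereal) \<Rightarrow> 'a set \<Rightarrow> 'a set" where
  "max_ideal v F = {x \<in> F. v x > 0}"

text \<open>The \<open>c\<close>-th power of the maximal ideal; here \<open>v\<close> is meant to be normalized on \<open>F\<close>.\<close>

definition max_ideal_power :: "('a::field \<Rightarrow> ereal) \<Rightarrow> 'a set \<Rightarrow> nat \<Rightarrow> 'a set" where
  "max_ideal_power v F c = {x \<in> F. v x \<ge> ereal (real c)}"

definition complete_field :: "('a::field \<Rightarrow> ereal) \<Rightarrow> 'a set \<Rightarrow> bool" where
  "complete_field v F \<longleftrightarrow>
     (\<forall>s :: nat \<Rightarrow> 'a. range s \<subseteq> F \<and>
        (\<forall>C::real. \<exists>N. \<forall>i\<ge>N. \<forall>j\<ge>N. v (s i - s j) \<ge> ereal C) \<longrightarrow>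
        (\<exists>l\<in>F. \<forall>C::real. \<exists>N. \<forall>i\<ge>N. v (s i - l) \<ge> ereal C))"

definition residue_field :: "('a::field \<Rightarrow> ereal) \<Rightarrow> 'a set \<Rightarrow> 'a set set" where
  "residue_field v F =
     int_ring v F // {(x, y). x \<in> int_ring v F \<and> y \<in> int_ring v F \<and> x - y \<in> max_ideal v F}"

text \<open>A nonarchimedean local field \<open>K\<close>; \<open>v\<close> is the valuation \<open>v\<^sub>K\<close>, already extended to all of \<open>'a\<close>.\<close>

definition local_field :: "('a::field \<Rightarrow> ereal) \<Rightarrow> 'a set \<Rightarrow> bool" where
  "local_field v K \<longleftrightarrow>
     is_subfield K \<and> normalized_on v K \<and> complete_field v K \<and> finite (residue_field v K)"


definition galois_group :: "'a::field set \<Rightarrow> 'a set \<Rightarrow> ('a \<Rightarrow> 'a) monoid" where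
  "galois_group L K = (BijGroup L)\<lparr>carrier :=
     {\<sigma> \<in> Bij L. (\<forall>x\<in>L. \<forall>y\<in>L. \<sigma> (x + y) = \<sigma> x + \<sigma> y \<and> \<sigma> (x * y) = \<sigma> x * \<sigma> y) \<and>
                 (\<forall>x\<in>K. \<sigma> x = x)}\<rparr>"

definition galois_extension :: "'a::field set \<Rightarrow> 'a set \<Rightarrow> bool" where
  "galois_extension L K \<longleftrightarrow>
     is_subfield K \<and> is_subfield L \<and> K \<subseteq> L \<and>
     (\<forall>x\<in>L. \<exists>f. f \<noteq> 0 \<and> (\<forall>i. Polynomial.coeff f i \<in> K) \<and> Polynomial.poly f x = 0) \<and>
     {x \<in> L. \<forall>\<sigma> \<in> carrier (galois_group L K). \<sigma> x = x} = K"

text \<open>The residue field extension is trivial.\<close>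

definition totally_ramified :: "('a::field \<Rightarrow> ereal) \<Rightarrow> 'a set \<Rightarrow> 'a set \<Rightarrow> bool" where
  "totally_ramified v L K \<longleftrightarrow> (\<forall>x \<in> int_ring v L. \<exists>y \<in> int_ring v K. x - y \<in> max_ideal v L)"


text \<open>Ramification groups as in Serre's \<^emph>\<open>Local Fields\<close>, Chapter IV: \<open>G\<^sub>u = G\<^sub>i\<close> with
  \<open>i = \<lceil>u\<rceil>\<close> for real \<open>u \<ge> -1\<close>, the Herbrand function \<open>\<phi>(u) = \<integral>\<^sub>0\<^sup>u dt / (G\<^sub>0 : G\<^sub>t)\<close>, which is \<open>u\<close>
  for \<open>-1 \<le> u \<le> 0\<close> by convention, and \<open>G\<^sup>u = G\<^sub>\<psi>\<^sub>(\<^sub>u\<^sub>)\<close> with \<open>\<psi>\<close> the inverse of \<open>\<phi>\<close>.\<close>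

definition lower_ram :: "('a::field \<Rightarrow> ereal) \<Rightarrow> 'a set \<Rightarrow> 'a set \<Rightarrow> real \<Rightarrow> ('a \<Rightarrow> 'a) set" where
  "lower_ram v L K u =
     {\<sigma> \<in> carrier (galois_group L K).
        \<forall>x \<in> int_ring v L. normalized_val v L (\<sigma> x - x) \<ge> ereal (of_int (\<lceil>u\<rceil> + 1))}"

definition herbrand_phi :: "('a::field \<Rightarrow> ereal) \<Rightarrow> 'a set \<Rightarrow> 'a set \<Rightarrow> real \<Rightarrow> real" where
  "herbrand_phi v L K u =
     (if u \<le> 0 then u
      else integral {0..u} (\<lambda>t. real (card (lower_ram v L K t)) / real (card (lower_ram v L K 0))))"

definition herbrand_psi :: "('a::field \<Rightarrow> ereal) \<Rightarrow> 'a set \<Rightarrow> 'a set \<Rightarrow> real \<Rightarrow> real" where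
  "herbrand_psi v L K = inv_into {-1..} (herbrand_phi v L K)"

definition upper_ram :: "('a::field \<Rightarrow> ereal) \<Rightarrow> 'a set \<Rightarrow> 'a set \<Rightarrow> real \<Rightarrow> ('a \<Rightarrow> 'a) set" where
  "upper_ram v L K u = lower_ram v L K (herbrand_psi v L K u)"

definition breaks :: "(real \<Rightarrow> 'b set) \<Rightarrow> real set" where
  "breaks G = {t. t \<ge> -1 \<and> (\<forall>\<epsilon>>0. G (t + \<epsilon>) \<noteq> G t)}"


text \<open>Integer polynomials in the variables \<open>X\<^sub>i\<close> (\<open>Inl i\<close>) and \<open>Y\<^sub>i\<close> (\<open>Inr i\<close>), \<open>i \<ge> 0\<close>.\<close>

type_synonym witt_poly = "((nat + nat) \<Rightarrow>\<^sub>0 nat) \<Rightarrow>\<^sub>0 int"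

definition witt_var :: "nat + nat \<Rightarrow> witt_poly" where
  "witt_var z = Poly_Mapping.single (Poly_Mapping.single z 1) 1"

definition witt_poly_eval :: "(nat + nat \<Rightarrow> 'a::comm_ring_1) \<Rightarrow> witt_poly \<Rightarrow> 'a" where
  "witt_poly_eval \<rho> P =
     (\<Sum>m \<in> Poly_Mapping.keys P. of_int (Poly_Mapping.lookup P m) *
        (\<Prod>z \<in> Poly_Mapping.keys m. \<rho> z ^ Poly_Mapping.lookup m z))"

definition ghost :: "nat \<Rightarrow> (nat \<Rightarrow> 'r::comm_ring_1) \<Rightarrow> nat \<Rightarrow> 'r" where
  "ghost p x k = (\<Sum>i\<le>k. of_nat (p ^ i) * x i ^ (p ^ (k - i)))"

text \<open>Witt's theorem: there is a unique sequence of integer polynomials whose ghost components are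
  the sums of those of \<open>X\<close> and \<open>Y\<close>.\<close>

definition witt_add_poly :: "nat \<Rightarrow> nat \<Rightarrow> witt_poly" where
  "witt_add_poly p =
     (THE S. \<forall>k. ghost p S k =
        ghost p (\<lambda>i. witt_var (Inl i)) k + ghost p (\<lambda>i. witt_var (Inr i)) k)"

definition witt_vecs :: "nat \<Rightarrow> 'a set \<Rightarrow> (nat \<Rightarrow> 'a) set" where
  "witt_vecs n R = {..<n} \<rightarrow>\<^sub>E R"

definition witt_add :: "nat \<Rightarrow> nat \<Rightarrow> (nat \<Rightarrow> 'a::comm_ring_1) \<Rightarrow> (nat \<Rightarrow> 'a) \<Rightarrow> nat \<Rightarrow> 'a" where
  "witt_add p n x y = (\<lambda>k\<in>{..<n}. witt_poly_eval (case_sum x y) (witt_add_poly p k))"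

definition witt_phi :: "nat \<Rightarrow> nat \<Rightarrow> (nat \<Rightarrow> 'a::comm_ring_1) \<Rightarrow> nat \<Rightarrow> 'a" where
  "witt_phi p n x = (\<lambda>k\<in>{..<n}. x k ^ p)"

definition witt_corresponds :: "nat \<Rightarrow> nat \<Rightarrow> 'a::field set \<Rightarrow> 'a set \<Rightarrow> (nat \<Rightarrow> 'a) \<Rightarrow> bool" where
  "witt_corresponds p n K L \<beta> \<longleftrightarrow>
     \<beta> \<in> witt_vecs n K \<and>
     (\<forall>x \<in> witt_vecs n UNIV. witt_phi p n x = witt_add p n x \<beta> \<longrightarrow>
        L = generate_field (ring_of_type_algebra :: 'a ring) (K \<union> x ` {..<n}))"

definition witt_reduced :: "('a \<Rightarrow> ereal) \<Rightarrow> nat \<Rightarrow> nat \<Rightarrow> (nat \<Rightarrow> 'a) \<Rightarrow> bool" where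
  "witt_reduced v p n \<beta> \<longleftrightarrow>
     (\<forall>i<n. v (\<beta> i) \<ge> 0 \<or> (\<exists>m::int. v (\<beta> i) = ereal (of_int m) \<and> \<not> int p dvd m))"


definition digit :: "nat \<Rightarrow> nat \<Rightarrow> nat \<Rightarrow> nat" where
  "digit p k s = s div p ^ k mod p"

definition scaffold_b :: "nat \<Rightarrow> nat \<Rightarrow> (nat \<Rightarrow> int) \<Rightarrow> nat \<Rightarrow> int" where
  "scaffold_b p n b s = (\<Sum>k<n. int (digit p k s) * int (p ^ k) * b (n - k))"

definition residue_mod :: "nat \<Rightarrow> nat \<Rightarrow> int \<Rightarrow> nat" where
  "residue_mod p n t = nat (t mod int (p ^ n))"

definition scaffold_a :: "nat \<Rightarrow> nat \<Rightarrow> (nat \<Rightarrow> int) \<Rightarrow> int \<Rightarrow> nat" where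
  "scaffold_a p n b t =
     inv_into {..<p ^ n} (\<lambda>s. residue_mod p n (- scaffold_b p n b s)) (residue_mod p n t)"

definition group_ring :: "'a set \<Rightarrow> ('g, 'm) monoid_scheme \<Rightarrow> ('g \<Rightarrow> 'a) set" where
  "group_ring K G = carrier G \<rightarrow>\<^sub>E K"

definition group_ring_act :: "('a \<Rightarrow> 'a, 'm) monoid_scheme \<Rightarrow> (('a \<Rightarrow> 'a) \<Rightarrow> 'a) \<Rightarrow> 'a \<Rightarrow> 'a::field" where
  "group_ring_act G \<Psi> x = (\<Sum>\<sigma>\<in>carrier G. \<Psi> \<sigma> * \<sigma> x)"

definition cong_mod :: "'a::field \<Rightarrow> 'a \<Rightarrow> 'a set \<Rightarrow> bool" where
  "cong_mod x y I \<longleftrightarrow> x - y \<in> I"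

text \<open>\<open>v\<close> is normalized on \<open>K\<close>, and \<open>b 1, \<dots>, b n\<close> are the lower ramification breaks of \<open>L/K\<close>.\<close>

definition galois_scaffold ::
  "nat \<Rightarrow> nat \<Rightarrow> ('a::field \<Rightarrow> ereal) \<Rightarrow> 'a set \<Rightarrow> 'a set \<Rightarrow> (nat \<Rightarrow> int) \<Rightarrow> nat \<Rightarrow>
     (nat \<Rightarrow> ('a \<Rightarrow> 'a) \<Rightarrow> 'a) \<Rightarrow> (int \<Rightarrow> 'a) \<Rightarrow> bool" where
  "galois_scaffold p n v K L b c \<Psi> lam \<longleftrightarrow>
     (let vL = normalized_val v L; act = group_ring_act (galois_group L K) in
     (\<forall>i\<in>{1..n}. \<Psi> i \<in> group_ring K (galois_group L K)) \<and>
     (\<forall>t. lam t \<in> L) \<and>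
     (\<forall>t. vL (lam t) = ereal (of_int t)) \<and>
     (\<forall>t1 t2. [t1 = t2] (mod int (p ^ n)) \<longrightarrow> lam t1 * inverse (lam t2) \<in> K) \<and>
     (\<forall>i\<in>{1..n}. act (\<Psi> i) 1 = 0) \<and>
     (\<forall>i\<in>{1..n}. \<forall>t. \<exists>u\<in>K. v u = 0 \<and>
        (let l = lam (t + int (p ^ (n - i)) * b i);
             I = (\<lambda>z. l * z) ` max_ideal_power vL L c;
             d = digit p (n - i) (scaffold_a p n b t)
         in (d \<ge> 1 \<longrightarrow> cong_mod (act (\<Psi> i) (lam t)) (u * l) I) \<and>
            (d = 0 \<longrightarrow> cong_mod (act (\<Psi> i) (lam t)) 0 I))))"

end

theory Submission
  imports Defs
begin

text \<open>
  Let \<open>x\<^sub>i\<close> be the coordinates of a solution of the Artin-Schreier-Witt equation. Because \<open>\<beta>\<^sub>i\<close> is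
  \<open>\<beta>\<close> times a \<open>p\<^sup>n\<^sup>-\<^sup>1\<close>-th power up to a small error, the leading terms of the \<open>x\<^sub>l\<close> can be
  eliminated successively by \<open>K\<close>-linear combinations \<open>Y\<^sub>j = x\<^sub>j + \<Sum>\<^bsub>l<j\<^esub> T\<^sub>j\<^sub>l x\<^sub>l\<close> whose
  valuation is \<open>-b\<^sub>j\<close> (normalised on the field generated by \<open>x\<^sub>1, \<dots>, x\<^sub>j\<close>), which is prime to \<open>p\<close>. An
  element moved by exactly \<open>1\<close> cannot have larger valuation, and this is what relates the reduced
  Witt vector to the ramification breaks. Suitable generators \<open>\<sigma>\<^sub>i\<close> of the ramification subgroups fix
  \<open>Y\<^sub>j\<close> for \<open>j < i\<close>, send \<open>Y\<^sub>i\<close> to \<open>Y\<^sub>i + 1\<close>, and move \<open>Y\<^sub>j\<close> for \<open>j > i\<close> by an element of \<open>K\<close>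
  up to an error which is small because the carry polynomials of Witt addition are isobaric.

  By Vandermonde's identity \<open>\<sigma>\<^sub>i - 1\<close> lowers \<open>d\<^sub>i\<close> by \<open>1\<close> in \<open>\<Prod>\<^sub>j (Y\<^sub>j choose d\<^sub>j)\<close>, up to a
  small error, once \<open>\<sigma>\<^sub>i\<close> has been corrected by truncated powers of the operators already constructed for
  \<open>j > i\<close>. These products take all valuations modulo \<open>p\<^sup>n\<close>, and scaled by powers of a uniformizer
  of \<open>K\<close> they are the \<open>\<lambda>\<^sub>t\<close>.
\<close>

section \<open>Valuations\<close>

text \<open>All values, also those in intermediate fields, are real numbers in the normalisation of
  \<open>K\<close>, so nothing is rescaled along the tower. Intermediate fields are just the sets
  fixed by \<open>\<sigma> ^^ (p ^ j)\<close> for a generator \<open>\<sigma>\<close> of the Galois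
  group. Since \<open>v\<close> is merely some extension of the valuation of \<open>K\<close>, its
  invariance under \<open>\<sigma>\<close> has to be derived from completeness. The main obstacle is
  circularity: the identity u_i = -v(\<beta>_(i-1)), the primality of b_i to p, and the values of
  the Y_j and of their coefficients depend on one another. One induction (\<open>asw_values\<close>)
  proves them together: the value of \<beta>_j predicts a candidate for the next lower break, and
  the effect of a power of \<open>\<sigma>\<close> on Y_j identifies the candidate with the break.
  The difference b_(i+1) - p^n u_i weighs the term b_(i+1)/p^j in the value of a coefficient of Y_j
  against the loss u_i caused by the displacement of a Witt coordinate, in the worst case j = n
  (\<open>eps_vge\<close>).\<close>

locale valued =
  fixes v :: "'a::field \<Rightarrow> ereal"
  assumes val: "valuation v"
begin

text \<open>With real bounds, \<open>ereal\<close> arithmetic stays confined to the first lemmas.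
  Zero satisfies every \<open>vge\<close> and no \<open>veq\<close>.\<close>

definition vge :: "'a \<Rightarrow> real \<Rightarrow> bool" where "vge x r \<longleftrightarrow> ereal r \<le> v x"
definition veq :: "'a \<Rightarrow> real \<Rightarrow> bool" where "veq x r \<longleftrightarrow> v x = ereal r"

lemma v_eq_inf: "v x = \<infinity> \<longleftrightarrow> x = 0"
  and v_not_minf: "v x \<noteq> -\<infinity>"
  and v_mult: "v (x * y) = v x + v y"
  and v_add: "min (v x) (v y) \<le> v (x + y)"
  using val unfolding valuation_def by blast+

lemma vge_0 [simp]: "vge 0 r"
  using v_eq_inf[of 0] by (simp add: vge_def)

lemma ex_veq: assumes "x \<noteq> 0" obtains r where "veq x r"
  using v_eq_inf[of x] v_not_minf[of x] assms by (cases "v x") (auto simp: veq_def)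

lemma veq_nz: "veq x r \<Longrightarrow> x \<noteq> 0"
  using v_eq_inf[of x] by (auto simp: veq_def)

lemma veq_unique: "veq x r \<Longrightarrow> veq x s \<Longrightarrow> r = s"
  by (auto simp: veq_def)

lemma veq_vge: "veq x r \<Longrightarrow> s \<le> r \<Longrightarrow> vge x s"
  by (auto simp: veq_def vge_def)

lemma vge_veq_le: "vge x s \<Longrightarrow> veq x r \<Longrightarrow> s \<le> r"
  by (auto simp: veq_def vge_def)

lemma vge_mono: "vge x r \<Longrightarrow> s \<le> r \<Longrightarrow> vge x s"
  unfolding vge_def by (meson ereal_less_eq(3) order_trans)

lemma veq_mult: "veq x r \<Longrightarrow> veq y s \<Longrightarrow> veq (x * y) (r + s)"
  by (simp add: veq_def v_mult)

lemma vge_mult: "vge x r \<Longrightarrow> vge y s \<Longrightarrow> vge (x * y) (r + s)"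
  unfolding vge_def v_mult using add_mono[of "ereal r" "v x" "ereal s" "v y"] by simp

lemma vge_veq_eqI:
  assumes "\<And>s. veq x s \<Longrightarrow> r \<le> s" shows "vge x r"
proof (cases "x = 0")
  case False
  then obtain s where "veq x s" by (rule ex_veq)
  with assms show ?thesis by (auto intro: veq_vge)
qed simp

lemma vge_add: "vge x r \<Longrightarrow> vge y r \<Longrightarrow> vge (x + y) r"
  unfolding vge_def using v_add[of x y] by (meson min.bounded_iff order_trans)

lemma veq_1 [simp]: "veq 1 0"
proof -
  obtain r where r: "veq (1::'a) r" by (rule ex_veq[of 1]) auto
  from veq_mult[OF r r] have "veq (1::'a) (r + r)" by simp
  with r have "r = r + r" by (rule veq_unique)
  with r show ?thesis by simp
qed

lemma veq_m1 [simp]: "veq (- 1) 0"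
proof -
  obtain r where r: "veq (-1::'a) r" by (rule ex_veq[of "-1"]) auto
  from veq_mult[OF r r] have "veq (1::'a) (r + r)" by simp
  with veq_1 have "0 = r + r" by (rule veq_unique)
  with r show ?thesis by simp
qed

lemma vge_uminus_iff [simp]: "vge (- x) r \<longleftrightarrow> vge x r"
  using vge_mult[OF veq_vge[OF veq_m1 order_refl], of x r]
        vge_mult[OF veq_vge[OF veq_m1 order_refl], of "-x" r] by auto

lemma veq_uminus_iff [simp]: "veq (- x) r \<longleftrightarrow> veq x r"
  using veq_mult[OF veq_m1, of x r] veq_mult[OF veq_m1, of "-x" r] by auto

lemma vge_diff: "vge x r \<Longrightarrow> vge y r \<Longrightarrow> vge (x - y) r"
  using vge_add[of x r "-y"] by simp

lemma vge_diff_commute: "vge (x - y) r \<longleftrightarrow> vge (y - x) r"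
  using vge_uminus_iff[of "x - y" r] by simp

lemma vge_sum: "(\<And>i. i \<in> I \<Longrightarrow> vge (f i) r) \<Longrightarrow> vge (sum f I) r"
  by (induction I rule: infinite_finite_induct) (auto intro: vge_add)

lemma veq_power: "veq x r \<Longrightarrow> veq (x ^ n) (real n * r)"
proof (induction n)
  case (Suc n)
  then have "veq (x * x ^ n) (r + real n * r)" by (intro veq_mult) auto
  then show ?case by (simp add: algebra_simps)
qed simp

lemma vge_power: "vge x r \<Longrightarrow> vge (x ^ n) (real n * r)"
proof (induction n)
  case 0 show ?case using veq_vge[OF veq_1] by simp
next
  case (Suc n)
  then have "vge (x * x ^ n) (r + real n * r)" by (intro vge_mult) auto
  then show ?case by (simp add: algebra_simps)
qed

lemma veq_inverse: assumes "veq x r" shows "veq (inverse x) (- r)"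
proof -
  have "x \<noteq> 0" using assms by (rule veq_nz)
  then have "inverse x \<noteq> 0" by simp
  then obtain s where s: "veq (inverse x) s" by (rule ex_veq)
  from veq_mult[OF assms s] \<open>x \<noteq> 0\<close> have "veq (1::'a) (r + s)" by simp
  with veq_1 have "0 = r + s" by (rule veq_unique)
  then have "s = - r" by linarith
  with s show ?thesis by simp
qed

lemma veq_divide: "veq x r \<Longrightarrow> veq y s \<Longrightarrow> veq (x / y) (r - s)"
  using veq_mult[of x r "inverse y" "-s"] veq_inverse[of y s] by (simp add: divide_inverse)

lemma vge_divide: "vge x r \<Longrightarrow> veq y s \<Longrightarrow> vge (x / y) (r - s)"
  using vge_mult[of x r "inverse y" "-s"] veq_vge[OF veq_inverse[of y s]]
  by (simp add: divide_inverse)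

lemma veq_power_int: "veq x r \<Longrightarrow> veq (power_int x k) (of_int k * r)"
  using veq_power[of x r "nat k"] veq_power[OF veq_inverse[of x r], of "nat (-k)"]
  by (cases "k \<ge> 0") (auto simp: power_int_def)

lemma vge_all_0: assumes "\<And>C. vge x C" shows "x = 0"
proof (rule ccontr)
  assume "x \<noteq> 0"
  then obtain r where "veq x r" by (rule ex_veq)
  with assms[of "r + 1"] vge_veq_le show False by fastforce
qed

lemma veq_add_dom: assumes "veq x r" "vge y s" "r < s" shows "veq (x + y) r"
proof -
  have "x + y \<noteq> 0"
  proof
    assume "x + y = 0"
    then have "y = - x" by (simp add: add_eq_0_iff)
    with assms vge_veq_le[of y s r] show False by simp
  qed
  then obtain t where t: "veq (x + y) t" by (rule ex_veq)
  have "vge (x + y) r" using assms by (intro vge_add) (auto intro: veq_vge vge_mono)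
  then have "r \<le> t" using t by (rule vge_veq_le)
  moreover have "t \<le> r"
  proof (rule ccontr)
    assume "\<not> t \<le> r"
    define q where "q = min s t"
    have "vge (x + y - y) q" using t assms by (intro vge_diff) (auto intro: veq_vge vge_mono simp: q_def)
    then have "q \<le> r" using assms(1) vge_veq_le by fastforce
    with \<open>\<not> t \<le> r\<close> assms show False by (simp add: q_def)
  qed
  ultimately show ?thesis using t by simp
qed

lemma veq_close: "veq x r \<Longrightarrow> vge (y - x) s \<Longrightarrow> r < s \<Longrightarrow> veq y r"
  using veq_add_dom[of x r "y - x" s] by simp

lemma vge_of_nat [simp]: "vge (of_nat k) 0"
  by (induction k) (auto intro: vge_add veq_vge[OF veq_1])

lemma vge_of_int [simp]: "vge (of_int k) 0"
  by (cases k rule: int_cases2) auto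

lemma vge_prod: "(\<And>k. k \<in> I \<Longrightarrow> vge (f k) (A k)) \<Longrightarrow> vge (prod f I) (sum A I)"
  by (induction I rule: infinite_finite_induct)
     (auto intro: vge_mult veq_vge[OF veq_1])

lemma veq_prod: "(\<And>k. k \<in> I \<Longrightarrow> veq (f k) (A k)) \<Longrightarrow> veq (prod f I) (sum A I)"
  by (induction I rule: infinite_finite_induct) (auto intro: veq_mult)

text \<open>\<open>R\<close> is a relative error, measured above the nominal values \<open>A\<close>
  and \<open>B\<close>. In this form errors pass unchanged through products of any length.\<close>

lemma mult_lipschitz:
  assumes "vge a A" "vge b B" "vge a' A" "vge b' B" "vge (a - a') (A + R)" "vge (b - b') (B + R)"
  shows "vge (a * b - a' * b') (A + B + R)"
proof -
  have "vge ((a - a') * b) (A + R + B)" "vge (a' * (b - b')) (A + (B + R))"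
    using assms by (auto intro: vge_mult)
  then have "vge ((a - a') * b + a' * (b - b')) (A + B + R)"
    by (intro vge_add) (auto simp: algebra_simps)
  then show ?thesis by (simp add: algebra_simps)
qed

lemma prod_lipschitz:
  assumes "\<And>k. k \<in> I \<Longrightarrow> vge (f k) (A k)" "\<And>k. k \<in> I \<Longrightarrow> vge (g k) (A k)"
    "\<And>k. k \<in> I \<Longrightarrow> vge (f k - g k) (A k + R)"
  shows "vge (prod f I - prod g I) (sum A I + R)"
  using assms
proof (induction I rule: infinite_finite_induct)
  case (insert k I)
  have "vge (f k * prod f I - g k * prod g I) (A k + sum A I + R)"
    using insert by (intro mult_lipschitz vge_prod) auto
  then show ?case using insert by simp
qed auto

lemma power_lipschitz:
  assumes "vge a A" "vge b A" "vge (a - b) (A + R)"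
  shows "vge (a ^ m - b ^ m) (real m * A + R)"
  using prod_lipschitz[of "{..<m}" "\<lambda>_. a" "\<lambda>_. A" "\<lambda>_. b" R] assms by simp

lemma sum_eq_ge:
  assumes "finite I" "i0 \<in> I" "veq (f i0) r" "\<And>i. i \<in> I \<Longrightarrow> i \<noteq> i0 \<Longrightarrow> vge (f i) s" "r < s"
  shows "veq (sum f I) r"
proof -
  have "veq (f i0 + sum f (I - {i0})) r"
    using assms by (intro veq_add_dom[of _ _ _ s] vge_sum) auto
  then show ?thesis using assms(1,2) by (simp add: sum.remove)
qed

text \<open>If \<open>v x < 0\<close>, the term \<open>x ^ p\<close> dominates and
  \<open>v y = p * v x\<close>; otherwise the bound is trivial because
  \<open>r \<le> 0\<close>.\<close>

lemma artin_schreier_vge: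
  assumes "x ^ p - x = y" "vge y r" "p \<ge> 2" "r \<le> 0"
  shows "vge x (r / real p)"
proof (rule vge_veq_eqI)
  fix s assume s: "veq x s"
  show "r / real p \<le> s"
  proof (cases "s < 0")
    case True
    have "real p \<ge> 2" using \<open>p \<ge> 2\<close> by simp
    then have "real p * s \<le> 2 * s" using True by (intro mult_right_mono_neg) auto
    then have "real p * s < s" using True by linarith
    have "veq (x ^ p + - x) (real p * s)"
      using s True by (intro veq_add_dom[where s = s] veq_power) (use \<open>real p * s < s\<close> in \<open>auto intro: veq_vge\<close>)
    with assms(1,2) have "r \<le> real p * s" using vge_veq_le by auto
    then show ?thesis using \<open>p \<ge> 2\<close> by (simp add: field_simps)
  next
    case False
    have "r / real p \<le> 0" using assms by (simp add: divide_nonpos_nonneg)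
    with False show ?thesis by linarith
  qed
qed

text \<open>If \<open>v x\<close> exceeded \<open>r / p\<close>, both \<open>x ^ p\<close> and
  \<open>x\<close> would have value greater than \<open>r\<close>, the latter because
  \<open>r \<le> r / p\<close> for negative \<open>r\<close>.\<close>

lemma artin_schreier_veq:
  assumes "x ^ p - x = y" "veq y r" "p \<ge> 2" "r < 0"
  shows "veq x (r / real p)"
proof -
  have ge: "vge x (r / real p)"
    using assms by (intro artin_schreier_vge[OF assms(1)]) (auto intro: veq_vge)
  have "x \<noteq> 0" using assms veq_nz[of y r] by auto
  then obtain s where s: "veq x s" by (rule ex_veq)
  from ge s have le: "r / real p \<le> s" by (rule vge_veq_le)
  moreover have "s \<le> r / real p"
  proof (rule ccontr)
    assume "\<not> s \<le> r / real p"
    then have lt: "r < real p * s" using assms(3) by (simp add: field_simps)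
    have "r < s"
    proof -
      have "r \<le> r / real p" using assms by (simp add: field_simps)
      with \<open>\<not> s \<le> r / real p\<close> show ?thesis by linarith
    qed
    have "vge (x ^ p - x) (min (real p * s) s)"
      using s by (intro vge_diff) (auto intro: veq_vge dest: veq_power)
    with assms(1,2) have "min (real p * s) s \<le> r" using vge_veq_le by auto
    with lt \<open>r < s\<close> show False by auto
  qed
  ultimately show ?thesis using s by simp
qed

end

section \<open>Binomial coefficients\<close>

text \<open>The index is an integer, with value \<open>0\<close> below \<open>0\<close>, so that
  lowering a digit \<open>0\<close> by one gives \<open>0\<close>; this becomes the vanishing case
  of the scaffold congruences. In characteristic \<open>p\<close> the denominator is nonzero only
  for \<open>k < p\<close>, hence the bounds on \<open>k\<close> below.\<close>

definition bz :: "'a::field \<Rightarrow> int \<Rightarrow> 'a" where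
  "bz y k = (if k < 0 then 0 else (\<Prod>r<nat k. y - of_nat r) / of_nat (fact (nat k)))"

lemma bz_neg [simp]: "k < 0 \<Longrightarrow> bz y k = 0"
  and bz_0 [simp]: "bz y 0 = 1"
  by (auto simp: bz_def)

lemma bz_Suc:
  assumes "of_nat (Suc k) \<noteq> (0::'a::field)"
  shows "of_nat (Suc k) * bz (y::'a) (int (Suc k)) = (y - of_nat k) * bz y (int k)"
proof -
  have "nat (int (Suc k)) = Suc k" "nat (int k) = k" by auto
  then have "bz y (int (Suc k)) = ((y - of_nat k) * (\<Prod>r<k. y - of_nat r)) / (of_nat (Suc k) * of_nat (fact k))"
    by (simp add: bz_def algebra_simps)
  also have "of_nat (Suc k) * \<dots> = (y - of_nat k) * (\<Prod>r<k. y - of_nat r) / of_nat (fact k)"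
    unfolding times_divide_eq_right by (rule mult_divide_mult_cancel_left) (rule assms)
  also have "\<dots> = (y - of_nat k) * bz y (int k)" by (simp add: bz_def)
  finally show ?thesis .
qed

lemma of_nat_char_nz:
  assumes "Factorial_Ring.prime p" "CHAR('a::field) = p" "0 < k" "k < p"
  shows "of_nat k \<noteq> (0::'a)"
  using assms by (auto simp: of_nat_eq_0_iff_char_dvd dest: dvd_imp_le)

text \<open>Induction on \<open>k\<close>: multiply by \<open>k + 1\<close>, split this factor as
  \<open>r + (k + 1 - r)\<close> in each term, and absorb each part by \<open>bz_Suc\<close>. The
  factor can be cancelled since \<open>k + 1 < p\<close>.\<close>

lemma bz_vandermonde_nat:
  assumes "Factorial_Ring.prime p" "CHAR('a::field) = p" "k < p"
  shows "bz (a + b :: 'a) (int k) = (\<Sum>r\<le>k. bz b (int r) * bz a (int (k - r)))"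
  using assms(3)
proof (induction k)
  case (Suc k)
  let ?S = "\<lambda>k. \<Sum>r\<le>k. bz b (int r) * bz a (int (k - r))"
  have nz: "of_nat j \<noteq> (0::'a)" if "0 < j" "j \<le> Suc k" for j
    using of_nat_char_nz[OF assms(1,2)] that Suc.prems by auto
  have "of_nat (Suc k) * ?S (Suc k) =
      (\<Sum>r\<le>Suc k. of_nat r * bz b (int r) * bz a (int (Suc k - r))) +
      (\<Sum>r\<le>Suc k. bz b (int r) * (of_nat (Suc k - r) * bz a (int (Suc k - r))))"
    unfolding sum_distrib_left sum.distrib[symmetric]
  proof (intro sum.cong refl)
    fix r assume "r \<in> {..Suc k}"
    then have "of_nat (Suc k) = (of_nat r + of_nat (Suc k - r) :: 'a)"
      by (subst of_nat_add[symmetric]) auto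
    then show "of_nat (Suc k) * (bz b (int r) * bz a (int (Suc k - r))) =
       of_nat r * bz b (int r) * bz a (int (Suc k - r)) +
       bz b (int r) * (of_nat (Suc k - r) * bz a (int (Suc k - r)))"
      by (simp only:) (simp add: algebra_simps)
  qed
  also have "(\<Sum>r\<le>Suc k. of_nat r * bz b (int r) * bz a (int (Suc k - r))) =
      (\<Sum>r\<le>k. (b - of_nat r) * bz b (int r) * bz a (int (k - r)))"
  proof (subst sum.atMost_Suc_shift, simp only: of_nat_0 mult_zero_left add_0, intro sum.cong refl)
    fix r assume "r \<in> {..k}"
    then have "of_nat (Suc r) * bz b (int (Suc r)) = (b - of_nat r) * bz b (int r)"
      using nz[of "Suc r"] by (intro bz_Suc) auto
    then show "of_nat (Suc r) * bz b (int (Suc r)) * bz a (int (Suc k - Suc r)) =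
         (b - of_nat r) * bz b (int r) * bz a (int (k - r))" by simp
  qed
  also have "(\<Sum>r\<le>Suc k. bz b (int r) * (of_nat (Suc k - r) * bz a (int (Suc k - r)))) =
      (\<Sum>r\<le>k. bz b (int r) * ((a - of_nat (k - r)) * bz a (int (k - r))))"
  proof (subst sum.atMost_Suc, simp only: diff_self_eq_0 of_nat_0 mult_zero_left mult_zero_right add_0_right, intro sum.cong refl)
    fix r assume "r \<in> {..k}"
    then have "Suc k - r = Suc (k - r)" by (simp add: Suc_diff_le)
    moreover have "of_nat (Suc (k - r)) * bz a (int (Suc (k - r))) = (a - of_nat (k - r)) * bz a (int (k - r))"
      using nz[of "Suc (k - r)"] by (intro bz_Suc) auto
    ultimately show "bz b (int r) * (of_nat (Suc k - r) * bz a (int (Suc k - r))) =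
         bz b (int r) * ((a - of_nat (k - r)) * bz a (int (k - r)))" by metis
  qed
  also have "(\<Sum>r\<le>k. (b - of_nat r) * bz b (int r) * bz a (int (k - r))) + \<dots> =
      (a + b - of_nat k) * ?S k"
    unfolding sum_distrib_left sum.distrib[symmetric]
    by (intro sum.cong refl) (auto simp: of_nat_diff algebra_simps)
  also have "?S k = bz (a + b) (int k)" using Suc by simp
  also have "(a + b - of_nat k) * bz (a + b) (int k) = of_nat (Suc k) * bz (a + b) (int (Suc k))"
    by (subst bz_Suc[OF nz]) (use Suc in auto)
  finally have "of_nat (Suc k) * ?S (Suc k) = of_nat (Suc k) * bz (a + b) (int (Suc k))" .
  with nz[of "Suc k"] show ?case by (metis le_refl mult_left_cancel zero_less_Suc)
qed simp

text \<open>Terms with \<open>r > k\<close> vanish by the convention on negative indices. The range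
  \<open>r < p\<close> is thus the same for all degrees, so that one truncated operator serves every
  digit.\<close>

lemma bz_vandermonde:
  assumes "Factorial_Ring.prime p" "CHAR('a::field) = p" "k < int p"
  shows "bz (a + b :: 'a) k = (\<Sum>r<p. bz b (int r) * bz a (k - int r))"
proof (cases "k < 0")
  case False
  then obtain k' where k: "k = int k'" using zero_le_imp_eq_int by force
  have "(\<Sum>r<p. bz b (int r) * bz a (k - int r)) = (\<Sum>r\<le>k'. bz b (int r) * bz a (k - int r))"
    using assms(3) by (intro sum.mono_neutral_right) (auto simp: k)
  also have "\<dots> = (\<Sum>r\<le>k'. bz b (int r) * bz a (int (k' - r)))"
    by (intro sum.cong) (auto simp: k of_nat_diff)
  finally show ?thesis using bz_vandermonde_nat[OF assms(1,2), of k' a b] assms(3) by (simp add: k)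
qed simp

lemma bz_plus_1:
  assumes "Factorial_Ring.prime p" "CHAR('a::field) = p" "k < int p"
  shows "bz (a + 1 :: 'a) k = bz a k + bz a (k - 1)"
proof -
  have "p \<ge> 2" using assms(1) by (rule prime_ge_2_nat)
  have z: "bz (1::'a) (int r) = 0" if "r \<ge> 2" for r
    using that by (auto simp: bz_def intro!: bexI[of _ 1])
  have "bz (a + 1 :: 'a) k = (\<Sum>r<p. bz 1 (int r) * bz a (k - int r))"
    by (rule bz_vandermonde[OF assms])
  also have "\<dots> = (\<Sum>r\<in>{0,1}. bz 1 (int r) * bz a (k - int r))"
    using \<open>p \<ge> 2\<close> z by (intro sum.mono_neutral_right) auto
  also have "\<dots> = bz a k + bz a (k - 1)" by (simp add: bz_def)
  finally show ?thesis .
qed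

locale valued_p = valued v for v :: "'a::field \<Rightarrow> ereal" +
  fixes p :: nat
  assumes prime: "Factorial_Ring.prime p" and char: "CHAR('a) = p"
begin

lemma p_ge_2: "p \<ge> 2" using prime by (rule prime_ge_2_nat)
lemma p_pos: "p > 0" using p_ge_2 by simp

text \<open>By Bezout the inverse of \<open>k\<close> is again the image of a natural number; the
  two values are nonnegative and add up to \<open>0\<close>.\<close>

lemma veq_of_nat: assumes "0 < k" "\<not> p dvd k" shows "veq (of_nat k) 0"
proof -
  have cop: "coprime k p" using assms prime by (metis coprime_commute prime_imp_coprime)
  obtain m q where "k * m = p * q + 1"
    using bezout_nat[of k p] cop assms by auto
  then have "of_nat (k * m) = (of_nat (p * q + 1) :: 'a)" by simp
  then have eq: "of_nat k * of_nat m = (1::'a)" using of_nat_CHAR[where 'a = 'a] by (simp add: char)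
  then have "of_nat k \<noteq> (0::'a)" "of_nat m \<noteq> (0::'a)" by auto
  then obtain r s where rs: "veq (of_nat k) r" "veq (of_nat m) s" by (metis ex_veq)
  from veq_mult[OF this] eq veq_unique veq_1 have "r + s = 0" by metis
  moreover have "0 \<le> r" "0 \<le> s" using rs vge_veq_le vge_of_nat by blast+
  ultimately have "r = 0" by linarith
  with rs show ?thesis by simp
qed

lemma frob_add: "((x::'a) + y) ^ (p ^ k) = x ^ (p ^ k) + y ^ (p ^ k)"
  using prime char by (intro freshmans_dream') auto

lemma frob_diff: "((x::'a) - y) ^ (p ^ k) = x ^ (p ^ k) - y ^ (p ^ k)"
  using frob_add[of "x - y" y k] by (simp add: algebra_simps)

lemma frob_sum: "(\<Sum>i\<in>I. f i :: 'a) ^ (p ^ k) = (\<Sum>i\<in>I. f i ^ (p ^ k))"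
  by (induction I rule: infinite_finite_induct) (auto simp: frob_add p_pos)

lemma veq_fact: assumes "k < p" shows "veq (of_nat (fact k)) 0"
  using assms prime by (intro veq_of_nat) (auto simp: prime_dvd_fact_iff)

lemma vge_bz:
  assumes "vge y r" "r \<le> 0" "k < int p"
  shows "vge (bz y k) (of_int k * r)"
proof (cases "k < 0")
  case False
  have "vge (\<Prod>i<nat k. y - of_nat i) (\<Sum>i<nat k. r)"
    using assms(1,2) by (intro vge_prod vge_diff) (auto intro: vge_mono[OF vge_of_nat])
  from vge_divide[OF this veq_fact[of "nat k"]] False assms(3) show ?thesis by (simp add: bz_def)
qed simp

lemma veq_bz:
  assumes "veq y r" "r < 0" "0 \<le> k" "k < int p"
  shows "veq (bz y k) (of_int k * r)"
proof -
  have "veq (y - of_nat i) r" for i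
    using veq_add_dom[of y r "- of_nat i" 0] assms(1,2) by simp
  then have "veq (\<Prod>i<nat k. y - of_nat i) (\<Sum>i<nat k. r)"
    by (intro veq_prod)
  from veq_divide[OF this veq_fact[of "nat k"]] assms(3,4) show ?thesis by (simp add: bz_def)
qed

lemma vge_bz_pos:
  assumes "vge y r" "0 \<le> r" "0 < k" "k < int p"
  shows "vge (bz y k) r"
proof -
  \<comment> \<open>Only the factor for \<open>i = 0\<close>, which is \<open>y\<close> itself, is
    small; the others contribute merely \<open>0\<close>.\<close>
  have "vge (\<Prod>i<nat k. y - of_nat i) (\<Sum>i<nat k. if i = 0 then r else 0)"
    using assms(1,2) by (intro vge_prod) (auto intro!: vge_diff intro: vge_mono[OF vge_of_nat] vge_mono)
  moreover have "(\<Sum>i<nat k. if i = 0 then r else 0) = r" using assms(3) by simp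
  ultimately show ?thesis using vge_divide[OF _ veq_fact[of "nat k"]] assms(3,4) by (force simp: bz_def)
qed

text \<open>Vandermonde isolates the term \<open>r = 0\<close>; every other term contains
  \<open>bz e r\<close> with \<open>r \<ge> 1\<close> and so gains \<open>R\<close> at least once.
  Two cases are needed: \<open>bz e r\<close> is bounded like the power \<open>e ^ r\<close> if the
  bound for \<open>e\<close> is nonpositive, and only like \<open>e\<close> itself
  otherwise.\<close>

lemma bz_lipschitz:
  assumes y: "vge y (- B)" and e: "vge e (R - B)" and "0 \<le> R" "0 \<le> B" "k < int p"
  shows "vge (bz (y + e) k - bz y k) (- of_int k * B + R)"
proof (cases "k < 0")
  case False
  have "vge (bz e (int r) * bz y (k - int r)) (- of_int k * B + R)" if r: "r \<in> {..<p} - {0}" for r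
  proof (cases "k - int r < 0")
    case k: False
    have "real r \<ge> 1" using r by simp
    have 1: "vge (bz y (k - int r)) (of_int (k - int r) * (- B))"
      using assms k r by (intro vge_bz) auto
    have 2: "vge (bz e (int r)) (- real r * B + R)"
    proof (cases "R - B \<le> 0")
      case True
      have "vge (bz e (int r)) (of_int (int r) * (R - B))" using r True e by (intro vge_bz) auto
      moreover have "real r * R \<ge> R" using \<open>0 \<le> R\<close> \<open>real r \<ge> 1\<close> by (simp add: mult_le_cancel_right1)
      ultimately show ?thesis by (auto elim!: vge_mono simp: algebra_simps)
    next
      case False
      then have "vge (bz e (int r)) (R - B)" using r e by (intro vge_bz_pos) auto
      moreover have "real r * B \<ge> B" using \<open>0 \<le> B\<close> \<open>real r \<ge> 1\<close> by (simp add: mult_le_cancel_right1)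
      ultimately show ?thesis by (auto elim!: vge_mono simp: algebra_simps)
    qed
    from vge_mult[OF 2 1] show ?thesis by (simp add: algebra_simps)
  qed simp
  then have "vge (\<Sum>r\<in>{..<p} - {0}. bz e (int r) * bz y (k - int r)) (- of_int k * B + R)"
    by (rule vge_sum)
  moreover have "bz (y + e) k = bz y k + (\<Sum>r\<in>{..<p} - {0}. bz e (int r) * bz y (k - int r))"
    unfolding bz_vandermonde[OF prime char assms(5)] using p_pos
    by (subst sum.remove[of _ 0]) auto
  ultimately show ?thesis by simp
qed simp

end

section \<open>Witt vector addition\<close>

definition witt_mon :: "(nat + nat \<Rightarrow> 'a::comm_ring_1) \<Rightarrow> ((nat + nat) \<Rightarrow>\<^sub>0 nat) \<Rightarrow> 'a" where
  "witt_mon \<rho> m = (\<Prod>z\<in>Poly_Mapping.keys m. \<rho> z ^ Poly_Mapping.lookup m z)"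

lemma witt_poly_eval_mon:
  "witt_poly_eval \<rho> P = (\<Sum>m\<in>Poly_Mapping.keys P. of_int (Poly_Mapping.lookup P m) * witt_mon \<rho> m)"
  by (simp add: witt_poly_eval_def witt_mon_def)

lemma witt_mon_superset:
  assumes "finite A" "Poly_Mapping.keys m \<subseteq> A"
  shows "witt_mon \<rho> m = (\<Prod>z\<in>A. \<rho> z ^ Poly_Mapping.lookup m z)"
  unfolding witt_mon_def using assms
  by (intro prod.mono_neutral_left) (auto simp: in_keys_iff)

lemma witt_mon_add: "witt_mon \<rho> (m + m') = witt_mon \<rho> m * witt_mon \<rho> m'"
proof -
  let ?A = "Poly_Mapping.keys m \<union> Poly_Mapping.keys m'"
  have "Poly_Mapping.keys (m + m') \<subseteq> ?A" by (rule Poly_Mapping.keys_add)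
  then show ?thesis
    by (simp add: witt_mon_superset[of ?A] lookup_add power_add prod.distrib)
qed

lemma witt_poly_eval_superset:
  assumes "finite A" "Poly_Mapping.keys P \<subseteq> A"
  shows "witt_poly_eval \<rho> P = (\<Sum>m\<in>A. of_int (Poly_Mapping.lookup P m) * witt_mon \<rho> m)"
  unfolding witt_poly_eval_mon using assms
  by (intro sum.mono_neutral_left) (auto simp: in_keys_iff)

lemma witt_poly_eval_add: "witt_poly_eval \<rho> (P + Q) = witt_poly_eval \<rho> P + witt_poly_eval \<rho> Q"
proof -
  let ?A = "Poly_Mapping.keys P \<union> Poly_Mapping.keys Q"
  have "Poly_Mapping.keys (P + Q) \<subseteq> ?A" by (rule Poly_Mapping.keys_add)
  then show ?thesis
    by (simp add: witt_poly_eval_superset[of ?A] lookup_add ring_distribs sum.distrib)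
qed

lemma witt_poly_eval_0 [simp]: "witt_poly_eval \<rho> 0 = 0"
  by (simp add: witt_poly_eval_def)

lemma witt_poly_eval_uminus: "witt_poly_eval \<rho> (- P) = - witt_poly_eval \<rho> P"
  using witt_poly_eval_add[of \<rho> P "-P"] by (simp add: add_eq_0_iff)

lemma witt_poly_eval_diff: "witt_poly_eval \<rho> (P - Q) = witt_poly_eval \<rho> P - witt_poly_eval \<rho> Q"
  using witt_poly_eval_add[of \<rho> P "-Q"] by (simp add: witt_poly_eval_uminus)

lemma witt_poly_eval_sum: "witt_poly_eval \<rho> (sum f I) = (\<Sum>i\<in>I. witt_poly_eval \<rho> (f i))"
  by (induction I rule: infinite_finite_induct) (auto simp: witt_poly_eval_add)

lemma witt_poly_eval_single: "witt_poly_eval \<rho> (Poly_Mapping.single m c) = of_int c * witt_mon \<rho> m"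
  by (auto simp: witt_poly_eval_mon)

lemma poly_mapping_sum_single: "P = (\<Sum>m\<in>Poly_Mapping.keys P. Poly_Mapping.single m (Poly_Mapping.lookup P m))"
  by (rule poly_mapping_eqI) (auto simp: lookup_sum lookup_single when_def not_in_keys_iff_lookup_eq_zero)

lemma witt_poly_induct [case_names zero single add]:
  fixes P :: witt_poly
  assumes "C 0" "\<And>m c. C (Poly_Mapping.single m c)" "\<And>P Q. C P \<Longrightarrow> C Q \<Longrightarrow> C (P + Q)"
  shows "C P"
proof -
  have "C (\<Sum>m\<in>A. Poly_Mapping.single m (Poly_Mapping.lookup P m))" for A
    by (induction A rule: infinite_finite_induct) (auto intro: assms)
  then show ?thesis by (metis poly_mapping_sum_single)
qed

lemma witt_poly_eval_mult: "witt_poly_eval \<rho> (P * Q) = witt_poly_eval \<rho> P * witt_poly_eval \<rho> Q"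
proof (induction P rule: witt_poly_induct)
  case (single m c)
  show ?case
    by (induction Q rule: witt_poly_induct)
       (auto simp: mult_single witt_poly_eval_single witt_mon_add ring_distribs witt_poly_eval_add)
qed (auto simp: ring_distribs witt_poly_eval_add)

lemma witt_poly_eval_1 [simp]: "witt_poly_eval \<rho> 1 = 1"
proof -
  have "witt_poly_eval \<rho> (Poly_Mapping.single 0 1) = 1"
    unfolding witt_poly_eval_single by (simp add: witt_mon_def)
  then show ?thesis unfolding single_one .
qed

lemma witt_poly_eval_power: "witt_poly_eval \<rho> (P ^ k) = witt_poly_eval \<rho> P ^ k"
  by (induction k) (auto simp: witt_poly_eval_mult)

lemma witt_poly_eval_of_nat: "witt_poly_eval \<rho> (of_nat k) = of_nat k"
  by (induction k) (auto simp: witt_poly_eval_add)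

lemma witt_poly_eval_var [simp]: "witt_poly_eval \<rho> (witt_var z) = \<rho> z"
  by (simp add: witt_var_def witt_poly_eval_single witt_mon_def)

lemma single_eq_mon: "Poly_Mapping.single m c = of_int c * witt_mon witt_var m"
proof -
  have pow: "(witt_var z) ^ k = Poly_Mapping.single (Poly_Mapping.single z k) 1" for z k
    by (induction k) (auto simp: witt_var_def mult_single single_add[symmetric])
  have prod: "(\<Prod>z\<in>A. witt_var z ^ f z) = Poly_Mapping.single (\<Sum>z\<in>A. Poly_Mapping.single z (f z)) (1::int)"
    if "finite A" for A and f :: "nat + nat \<Rightarrow> nat"
    using that by (induction A) (auto simp: pow mult_single)
  have "(\<Sum>z\<in>Poly_Mapping.keys m. Poly_Mapping.single z (Poly_Mapping.lookup m z)) = m"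
    by (rule poly_mapping_eqI) (auto simp: lookup_sum lookup_single when_def not_in_keys_iff_lookup_eq_zero)
  then have "witt_mon witt_var m = Poly_Mapping.single m 1"
    unfolding witt_mon_def by (simp add: prod)
  moreover have "(of_int c :: witt_poly) = Poly_Mapping.single 0 c"
    using single_of_int[of c, where 'a = "(nat + nat) \<Rightarrow>\<^sub>0 nat" and 'b = int] unfolding of_int_eq_id id_apply by (rule sym)
  ultimately show ?thesis by (simp only: mult_single add_0_left mult_1_right)
qed

lemma freshman_dvd:
  fixes a b :: "'a::comm_ring_1"
  assumes "Factorial_Ring.prime p"
  shows "of_nat p dvd (a + b) ^ p - (a ^ p + b ^ p)"
proof -
  have p: "p \<ge> 2" using assms by (rule prime_ge_2_nat)
  have "(a + b) ^ p = (\<Sum>k\<le>p. of_nat (p choose k) * a ^ k * b ^ (p - k))" by (rule binomial_ring)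
  also have "{..p} = insert 0 (insert p {0<..<p})" by auto
  also have "(\<Sum>k\<in>\<dots>. of_nat (p choose k) * a ^ k * b ^ (p - k)) =
     b ^ p + (a ^ p + (\<Sum>k\<in>{0<..<p}. of_nat (p choose k) * a ^ k * b ^ (p - k)))"
    using p by (subst sum.insert; simp)+
  finally have "(a + b) ^ p - (a ^ p + b ^ p) = (\<Sum>k\<in>{0<..<p}. of_nat (p choose k) * a ^ k * b ^ (p - k))"
    by simp
  moreover have "of_nat p dvd (of_nat (p choose k) * a ^ k * b ^ (p - k) :: 'a)" if "k \<in> {0<..<p}" for k
  proof -
    have "p dvd (p choose k)" using that assms by (intro dvd_choose_prime) auto
    then have "(of_nat p :: 'a) dvd of_nat (p choose k)" by (elim dvdE) simp
    then show ?thesis by (intro dvd_mult2)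
  qed
  ultimately show ?thesis by (auto intro: dvd_sum)
qed

lemma dvd_power_diff: "(d::'a::comm_ring_1) dvd a - b \<Longrightarrow> d dvd a ^ k - b ^ k"
  by (metis dvd_mult2 power_diff_sumr2)

lemma fermat_of_int:
  assumes "Factorial_Ring.prime p"
  shows "(of_nat p :: 'a::comm_ring_1) dvd of_int c ^ p - of_int c"
proof -
  have p: "p > 0" using assms by (rule prime_gt_0_nat)
  have step: "of_nat p dvd ((x + 1) ^ p - (x + 1)) - (x ^ p - x)" for x :: 'a
    using freshman_dvd[OF assms, of x 1] by (simp add: algebra_simps)
  show ?thesis
  proof (induction c rule: int_induct[where k = 0])
    case base
    show ?case using p by (simp add: power_0_left)
  next
    case (step1 i)
    then show ?case using dvd_add[OF step[of "of_int i"] step1(2)]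
      by (simp add: add.commute diff_diff_eq)
  next
    case (step2 i)
    then show ?case using dvd_diff[OF step2(2) step[of "of_int (i - 1)"]]
      by (simp add: diff_diff_eq2)
  qed
qed

definition witt_frob :: "nat \<Rightarrow> witt_poly \<Rightarrow> witt_poly" where
  "witt_frob p = witt_poly_eval (\<lambda>z. witt_var z ^ p)"

text \<open>Modulo \<open>p\<close>, the substitution and the \<open>p\<close>-th power are both
  additive; on a single term they differ only in the coefficient, where Fermat's little theorem
  applies.\<close>

lemma witt_frob_dvd:
  assumes "Factorial_Ring.prime p"
  shows "of_nat p dvd witt_frob p P - P ^ p"
proof (induction P rule: witt_poly_induct)
  case zero
  show ?case using prime_gt_0_nat[OF assms] by (simp add: witt_frob_def power_0_left)
next
  case (single m c)
  let ?M = "witt_mon witt_var m :: witt_poly"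
  have "witt_mon (\<lambda>z. witt_var z ^ p) m = ?M ^ p"
    by (simp add: witt_mon_def prod_power_distrib power_mult[symmetric] mult.commute)
  then have "witt_frob p (Poly_Mapping.single m c) - (Poly_Mapping.single m c) ^ p
      = - ((of_int c ^ p - of_int c) * ?M ^ p)"
    by (simp add: witt_frob_def witt_poly_eval_single del: single_of_int)
       (simp add: single_eq_mon power_mult_distrib algebra_simps del: single_of_int)
  then show ?case using fermat_of_int[OF assms, of c] by (metis dvd_minus_iff dvd_mult2)
next
  case (add P Q)
  have "witt_frob p (P + Q) - (P + Q) ^ p =
     (witt_frob p P - P ^ p) + (witt_frob p Q - Q ^ p) - ((P + Q) ^ p - (P ^ p + Q ^ p))"
    by (simp add: witt_frob_def witt_poly_eval_add)
  then show ?case using add freshman_dvd[OF assms, of P Q] by (metis dvd_add dvd_diff)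
qed

text \<open>Each step gains one factor \<open>p\<close>: in the factorisation of
  \<open>?a ^ p - ?b ^ p\<close>, all \<open>p\<close> summands of the cofactor of
  \<open>?a - ?b\<close> are congruent modulo \<open>p\<close>, so the cofactor is divisible by
  \<open>p\<close>.\<close>

lemma dvd_frob_power:
  fixes a b :: "'a::comm_ring_1"
  assumes "of_nat p dvd a - b"
  shows "of_nat (p ^ Suc j) dvd a ^ (p ^ j) - b ^ (p ^ j)"
proof (induction j)
  case 0
  show ?case using assms by simp
next
  case (Suc j)
  let ?a = "a ^ (p ^ j)" and ?b = "b ^ (p ^ j)"
  have p: "of_nat p dvd ?a - ?b" using assms by (rule dvd_power_diff)
  have "of_nat p dvd ?b ^ (p - Suc i) * ?a ^ i - ?b ^ (p - 1)" if "i < p" for i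
  proof -
    have "?b ^ (p - 1) = ?b ^ (p - Suc i) * ?b ^ i"
      using that by (simp add: power_add[symmetric])
    then show ?thesis using dvd_power_diff[OF p, of i] by (metis dvd_mult right_diff_distrib)
  qed
  then have "of_nat p dvd (\<Sum>i<p. ?b ^ (p - Suc i) * ?a ^ i - ?b ^ (p - 1))"
    by (intro dvd_sum) auto
  then have "of_nat p dvd (\<Sum>i<p. ?b ^ (p - Suc i) * ?a ^ i) - of_nat p * ?b ^ (p - 1)"
    by (simp add: sum_subtractf)
  then have "of_nat p dvd (\<Sum>i<p. ?b ^ (p - Suc i) * ?a ^ i)"
    by (metis diff_add_cancel dvd_add dvd_triv_left)
  with Suc have "of_nat (p ^ Suc j) * of_nat p dvd (?a - ?b) * (\<Sum>i<p. ?b ^ (p - Suc i) * ?a ^ i)"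
    by (rule mult_dvd_mono)
  also have "\<dots> = ?a ^ p - ?b ^ p" by (rule power_diff_sumr2[symmetric])
  finally show ?case by (simp add: power_mult[symmetric] mult_ac)
qed

lemma lookup_of_nat_mult: "Poly_Mapping.lookup (of_nat k * P :: witt_poly) m = int k * Poly_Mapping.lookup P m"
  by (induction k) (auto simp: ring_distribs lookup_add)

lemma witt_of_nat_cancel:
  assumes "of_nat k * P = of_nat k * (Q :: witt_poly)" "k > 0" shows "P = Q"
proof (rule poly_mapping_eqI)
  fix m
  have "int k * Poly_Mapping.lookup P m = int k * Poly_Mapping.lookup Q m"
    using assms(1) by (metis lookup_of_nat_mult)
  then show "Poly_Mapping.lookup P m = Poly_Mapping.lookup Q m" using assms(2) by simp
qed

definition witt_sum_ghost :: "nat \<Rightarrow> nat \<Rightarrow> witt_poly" where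
  "witt_sum_ghost p k = ghost p (\<lambda>i. witt_var (Inl i)) k + ghost p (\<lambda>i. witt_var (Inr i)) k"

lemma ghost_rec: "ghost p x k = (\<Sum>i<k. of_nat (p ^ i) * x i ^ (p ^ (k - i))) + of_nat (p ^ k) * x k"
  unfolding ghost_def by (simp add: lessThan_Suc_atMost[symmetric])

text \<open>Dwork's criterion: the Frobenius lift \<open>witt_frob\<close> shows that the next ghost component is correct modulo \<open>p\<^sup>k\<close>.\<close>

lemma witt_sum_exists:
  assumes p: "Factorial_Ring.prime p"
  shows "\<exists>S. \<forall>j<k. ghost p S j = witt_sum_ghost p j"
proof (induction k)
  case (Suc k)
  then obtain S where S: "ghost p S j = witt_sum_ghost p j" if "j < k" for j by blast
  let ?X = "\<lambda>i. witt_var (Inl i)" and ?Y = "\<lambda>i. witt_var (Inr i)"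
  let ?low = "\<Sum>i<k. of_nat (p ^ i) * S i ^ (p ^ (k - i))"
  have "of_nat (p ^ k) dvd witt_sum_ghost p k - ?low"
  proof (cases k)
    case (Suc l)
    \<comment> \<open>Up to its last term, ghost component \<open>k\<close> of \<open>z\<close> is
      ghost component \<open>l\<close> of the \<open>p\<close>-th powers of the \<open>z i\<close>;
      for the variables these powers are what \<open>witt_frob\<close> substitutes.\<close>
    have eq: "(\<Sum>i<k. of_nat (p ^ i) * z i ^ (p ^ (k - i))) = (\<Sum>i\<le>l. of_nat (p ^ i) * (z i ^ p) ^ (p ^ (l - i)))"
      for z :: "nat \<Rightarrow> witt_poly"
      unfolding Suc lessThan_Suc_atMost
      by (intro sum.cong refl) (auto simp: power_mult[symmetric] Suc_diff_le)
    have "witt_frob p (ghost p S l) = witt_frob p (witt_sum_ghost p l)" using S[of l] Suc by simp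
    then have fr: "(\<Sum>i\<le>l. of_nat (p ^ i) * witt_frob p (S i) ^ (p ^ (l - i))) =
       (\<Sum>i\<le>l. of_nat (p ^ i) * (?X i ^ p) ^ (p ^ (l - i))) + (\<Sum>i\<le>l. of_nat (p ^ i) * (?Y i ^ p) ^ (p ^ (l - i)))"
      unfolding witt_sum_ghost_def ghost_def witt_frob_def
      by (simp add: witt_poly_eval_add witt_poly_eval_sum witt_poly_eval_mult witt_poly_eval_power
        witt_poly_eval_of_nat del: of_nat_power)
    have "witt_sum_ghost p k - ?low = of_nat (p ^ k) * (?X k + ?Y k) +
      (\<Sum>i\<le>l. of_nat (p ^ i) * (witt_frob p (S i) ^ (p ^ (l - i)) - (S i ^ p) ^ (p ^ (l - i))))"
      unfolding witt_sum_ghost_def ghost_rec eq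
      by (simp add: right_diff_distrib sum_subtractf fr algebra_simps del: of_nat_power)
    moreover have "of_nat (p ^ k) dvd of_nat (p ^ i) * (witt_frob p (S i) ^ (p ^ (l - i)) - (S i ^ p) ^ (p ^ (l - i)))"
      if "i \<le> l" for i
    proof -
      have "of_nat (p ^ i) * of_nat (p ^ Suc (l - i)) dvd
         of_nat (p ^ i) * (witt_frob p (S i) ^ (p ^ (l - i)) - (S i ^ p) ^ (p ^ (l - i)))"
        by (intro mult_dvd_mono dvd_refl dvd_frob_power witt_frob_dvd p)
      moreover have "p ^ i * p ^ Suc (l - i) = p ^ k"
        using that Suc by (simp add: power_add[symmetric] Suc_diff_le del: power_Suc)
      ultimately show ?thesis by (metis of_nat_mult)
    qed
    ultimately show ?thesis by (auto intro!: dvd_add dvd_sum)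
  qed simp
  then obtain T where T: "witt_sum_ghost p k - ?low = of_nat (p ^ k) * T" by (rule dvdE)
  have "ghost p (S(k := T)) j = witt_sum_ghost p j" if "j < Suc k" for j
  proof (cases "j = k")
    case True
    then show ?thesis using T by (simp add: ghost_rec algebra_simps del: of_nat_power)
  next
    case False
    then have "ghost p (S(k := T)) j = ghost p S j"
      using that unfolding ghost_def by (intro sum.cong) auto
    with False that S show ?thesis by simp
  qed
  then show ?case by blast
qed simp

text \<open>Once the earlier coordinates agree, the ghost equation determines \<open>p ^ i\<close>
  times the next one, and integer polynomials have no torsion.\<close>

lemma witt_sum_unique:
  assumes "p > 0" "\<And>j. j \<le> k \<Longrightarrow> ghost p S j = witt_sum_ghost p j"
    "\<And>j. j \<le> k \<Longrightarrow> ghost p S' j = witt_sum_ghost p j" "i \<le> k"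
  shows "S i = S' i"
  using assms(4)
proof (induction i rule: less_induct)
  case (less i)
  have "ghost p S i = ghost p S' i" using assms less by simp
  moreover have "(\<Sum>j<i. of_nat (p ^ j) * S j ^ (p ^ (i - j))) = (\<Sum>j<i. of_nat (p ^ j) * S' j ^ (p ^ (i - j)))"
    using less by (intro sum.cong) auto
  ultimately have "of_nat (p ^ i) * S i = of_nat (p ^ i) * S' i" unfolding ghost_rec by simp
  moreover have "p ^ i > 0" using assms(1) by simp
  ultimately show ?case by (rule witt_of_nat_cancel)
qed

text \<open>Truncated solutions agree by uniqueness, so their diagonal solves all ghost equations at
  once. This justifies the definite description in \<open>witt_add_poly\<close>.\<close>

lemma ghost_witt_add_poly:
  assumes p: "Factorial_Ring.prime p"
  shows "ghost p (witt_add_poly p) k = witt_sum_ghost p k"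
proof -
  have p0: "p > 0" using p by (rule prime_gt_0_nat)
  have "\<forall>k. \<exists>S. \<forall>j\<le>k. ghost p S j = witt_sum_ghost p j"
    using witt_sum_exists[OF p] unfolding less_Suc_eq_le[symmetric] by blast
  then obtain W where W: "ghost p (W k) j = witt_sum_ghost p j" if "j \<le> k" for j k
    by metis
  define S where "S = (\<lambda>k. W k k)"
  have "ghost p S k = witt_sum_ghost p k" for k
  proof -
    have "S i = W k i" if "i \<le> k" for i
      unfolding S_def
      using that W by (intro witt_sum_unique[OF p0, of i "W i" "W k" i]) auto
    then have "ghost p S k = ghost p (W k) k"
      unfolding ghost_def by (intro sum.cong) auto
    then show ?thesis using W by simp
  qed
  then have "\<exists>!S. \<forall>k. ghost p S k = witt_sum_ghost p k"
  proof (intro ex1I[of _ S] allI ext)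
    fix T i assume T: "\<forall>k. ghost p T k = witt_sum_ghost p k" and S: "\<And>k. ghost p S k = witt_sum_ghost p k"
    show "T i = S i"
      by (rule witt_sum_unique[OF p0, of i T S i]) (simp_all add: S T)
  qed
  from theI'[OF this] show ?thesis
    unfolding witt_add_poly_def witt_sum_ghost_def by blast
qed

section \<open>Weights of monomials and isobaric carry polynomials\<close>

definition witt_idx :: "nat + nat \<Rightarrow> nat" where "witt_idx = case_sum id id"

lemma witt_idx_simps [simp]: "witt_idx (Inl i) = i" "witt_idx (Inr i) = i"
  by (auto simp: witt_idx_def)

definition witt_wt :: "nat \<Rightarrow> ((nat + nat) \<Rightarrow>\<^sub>0 nat) \<Rightarrow> nat" where
  "witt_wt p m = (\<Sum>z\<in>Poly_Mapping.keys m. Poly_Mapping.lookup m z * p ^ witt_idx z)"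

definition isobaric :: "nat \<Rightarrow> nat \<Rightarrow> nat \<Rightarrow> witt_poly set" where
  "isobaric p w k = {P. \<forall>m\<in>Poly_Mapping.keys P. witt_wt p m = w \<and> (\<forall>z\<in>Poly_Mapping.keys m. witt_idx z < k)}"

lemma witt_wt_add: "witt_wt p (m + m') = witt_wt p m + witt_wt p m'"
proof -
  let ?A = "Poly_Mapping.keys m \<union> Poly_Mapping.keys m'"
  have *: "witt_wt p l = (\<Sum>z\<in>?A. Poly_Mapping.lookup l z * p ^ witt_idx z)" if "Poly_Mapping.keys l \<subseteq> ?A" for l
    unfolding witt_wt_def using that by (intro sum.mono_neutral_left) (auto simp: in_keys_iff)
  show ?thesis
    by (simp add: * Poly_Mapping.keys_add lookup_add ring_distribs sum.distrib)
qed

lemma isobaric_0 [simp]: "0 \<in> isobaric p w k" by (simp add: isobaric_def)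

lemma isobaric_add: "P \<in> isobaric p w k \<Longrightarrow> Q \<in> isobaric p w k \<Longrightarrow> P + Q \<in> isobaric p w k"
  using Poly_Mapping.keys_add[of P Q] unfolding isobaric_def by blast

lemma isobaric_uminus: "P \<in> isobaric p w k \<Longrightarrow> - P \<in> isobaric p w k"
  by (simp add: isobaric_def)

lemma isobaric_diff: "P \<in> isobaric p w k \<Longrightarrow> Q \<in> isobaric p w k \<Longrightarrow> P - Q \<in> isobaric p w k"
  using isobaric_add[of P p w k "-Q"] isobaric_uminus[of Q] by simp

lemma isobaric_mult:
  assumes "P \<in> isobaric p w k" "Q \<in> isobaric p w' k" shows "P * Q \<in> isobaric p (w + w') k"
  unfolding isobaric_def
proof (intro CollectI ballI conjI)
  fix m assume "m \<in> Poly_Mapping.keys (P * Q)"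
  then obtain a b where m: "m = a + b" "a \<in> Poly_Mapping.keys P" "b \<in> Poly_Mapping.keys Q"
    using keys_mult[of P Q] by blast
  then show "witt_wt p m = w + w'" using assms by (auto simp: witt_wt_add isobaric_def)
  fix z assume "z \<in> Poly_Mapping.keys m"
  then have "z \<in> Poly_Mapping.keys a \<union> Poly_Mapping.keys b" using Poly_Mapping.keys_add[of a b] m by blast
  then show "witt_idx z < k" using m assms by (auto simp: isobaric_def)
qed

lemma isobaric_1: "1 \<in> isobaric p 0 k"
  by (auto simp: isobaric_def witt_wt_def)

lemma isobaric_power: "P \<in> isobaric p w k \<Longrightarrow> P ^ j \<in> isobaric p (j * w) k"
  by (induction j) (auto simp: isobaric_1 dest: isobaric_mult)

lemma isobaric_sum: "(\<And>i. i \<in> I \<Longrightarrow> f i \<in> isobaric p w k) \<Longrightarrow> sum f I \<in> isobaric p w k"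
  by (induction I rule: infinite_finite_induct) (auto intro: isobaric_add)

lemma isobaric_of_nat_mult_iff:
  assumes "j > 0" shows "of_nat j * P \<in> isobaric p w k \<longleftrightarrow> P \<in> isobaric p w k"
proof -
  have "Poly_Mapping.keys (of_nat j * P) = Poly_Mapping.keys P"
    using assms by (auto simp: in_keys_iff lookup_of_nat_mult)
  then show ?thesis by (simp add: isobaric_def)
qed

lemma isobaric_mono: "P \<in> isobaric p w k \<Longrightarrow> k \<le> k' \<Longrightarrow> P \<in> isobaric p w k'"
  by (force simp: isobaric_def)

lemma isobaric_var: "witt_idx z < k \<Longrightarrow> witt_var z \<in> isobaric p (p ^ witt_idx z) k"
  by (auto simp: isobaric_def witt_var_def witt_wt_def)

definition witt_carry :: "nat \<Rightarrow> nat \<Rightarrow> witt_poly" where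
  "witt_carry p k = witt_add_poly p k - witt_var (Inl k) - witt_var (Inr k)"

text \<open>The ghost equation expresses \<open>p ^ k\<close> times the carry through coordinates of
  index \<open>i < k\<close>, whose powers with exponent \<open>p ^ (k - i)\<close> all have weight
  \<open>p ^ k\<close>. Division by an integer leaves the set of monomials unchanged.\<close>

lemma witt_carry_isobaric:
  assumes p: "Factorial_Ring.prime p"
  shows "witt_carry p k \<in> isobaric p (p ^ k) k"
proof (induction k rule: less_induct)
  case (less k)
  let ?X = "\<lambda>i. witt_var (Inl i)" and ?Y = "\<lambda>i. witt_var (Inr i)" and ?S = "witt_add_poly p"
  have X: "?X i \<in> isobaric p (p ^ i) k" and Y: "?Y i \<in> isobaric p (p ^ i) k" if "i < k" for i
    using isobaric_var[of "Inl i" k p] isobaric_var[of "Inr i" k p] that by auto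
  have S: "?S i \<in> isobaric p (p ^ i) k" if "i < k" for i
  proof -
    have "?S i = witt_carry p i + ?X i + ?Y i" by (simp add: witt_carry_def)
    then show ?thesis using less[OF that] X[OF that] Y[OF that] that
      by (auto intro!: isobaric_add intro: isobaric_mono)
  qed
  have pw: "z i ^ (p ^ (k - i)) \<in> isobaric p (p ^ k) k" if "z i \<in> isobaric p (p ^ i) k" "i < k" for z i
    using isobaric_power[OF that(1), of "p ^ (k - i)"] that(2) by (simp add: power_add[symmetric])
  have "of_nat (p ^ k) * witt_carry p k =
     (\<Sum>i<k. of_nat (p ^ i) * (?X i ^ (p ^ (k - i)) + ?Y i ^ (p ^ (k - i)) - ?S i ^ (p ^ (k - i))))"
    using ghost_witt_add_poly[OF p, of k] unfolding witt_sum_ghost_def ghost_rec witt_carry_def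
    by (simp add: ring_distribs sum.distrib sum_subtractf del: of_nat_power)
       (simp add: algebra_simps del: of_nat_power)
  also have "\<dots> \<in> isobaric p (p ^ k) k"
  proof (intro isobaric_sum)
    fix i assume "i \<in> {..<k}"
    then have "?X i ^ (p ^ (k - i)) + ?Y i ^ (p ^ (k - i)) - ?S i ^ (p ^ (k - i)) \<in> isobaric p (p ^ k) k"
      by (intro isobaric_add isobaric_diff pw X Y S) auto
    then show "of_nat (p ^ i) * (?X i ^ (p ^ (k - i)) + ?Y i ^ (p ^ (k - i)) - ?S i ^ (p ^ (k - i))) \<in> isobaric p (p ^ k) k"
      using prime_gt_0_nat[OF p] by (subst isobaric_of_nat_mult_iff) auto
  qed
  finally show ?case using prime_gt_0_nat[OF p] by (subst (asm) isobaric_of_nat_mult_iff) auto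
qed

lemma witt_add_eq:
  assumes "k < n"
  shows "witt_add p n x y k = x k + y k + witt_poly_eval (case_sum x y) (witt_carry p k)"
  using assms by (simp add: witt_add_def witt_carry_def witt_poly_eval_diff)

lemma isobaric_eval_cong:
  assumes "P \<in> isobaric p w k" "\<And>z. witt_idx z < k \<Longrightarrow> \<rho> z = \<rho>' z"
  shows "witt_poly_eval \<rho> P = witt_poly_eval \<rho>' P"
  using assms unfolding witt_poly_eval_def isobaric_def by (intro sum.cong prod.cong refl) auto

context valued
begin

text \<open>A bound proportional to the weight is multiplicative, so all monomials of weight
  \<open>w\<close> share the bound \<open>- A * w\<close>; integer coefficients cost nothing.
  \<open>R\<close> is again a relative error.\<close>

lemma isobaric_lipschitz:
  assumes P: "P \<in> isobaric p w k"
    and "\<And>z. witt_idx z < k \<Longrightarrow> vge (\<rho> z) (- A * real (p ^ witt_idx z))"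
    and "\<And>z. witt_idx z < k \<Longrightarrow> vge (\<rho>' z) (- A * real (p ^ witt_idx z))"
    and "\<And>z. witt_idx z < k \<Longrightarrow> vge (\<rho> z - \<rho>' z) (- A * real (p ^ witt_idx z) + R)"
  shows "vge (witt_poly_eval \<rho> P - witt_poly_eval \<rho>' P) (- A * real w + R)"
proof -
  have "vge (of_int (Poly_Mapping.lookup P m) * (witt_mon \<rho> m - witt_mon \<rho>' m)) (0 + (- A * real w + R))"
    if m: "m \<in> Poly_Mapping.keys P" for m
  proof (intro vge_mult vge_of_int)
    have wt: "witt_wt p m = w" and idx: "\<And>z. z \<in> Poly_Mapping.keys m \<Longrightarrow> witt_idx z < k"
      using P m by (auto simp: isobaric_def)
    have "vge (witt_mon \<rho> m - witt_mon \<rho>' m)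
      ((\<Sum>z\<in>Poly_Mapping.keys m. real (Poly_Mapping.lookup m z) * (- A * real (p ^ witt_idx z))) + R)"
      unfolding witt_mon_def
      by (intro prod_lipschitz power_lipschitz vge_power) (use assms idx in auto)
    also have "(\<Sum>z\<in>Poly_Mapping.keys m. real (Poly_Mapping.lookup m z) * (- A * real (p ^ witt_idx z))) =
      - A * real (witt_wt p m)"
      unfolding witt_wt_def by (simp add: sum_distrib_left sum_negf mult_ac)
    finally show "vge (witt_mon \<rho> m - witt_mon \<rho>' m) (- A * real w + R)" by (simp add: wt)
  qed
  then have "vge (\<Sum>m\<in>Poly_Mapping.keys P. of_int (Poly_Mapping.lookup P m) * (witt_mon \<rho> m - witt_mon \<rho>' m)) (- A * real w + R)"
    by (intro vge_sum) auto
  then show ?thesis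
    unfolding witt_poly_eval_mon by (simp add: right_diff_distrib sum_subtractf)
qed

lemma isobaric_vge:
  assumes P: "P \<in> isobaric p w k"
    and "\<And>z. witt_idx z < k \<Longrightarrow> vge (\<rho> z) (- A * real (p ^ witt_idx z))"
  shows "vge (witt_poly_eval \<rho> P) (- A * real w)"
  unfolding witt_poly_eval_mon
proof (intro vge_sum)
  fix m assume m: "m \<in> Poly_Mapping.keys P"
  have wt: "witt_wt p m = w" and idx: "\<And>z. z \<in> Poly_Mapping.keys m \<Longrightarrow> witt_idx z < k"
    using P m by (auto simp: isobaric_def)
  have "vge (witt_mon \<rho> m) (\<Sum>z\<in>Poly_Mapping.keys m. real (Poly_Mapping.lookup m z) * (- A * real (p ^ witt_idx z)))"
    unfolding witt_mon_def by (intro vge_prod vge_power assms idx)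
  also have "(\<Sum>z\<in>Poly_Mapping.keys m. real (Poly_Mapping.lookup m z) * (- A * real (p ^ witt_idx z))) = - A * real w"
    unfolding wt[symmetric] witt_wt_def by (simp add: sum_distrib_left sum_negf mult_ac)
  finally show "vge (of_int (Poly_Mapping.lookup P m) * witt_mon \<rho> m) (- A * real w)"
    using vge_mult[OF vge_of_int, of "witt_mon \<rho> m" "- A * real w"] by simp
qed

end

section \<open>Operators of the group ring\<close>

text \<open>Subfields in terms of the type class operations instead of the carrier record; as
  \<open>inverse 0 = 0\<close>, closure under \<open>inverse\<close> includes
  \<open>0\<close>.\<close>

definition fld :: "'a::field set \<Rightarrow> bool" where
  "fld F \<longleftrightarrow> 0 \<in> F \<and> 1 \<in> F \<and> (\<forall>x\<in>F. \<forall>y\<in>F. x + y \<in> F \<and> x - y \<in> F \<and> x * y \<in> F) \<and> (\<forall>x\<in>F. inverse x \<in> F)"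

lemma fldD:
  assumes "fld F"
  shows "0 \<in> F" "1 \<in> F" "x \<in> F \<Longrightarrow> y \<in> F \<Longrightarrow> x + y \<in> F" "x \<in> F \<Longrightarrow> y \<in> F \<Longrightarrow> x - y \<in> F"
    "x \<in> F \<Longrightarrow> y \<in> F \<Longrightarrow> x * y \<in> F" "x \<in> F \<Longrightarrow> inverse x \<in> F" "x \<in> F \<Longrightarrow> - x \<in> F"
    "x \<in> F \<Longrightarrow> y \<in> F \<Longrightarrow> x / y \<in> F" "x \<in> F \<Longrightarrow> x ^ k \<in> F" "of_nat k \<in> F"
    "x \<in> F \<Longrightarrow> power_int x j \<in> F"
proof -
  show 1: "0 \<in> F" "1 \<in> F" "x \<in> F \<Longrightarrow> y \<in> F \<Longrightarrow> x + y \<in> F" "x \<in> F \<Longrightarrow> y \<in> F \<Longrightarrow> x - y \<in> F"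
    "x \<in> F \<Longrightarrow> y \<in> F \<Longrightarrow> x * y \<in> F" "x \<in> F \<Longrightarrow> inverse x \<in> F" for x y
    using assms by (auto simp: fld_def)
  show "x \<in> F \<Longrightarrow> - x \<in> F" using 1(1) 1(4)[of 0 x] by simp
  show "x \<in> F \<Longrightarrow> y \<in> F \<Longrightarrow> x / y \<in> F" using 1 by (simp add: divide_inverse)
  show 2: "x \<in> F \<Longrightarrow> x ^ k \<in> F" for x k by (induction k) (auto intro: 1)
  show "of_nat k \<in> F" by (induction k) (auto intro: 1)
  show "x \<in> F \<Longrightarrow> power_int x j \<in> F" by (auto simp: power_int_def intro: 1 2)
qed

lemma fld_sum: "fld F \<Longrightarrow> (\<And>i. i \<in> I \<Longrightarrow> f i \<in> F) \<Longrightarrow> sum f I \<in> F"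
  by (induction I rule: infinite_finite_induct) (auto intro: fldD)

lemma fld_prod: "fld F \<Longrightarrow> (\<And>i. i \<in> I \<Longrightarrow> f i \<in> F) \<Longrightarrow> prod f I \<in> F"
  by (induction I rule: infinite_finite_induct) (auto intro: fldD)

lemma fld_bz: "fld F \<Longrightarrow> y \<in> F \<Longrightarrow> bz y k \<in> F"
  by (auto simp: bz_def intro!: fldD(1) fldD(8) fld_prod fldD(4) fldD(10))

text \<open>The Galois group enters through one automorphism \<open>\<sigma>\<close> of finite
  period, a function on the whole type of which only the values on \<open>L\<close> matter.
  \<open>K_int\<close> and \<open>K_unif\<close> say that \<open>v\<close> is normalised on
  \<open>K\<close>, and \<open>resid\<close> is total ramification.\<close>

locale cyc_ext = valued_p v p for v :: "'a::field \<Rightarrow> ereal" and p :: nat +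
  fixes K L :: "'a set" and \<sigma> :: "'a \<Rightarrow> 'a" and N :: nat
  assumes K: "fld K" and L: "fld L" and KL: "K \<subseteq> L"
    and \<sigma>_in: "x \<in> L \<Longrightarrow> \<sigma> x \<in> L"
    and \<sigma>_add: "x \<in> L \<Longrightarrow> y \<in> L \<Longrightarrow> \<sigma> (x + y) = \<sigma> x + \<sigma> y"
    and \<sigma>_mult: "x \<in> L \<Longrightarrow> y \<in> L \<Longrightarrow> \<sigma> (x * y) = \<sigma> x * \<sigma> y"
    and \<sigma>_fix: "x \<in> K \<Longrightarrow> \<sigma> x = x"
    and N_pos: "N > 0" and period: "x \<in> L \<Longrightarrow> (\<sigma> ^^ N) x = x"
    and K_int: "x \<in> K \<Longrightarrow> veq x r \<Longrightarrow> \<exists>m::int. r = of_int m"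
    and K_unif: "\<exists>w\<in>K. veq w 1"
    and resid: "x \<in> L \<Longrightarrow> vge x 0 \<Longrightarrow> \<exists>y\<in>K. \<exists>s>0. vge (x - y) s"
begin

lemma inL [simp]: "x \<in> K \<Longrightarrow> x \<in> L" using KL by blast

lemma pow_in [simp]: "x \<in> L \<Longrightarrow> (\<sigma> ^^ k) x \<in> L"
  by (induction k) (auto intro: \<sigma>_in)
lemma pow_add: "x \<in> L \<Longrightarrow> y \<in> L \<Longrightarrow> (\<sigma> ^^ k) (x + y) = (\<sigma> ^^ k) x + (\<sigma> ^^ k) y"
  by (induction k) (auto simp: \<sigma>_add)
lemma pow_mult: "x \<in> L \<Longrightarrow> y \<in> L \<Longrightarrow> (\<sigma> ^^ k) (x * y) = (\<sigma> ^^ k) x * (\<sigma> ^^ k) y"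
  by (induction k) (auto simp: \<sigma>_mult)
lemma pow_fix [simp]: "x \<in> K \<Longrightarrow> (\<sigma> ^^ k) x = x"
  by (induction k) (auto simp: \<sigma>_fix)
lemma pow_scale: "c \<in> K \<Longrightarrow> y \<in> L \<Longrightarrow> (\<sigma> ^^ k) (c * y) = c * (\<sigma> ^^ k) y"
  by (simp add: pow_mult)
lemma pow_diff: "x \<in> L \<Longrightarrow> y \<in> L \<Longrightarrow> (\<sigma> ^^ k) (x - y) = (\<sigma> ^^ k) x - (\<sigma> ^^ k) y"
  using pow_add[of "x - y" y k] fldD[OF L] by (simp add: algebra_simps)
lemma pow_power: "x \<in> L \<Longrightarrow> (\<sigma> ^^ k) (x ^ j) = ((\<sigma> ^^ k) x) ^ j"
  by (induction j) (auto simp: pow_mult fldD[OF L] fldD[OF K])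
lemma pow_sum: "(\<And>i. i \<in> I \<Longrightarrow> f i \<in> L) \<Longrightarrow> (\<sigma> ^^ k) (sum f I) = (\<Sum>i\<in>I. (\<sigma> ^^ k) (f i))"
  by (induction I rule: infinite_finite_induct) (auto simp: pow_add fldD[OF K] fld_sum[OF L])
lemma pow_prod: "(\<And>i. i \<in> I \<Longrightarrow> f i \<in> L) \<Longrightarrow> (\<sigma> ^^ k) (prod f I) = (\<Prod>i\<in>I. (\<sigma> ^^ k) (f i))"
  by (induction I rule: infinite_finite_induct) (auto simp: pow_mult fldD[OF K] fld_prod[OF L])
lemma pow_bz: assumes "y \<in> L" shows "(\<sigma> ^^ k) (bz y j) = bz ((\<sigma> ^^ k) y) j"
proof -
  have "(\<sigma> ^^ k) (\<Prod>r<nat j. y - of_nat r) = (\<Prod>r<nat j. (\<sigma> ^^ k) y - of_nat r)"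
    using assms by (subst pow_prod) (auto simp: pow_diff fldD[OF L] fldD[OF K])
  moreover have "(\<Prod>r<nat j. y - of_nat r) \<in> L" using assms by (intro fld_prod[OF L] fldD[OF L])
  ultimately show ?thesis
    by (simp add: bz_def divide_inverse pow_mult fldD[OF K] fldD[OF L])
qed

lemma pow_period_mult [simp]: "x \<in> L \<Longrightarrow> (\<sigma> ^^ (N * q)) x = x"
  by (induction q) (auto simp: funpow_add period)

lemma pow_mod: "x \<in> L \<Longrightarrow> (\<sigma> ^^ (k mod N)) x = (\<sigma> ^^ k) x"
proof -
  assume x: "x \<in> L"
  have "(\<sigma> ^^ k) x = (\<sigma> ^^ (k mod N + N * (k div N))) x" by simp
  also have "\<dots> = (\<sigma> ^^ (k mod N)) ((\<sigma> ^^ (N * (k div N))) x)" by (simp only: funpow_add comp_def)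
  finally show ?thesis using x by simp
qed

lemma pow_inj: assumes "x \<in> L" "y \<in> L" "(\<sigma> ^^ k) x = (\<sigma> ^^ k) y" shows "x = y"
proof -
  have "k \<le> N * k" using N_pos by simp
  then have "(\<sigma> ^^ (N * k)) z = (\<sigma> ^^ (N * k - k)) ((\<sigma> ^^ k) z)" for z
    by (metis comp_apply funpow_add le_add_diff_inverse2)
  then have "(\<sigma> ^^ (N * k)) x = (\<sigma> ^^ (N * k)) y" using assms by metis
  then show ?thesis using assms by simp
qed

text \<open>Only an inclusion of value groups: \<open>E\<close> may be too large. Exactness is
  expressed separately by an element of value \<open>1 / E\<close>.\<close>

definition discr :: "'a set \<Rightarrow> nat \<Rightarrow> bool" where
  "discr F E \<longleftrightarrow> E > 0 \<and> (\<forall>x\<in>F. \<forall>r. veq x r \<longrightarrow> (\<exists>m::int. real E * r = of_int m))"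

lemma disc_step:
  assumes "discr F E" "x \<in> F" "vge x s" "r < s" "real E * r = of_int m"
  shows "vge x (r + 1 / real E)"
proof (rule vge_veq_eqI)
  have E: "E > 0" using assms(1) by (simp add: discr_def)
  fix t assume t: "veq x t"
  then obtain k :: int where k: "real E * t = of_int k" using assms(1,2) by (auto simp: discr_def)
  have "s \<le> t" using t assms(3) vge_veq_le by blast
  then have "real E * r < real E * t" using assms(4) E by auto
  then have "m < k" using assms(5) k by simp
  then have "of_int m + 1 \<le> (of_int k :: real)" by linarith
  then show "r + 1 / real E \<le> t" using assms(5) k E by (simp add: field_simps)
qed

text \<open>Total ramification: the unit \<open>x / y\<close> is congruent to a constant of
  \<open>K\<close>. Discreteness turns the strict gain into \<open>1 / E\<close>, which gives
  successive approximation a fixed gain per step.\<close>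

lemma approx:
  assumes F: "fld F" "F \<subseteq> L" "K \<subseteq> F" "discr F E" and xy: "x \<in> F" "y \<in> F" "veq x r" "veq y r"
  obtains c where "c \<in> K" "vge c 0" "vge (x - c * y) (r + 1 / real E)"
proof -
  have y0: "y \<noteq> 0" using xy by (auto dest: veq_nz)
  have 0: "veq (x / y) 0" using veq_divide[OF xy(3,4)] by simp
  then have "vge (x / y) 0" by (rule veq_vge) simp
  moreover have "x / y \<in> L" using F(2) fldD(8)[OF F(1) xy(1,2)] by blast
  ultimately obtain c s where c: "c \<in> K" "s > 0" "vge (x / y - c) s"
    using resid by blast
  have "vge (x / y - (x / y - c)) 0"
    using c(2) by (intro vge_diff veq_vge[OF 0] vge_mono[OF c(3)]) auto
  then have "vge c 0" by simp
  have "vge ((x / y - c) * y) (s + r)" using c(3) xy(4) by (intro vge_mult) (auto intro: veq_vge)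
  moreover have "(x / y - c) * y = x - c * y" using y0 by (simp add: left_diff_distrib)
  ultimately have "vge (x - c * y) (s + r)" by simp
  moreover obtain m :: int where "real E * r = of_int m" using F(4) xy(1,3) by (auto simp: discr_def)
  moreover have "c \<in> F" using c(1) F(3) by blast
  then have "x - c * y \<in> F" using xy by (intro fldD(4,5)[OF F(1)])
  ultimately have "vge (x - c * y) (r + 1 / real E)"
    using c(2) by (intro disc_step[OF F(4), of _ "s + r"]) auto
  with \<open>vge c 0\<close> c(1) show ?thesis by (intro that)
qed

text \<open>Group ring elements as operators, prescribed only on \<open>L\<close>: multiplication
  becomes composition of functions. The exponents of \<open>\<sigma>\<close> are reduced modulo
  \<open>N\<close> only when \<open>KG_repr\<close> recovers the coefficients.\<close>

inductive_set KG :: "('a \<Rightarrow> 'a) set" where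
  zero: "(\<lambda>x. 0) \<in> KG"
| step: "T \<in> KG \<Longrightarrow> c \<in> K \<Longrightarrow> (\<And>x. x \<in> L \<Longrightarrow> T' x = T x + c * (\<sigma> ^^ k) x) \<Longrightarrow> T' \<in> KG"

lemma KG_cong: "T \<in> KG \<Longrightarrow> (\<And>x. x \<in> L \<Longrightarrow> T' x = T x) \<Longrightarrow> T' \<in> KG"
  by (rule KG.step[of T 0]) (auto simp: fldD[OF K])

lemma KG_in [simp]: "T \<in> KG \<Longrightarrow> x \<in> L \<Longrightarrow> T x \<in> L"
  by (induction rule: KG.induct) (auto intro!: fldD[OF L])

lemma KG_add: "T \<in> KG \<Longrightarrow> x \<in> L \<Longrightarrow> y \<in> L \<Longrightarrow> T (x + y) = T x + T y"
  by (induction rule: KG.induct) (auto simp: fldD[OF L] pow_add algebra_simps)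

lemma KG_scale: "T \<in> KG \<Longrightarrow> c \<in> K \<Longrightarrow> y \<in> L \<Longrightarrow> T (c * y) = c * T y"
  by (induction rule: KG.induct) (auto simp: fldD[OF L] pow_scale algebra_simps)

lemma KG_diff: "T \<in> KG \<Longrightarrow> x \<in> L \<Longrightarrow> y \<in> L \<Longrightarrow> T (x - y) = T x - T y"
  using KG_add[of T "x - y" y] fldD[OF L] by (simp add: algebra_simps)

lemma KG_0: "T \<in> KG \<Longrightarrow> T 0 = 0"
  using KG_diff[of T 0 0] fldD[OF L] by simp

lemma KG_sum: "T \<in> KG \<Longrightarrow> (\<And>i. i \<in> I \<Longrightarrow> f i \<in> L) \<Longrightarrow> T (sum f I) = (\<Sum>i\<in>I. T (f i))"
  by (induction I rule: infinite_finite_induct) (auto simp: KG_0 KG_add fld_sum[OF L])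

lemma KG_id: "(\<lambda>x. x) \<in> KG"
  by (rule KG.step[OF KG.zero, of 1 _ 0]) (auto simp: fldD[OF K])

lemma KG_plus: "T \<in> KG \<Longrightarrow> U \<in> KG \<Longrightarrow> (\<lambda>x. T x + U x) \<in> KG"
proof (induction arbitrary: rule: KG.induct)
  case zero
  then show ?case by simp
next
  case (step T c T' k)
  then have "(\<lambda>x. T x + U x) \<in> KG" by blast
  then show ?case by (rule KG.step[OF _ step(2), of _ _ k]) (use step in auto)
qed

lemma KG_cmult: "T \<in> KG \<Longrightarrow> c \<in> K \<Longrightarrow> (\<lambda>x. c * T x) \<in> KG"
proof (induction rule: KG.induct)
  case zero
  then show ?case using KG.zero by simp
next
  case (step T d T' k)
  then have "(\<lambda>x. c * T x) \<in> KG" by blast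
  then show ?case by (rule KG.step[of _ "c * d" _ k]) (use step in \<open>auto intro: fldD[OF K] simp: algebra_simps\<close>)
qed

lemma KG_pow: "T \<in> KG \<Longrightarrow> (\<lambda>x. (\<sigma> ^^ k) (T x)) \<in> KG"
proof (induction rule: KG.induct)
  case zero
  then show ?case using KG.zero fldD[OF K] by simp
next
  case (step T d T' j)
  from step(4) step(2) show ?case
    by (rule KG.step[of _ d _ "k + j"])
       (use step in \<open>auto simp: pow_add pow_scale funpow_add fldD[OF L]\<close>)
qed

lemma KG_comp: "T \<in> KG \<Longrightarrow> U \<in> KG \<Longrightarrow> (\<lambda>x. T (U x)) \<in> KG"
proof (induction rule: KG.induct)
  case zero
  then show ?case using KG.zero by simp
next
  case (step T c T' k)
  have "(\<lambda>x. T (U x) + c * (\<sigma> ^^ k) (U x)) \<in> KG"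
    using step by (intro KG_plus KG_cmult KG_pow) auto
  then show ?case by (rule KG_cong) (use step in auto)
qed

lemma KG_funpow: "T \<in> KG \<Longrightarrow> (T ^^ k) \<in> KG"
  by (induction k) (auto intro: KG_comp KG_id simp: comp_def id_def)

lemma KG_Sum: "(\<And>i. i \<in> I \<Longrightarrow> T i \<in> KG) \<Longrightarrow> (\<lambda>x. \<Sum>i\<in>I. T i x) \<in> KG"
  by (induction I rule: infinite_finite_induct) (auto intro: KG.zero KG_plus)

lemma KG_minus: "T \<in> KG \<Longrightarrow> U \<in> KG \<Longrightarrow> (\<lambda>x. T x - U x) \<in> KG"
  using KG_plus[OF _ KG_cmult[of U "-1"], of T] fldD[OF K] by simp

lemma KG_repr:
  "T \<in> KG \<Longrightarrow> \<exists>a. (\<forall>i. a i \<in> K) \<and> (\<forall>x\<in>L. T x = (\<Sum>i<N. a i * (\<sigma> ^^ i) x))"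
proof (induction rule: KG.induct)
  case zero
  then show ?case by (intro exI[of _ "\<lambda>_. 0"]) (auto simp: fldD[OF K])
next
  case (step T c T' k)
  then obtain a where a: "\<And>i. a i \<in> K" "\<And>x. x \<in> L \<Longrightarrow> T x = (\<Sum>i<N. a i * (\<sigma> ^^ i) x)" by blast
  define a' where "a' = (\<lambda>i. a i + (if i = k mod N then c else 0))"
  have "a' i \<in> K" for i using a step(2) fldD[OF K] by (auto simp: a'_def)
  moreover have "T' x = (\<Sum>i<N. a' i * (\<sigma> ^^ i) x)" if "x \<in> L" for x
  proof -
    have "(\<Sum>i<N. a' i * (\<sigma> ^^ i) x) = (\<Sum>i<N. a i * (\<sigma> ^^ i) x) + (\<Sum>i<N. (if i = k mod N then c * (\<sigma> ^^ i) x else 0))"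
      unfolding sum.distrib[symmetric] by (intro sum.cong) (auto simp: a'_def algebra_simps)
    also have "(\<Sum>i<N. (if i = k mod N then c * (\<sigma> ^^ i) x else 0)) = c * (\<sigma> ^^ (k mod N)) x"
      using N_pos by (subst sum.delta) auto
    finally show ?thesis using that a step(3) pow_mod[of x k] by simp
  qed
  ultimately show ?case by blast
qed

end

locale cyc_iso = cyc_ext +
  assumes iso: "x \<in> L \<Longrightarrow> v (\<sigma> x) = v x"
    and disc: "x \<in> L \<Longrightarrow> veq x r \<Longrightarrow> \<exists>m::int. real N * r = of_int m"
begin

lemma discr_L: "discr L N"
  using disc N_pos by (auto simp: discr_def)

lemma iso_pow: "x \<in> L \<Longrightarrow> v ((\<sigma> ^^ k) x) = v x"
  by (induction k) (auto simp: iso)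

lemma veq_pow [simp]: "x \<in> L \<Longrightarrow> veq ((\<sigma> ^^ k) x) r \<longleftrightarrow> veq x r"
  and vge_pow [simp]: "x \<in> L \<Longrightarrow> vge ((\<sigma> ^^ k) x) r \<longleftrightarrow> vge x r"
  by (auto simp: veq_def vge_def iso_pow)

lemma KG_bounded: "T \<in> KG \<Longrightarrow> \<exists>C\<ge>0. \<forall>x\<in>L. \<forall>r. vge x r \<longrightarrow> vge (T x) (r - C)"
proof (induction rule: KG.induct)
  case zero
  then show ?case by (intro exI[of _ 0]) auto
next
  case (step T c T' k)
  then obtain C where C: "C \<ge> 0" "\<And>x r. x \<in> L \<Longrightarrow> vge x r \<Longrightarrow> vge (T x) (r - C)" by blast
  obtain s where s: "vge c s" using ex_veq[of c] vge_0 veq_vge by (metis order_refl)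
  define D where "D = C + \<bar>s\<bar>"
  have "vge (T' x) (r - D)" if "x \<in> L" "vge x r" for x r
  proof -
    have "vge (T x) (r - D)" using C(2)[OF that] by (rule vge_mono) (simp add: D_def)
    moreover have "vge (c * (\<sigma> ^^ k) x) (s + r)" using that s by (intro vge_mult) auto
    then have "vge (c * (\<sigma> ^^ k) x) (r - D)" by (rule vge_mono) (use C(1) in \<open>simp add: D_def\<close>)
    ultimately show ?thesis using step(3)[OF that(1)] by (simp add: vge_add)
  qed
  moreover have "D \<ge> 0" using C(1) by (simp add: D_def)
  ultimately show ?case by blast
qed

text \<open>A bound for an operator of \<open>K[G]\<close> on elements representing all values extends to all of \<open>L\<close> by
  successive approximation; the a priori bound for the operator disposes of the remainder.\<close>

lemma KG_density:
  assumes T: "T \<in> KG"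
    and g: "\<And>m::int. \<exists>y\<in>L. veq y (of_int m / real N) \<and> vge (T y) (of_int m / real N + w)"
    and x: "x \<in> L" "vge x r"
  shows "vge (T x) (r + w)"
proof -
  obtain C where C: "C \<ge> 0" "\<And>x r. x \<in> L \<Longrightarrow> vge x r \<Longrightarrow> vge (T x) (r - C)"
    using KG_bounded[OF T] by blast
  \<comment> \<open>\<open>k\<close> counts approximation steps, each of which raises the remainder
    by \<open>1 / N\<close>; the minimum is \<open>r + w\<close> as soon as \<open>k / N\<close>
    reaches \<open>w + C\<close>.\<close>
  have main: "vge (T x) (min (r + w) (r + real k / real N - C))" if "x \<in> L" "vge x r" for k x r
    using that
  proof (induction k arbitrary: x r)
    case 0
    from C(2)[OF this] show ?case by (rule vge_mono) simp
  next
    case (Suc k)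
    show ?case
    proof (cases "x = 0")
      case True
      then show ?thesis by (simp add: KG_0 T)
    next
      case False
      then obtain r0 where r0: "veq x r0" by (rule ex_veq)
      then obtain m :: int where m: "real N * r0 = of_int m" using disc Suc by blast
      then have "r0 = of_int m / real N" using N_pos by (simp add: field_simps)
      with g[of m] obtain y where y: "y \<in> L" "veq y r0" "vge (T y) (r0 + w)" by metis
      obtain c where c: "c \<in> K" "vge c 0" "vge (x - c * y) (r0 + 1 / real N)"
        using approx[OF L order_refl KL discr_L Suc(2) y(1) r0 y(2)] by blast
      have in_L: "c * y \<in> L" "x - c * y \<in> L" using c y Suc by (auto intro!: fldD[OF L])
      have le: "r \<le> r0" using Suc r0 vge_veq_le by blast
      have eq: "T x = c * T y + T (x - c * y)"
        using in_L y c Suc(2) by (simp add: KG_diff T KG_scale)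
      have "vge (c * T y) (0 + (r0 + w))" by (intro vge_mult c y)
      then have 1: "vge (c * T y) (r + w)" by (rule vge_mono) (use le in simp)
      have "vge (T (x - c * y)) (min (r0 + 1 / real N + w) (r0 + 1 / real N + real k / real N - C))"
        using in_L c by (intro Suc.IH)
      then have 2: "vge (T (x - c * y)) (min (r + w) (r + real (Suc k) / real N - C))"
        proof (rule vge_mono)
          have "0 \<le> 1 / real N" "real (Suc k) / real N = 1 / real N + real k / real N"
            by (auto simp: add_divide_distrib)
          then show "min (r + w) (r + real (Suc k) / real N - C) \<le>
             min (r0 + 1 / real N + w) (r0 + 1 / real N + real k / real N - C)"
            using le min.cobounded1[of "r + w" "r + real (Suc k) / real N - C"]
              min.cobounded2[of "r + w" "r + real (Suc k) / real N - C"]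
            by (intro min.boundedI) linarith+
        qed
      show ?thesis unfolding eq
        by (intro vge_add vge_mono[OF 1] 2) simp
    qed
  qed
  obtain k :: nat where "real N * (w + C) \<le> real k" using real_arch_simple by blast
  then have "w + C \<le> real k / real N" using N_pos by (simp add: field_simps)
  then show ?thesis using main[OF x, of k] by (rule_tac vge_mono) auto
qed

end

section \<open>Scaffold operators from Artin-Schreier type generators\<close>

text \<open>All valuations are normalised on \<open>K\<close>: \<open>B i\<close> is \<open>b\<^sub>i / p\<^sup>i\<close>, the operators \<open>\<sigma>\<^sup>s\<^sup>i\<close>
  generate the ramification subgroups, \<open>G i j\<close> is \<open>b\<^sub>i / p\<^sup>j\<close> and \<open>R i\<close> bounds the error of the
  \<open>i\<close>-th operator of the scaffold.\<close>

locale scaffold_data = cyc_iso +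
  fixes n :: nat and Y :: "nat \<Rightarrow> 'a" and B R :: "nat \<Rightarrow> real" and s :: "nat \<Rightarrow> nat"
    and \<mu> \<epsilon> :: "nat \<Rightarrow> nat \<Rightarrow> 'a" and G :: "nat \<Rightarrow> nat \<Rightarrow> real"
  assumes Y_in: "i \<in> {1..n} \<Longrightarrow> Y i \<in> L"
    and Y_val: "i \<in> {1..n} \<Longrightarrow> veq (Y i) (- B i)"
    and B_pos: "i \<in> {1..n} \<Longrightarrow> 0 < B i"
    and R_ge: "i \<in> {1..n} \<Longrightarrow> B i \<le> R i"
    and s_less: "i \<in> {1..n} \<Longrightarrow> j \<in> {1..n} \<Longrightarrow> j < i \<Longrightarrow> (\<sigma> ^^ s i) (Y j) = Y j"
    and s_eq: "i \<in> {1..n} \<Longrightarrow> (\<sigma> ^^ s i) (Y i) = Y i + 1"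
    and s_greater: "i \<in> {1..n} \<Longrightarrow> j \<in> {1..n} \<Longrightarrow> i < j \<Longrightarrow> (\<sigma> ^^ s i) (Y j) = Y j + \<mu> i j + \<epsilon> i j"
    and \<mu>_in: "i \<in> {1..n} \<Longrightarrow> j \<in> {1..n} \<Longrightarrow> i < j \<Longrightarrow> \<mu> i j \<in> K"
    and \<mu>_val: "i \<in> {1..n} \<Longrightarrow> j \<in> {1..n} \<Longrightarrow> i < j \<Longrightarrow> vge (\<mu> i j) (G i j - B j)"
    and \<epsilon>_val: "i \<in> {1..n} \<Longrightarrow> j \<in> {1..n} \<Longrightarrow> i < j \<Longrightarrow> vge (\<epsilon> i j) (R i - B j)"
    and G_ge: "i \<in> {1..n} \<Longrightarrow> j \<in> {1..n} \<Longrightarrow> i < j \<Longrightarrow> 0 \<le> G i j"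
    and G_le: "i \<in> {1..n} \<Longrightarrow> j \<in> {1..n} \<Longrightarrow> i < j \<Longrightarrow> G i j \<le> B j"
    and R_G: "i \<in> {1..n} \<Longrightarrow> j \<in> {1..n} \<Longrightarrow> i < j \<Longrightarrow> R i \<le> R j - B j + G i j"
    and all_values: "\<exists>(d::nat \<Rightarrow> int) q::int. (\<forall>i\<in>{1..n}. 0 \<le> d i \<and> d i < int p) \<and>
       of_int m / real N = of_int q - (\<Sum>i=1..n. of_int (d i) * B i)"
begin

text \<open>There is no lower bound because repeated lowering leads to negative digits; there
  \<open>e d = 0\<close>, and upper estimates hold trivially.\<close>

definition valid :: "(nat \<Rightarrow> int) \<Rightarrow> bool" where "valid d \<longleftrightarrow> (\<forall>i\<in>{1..n}. d i < int p)"
definition e :: "(nat \<Rightarrow> int) \<Rightarrow> 'a" where "e d = (\<Prod>i\<in>{1..n}. bz (Y i) (d i))"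
definition V :: "(nat \<Rightarrow> int) \<Rightarrow> real" where "V d = (\<Sum>i\<in>{1..n}. - of_int (d i) * B i)"

text \<open>The intended main term has size \<open>V d + B i\<close>, so \<open>R i - B i\<close> is
  the relative precision of the operator.\<close>

definition good :: "nat \<Rightarrow> ('a \<Rightarrow> 'a) \<Rightarrow> bool" where
  "good i \<Psi> \<longleftrightarrow> \<Psi> \<in> KG \<and> \<Psi> 1 = 0 \<and>
     (\<forall>d. valid d \<longrightarrow> vge (\<Psi> (e d) - e (d(i := d i - 1))) (V d + R i))"

lemma e_in [simp]: "e d \<in> L"
  unfolding e_def by (intro fld_prod[OF L] fld_bz[OF L] Y_in)

lemma one_in: "1 \<in> K" "1 \<in> L" using fldD[OF K] fldD[OF L] by auto

lemma vge_Y: "i \<in> {1..n} \<Longrightarrow> vge (Y i) (- B i)"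
  using Y_val by (auto intro: veq_vge)

lemma vge_e: assumes "valid d" shows "vge (e d) (V d)"
  unfolding e_def V_def
proof (intro vge_prod)
  fix i assume i: "i \<in> {1..n}"
  have "vge (bz (Y i) (d i)) (of_int (d i) * (- B i))"
    using vge_Y[OF i] B_pos[OF i] assms i by (intro vge_bz) (auto simp: valid_def)
  then show "vge (bz (Y i) (d i)) (- of_int (d i) * B i)" by simp
qed

lemma veq_e: assumes "valid d" "\<And>i. i \<in> {1..n} \<Longrightarrow> 0 \<le> d i" shows "veq (e d) (V d)"
  unfolding e_def V_def
proof (intro veq_prod)
  fix i assume i: "i \<in> {1..n}"
  have "veq (bz (Y i) (d i)) (of_int (d i) * (- B i))"
    using Y_val[OF i] B_pos[OF i] assms i by (intro veq_bz) (auto simp: valid_def)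
  then show "veq (bz (Y i) (d i)) (- of_int (d i) * B i)" by simp
qed

lemma V_upd: "j \<in> {1..n} \<Longrightarrow> V (d(j := d j - k)) = V d + of_int k * B j"
proof -
  assume j: "j \<in> {1..n}"
  have "V (d(j := d j - k)) = - of_int (d j - k) * B j + (\<Sum>i\<in>{1..n} - {j}. - of_int (d i) * B i)"
    unfolding V_def using j by (subst sum.remove[of _ j]) (auto intro!: sum.cong)
  also have "V d = - of_int (d j) * B j + (\<Sum>i\<in>{1..n} - {j}. - of_int (d i) * B i)"
    unfolding V_def using j by (subst sum.remove[of _ j]) auto
  ultimately show ?thesis by (simp add: algebra_simps)
qed

lemma valid_upd: "valid d \<Longrightarrow> k \<ge> 0 \<Longrightarrow> valid (d(j := d j - k))"
  unfolding valid_def by (auto simp: fun_upd_apply intro: le_less_trans[of "d j - k" "d j"])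

text \<open>By \<open>all_values\<close>, the products of some \<open>e d\<close> with powers of a
  uniformizer of \<open>K\<close> take every value in \<open>1 / N\<close> times the integers.
  Operators are \<open>K\<close>-linear, so these products serve as test elements for
  \<open>KG_density\<close>.\<close>

lemma density:
  assumes T: "T \<in> KG" and g: "\<And>d. valid d \<Longrightarrow> vge (T (e d)) (V d + w)" and x: "x \<in> L" "vge x r"
  shows "vge (T x) (r + w)"
proof (rule KG_density[OF T _ x])
  fix m :: int
  obtain d :: "nat \<Rightarrow> int" and q :: int where d: "\<forall>i\<in>{1..n}. 0 \<le> d i \<and> d i < int p"
    "of_int m / real N = of_int q - (\<Sum>i=1..n. of_int (d i) * B i)"
    using all_values by blast
  have valid: "valid d" using d(1) by (simp add: valid_def)
  have m: "of_int m / real N = of_int q + V d"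
    unfolding d(2) V_def by (simp add: sum_negf)
  obtain w0 where w0: "w0 \<in> K" "veq w0 1" using K_unif by blast
  let ?c = "power_int w0 q"
  have c: "?c \<in> K" "veq ?c (of_int q)" using w0 fldD(11)[OF K] veq_power_int[of w0 1 q] by auto
  have "veq (?c * e d) (of_int q + V d)" using d(1) valid by (intro veq_mult c veq_e) auto
  moreover have "vge (?c * T (e d)) (of_int q + (V d + w))"
    using c g[OF valid] by (intro vge_mult) (auto intro: veq_vge)
  moreover have "?c * e d \<in> L" by (rule fldD(5)[OF L inL[OF c(1)] e_in])
  ultimately show "\<exists>y\<in>L. veq y (of_int m / real N) \<and> vge (T y) (of_int m / real N + w)"
    unfolding m KG_scale[OF T c(1) e_in, symmetric] add.assoc
    by (intro bexI[where x = "?c * e d"] conjI)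
qed

text \<open>Operators are later applied to error terms, which are arbitrary elements of
  \<open>L\<close>. Since \<open>B i \<le> R i\<close>, main term and error both gain
  \<open>B i\<close> on the \<open>e d\<close>, and \<open>density\<close> does the rest.\<close>

lemma good_global:
  assumes "good i \<Psi>" "i \<in> {1..n}" "x \<in> L" "vge x r"
  shows "vge (\<Psi> x) (r + B i)"
proof (rule density[OF _ _ assms(3,4)])
  show "\<Psi> \<in> KG" using assms by (simp add: good_def)
  fix d assume d: "valid d"
  let ?d = "d(i := d i - 1)"
  have "vge (e ?d) (V d + B i)"
    using vge_e[of ?d] valid_upd[OF d, of 1 i] V_upd[OF assms(2), of d 1] by simp
  moreover have "vge (\<Psi> (e d) - e ?d) (V d + B i)"
    using assms(1) d R_ge[OF assms(2)] unfolding good_def by (auto intro: vge_mono)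
  ultimately have "vge (\<Psi> (e d) - e ?d + e ?d) (V d + B i)" by (intro vge_add)
  then show "vge (\<Psi> (e d)) (V d + B i)" by simp
qed

lemma good_global_pow:
  assumes "good i \<Psi>" "i \<in> {1..n}" "x \<in> L" "vge x r"
  shows "vge ((\<Psi> ^^ k) x) (r + real k * B i)"
proof (induction k)
  case (Suc k)
  have "\<Psi> \<in> KG" using assms(1) by (simp add: good_def)
  then have "(\<Psi> ^^ k) x \<in> L" by (rule KG_in[OF KG_funpow assms(3)])
  from good_global[OF assms(1,2) this Suc] show ?case by (simp add: algebra_simps)
qed (use assms in simp)

text \<open>Telescoping: each intermediate error carries \<open>R j\<close> from the application in
  which it arises and \<open>B j\<close> from each of the other \<open>k - 1\<close>
  applications.\<close>

lemma good_pow: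
  assumes g: "good j \<Psi>" and j: "j \<in> {1..n}" and d: "valid d"
  shows "vge ((\<Psi> ^^ k) (e d) - e (d(j := d j - int k))) (V d + (real k - 1) * B j + R j)"
  using d
proof (induction k arbitrary: d)
  case (Suc k)
  let ?d = "d(j := d j - 1)"
  have \<Psi>: "\<Psi> \<in> KG" using g by (simp add: good_def)
  have 1: "vge ((\<Psi> ^^ k) (\<Psi> (e d) - e ?d)) (V d + R j + real k * B j)"
    using g Suc.prems \<Psi> by (intro good_global_pow[OF g j]) (auto simp: good_def intro!: fldD(4)[OF L])
  have 2: "vge ((\<Psi> ^^ k) (e ?d) - e (?d(j := ?d j - int k))) (V ?d + (real k - 1) * B j + R j)"
    by (intro Suc.IH valid_upd Suc.prems) auto
  have "vge ((\<Psi> ^^ k) (\<Psi> (e d) - e ?d) + ((\<Psi> ^^ k) (e ?d) - e (?d(j := ?d j - int k))))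
      (V d + (real (Suc k) - 1) * B j + R j)"
    using 1 2 V_upd[OF j, of d 1] by (intro vge_add) (auto simp: algebra_simps)
  moreover have "(\<Psi> ^^ k) (\<Psi> (e d) - e ?d) = (\<Psi> ^^ Suc k) (e d) - (\<Psi> ^^ k) (e ?d)"
    using \<Psi> KG_funpow[OF \<Psi>, of k] by (simp add: KG_diff funpow_swap1)
  moreover have "?d(j := ?d j - int k) = d(j := d j - int (Suc k))" by auto
  ultimately show ?case by (simp only: diff_add_cancel add_diff_eq)
qed simp

text \<open>The truncated power \<open>(1 + \<Psi>)\<^sup>-\<^sup>m\<close>, which replaces \<open>bz (Y j)\<close> by \<open>bz (Y j - m)\<close>.\<close>

definition trunc :: "('a \<Rightarrow> 'a) \<Rightarrow> 'a \<Rightarrow> 'a \<Rightarrow> 'a" where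
  "trunc \<Psi> m x = (\<Sum>k<p. bz (- m) (int k) * (\<Psi> ^^ k) x)"

lemma bz_mu:
  assumes "j \<in> {1..n}" "vge m (g - B j)" "g \<le> B j" "k < p"
  shows "vge (bz (- m) (int k)) (real k * (g - B j))"
  using vge_bz[of "- m" "g - B j" "int k"] assms by auto

text \<open>\<open>m\<close> may have a pole, but \<open>bz (- m) k\<close> loses at most
  \<open>k * (B j - g)\<close> while the \<open>k\<close>-th power of the operator gains
  \<open>k * B j\<close>; hence values do not drop. In the error, one \<open>B j\<close> is replaced
  by \<open>R j\<close>, and the term \<open>k = 0\<close> is exact.\<close>

lemma trunc_props:
  assumes g: "good j \<Psi>" and j: "j \<in> {1..n}" and m: "m \<in> K" "vge m (g - B j)" "0 \<le> g" "g \<le> B j"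
  shows "trunc \<Psi> m \<in> KG" "trunc \<Psi> m 1 = 1"
    "\<And>x r. x \<in> L \<Longrightarrow> vge x r \<Longrightarrow> vge (trunc \<Psi> m x) r"
    "\<And>d. valid d \<Longrightarrow> vge (trunc \<Psi> m (e d) - (\<Sum>k<p. bz (- m) (int k) * e (d(j := d j - int k)))) (V d + g + R j - B j)"
proof -
  have \<Psi>: "\<Psi> \<in> KG" "\<Psi> 1 = 0" using g by (auto simp: good_def)
  show "trunc \<Psi> m \<in> KG" unfolding trunc_def[abs_def]
    using m by (intro KG_Sum KG_cmult KG_funpow \<Psi> fld_bz[OF K] fldD(7)[OF K])
  have "(\<Psi> ^^ Suc k) 1 = 0" for k by (induction k) (auto simp: \<Psi> KG_0)
  then have "bz (- m) (int k) * (\<Psi> ^^ k) 1 = (if k = 0 then 1 else 0)" for k by (cases k) auto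
  then show "trunc \<Psi> m 1 = 1" unfolding trunc_def using p_pos by simp
  show "vge (trunc \<Psi> m x) r" if "x \<in> L" "vge x r" for x r
    unfolding trunc_def
  proof (intro vge_sum)
    fix k assume "k \<in> {..<p}"
    then have "vge (bz (- m) (int k) * (\<Psi> ^^ k) x) (real k * (g - B j) + (r + real k * B j))"
      using m that by (intro vge_mult bz_mu good_global_pow[OF g j] j) auto
    then show "vge (bz (- m) (int k) * (\<Psi> ^^ k) x) r"
      by (rule vge_mono) (use m in \<open>simp add: algebra_simps\<close>)
  qed
  show "vge (trunc \<Psi> m (e d) - (\<Sum>k<p. bz (- m) (int k) * e (d(j := d j - int k)))) (V d + g + R j - B j)"
    if d: "valid d" for d
    unfolding trunc_def sum_subtractf[symmetric] right_diff_distrib[symmetric]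
  proof (intro vge_sum)
    fix k assume k: "k \<in> {..<p}"
    show "vge (bz (- m) (int k) * ((\<Psi> ^^ k) (e d) - e (d(j := d j - int k)))) (V d + g + R j - B j)"
    proof (cases "k = 0")
      case False
      have "vge (bz (- m) (int k) * ((\<Psi> ^^ k) (e d) - e (d(j := d j - int k))))
        (real k * (g - B j) + (V d + (real k - 1) * B j + R j))"
        using m k d by (intro vge_mult bz_mu good_pow[OF g j] j) auto
      moreover have "g \<le> real k * g" using False m(3) by (cases k) (auto simp: algebra_simps)
      ultimately show ?thesis by (elim vge_mono) (simp add: algebra_simps)
    qed simp
  qed
qed

text \<open>\<open>S\<close> collects the indices whose translation by \<open>\<mu> i k\<close> has
  already been arranged; \<open>twist_exists\<close> enlarges it by one index at a time.\<close>

definition eS :: "nat \<Rightarrow> nat set \<Rightarrow> (nat \<Rightarrow> int) \<Rightarrow> 'a" where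
  "eS i S d = (\<Prod>k\<in>{1..n}. bz (Y k - (if k \<in> S then \<mu> i k else 0)) (d k))"

lemma eS_vandermonde:
  assumes "j \<in> {1..n}" "j \<notin> S" "valid d"
  shows "(\<Sum>k<p. bz (- \<mu> i j) (int k) * eS i S (d(j := d j - int k))) = eS i (insert j S) d"
proof -
  let ?P = "\<lambda>S d. \<Prod>k\<in>{1..n} - {j}. bz (Y k - (if k \<in> S then \<mu> i k else 0)) (d k)"
  have 1: "eS i S (d(j := d j - int k)) = bz (Y j) (d j - int k) * ?P S d" for k
    unfolding eS_def using assms(1,2) by (subst prod.remove[of _ j]) (auto intro!: prod.cong)
  have 2: "eS i (insert j S) d = bz (Y j + - \<mu> i j) (d j) * ?P S d"
    unfolding eS_def using assms(1,2) by (subst prod.remove[of _ j]) (auto intro!: prod.cong)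
  have "bz (Y j + - \<mu> i j) (d j) = (\<Sum>k<p. bz (- \<mu> i j) (int k) * bz (Y j) (d j - int k))"
    using assms by (intro bz_vandermonde prime char) (auto simp: valid_def)
  then show ?thesis unfolding 1 2 by (simp add: sum_distrib_right mult.assoc)
qed

text \<open>\<open>Q\<close> compensates in advance the translations by \<open>\<mu> i j\<close>
  that \<open>\<sigma> ^^ s i\<close> causes for \<open>j > i\<close>. Each truncated power changes
  one digit only, so the indices can be treated successively; \<open>R_G\<close> says that the error
  for index \<open>j\<close> is within \<open>R i\<close>.\<close>

lemma twist_exists:
  assumes i: "i \<in> {1..n}" and \<Psi>: "\<And>j. j \<in> {i<..n} \<Longrightarrow> good j (\<Psi> j)" and m: "i \<le> m" "m \<le> n"
  shows "\<exists>Q\<in>KG. Q 1 = 1 \<and> (\<forall>x\<in>L. \<forall>r. vge x r \<longrightarrow> vge (Q x) r) \<and>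
     (\<forall>d. valid d \<longrightarrow> vge (Q (e d) - eS i {i<..m} d) (V d + R i))"
  using m
proof (induction m rule: dec_induct)
  case base
  have "eS i {} d = e d" for d by (simp add: eS_def e_def)
  then show ?case by (intro bexI[of _ "\<lambda>x. x"]) (auto simp: KG_id)
next
  case (step m)
  have "m \<le> n" using step by simp
  from step.IH[OF this] obtain Q where Q0: "Q \<in> KG" and
    Q1: "Q 1 = 1 \<and> (\<forall>x\<in>L. \<forall>r. vge x r \<longrightarrow> vge (Q x) r) \<and>
     (\<forall>d. valid d \<longrightarrow> vge (Q (e d) - eS i {i<..m} d) (V d + R i))" by (rule bexE)
  have Q: "Q \<in> KG" "Q 1 = 1" "\<And>x r. x \<in> L \<Longrightarrow> vge x r \<Longrightarrow> vge (Q x) r"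
    "\<And>d. valid d \<Longrightarrow> vge (Q (e d) - eS i {i<..m} d) (V d + R i)"
    using Q0 Q1 by simp_all
  define j where "j = Suc m"
  have j: "j \<in> {1..n}" "i < j" "j \<in> {i<..n}" using step by (auto simp: j_def)
  let ?T = "trunc (\<Psi> j) (\<mu> i j)"
  note tp = trunc_props[OF \<Psi>[OF j(3)] j(1) \<mu>_in[OF i j(1,2)] \<mu>_val[OF i j(1,2)] G_ge[OF i j(1,2)] G_le[OF i j(1,2)]]
  have ins: "{i<..Suc m} = insert j {i<..m}" using step by (auto simp: j_def)
  have bzK: "bz (- \<mu> i j) k \<in> K" for k using \<mu>_in[OF i j(1,2)] by (intro fld_bz[OF K] fldD[OF K])
  have "vge (Q (?T (e d)) - eS i {i<..Suc m} d) (V d + R i)" if d: "valid d" for d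
  proof -
    let ?F = "\<Sum>k<p. bz (- \<mu> i j) (int k) * e (d(j := d j - int k))"
    have F: "?F \<in> L" using bzK by (intro fld_sum[OF L] fldD(5)[OF L]) auto
    have "vge (?T (e d) - ?F) (V d + R i)"
      using tp(4)[OF d] R_G[OF i j(1,2)] by (auto elim!: vge_mono)
    then have 1: "vge (Q (?T (e d) - ?F)) (V d + R i)" using F tp(1) by (intro Q fldD(4)[OF L]) auto
    have QF: "Q ?F = (\<Sum>k<p. bz (- \<mu> i j) (int k) * Q (e (d(j := d j - int k))))"
      using bzK Q(1) by (subst KG_sum) (auto simp: KG_scale intro!: fldD(5)[OF L])
    have 2: "vge (Q ?F - eS i {i<..Suc m} d) (V d + R i)"
      unfolding QF ins
    proof -
      have nin: "j \<notin> {i<..m}" by (simp add: j_def)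
      show "vge ((\<Sum>k<p. bz (- \<mu> i j) (int k) * Q (e (d(j := d j - int k)))) - eS i (insert j {i<..m}) d) (V d + R i)"
        unfolding eS_vandermonde[OF j(1) nin d, symmetric] sum_subtractf[symmetric] right_diff_distrib[symmetric]
      proof (intro vge_sum)
        fix k assume k: "k \<in> {..<p}"
        let ?d = "d(j := d j - int k)"
        have "vge (bz (- \<mu> i j) (int k) * (Q (e ?d) - eS i {i<..m} ?d)) (real k * (G i j - B j) + (V ?d + R i))"
          using k by (intro vge_mult bz_mu[OF j(1) \<mu>_val[OF i j(1,2)] G_le[OF i j(1,2)]] Q valid_upd d) auto
        then show "vge (bz (- \<mu> i j) (int k) * (Q (e ?d) - eS i {i<..m} ?d)) (V d + R i)"
          by (rule vge_mono) (use V_upd[OF j(1), of d "int k"] G_ge[OF i j(1,2)] in \<open>simp add: algebra_simps\<close>)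
      qed
    qed
    have "Q (?T (e d) - ?F) = Q (?T (e d)) - Q ?F"
      using F tp(1) by (intro KG_diff Q) auto
    with vge_add[OF 1 2] show ?thesis by simp
  qed
  moreover have "(\<lambda>x. Q (?T x)) \<in> KG" by (rule KG_comp[OF Q(1) tp(1)])
  moreover have "Q (?T 1) = 1" unfolding tp(2) by (rule Q(2))
  moreover have "vge (Q (?T x)) r" if "x \<in> L" "vge x r" for x r
    using that tp(1) by (intro Q(3) tp(3)) auto
  ultimately show ?case
    by (intro bexI[of _ "\<lambda>x. Q (?T x)"] conjI ballI allI impI)
qed

text \<open>On \<open>e d\<close>, the composite of \<open>Q\<close> and
  \<open>\<sigma> ^^ s i\<close> merely replaces \<open>Y i\<close> by \<open>Y i + 1\<close>, up to
  the allowed error. By Pascal's rule \<open>bz_plus_1\<close>, subtracting the identity leaves the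
  product with digit \<open>i\<close> lowered.\<close>

lemma good_exists:
  assumes i: "i \<in> {1..n}" and \<Psi>: "\<And>j. j \<in> {i<..n} \<Longrightarrow> good j (\<Psi> j)"
  shows "\<exists>\<Phi>. good i \<Phi>"
proof -
  obtain Q where Q: "Q \<in> KG" "Q 1 = 1" "\<And>d. valid d \<Longrightarrow> vge (Q (e d) - eS i {i<..n} d) (V d + R i)"
    using twist_exists[OF i \<Psi>, of n] i by (metis atLeastAtMost_iff order_refl)
  define \<Phi> where "\<Phi> = (\<lambda>x. (\<sigma> ^^ s i) (Q x) - x)"
  have "\<Phi> \<in> KG" unfolding \<Phi>_def by (intro KG_minus KG_pow KG_id Q)
  moreover have "\<Phi> 1 = 0" using one_in by (simp add: \<Phi>_def Q)
  moreover have "vge (\<Phi> (e d) - e (d(i := d i - 1))) (V d + R i)" if d: "valid d" for d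
  proof -
    let ?h = "\<lambda>k. Y k - (if k \<in> {i<..n} then \<mu> i k else 0)"
    have h: "?h k \<in> L" if "k \<in> {1..n}" for k
      using that Y_in \<mu>_in i by (auto intro!: fldD(4)[OF L])
    have eS_in: "eS i {i<..n} d \<in> L"
      unfolding eS_def by (intro fld_prod[OF L] fld_bz[OF L] h)
    have 1: "vge ((\<sigma> ^^ s i) (Q (e d) - eS i {i<..n} d)) (V d + R i)"
      using Q(3)[OF d] Q(1) eS_in by (subst vge_pow) (auto intro!: fldD(4)[OF L])
    define f where "f = (\<lambda>k. bz ((\<sigma> ^^ s i) (?h k)) (d k))"
    define g where "g = (\<lambda>k. if k = i then bz (Y i + 1) (d i) else bz (Y k) (d k))"
    have f: "(\<sigma> ^^ s i) (eS i {i<..n} d) = prod f {1..n}"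
    proof -
      have "(\<sigma> ^^ s i) (eS i {i<..n} d) = (\<Prod>k\<in>{1..n}. (\<sigma> ^^ s i) (bz (?h k) (d k)))"
        unfolding eS_def by (rule pow_prod) (rule fld_bz[OF L h])
      also have "\<dots> = prod f {1..n}"
        unfolding f_def by (rule prod.cong[OF refl]) (rule pow_bz[OF h])
      finally show ?thesis .
    qed
    have di: "d i < int p" using d i by (simp add: valid_def)
    have g: "prod g {1..n} = e d + e (d(i := d i - 1))"
    proof -
      have "prod g {1..n} = bz (Y i + 1) (d i) * (\<Prod>k\<in>{1..n} - {i}. bz (Y k) (d k))"
        using i by (subst prod.remove[of _ i]) (auto simp: g_def intro!: prod.cong)
      moreover have "e d = bz (Y i) (d i) * (\<Prod>k\<in>{1..n} - {i}. bz (Y k) (d k))"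
        unfolding e_def using i by (subst prod.remove[of _ i]) auto
      moreover have "e (d(i := d i - 1)) = bz (Y i) (d i - 1) * (\<Prod>k\<in>{1..n} - {i}. bz (Y k) (d k))"
        unfolding e_def using i by (subst prod.remove[of _ i]) (auto intro!: prod.cong)
      ultimately show ?thesis using bz_plus_1[OF prime char di, of "Y i"] by (simp add: algebra_simps)
    qed
    have val: "vge (bz y (d k)) (- of_int (d k) * B k)" if "vge y (- B k)" "k \<in> {1..n}" for y k
      using vge_bz[of y "- B k" "d k"] that B_pos[of k] d by (auto simp: valid_def)
    have sh: "(\<sigma> ^^ s i) (?h k) = (if k < i then Y k else if k = i then Y k + 1 else Y k + \<epsilon> i k)"
      if k: "k \<in> {1..n}" for k
    proof -
      consider "k < i" | "k = i" | "i < k" by linarith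
      then show ?thesis
      proof cases
        case 3
        then have "(\<sigma> ^^ s i) (?h k) = (\<sigma> ^^ s i) (Y k) - \<mu> i k"
          using k i \<mu>_in[OF i k 3] Y_in[OF k] by (simp add: pow_diff)
        then show ?thesis using 3 s_greater[OF i k 3] by simp
      qed (use k i s_less s_eq in auto)
    qed
    have Y1: "vge (Y i + 1) (- B i)" using vge_Y[OF i] B_pos[OF i] by (intro vge_add veq_vge[OF veq_1]) auto
    have Ye: "vge (Y k + \<epsilon> i k) (- B k)" if "k \<in> {1..n}" "i < k" for k
      using vge_Y[OF that(1)] \<epsilon>_val[OF i that] R_ge[OF i] B_pos[OF i] by (intro vge_add) (auto elim!: vge_mono)
    have "vge (prod f {1..n} - prod g {1..n}) ((\<Sum>k\<in>{1..n}. - of_int (d k) * B k) + R i)"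
    proof (intro prod_lipschitz)
      fix k assume k: "k \<in> {1..n}"
      show "vge (f k) (- of_int (d k) * B k)"
        unfolding f_def sh[OF k] using k Y1 Ye[OF k] vge_Y[OF k] by (intro val k) auto
      show "vge (g k) (- of_int (d k) * B k)"
        unfolding g_def using val[OF Y1 i] val[OF vge_Y[OF k] k] by auto
      consider "k < i" | "k = i" | "i < k" by linarith
      then show "vge (f k - g k) (- of_int (d k) * B k + R i)"
      proof cases
        case 3
        have "vge (bz (Y k + \<epsilon> i k) (d k) - bz (Y k) (d k)) (- of_int (d k) * B k + R i)"
          using vge_Y[OF k] \<epsilon>_val[OF i k 3] R_ge[OF i] B_pos[OF i] B_pos[OF k] d k
          by (intro bz_lipschitz) (auto simp: valid_def)
        with 3 show ?thesis unfolding f_def g_def sh[OF k] by simp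
      qed (unfold f_def g_def sh[OF k], auto)
    qed
    then have 2: "vge ((\<sigma> ^^ s i) (eS i {i<..n} d) - (e d + e (d(i := d i - 1)))) (V d + R i)"
      unfolding f g V_def .
    have "\<Phi> (e d) - e (d(i := d i - 1)) =
      (\<sigma> ^^ s i) (Q (e d) - eS i {i<..n} d) + ((\<sigma> ^^ s i) (eS i {i<..n} d) - (e d + e (d(i := d i - 1))))"
      unfolding \<Phi>_def using eS_in Q(1) by (simp add: pow_diff)
    with vge_add[OF 1 2] show ?thesis by (simp only:)
  qed
  ultimately show ?thesis unfolding good_def by blast
qed

lemma scaffold_operators: "\<exists>\<Psi>. \<forall>i\<in>{1..n}. good i (\<Psi> i)"
proof -
  have "\<exists>\<Phi>. good i \<Phi>" if "i \<in> {1..n}" for i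
    using that
  proof (induction "n - i" arbitrary: i rule: less_induct)
    case less
    have "\<exists>\<Phi>. good j \<Phi>" if "j \<in> {i<..n}" for j
      using that less by (intro less.hyps) auto
    then obtain \<Psi> where "\<And>j. j \<in> {i<..n} \<Longrightarrow> good j (\<Psi> j)" by metis
    then show ?case by (intro good_exists less.prems)
  qed
  then show ?thesis by metis
qed

end

section \<open>Totally ramified cyclic extensions\<close>

context valued
begin

text \<open>Among nonzero terms of distinct values the minimum is attained once, so no cancellation
  occurs and the sum has this minimal value.\<close>

lemma vge_sum_distinct:
  assumes fin: "finite I" and dist: "\<And>i j r. i \<in> I \<Longrightarrow> j \<in> I \<Longrightarrow> veq (f i) r \<Longrightarrow> veq (f j) r \<Longrightarrow> i = j"
    and s: "vge (sum f I) r" and i: "i \<in> I"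
  shows "vge (f i) r"
proof (rule ccontr)
  assume n: "\<not> vge (f i) r"
  define J where "J = {j \<in> I. f j \<noteq> 0}"
  have "f i \<noteq> 0" using n by auto
  then have J: "finite J" "i \<in> J" using fin i by (auto simp: J_def)
  define w where "w = (\<lambda>j. SOME t. veq (f j) t)"
  have w: "veq (f j) (w j)" if "j \<in> J" for j
    using that ex_veq[of "f j"] unfolding w_def J_def by (auto intro: someI)
  have inj: "inj_on w J"
    using dist w by (force simp: inj_on_def J_def)
  obtain i0 where i0: "i0 \<in> J" "\<And>j. j \<in> J \<Longrightarrow> w i0 \<le> w j"
    using J by (metis arg_min_if_finite(1) arg_min_least empty_iff)
  have less: "w i0 < w j" if "j \<in> J" "j \<noteq> i0" for j
    using i0 that inj by (metis inj_onD order_le_less)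
  define s where "s = (if J - {i0} = {} then w i0 + 1 else Min (w ` (J - {i0})))"
  have s0: "w i0 < s" using J(1) less by (auto simp: s_def)
  have s1: "s \<le> w j" if "j \<in> J" "j \<noteq> i0" for j using that J(1) by (auto simp: s_def intro!: Min_le)
  have "veq (sum f J) (w i0)"
  proof (rule sum_eq_ge[of J i0 f "w i0" s])
    show "vge (f j) s" if "j \<in> J" "j \<noteq> i0" for j using that by (intro veq_vge[OF w s1])
  qed (use J(1) i0(1) w s0 in auto)
  moreover have "sum f I = sum f J" unfolding J_def using fin by (intro sum.mono_neutral_right) auto
  ultimately have "r \<le> w i0" using \<open>vge (sum f I) r\<close> vge_veq_le by simp
  also have "w i0 \<le> w i" using i0 J by blast
  finally show False using n w[OF J(2)] veq_vge by blast
qed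

end

lemma real_div_mod_eq: "e > 0 \<Longrightarrow> e * r = q * e + i \<Longrightarrow> r = q + i / e" for e r q i :: real
  using nonzero_mult_div_cancel_left[of e r] by (simp add: add_divide_distrib)

lemma real_div_mod_cong: "e > 0 \<Longrightarrow> a + i * (1 / e) = s \<Longrightarrow> b + j * (1 / e) = s \<Longrightarrow> a * e + i = b * e + j"
  for e a b i j s :: real
proof -
  assume e: "e > 0" and eq: "a + i * (1 / e) = s" "b + j * (1 / e) = s"
  have "a * e + i = (a + i * (1 / e)) * e" "b * e + j = (b + j * (1 / e)) * e"
    using e by (simp_all add: distrib_right)
  then show ?thesis using eq by (simp only:)
qed

text \<open>Invariance of \<open>v\<close> under \<open>\<sigma>\<close> is a result here, not an
  assumption: it follows from completeness of \<open>K\<close>, and the closing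
  \<open>sublocale\<close> records it together with the ramification index \<open>N\<close>.\<close>

locale cyc_gal = cyc_ext +
  assumes complete: "complete_field v K"
    and fixed: "x \<in> L \<Longrightarrow> \<sigma> x = x \<Longrightarrow> x \<in> K"
    and faithful: "0 < i \<Longrightarrow> i < N \<Longrightarrow> \<exists>x\<in>L. (\<sigma> ^^ i) x \<noteq> x"
begin

lemma coeff_linear_mult:
  "Polynomial.coeff ([:- a, 1:] * q) j = - a * Polynomial.coeff q j + (if j = 0 then 0 else Polynomial.coeff q (j - 1))"
  for a :: 'a
  by (cases j) (auto simp: coeff_pCons)

lemma orbit_poly_in:
  "finite I \<Longrightarrow> (\<And>i. i \<in> I \<Longrightarrow> f i \<in> L) \<Longrightarrow> Polynomial.coeff (\<Prod>i\<in>I. [:- f i, 1:]) j \<in> L"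
proof (induction I arbitrary: j rule: finite_induct)
  case empty
  then show ?case by (auto simp: coeff_pCons fldD[OF L] one_pCons split: nat.splits)
next
  case (insert i I)
  then have "- f i * Polynomial.coeff (\<Prod>i\<in>I. [:- f i, 1:]) j +
     (if j = 0 then 0 else Polynomial.coeff (\<Prod>i\<in>I. [:- f i, 1:]) (j - 1)) \<in> L"
    by (cases "j = 0") (auto intro!: fldD(4,5,7)[OF L])
  then show ?case unfolding prod.insert[OF insert(1,2)] coeff_linear_mult .
qed

lemma orbit_poly_sigma:
  "finite I \<Longrightarrow> (\<And>i. i \<in> I \<Longrightarrow> f i \<in> L) \<Longrightarrow>
   \<sigma> (Polynomial.coeff (\<Prod>i\<in>I. [:- f i, 1:]) j) = Polynomial.coeff (\<Prod>i\<in>I. [:- \<sigma> (f i), 1:]) j"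
proof (induction I arbitrary: j rule: finite_induct)
  case empty
  then show ?case by (auto simp: coeff_pCons fldD[OF K] \<sigma>_fix one_pCons split: nat.splits)
next
  case (insert i I)
  let ?q = "\<Prod>i\<in>I. [:- f i, 1:]"
  have q: "Polynomial.coeff ?q j \<in> L" for j using insert by (intro orbit_poly_in) auto
  have \<sigma>m: "\<sigma> (- x) = - \<sigma> x" if "x \<in> L" for x using pow_diff[of 0 x 1] that fldD[OF L] fldD[OF K] \<sigma>_fix[of 0] by simp
  have "\<sigma> (- f i * Polynomial.coeff ?q j + (if j = 0 then 0 else Polynomial.coeff ?q (j - 1))) =
    - \<sigma> (f i) * \<sigma> (Polynomial.coeff ?q j) + (if j = 0 then 0 else \<sigma> (Polynomial.coeff ?q (j - 1)))"
  proof -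
    have f: "f i \<in> L" "- f i \<in> L" "- f i * Polynomial.coeff ?q j \<in> L"
      using insert q fldD(5,7)[OF L] by auto
    have "(if j = 0 then 0 else Polynomial.coeff ?q (j - 1)) \<in> L" using q fldD(1)[OF L] by auto
    from \<sigma>_add[OF f(3) this] show ?thesis
      unfolding \<sigma>_mult[OF f(2) q] \<sigma>m[OF f(1)] using \<sigma>_fix[OF fldD(1)[OF K]] by auto
  qed
  with insert show ?case unfolding prod.insert[OF insert(1,2)] coeff_linear_mult by simp
qed

lemma orbit_poly_in_K:
  assumes a: "a \<in> L"
  shows "Polynomial.coeff (\<Prod>i<N. [:- (\<sigma> ^^ i) a, 1:]) j \<in> K"
proof -
  let ?P = "\<lambda>k. \<Prod>i<N. [:- (\<sigma> ^^ (i + k)) a, 1:]"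
  let ?f = "\<lambda>i. [:- (\<sigma> ^^ i) a, 1:]"
  \<comment> \<open>Both sides are the product over \<open>i \<le> N\<close>. The factors for
    \<open>0\<close> and \<open>N\<close> coincide, so cancelling them shows that
    \<open>\<sigma>\<close> only permutes the linear factors.\<close>
  have "?f 0 * ?P 1 = ?P 0 * ?f N"
    using prod.lessThan_Suc_shift[of ?f N] prod.lessThan_Suc[of ?f N] by simp
  then have "?f 0 * ?P 1 = ?f 0 * ?P 0" using period[OF a] by (simp add: mult.commute)
  moreover have "?f 0 \<noteq> 0" by simp
  ultimately have eq: "?P 1 = ?P 0" using mult_left_cancel by blast
  have "\<sigma> (Polynomial.coeff (?P 0) j) = Polynomial.coeff (?P 1) j"
    using a by (subst orbit_poly_sigma) auto
  then have "\<sigma> (Polynomial.coeff (?P 0) j) = Polynomial.coeff (?P 0) j" unfolding eq .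
  moreover have "Polynomial.coeff (?P 0) j \<in> L" using a by (intro orbit_poly_in) auto
  ultimately show ?thesis using fixed by simp
qed

text \<open>\<open>a\<close> is a root of its orbit polynomial, monic of degree \<open>N\<close>
  over \<open>K\<close>. If no such multiple of \<open>r\<close> were an integer, the nonzero terms
  at \<open>a\<close> would have distinct values, and their sum being \<open>0\<close> would force
  the leading term to vanish.\<close>

lemma val_denominator:
  assumes a: "a \<in> L" "veq a r"
  shows "\<exists>k. 0 < k \<and> k \<le> N \<and> (\<exists>m::int. real k * r = of_int m)"
proof -
  let ?P = "\<Prod>i<N. [:- (\<sigma> ^^ i) a, 1:]"
  have deg: "Polynomial.degree ?P = N" by (subst degree_prod_eq_sum_degree) auto
  have lc: "Polynomial.coeff ?P N = 1"
    using lead_coeff_prod[of "\<lambda>i. [:- (\<sigma> ^^ i) a, 1:]" "{..<N}"] deg by simp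
  have "Polynomial.poly ?P a = 0" using N_pos by (auto simp: poly_prod intro!: bexI[of _ 0])
  then have s: "(\<Sum>j\<le>N. Polynomial.coeff ?P j * a ^ j) = 0" by (simp add: poly_altdef deg)
  show ?thesis
  proof (rule ccontr)
    assume no: "\<not> ?thesis"
    have less: False if "i < j" "j \<le> N" "veq (Polynomial.coeff ?P i * a ^ i) t" "veq (Polynomial.coeff ?P j * a ^ j) t" for i j t
    proof -
      have "Polynomial.coeff ?P i \<noteq> 0" "Polynomial.coeff ?P j \<noteq> 0" using that veq_nz by fastforce+
      then obtain c d where cd: "veq (Polynomial.coeff ?P i) c" "veq (Polynomial.coeff ?P j) d" by (metis ex_veq)
      obtain m1 m2 :: int where m: "c = of_int m1" "d = of_int m2"
        using K_int[OF orbit_poly_in_K[OF a(1)]] cd by metis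
      have "c + real i * r = t" "d + real j * r = t"
        using veq_unique[OF veq_mult[OF cd(1) veq_power[OF a(2), of i]] that(3)]
          veq_unique[OF veq_mult[OF cd(2) veq_power[OF a(2), of j]] that(4)] by simp_all
      then have "real (j - i) * r = of_int (m1 - m2)"
        using \<open>i < j\<close> by (simp add: of_nat_diff algebra_simps m)
      moreover have "0 < j - i" "j - i \<le> N" using that by auto
      ultimately show False using no by blast
    qed
    have "vge (Polynomial.coeff ?P N * a ^ N) C" for C
    proof (rule vge_sum_distinct[of "{..N}" "\<lambda>j. Polynomial.coeff ?P j * a ^ j" C N])
      show "vge (\<Sum>j\<le>N. Polynomial.coeff ?P j * a ^ j) C" by (simp only: s vge_0)
      fix i j t assume "i \<in> {..N}" "j \<in> {..N}" "veq (Polynomial.coeff ?P i * a ^ i) t" "veq (Polynomial.coeff ?P j * a ^ j) t"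
      then show "i = j" using less by (metis atMost_iff linorder_neqE_nat)
    qed auto
    then have "Polynomial.coeff ?P N * a ^ N = 0" by (rule vge_all_0)
    then show False using lc a(2) veq_nz[of a r] by simp
  qed
qed

text \<open>The factorial of \<open>N\<close> is a common denominator of all values, so there is a
  least positive one; division with remainder shows that it generates the value group. Its
  denominator \<open>E\<close> is identified with \<open>N\<close> only in
  \<open>discr_N\<close>.\<close>

lemma uniformizer_exists: "\<exists>E \<pi>. discr L E \<and> \<pi> \<in> L \<and> veq \<pi> (1 / real E)"
proof -
  define M :: nat where "M = fact N"
  have M: "M > 0" by (simp add: M_def)
  have int: "\<exists>m::int. real M * r = of_int m" if a: "a \<in> L" "veq a r" for a r
  proof -
    obtain k m where k: "0 < k" "k \<le> N" "real k * r = of_int (m::int)" using val_denominator[OF a] by blast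
    have "k dvd M" unfolding M_def using k by (simp add: dvd_fact)
    then obtain q where "M = k * q" by (rule dvdE)
    then have "real M * r = of_int (int q * m)" using k by (simp add: mult_ac)
    then show ?thesis by blast
  qed
  define S where "S = (\<lambda>k::nat. 0 < k \<and> (\<exists>a\<in>L. veq a (real k / real M)))"
  have SM: "S M" using K_unif M by (auto simp: S_def)
  define k0 where "k0 = (LEAST k. S k)"
  have k0: "S k0" unfolding k0_def using SM by (rule LeastI)
  then obtain \<pi> where \<pi>: "\<pi> \<in> L" "veq \<pi> (real k0 / real M)" and k0p: "k0 > 0" by (auto simp: S_def)
  have dvd: "int k0 dvd m" if a: "a \<in> L" "veq a (of_int m / real M)" for a m
  proof -
    let ?q = "m div int k0"
    have "veq (a / power_int \<pi> ?q) (of_int m / real M - of_int ?q * (real k0 / real M))"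
      by (intro veq_divide veq_power_int a \<pi>)
    moreover have "of_int m / real M - of_int ?q * (real k0 / real M) = real (nat (m mod int k0)) / real M"
    proof -
      have "of_int m = (of_int (?q * int k0 + m mod int k0) :: real)"
        by (simp only: div_mult_mod_eq)
      also have "\<dots> = of_int ?q * real k0 + of_int (m mod int k0)" by (simp only: of_int_add of_int_mult of_int_of_nat_eq)
      finally have "of_int m - of_int ?q * real k0 = (of_int (m mod int k0) :: real)" by linarith
      moreover have "of_int (m mod int k0) = real (nat (m mod int k0))" using k0p by simp
      ultimately show ?thesis by (simp only: times_divide_eq_right diff_divide_distrib[symmetric])
    qed
    ultimately have v: "veq (a / power_int \<pi> ?q) (real (nat (m mod int k0)) / real M)" by (simp only:)
    have "nat (m mod int k0) < k0" using k0p by (simp add: nat_less_iff)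
    then have "\<not> S (nat (m mod int k0))" unfolding k0_def by (rule not_less_Least)
    moreover have "a / power_int \<pi> ?q \<in> L" by (intro fldD(8,11)[OF L] a \<pi>)
    ultimately have "nat (m mod int k0) = 0" using v unfolding S_def neq0_conv[symmetric] by blast
    moreover have "m mod int k0 \<ge> 0" using k0p by simp
    ultimately have "m mod int k0 = 0" by linarith
    then show ?thesis by (simp only: dvd_eq_mod_eq_0)
  qed
  have "int k0 dvd int M" using SM dvd[of _ "int M"] by (auto simp: S_def)
  then obtain E where E: "M = k0 * E" by (auto simp: int_dvd_int_iff elim: dvdE)
  then have E0: "E > 0" using M by (cases E) auto
  have v: "real k0 / real M = 1 / real E" using E k0p by simp
  have "\<exists>m::int. real E * r = of_int m" if a: "a \<in> L" "veq a r" for a r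
  proof -
    obtain m :: int where m: "real M * r = of_int m" using int[OF a] by blast
    then have "r = of_int m / real M" using M by (simp add: field_simps)
    then obtain q where "m = int k0 * q" using dvd[of a m] a by (auto elim: dvdE)
    then have "real E * r = of_int q" using m E k0p by simp
    then show ?thesis by blast
  qed
  then show ?thesis using E0 \<pi> v by (intro exI[of _ E] exI[of _ \<pi>]) (auto simp: discr_def)
qed

lemma uniformizer_approx:
  assumes F: "fld F" "F \<subseteq> L" "K \<subseteq> F" "discr F E" and \<pi>: "\<pi> \<in> F" "veq \<pi> (1 / real E)"
    and x: "x \<in> F" "veq x r"
  obtains c i and m :: int where "c \<in> K" "i < E" "real E * r = of_int m" "int i = m mod int E"
    "vge c (r - real i / real E)" "vge (x - c * \<pi> ^ i) (r + 1 / real E)"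
proof -
  have E0: "E > 0" using F by (simp add: discr_def)
  obtain w where w: "w \<in> K" "veq w 1" using K_unif by blast
  obtain m :: int where m: "real E * r = of_int m" using F(4) x by (auto simp: discr_def)
  define i q where "i = nat (m mod int E)" and "q = m div int E"
  have i: "int i = m mod int E" using E0 by (simp add: i_def)
  have mq: "m = q * int E + int i" using E0 by (simp add: i_def q_def)
  have "i < E" using E0 by (simp add: i_def nat_less_iff)
  have r: "r = of_int q + real i / real E"
  proof (rule real_div_mod_eq)
    show "real E * r = of_int q * real E + real i" unfolding m mq by simp
  qed (use E0 in simp)
  let ?y = "power_int w q * \<pi> ^ i"
  have wq: "power_int w q \<in> K" "veq (power_int w q) (of_int q)"
    using veq_power_int[OF w(2), of q] by (auto intro: fldD(11)[OF K w(1)])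
  have "veq ?y (of_int q + real i * (1 / real E))" by (intro veq_mult veq_power \<pi> wq)
  then have y: "veq ?y r" by (simp add: r)
  have "power_int w q \<in> F" using wq(1) F(3) by blast
  then have yF: "?y \<in> F" by (intro fldD(5,9)[OF F(1)] \<pi>)
  obtain c where c: "c \<in> K" "vge c 0" "vge (x - c * ?y) (r + 1 / real E)"
    using approx[OF F x(1) yF x(2) y] by blast
  have "vge (c * power_int w q) (0 + of_int q)" using c wq by (intro vge_mult) (auto intro: veq_vge)
  then have "vge (c * power_int w q) (r - real i / real E)" by (simp add: r)
  moreover have "c * power_int w q \<in> K" using c wq by (intro fldD(5)[OF K])
  moreover have "vge (x - c * power_int w q * \<pi> ^ i) (r + 1 / real E)" using c(3) by (simp add: mult.assoc)
  ultimately show ?thesis using that \<open>i < E\<close> m i by blast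
qed

text \<open>Each approximation step changes a single coefficient by an element of \<open>K\<close>;
  the coefficient sequences are Cauchy and converge because \<open>K\<close> is complete.\<close>

lemma span_uniformizer:
  assumes E: "discr L E" and \<pi>: "\<pi> \<in> L" "veq \<pi> (1 / real E)" and x: "x \<in> L"
  shows "\<exists>A. (\<forall>j. A j \<in> K) \<and> x = (\<Sum>j<E. A j * \<pi> ^ j)"
proof -
  have E0: "E > 0" using E by (simp add: discr_def)
  have step: "\<exists>c i. c \<in> K \<and> i < E \<and> (\<forall>r. vge x r \<longrightarrow> vge c (r - real i / real E) \<and> vge (x - c * \<pi> ^ i) (r + 1 / real E))"
    if x: "x \<in> L" for x
  proof (cases "x = 0")
    case True
    then show ?thesis using E0 fldD(1)[OF K] by (intro exI[of _ 0] exI[of _ 0]) auto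
  next
    case False
    then obtain r0 where r0: "veq x r0" by (rule ex_veq)
    obtain c i m where c: "c \<in> K" "i < E" "vge c (r0 - real i / real E)" "vge (x - c * \<pi> ^ i) (r0 + 1 / real E)"
      using uniformizer_approx[OF L order_refl KL E \<pi> x r0] by metis
    have "vge c (r - real i / real E) \<and> vge (x - c * \<pi> ^ i) (r + 1 / real E)" if "vge x r" for r
      using vge_veq_le[OF that r0] vge_mono[OF c(3), of "r - real i / real E"]
        vge_mono[OF c(4), of "r + 1 / real E"] by simp
    then show ?thesis using c(1,2) by blast
  qed
  then have "\<exists>c i. \<forall>x\<in>L. c x \<in> K \<and> i x < E \<and> (\<forall>r. vge x r \<longrightarrow> vge (c x) (r - real (i x) / real E) \<and>
       vge (x - c x * \<pi> ^ i x) (r + 1 / real E))" by metis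
  then obtain c and i :: "'a \<Rightarrow> nat" where ci: "\<And>x. x \<in> L \<Longrightarrow> c x \<in> K" "\<And>x. x \<in> L \<Longrightarrow> i x < E"
    "\<And>x r. x \<in> L \<Longrightarrow> vge x r \<Longrightarrow> vge (c x) (r - real (i x) / real E)"
    "\<And>x r. x \<in> L \<Longrightarrow> vge x r \<Longrightarrow> vge (x - c x * \<pi> ^ i x) (r + 1 / real E)" by blast
  define xs where "xs k = ((\<lambda>z. z - c z * \<pi> ^ i z) ^^ k) x" for k
  have X0: "xs 0 = x" and XS: "xs (Suc k) = xs k - c (xs k) * \<pi> ^ i (xs k)" for k by (auto simp: xs_def)
  have XL: "xs k \<in> L" for k
    by (induction k) (auto simp: X0 XS x ci intro!: fldD(4,5,9)[OF L] \<pi>)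
  obtain r where r: "vge x r" using ex_veq[of x] vge_0 veq_vge by (metis order_refl)
  have Xr: "vge (xs k) (r + real k / real E)" for k
  proof (induction k)
    case (Suc k)
    from ci(4)[OF XL Suc] show ?case by (simp add: XS add_divide_distrib add_ac)
  qed (simp add: X0 r)
  define A where "A = (\<lambda>k j. \<Sum>l<k. if i (xs l) = j then c (xs l) else 0)"
  have AK: "A k j \<in> K" for k j unfolding A_def using ci XL fldD(1)[OF K] by (intro fld_sum[OF K]) auto
  have xA: "x = xs k + (\<Sum>j<E. A k j * \<pi> ^ j)" for k
  proof (induction k)
    case (Suc k)
    have "(\<Sum>j<E. A (Suc k) j * \<pi> ^ j) = (\<Sum>j<E. A k j * \<pi> ^ j) + (\<Sum>j<E. if i (xs k) = j then c (xs k) * \<pi> ^ j else 0)"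
      unfolding sum.distrib[symmetric] by (intro sum.cong refl) (auto simp: A_def algebra_simps)
    also have "(\<Sum>j<E. if i (xs k) = j then c (xs k) * \<pi> ^ j else 0) = c (xs k) * \<pi> ^ i (xs k)"
      using ci(2)[OF XL, of k] by (subst sum.delta') auto
    finally show ?case using Suc by (simp add: XS)
  qed (simp add: X0 A_def)
  have cX: "vge (c (xs l)) (r - 1 + real k / real E)" if "k \<le> l" for k l
  proof -
    have "real (i (xs l)) / real E \<le> 1" using ci(2)[OF XL, of l] E0 by simp
    moreover have "real k / real E \<le> real l / real E" using that by (simp add: divide_right_mono)
    ultimately show ?thesis using ci(3)[OF XL Xr, of l] by (elim vge_mono) linarith
  qed
  have Adiff: "vge (A k' j - A k j) (r - 1 + real k / real E)" if "k \<le> k'" for k k' j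
  proof -
    have "A k' j = A k j + (\<Sum>l\<in>{k..<k'}. if i (xs l) = j then c (xs l) else 0)"
      unfolding A_def lessThan_atLeast0 using that by (subst sum.atLeastLessThan_concat) auto
    moreover have "vge (\<Sum>l\<in>{k..<k'}. if i (xs l) = j then c (xs l) else 0) (r - 1 + real k / real E)"
      by (intro vge_sum) (auto intro: cX)
    ultimately show ?thesis by simp
  qed
  have arch: "\<exists>k. C \<le> r - 1 + real k / real E" for C
  proof -
    obtain k :: nat where "real E * (C - r + 1) \<le> real k" using real_arch_simple by blast
    then have "C - r + 1 \<le> real k / real E" using E0 by (simp add: pos_le_divide_eq mult.commute)
    then show ?thesis by (intro exI[of _ k]) linarith
  qed
  have "\<exists>l\<in>K. \<forall>C::real. \<exists>M. \<forall>k\<ge>M. v (A k j - l) \<ge> ereal C" for j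
  proof -
    have "\<exists>M. \<forall>k\<ge>M. \<forall>k'\<ge>M. v (A k j - A k' j) \<ge> ereal C" for C
    proof -
      obtain M where M: "C \<le> r - 1 + real M / real E" using arch by blast
      have "vge (A k j - A k' j) C" if "M \<le> k" "M \<le> k'" for k k'
        using vge_diff[OF Adiff[OF that(1), of j] Adiff[OF that(2), of j]] M by (auto elim: vge_mono)
      then show ?thesis unfolding vge_def by blast
    qed
    moreover have "range (\<lambda>k. A k j) \<subseteq> K" using AK by blast
    ultimately show ?thesis
      using spec[OF complete[unfolded complete_field_def], of "\<lambda>k. A k j"] by blast
  qed
  then obtain l where l: "\<And>j. l j \<in> K" "\<And>j C. \<exists>M. \<forall>k\<ge>M. vge (A k j - l j) C"
    unfolding vge_def by metis
  have "vge (x - (\<Sum>j<E. l j * \<pi> ^ j)) C" for C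
  proof -
    have "\<forall>j. \<exists>M. \<forall>k\<ge>M. vge (A k j - l j) C" using l(2) by blast
    then obtain M where M: "\<And>j k. M j \<le> k \<Longrightarrow> vge (A k j - l j) C" by metis
    obtain M' where M': "C \<le> r - 1 + real M' / real E" using arch by blast
    define k where "k = Max (insert M' (M ` {..<E}))"
    have k: "M' \<le> k" "\<And>j. j < E \<Longrightarrow> M j \<le> k" by (auto simp: k_def intro!: Max_ge)
    have "x - (\<Sum>j<E. l j * \<pi> ^ j) = xs k + (\<Sum>j<E. (A k j - l j) * \<pi> ^ j)"
      using xA[of k] by (simp add: left_diff_distrib sum_subtractf)
    moreover have "vge (xs k) C"
    proof (rule vge_mono[OF Xr])
      have "real M' / real E \<le> real k / real E" using k(1) by (simp add: divide_right_mono)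
      then show "C \<le> r + real k / real E" using M' by linarith
    qed
    moreover have "vge (\<Sum>j<E. (A k j - l j) * \<pi> ^ j) C"
    proof (intro vge_sum)
      fix j assume "j \<in> {..<E}"
      then have "vge ((A k j - l j) * \<pi> ^ j) (C + real j * (1 / real E))"
        using k by (intro vge_mult M vge_power veq_vge[OF \<pi>(2)]) auto
      then show "vge ((A k j - l j) * \<pi> ^ j) C" by (rule vge_mono) simp
    qed
    ultimately show ?thesis by (simp add: vge_add)
  qed
  then have "x - (\<Sum>j<E. l j * \<pi> ^ j) = 0" by (rule vge_all_0)
  then show ?thesis using l(1) by (intro exI[of _ l]) auto
qed

text \<open>The values of the terms \<open>A j * \<pi> ^ j\<close> are incongruent modulo
  \<open>1\<close>, so every term is at least as small as \<open>x\<close>. Applying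
  \<open>\<sigma>\<close> replaces \<open>\<pi>\<close> by \<open>\<sigma> \<pi>\<close> in
  boundedly many powers, at bounded loss.\<close>

lemma sigma_vge:
  assumes E: "discr L E" and \<pi>: "\<pi> \<in> L" "veq \<pi> (1 / real E)"
  shows "\<exists>C. \<forall>x\<in>L. \<forall>r. vge x r \<longrightarrow> vge (\<sigma> x) (r - C)"
proof -
  have E0: "E > 0" using E by (simp add: discr_def)
  obtain t where t: "vge (\<sigma> \<pi>) t" using ex_veq[of "\<sigma> \<pi>"] vge_0 veq_vge by (metis order_refl)
  define C where "C = 1 + real E * \<bar>t\<bar>"
  have "vge (\<sigma> x) (r - C)" if x: "x \<in> L" "vge x r" for x r
  proof -
    obtain A where A: "\<And>j. A j \<in> K" "x = (\<Sum>j<E. A j * \<pi> ^ j)"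
      using span_uniformizer[OF E \<pi> x(1)] by blast
    have AL: "A j * \<pi> ^ j \<in> L" for j using A by (intro fldD(5,9)[OF L] \<pi>) auto
    have "\<sigma> x = (\<Sum>j<E. \<sigma> (A j * \<pi> ^ j))" using pow_sum[of "{..<E}" "\<lambda>j. A j * \<pi> ^ j" 1] AL by (simp add: A)
    also have "\<dots> = (\<Sum>j<E. A j * \<sigma> \<pi> ^ j)"
    proof (intro sum.cong refl)
      fix j
      have "\<sigma> (A j * \<pi> ^ j) = (\<sigma> ^^ 1) (A j * \<pi> ^ j)" by simp
      also have "\<dots> = A j * \<sigma> \<pi> ^ j" using A \<pi> fldD(9)[OF L \<pi>(1)] by (simp add: \<sigma>_mult \<sigma>_fix pow_power[of \<pi> 1, simplified])
      finally show "\<sigma> (A j * \<pi> ^ j) = A j * \<sigma> \<pi> ^ j" .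
    qed
    finally have sx: "\<sigma> x = (\<Sum>j<E. A j * \<sigma> \<pi> ^ j)" .
    have Aj: "vge (A j * \<pi> ^ j) r" if j: "j < E" for j
    proof (rule vge_sum_distinct[of "{..<E}" "\<lambda>j. A j * \<pi> ^ j" r j])
      show "vge (\<Sum>j<E. A j * \<pi> ^ j) r" using x A by simp
      fix i j s assume ij: "i \<in> {..<E}" "j \<in> {..<E}" "veq (A i * \<pi> ^ i) s" "veq (A j * \<pi> ^ j) s"
      have "A i \<noteq> 0" "A j \<noteq> 0" using ij veq_nz by fastforce+
      then obtain a b where ab: "veq (A i) a" "veq (A j) b" by (metis ex_veq)
      obtain m1 m2 :: int where m: "a = of_int m1" "b = of_int m2" using K_int[OF A(1)] ab by metis
      have "a + real i * (1 / real E) = s" "b + real j * (1 / real E) = s"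
        using veq_unique[OF veq_mult[OF ab(1) veq_power[OF \<pi>(2), of i]] ij(3)]
          veq_unique[OF veq_mult[OF ab(2) veq_power[OF \<pi>(2), of j]] ij(4)] by simp_all
      then have "of_int m1 * real E + real i = of_int m2 * real E + real j" unfolding m using E0 by (intro real_div_mod_cong[of "real E" _ _ s]) auto
      then have "(of_int (m1 * int E + int i) :: real) = of_int (m2 * int E + int j)" by simp
      then have "m1 * int E + int i = m2 * int E + int j" by (simp only: of_int_eq_iff)
      then have "(m1 * int E + int i) mod int E = (m2 * int E + int j) mod int E" by simp
      then show "i = j" using ij(1,2) by simp
    qed (use j in auto)
    have "vge (A j * \<sigma> \<pi> ^ j) (r - C)" if j: "j < E" for j
    proof -
      have "vge (A j * \<pi> ^ j / \<pi> ^ j) (r - real j * (1 / real E))"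
        by (intro vge_divide Aj j veq_power \<pi>)
      then have "vge (A j) (r - real j * (1 / real E))" using veq_nz[OF \<pi>(2)] by simp
      then have "vge (A j * \<sigma> \<pi> ^ j) (r - real j * (1 / real E) + real j * t)" by (intro vge_mult vge_power t)
      moreover have "real j * (1 / real E) \<le> 1" using j by simp
      moreover have "real j * t \<ge> - (real E * \<bar>t\<bar>)"
      proof -
        have "real j * \<bar>t\<bar> \<le> real E * \<bar>t\<bar>" using j by (intro mult_right_mono) auto
        moreover have "real j * t \<ge> real j * - \<bar>t\<bar>" by (intro mult_left_mono) auto
        ultimately show ?thesis by simp
      qed
      ultimately show ?thesis by (elim vge_mono) (simp add: C_def)
    qed
    then show ?thesis unfolding sx by (intro vge_sum) auto
  qed
  then show ?thesis by blast
qed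

text \<open>The loss \<open>C\<close> disappears by applying the bound to \<open>x ^ k\<close> and
  dividing by \<open>k\<close>; the finite period then turns the inequality into an
  equality.\<close>

lemma sigma_iso: assumes "x \<in> L" shows "v (\<sigma> x) = v x"
proof -
  from uniformizer_exists obtain E \<pi> where E: "discr L E" "\<pi> \<in> L" "veq \<pi> (1 / real E)" by (elim exE conjE)
  obtain C where C: "\<And>x r. x \<in> L \<Longrightarrow> vge x r \<Longrightarrow> vge (\<sigma> x) (r - C)" using sigma_vge[OF E] by blast
  have ge: "vge (\<sigma> x) r" if x: "x \<in> L" "vge x r" for x r
  proof (rule vge_veq_eqI)
    fix t assume t: "veq (\<sigma> x) t"
    have k: "real k * r - C \<le> real k * t" for k
    proof -
      have "vge (\<sigma> (x ^ k)) (real k * r - C)" using x by (intro C fldD(9)[OF L] vge_power)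
      then have "vge (\<sigma> x ^ k) (real k * r - C)" using pow_power[OF x(1), of 1 k] by simp
      then show ?thesis using veq_power[OF t, of k] vge_veq_le by blast
    qed
    show "r \<le> t"
    proof (rule ccontr)
      assume "\<not> r \<le> t"
      obtain k :: nat where "C / (r - t) < real k" using reals_Archimedean2 by blast
      with \<open>\<not> r \<le> t\<close> have "C < real k * (r - t)" by (simp add: field_simps)
      with k[of k] show False by (simp add: algebra_simps)
    qed
  qed
  have le: "v x \<le> v (\<sigma> x)" if "x \<in> L" for x
  proof (cases "x = 0")
    case True
    then show ?thesis using \<sigma>_fix[OF fldD(1)[OF K]] by simp
  next
    case False
    then obtain r where "veq x r" by (rule ex_veq)
    then show ?thesis using ge[OF that, of r] by (auto simp: veq_def vge_def)
  qed
  have "v (\<sigma> x) \<le> v ((\<sigma> ^^ k) (\<sigma> x))" for k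
  proof (induction k)
    case (Suc k)
    have "v ((\<sigma> ^^ k) (\<sigma> x)) \<le> v (\<sigma> ((\<sigma> ^^ k) (\<sigma> x)))" using assms by (intro le pow_in \<sigma>_in)
    with Suc show ?case by simp
  qed simp
  from this[of "N - 1"] have "v (\<sigma> x) \<le> v ((\<sigma> ^^ N) x)"
    using N_pos by (metis comp_apply diff_Suc_1 funpow_Suc_right gr0_conv_Suc)
  with period[OF assms] le[OF assms] show ?thesis by simp
qed

lemma uniformizer_moved:
  assumes E: "discr L E" "\<pi> \<in> L" "veq \<pi> (1 / real E)" and k: "0 < k" "k < N"
  shows "(\<sigma> ^^ k) \<pi> \<noteq> \<pi>"
proof
  assume \<pi>f: "(\<sigma> ^^ k) \<pi> = \<pi>"
  obtain x where x: "x \<in> L" "(\<sigma> ^^ k) x \<noteq> x" using faithful[OF k] by blast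
  obtain B where B: "\<And>j. B j \<in> K" "x = (\<Sum>j<E. B j * \<pi> ^ j)" using span_uniformizer[OF E x(1)] by blast
  have BL: "B j * \<pi> ^ j \<in> L" for j using B by (intro fldD(5,9)[OF L] E) auto
  have "(\<sigma> ^^ k) x = (\<Sum>l<E. (\<sigma> ^^ k) (B l * \<pi> ^ l))" unfolding B(2) by (rule pow_sum[OF BL])
  also have "\<dots> = x" unfolding B(2)
    using B E fldD(9)[OF L E(2)] by (intro sum.cong refl) (simp add: pow_scale pow_power \<pi>f)
  finally show False using x by simp
qed

text \<open>\<open>E\<close> divides a denominator \<open>k \<le> N\<close>, whence
  \<open>E \<le> N\<close>. Conversely \<open>\<pi>\<close> satisfies a monic equation of degree
  \<open>E\<close> over \<open>K\<close> and has \<open>N\<close> distinct conjugates.\<close>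

lemma discr_N: "discr L N" and uniformizer_N: "\<exists>\<pi>\<in>L. veq \<pi> (1 / real N)"
proof -
  from uniformizer_exists obtain E \<pi> where E: "discr L E" "\<pi> \<in> L" "veq \<pi> (1 / real E)" by (elim exE conjE)
  have E0: "E > 0" using E by (simp add: discr_def)
  obtain k and m :: int where k: "0 < k" "k \<le> N" "real k * (1 / real E) = of_int m" using val_denominator[OF E(2,3)] by blast
  then have "real k = of_int m * real E" using E0 by (simp add: field_simps)
  then have "(of_int (int k) :: real) = of_int (m * int E)" by simp
  then have "int k = m * int E" by (simp only: of_int_eq_iff)
  then have "E dvd k" by (metis dvd_triv_right int_dvd_int_iff)
  then have "E \<le> N" using k by (auto dest: dvd_imp_le)
  moreover have "N \<le> E"
  proof -
    obtain A where A: "\<And>j. A j \<in> K" "\<pi> ^ E = (\<Sum>j<E. A j * \<pi> ^ j)"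
      using span_uniformizer[OF E fldD(9)[OF L E(2)], of E] by blast
    define Q where "Q = Polynomial.monom 1 E - (\<Sum>j<E. Polynomial.monom (A j) j)"
    have "Polynomial.coeff Q E = 1" by (simp add: Q_def coeff_sum)
    then have Q0: "Q \<noteq> 0" by auto
    have deg: "Polynomial.degree Q \<le> E"
      unfolding Q_def using E0
      by (intro degree_diff_le degree_sum_le) (auto intro!: order.trans[OF degree_monom_le])
    have root: "Polynomial.poly Q ((\<sigma> ^^ i) \<pi>) = 0" for i
    proof -
      have AL: "A j * \<pi> ^ j \<in> L" for j using A by (intro fldD(5,9)[OF L] E) auto
      have "((\<sigma> ^^ i) \<pi>) ^ E = (\<sigma> ^^ i) (\<pi> ^ E)" using E by (simp add: pow_power)
      also have "\<dots> = (\<Sum>j<E. (\<sigma> ^^ i) (A j * \<pi> ^ j))" unfolding A(2) by (rule pow_sum[OF AL])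
      also have "\<dots> = (\<Sum>j<E. A j * ((\<sigma> ^^ i) \<pi>) ^ j)"
        using A E fldD(9)[OF L E(2)] by (intro sum.cong refl) (simp add: pow_scale pow_power)
      finally show ?thesis by (simp add: Q_def poly_sum poly_monom)
    qed
    have inj: "inj_on (\<lambda>i. (\<sigma> ^^ i) \<pi>) {..<N}"
    proof (rule linorder_inj_onI')
      fix i j assume ij: "i \<in> {..<N}" "j \<in> {..<N}" "i < j"
      show "(\<sigma> ^^ i) \<pi> \<noteq> (\<sigma> ^^ j) \<pi>"
      proof
        assume "(\<sigma> ^^ i) \<pi> = (\<sigma> ^^ j) \<pi>"
        moreover have "(\<sigma> ^^ j) \<pi> = (\<sigma> ^^ i) ((\<sigma> ^^ (j - i)) \<pi>)"
          using ij by (metis comp_apply funpow_add le_add_diff_inverse less_imp_le)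
        ultimately have "(\<sigma> ^^ (j - i)) \<pi> = \<pi>" using pow_inj[of \<pi> "(\<sigma> ^^ (j - i)) \<pi>" i] E by simp
        moreover have "0 < j - i" "j - i < N" using ij by auto
        ultimately show False using uniformizer_moved[OF E] by blast
      qed
    qed
    have "N = card ((\<lambda>i. (\<sigma> ^^ i) \<pi>) ` {..<N})" using card_image[OF inj] by simp
    also have "\<dots> \<le> card {x. Polynomial.poly Q x = 0}"
      using root by (intro card_mono poly_roots_finite Q0) auto
    also have "\<dots> \<le> Polynomial.degree Q" by (rule card_poly_roots_bound[OF Q0])
    finally show ?thesis using deg by simp
  qed
  ultimately have "E = N" by simp
  then show "discr L N" "\<exists>\<pi>\<in>L. veq \<pi> (1 / real N)" using E by auto
qed

sublocale cyc_iso
proof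
  fix x assume x: "x \<in> L"
  show "v (\<sigma> x) = v x" using x by (rule sigma_iso)
  fix r assume "veq x r"
  with x show "\<exists>m::int. real N * r = of_int m" using discr_N unfolding discr_def by blast
qed

end

section \<open>Ramification breaks\<close>

lemma exp_mult_inv_mod_prime_power:
  fixes p :: nat
  assumes "Factorial_Ring.prime p" "\<not> p dvd r"
  shows "\<exists>l. [r * l = 1] (mod p ^ e)"
proof -
  have "coprime r (p ^ e)" using assms
    by (metis coprime_commute coprime_power_right_iff prime_imp_coprime)
  then show ?thesis using cong_solve_coprime_nat by (metis One_nat_def)
qed

context cyc_gal
begin

text \<open>\<open>d\<close> is the relative displacement of the uniformizer. Constants of
  \<open>K\<close> do not move, so leading terms \<open>c * \<pi> ^ i\<close> are displaced by at
  least \<open>d\<close>, and approximation extends this to all of \<open>F\<close>. The field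
  \<open>F\<close> is general so that the lemma covers every \<open>Fj j\<close>.\<close>

lemma depth_ge:
  assumes F: "fld F" "F \<subseteq> L" "K \<subseteq> F" "discr F E" and \<pi>: "\<pi> \<in> F" "veq \<pi> (1 / real E)"
    and d: "vge ((\<sigma> ^^ k) \<pi> - \<pi>) (1 / real E + d)" "0 \<le> d"
    and x: "x \<in> F" "vge x r"
  shows "vge ((\<sigma> ^^ k) x - x) (r + d)"
proof -
  have E0: "E > 0" using F by (simp add: discr_def)
  have FL: "y \<in> F \<Longrightarrow> y \<in> L" for y using F(2) by blast
  have main: "vge ((\<sigma> ^^ k) x - x) (min (r + d) (r + real M / real E))" if "x \<in> F" "vge x r" for M x r
    using that
  proof (induction M arbitrary: x r)
    case 0
    have "vge ((\<sigma> ^^ k) x - x) r" using 0 FL by (intro vge_diff) auto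
    then show ?case by (rule vge_mono) simp
  next
    case (Suc M)
    show ?case
    proof (cases "x = 0")
      case True
      then show ?thesis using fldD(1)[OF K] by simp
    next
      case False
      then obtain r0 where r0: "veq x r0" by (rule ex_veq)
      obtain c i m where c: "c \<in> K" "i < E" "vge c (r0 - real i / real E)" "vge (x - c * \<pi> ^ i) (r0 + 1 / real E)"
        using uniformizer_approx[OF F \<pi> Suc.prems(1) r0] by metis
      let ?x = "x - c * \<pi> ^ i"
      have cF: "c \<in> F" using c F by blast
      have in_F: "c * \<pi> ^ i \<in> F" "?x \<in> F" "\<pi> ^ i \<in> F"
        using cF \<pi>(1) Suc.prems by (auto intro!: fldD(4,5,9)[OF F(1)])
      have le: "r \<le> r0" using Suc r0 vge_veq_le by blast
      have eq: "(\<sigma> ^^ k) x - x = ((\<sigma> ^^ k) ?x - ?x) + c * ((\<sigma> ^^ k) \<pi> ^ i - \<pi> ^ i)"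
        using in_F c Suc.prems FL \<pi>(1) by (simp add: pow_diff pow_scale pow_power algebra_simps)
      have "vge ((\<sigma> ^^ k) \<pi> ^ i - \<pi> ^ i) (real i * (1 / real E) + d)"
        using \<pi> FL d(1) by (intro power_lipschitz) (auto intro: veq_vge)
      then have "vge (c * ((\<sigma> ^^ k) \<pi> ^ i - \<pi> ^ i)) (r0 - real i / real E + (real i * (1 / real E) + d))"
        by (intro vge_mult c)
      then have 1: "vge (c * ((\<sigma> ^^ k) \<pi> ^ i - \<pi> ^ i)) (r + d)" by (rule vge_mono) (use le in simp)
      have "vge ((\<sigma> ^^ k) ?x - ?x) (min (r0 + 1 / real E + d) (r0 + 1 / real E + real M / real E))"
        by (intro Suc.IH in_F c)
      then have 2: "vge ((\<sigma> ^^ k) ?x - ?x) (min (r + d) (r + real (Suc M) / real E))"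
      proof (rule vge_mono)
        have "0 \<le> 1 / real E" "real (Suc M) / real E = 1 / real E + real M / real E"
          by (auto simp: add_divide_distrib)
        then show "min (r + d) (r + real (Suc M) / real E) \<le> min (r0 + 1 / real E + d) (r0 + 1 / real E + real M / real E)"
          using le min.cobounded1[of "r + d" "r + real (Suc M) / real E"]
              min.cobounded2[of "r + d" "r + real (Suc M) / real E"]
          by (intro min.boundedI) linarith+
      qed
      show ?thesis unfolding eq by (intro vge_add 2 vge_mono[OF 1]) simp
    qed
  qed
  obtain M :: nat where "real E * d \<le> real M" using real_arch_simple by blast
  then have "d \<le> real M / real E" using E0 by (simp add: pos_le_divide_eq mult.commute)
  then show ?thesis by (intro vge_mono[OF main[OF x, of M]]) simp
qed

text \<open>With \<open>\<sigma>\<close>-quotient \<open>1 + z\<close> of the uniformizer, the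
  leading term is displaced by the factor \<open>(1 + z) ^ i - 1\<close>, which is \<open>z\<close>
  times a sum congruent to \<open>i\<close>; this sum is a unit if \<open>p\<close> does not divide
  \<open>i\<close>.\<close>

lemma depth_eq:
  assumes F: "fld F" "F \<subseteq> L" "K \<subseteq> F" "discr F E" and \<pi>: "\<pi> \<in> F" "veq \<pi> (1 / real E)"
    and d: "veq ((\<sigma> ^^ k) \<pi> - \<pi>) (1 / real E + d)" "0 < d"
    and x: "x \<in> F" "veq x (of_int m / real E)" "\<not> int p dvd m" "p dvd E"
  shows "veq ((\<sigma> ^^ k) x - x) (of_int m / real E + d)"
proof -
  have E0: "E > 0" using F by (simp add: discr_def)
  have FL: "y \<in> F \<Longrightarrow> y \<in> L" for y using F(2) by blast
  let ?r = "of_int m / real E"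
  obtain c i m' where c: "c \<in> K" "i < E" "real E * ?r = of_int m'" "int i = m' mod int E" "vge (x - c * \<pi> ^ i) (?r + 1 / real E)"
    using uniformizer_approx[OF F \<pi> x(1,2)] by metis
  have "m' = m" using c(3) E0 by simp
  \<comment> \<open>\<open>i\<close> and \<open>m\<close> agree modulo \<open>E\<close>, which is
    divisible by \<open>p\<close>.\<close>
  then have pi: "\<not> p dvd i"
    using c(4) x(3,4) by (metis dvd_mod_iff int_dvd_int_iff)
  let ?x = "x - c * \<pi> ^ i" and ?z = "(\<sigma> ^^ k) \<pi> / \<pi> - 1"
  have \<pi>0: "\<pi> \<noteq> 0" using \<pi>(2) by (rule veq_nz)
  have in_F: "c * \<pi> ^ i \<in> F" "?x \<in> F" "\<pi> ^ i \<in> F"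
    using c F \<pi>(1) x by (auto intro!: fldD(4,5,9)[OF F(1)])
  have E1: "0 < 1 / real E" using E0 by simp
  have cx: "veq (c * \<pi> ^ i) ?r"
    by (rule veq_close[OF x(2), of _ "?r + 1 / real E"]) (use c(5) E1 in \<open>simp_all add: vge_diff_commute\<close>)
  have "veq (((\<sigma> ^^ k) \<pi> - \<pi>) / \<pi>) (1 / real E + d - 1 / real E)" by (intro veq_divide d \<pi>)
  then have z: "veq ?z d" using \<pi>0 by (simp add: diff_divide_distrib)
  have "vge ((1 + ?z) ^ l - 1 ^ l) (real l * 0 + d)" for l
    using z d(2) by (intro power_lipschitz vge_add) (auto intro: veq_vge veq_vge[OF veq_1])
  then have "vge (\<Sum>l<i. (1 + ?z) ^ l - 1) d" by (intro vge_sum) auto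
  then have "vge ((\<Sum>l<i. (1 + ?z) ^ l) - of_nat i) d" by (simp add: sum_subtractf)
  moreover have "veq (of_nat i) 0" using pi by (intro veq_of_nat) (auto intro: gr0I)
  ultimately have "veq (\<Sum>l<i. (1 + ?z) ^ l) 0" by (rule_tac veq_close[OF _ _ d(2)])
  then have "veq (?z * (\<Sum>l<i. (1 + ?z) ^ l)) (d + 0)" by (intro veq_mult z)
  also have "?z * (\<Sum>l<i. (1 + ?z) ^ l) = (1 + ?z) ^ i - 1" using power_diff_1_eq[of "1 + ?z" i] by simp
  finally have "veq (c * \<pi> ^ i * ((1 + ?z) ^ i - 1)) (?r + (d + 0))" by (intro veq_mult cx)
  moreover have "c * \<pi> ^ i * ((1 + ?z) ^ i - 1) = (\<sigma> ^^ k) (c * \<pi> ^ i) - c * \<pi> ^ i"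
    using \<pi>0 in_F c(1) FL \<pi>(1) by (simp add: pow_scale pow_power power_divide right_diff_distrib)
  ultimately have 1: "veq ((\<sigma> ^^ k) (c * \<pi> ^ i) - c * \<pi> ^ i) (?r + d)" by simp
  have 2: "vge ((\<sigma> ^^ k) ?x - ?x) (?r + 1 / real E + d)"
    by (rule depth_ge[OF F \<pi> veq_vge[OF d(1) order_refl] less_imp_le[OF d(2)] in_F(2) c(5)])
  have "veq (((\<sigma> ^^ k) (c * \<pi> ^ i) - c * \<pi> ^ i) + ((\<sigma> ^^ k) ?x - ?x)) (?r + d)"
    using E1 by (intro veq_add_dom[OF 1 2]) simp
  moreover have "((\<sigma> ^^ k) (c * \<pi> ^ i) - c * \<pi> ^ i) + ((\<sigma> ^^ k) ?x - ?x) = (\<sigma> ^^ k) x - x"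
    using in_F FL x(1) by (simp add: pow_diff)
  ultimately show ?thesis by simp
qed

section \<open>Ramification numbers of the powers of the generator\<close>

definition unif :: 'a where "unif = (SOME \<pi>. \<pi> \<in> L \<and> veq \<pi> (1 / real N))"

lemma unif: "unif \<in> L" "veq unif (1 / real N)"
  using uniformizer_N someI_ex[of "\<lambda>\<pi>. \<pi> \<in> L \<and> veq \<pi> (1 / real N)"] unfolding unif_def by blast+

text \<open>For \<open>0 < k < N\<close> this is the largest index of a lower ramification group
  containing \<open>\<sigma> ^^ k\<close>; the added \<open>1\<close> is the shift in Serre's
  definition of these groups.\<close>

definition ramnum :: "nat \<Rightarrow> int" where
  "ramnum k = (SOME i. veq ((\<sigma> ^^ k) unif - unif) ((of_int i + 1) / real N))"

lemma ramnum: assumes "0 < k" "k < N"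
  shows "veq ((\<sigma> ^^ k) unif - unif) ((of_int (ramnum k) + 1) / real N)"
proof -
  have "(\<sigma> ^^ k) unif - unif \<noteq> 0" using uniformizer_moved[OF discr_N unif assms] by simp
  then obtain r where r: "veq ((\<sigma> ^^ k) unif - unif) r" by (rule ex_veq)
  have "(\<sigma> ^^ k) unif - unif \<in> L" using unif by (intro fldD(4)[OF L]) auto
  then obtain m :: int where m: "real N * r = of_int m" using disc r by blast
  then have "r = (of_int (m - 1) + 1) / real N" using N_pos by (simp add: field_simps)
  with r have "\<exists>i::int. veq ((\<sigma> ^^ k) unif - unif) ((of_int i + 1) / real N)" by blast
  then show ?thesis unfolding ramnum_def by (rule someI_ex)
qed

text \<open>Membership in a ramification group, in a form relative to the value of \<open>x\<close>;
  this makes closure under composition immediate.\<close>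

definition shifts :: "nat \<Rightarrow> int \<Rightarrow> bool" where
  "shifts k i \<longleftrightarrow> (\<forall>x\<in>L. \<forall>r. vge x r \<longrightarrow> vge ((\<sigma> ^^ k) x - x) (r + of_int i / real N))"

lemma unif_quot_power:
  assumes k: "0 < k" "k < N" and a: "a \<in> K" "vge a 0" "vge ((\<sigma> ^^ k) unif - a * unif) (1 / real N + s)"
  shows "vge ((\<sigma> ^^ (k * l)) unif - a ^ l * unif) (1 / real N + s)"
proof (induction l)
  case (Suc l)
  have aK: "a ^ l \<in> K" using a by (intro fldD(9)[OF K])
  have inL: "(\<sigma> ^^ (k * l)) unif - a ^ l * unif \<in> L" "a ^ l * unif \<in> L"
    using unif aK by (auto intro!: fldD(4,5)[OF L])
  have 1: "vge ((\<sigma> ^^ k) ((\<sigma> ^^ (k * l)) unif - a ^ l * unif)) (1 / real N + s)" using inL Suc by simp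
  have "vge (a ^ l * ((\<sigma> ^^ k) unif - a * unif)) (real l * 0 + (1 / real N + s))"
    by (intro vge_mult vge_power a)
  then have 2: "vge (a ^ l * ((\<sigma> ^^ k) unif - a * unif)) (1 / real N + s)" by simp
  have "(\<sigma> ^^ k) ((\<sigma> ^^ (k * l)) unif - a ^ l * unif) + a ^ l * ((\<sigma> ^^ k) unif - a * unif)
      = (\<sigma> ^^ (k * Suc l)) unif - a ^ Suc l * unif"
    using unif aK inL by (simp add: pow_diff pow_scale funpow_add algebra_simps)
  with vge_add[OF 1 2] show ?case by simp
qed simp

end

locale cyc_ram = cyc_gal +
  fixes n :: nat
  assumes N_eq: "N = p ^ n"
begin

text \<open>There is no tame part. If \<open>\<sigma> ^^ k\<close> multiplies the uniformizer by a
  constant \<open>a\<close> to first order, then \<open>N\<close> repetitions give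
  \<open>a ^ N\<close> congruent to \<open>1\<close>; as \<open>N = p ^ n\<close> in characteristic
  \<open>p\<close>, this is \<open>(1 - a) ^ N\<close> being small, so \<open>a\<close> itself is
  congruent to \<open>1\<close>.\<close>

lemma ramnum_pos: assumes k: "0 < k" "k < N" shows "ramnum k \<ge> 1"
proof -
  let ?z = "(\<sigma> ^^ k) unif / unif"
  have "veq ?z (1 / real N - 1 / real N)" by (intro veq_divide) (use unif in auto)
  then have "vge ?z 0" by (auto intro: veq_vge)
  moreover have "?z \<in> L" using unif by (intro fldD(8)[OF L]) auto
  ultimately obtain a s where a: "a \<in> K" "s > 0" "vge (?z - a) s" using resid by blast
  have u0: "unif \<noteq> 0" using unif(2) by (rule veq_nz)
  have "vge (?z - (?z - a)) 0" using a(2) \<open>vge ?z 0\<close> by (intro vge_diff vge_mono[OF a(3)]) auto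
  then have a0: "vge a 0" by simp
  have "vge ((?z - a) * unif) (s + 1 / real N)" by (intro vge_mult a veq_vge[OF unif(2)]) simp
  then have au: "vge ((\<sigma> ^^ k) unif - a * unif) (1 / real N + s)" using u0 by (simp add: left_diff_distrib add.commute)
  from unif_quot_power[OF k a(1) a0 au, of N]
  have "vge (unif - a ^ N * unif) (1 / real N + s)" using unif by (simp add: mult.commute)
  then have "vge ((unif - a ^ N * unif) / unif) (1 / real N + s - 1 / real N)" by (intro vge_divide unif)
  moreover have "(unif - a ^ N * unif) / unif = (1 - a) ^ N"
    using u0 frob_diff[of 1 a n] by (simp add: diff_divide_distrib N_eq)
  ultimately have pw: "vge ((1 - a) ^ N) s" by simp
  have 1: "vge (1 - a) (s / real N)"
  proof (rule vge_veq_eqI)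
    fix t assume "veq (1 - a) t"
    then have "s \<le> real N * t" using veq_power vge_veq_le[OF pw] by blast
    then show "s / real N \<le> t" using N_pos by (simp add: pos_divide_le_eq mult.commute)
  qed
  have "vge ((1 - a) * unif) (s / real N + 1 / real N)" by (intro vge_mult 1 veq_vge[OF unif(2)]) simp
  moreover have "s / real N \<le> s" using a(2) N_pos by (simp add: pos_divide_le_eq)
  ultimately have "vge (((\<sigma> ^^ k) unif - a * unif) - (1 - a) * unif) (1 / real N + s / real N)"
    by (intro vge_diff vge_mono[OF au]) (auto simp: add.commute)
  then have "vge ((\<sigma> ^^ k) unif - unif) (1 / real N + s / real N)" by (simp add: algebra_simps)
  from vge_veq_le[OF this ramnum[OF k]] have "1 / real N + s / real N \<le> (of_int (ramnum k) + 1) / real N" .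
  then have "(1 + s) / real N \<le> (of_int (ramnum k) + 1) / real N" by (simp add: add_divide_distrib)
  then have "1 + s \<le> of_int (ramnum k) + 1" using N_pos by (simp add: divide_le_cancel)
  then show ?thesis using a(2) by linarith
qed

lemma shifts_ramnum: assumes k: "0 < k" "k < N" shows "shifts k (ramnum k)"
  unfolding shifts_def
proof (intro ballI allI impI)
  fix x r assume x: "x \<in> L" "vge x r"
  have "1 / real N + of_int (ramnum k) / real N = (of_int (ramnum k) + 1) / real N" by (simp add: add_divide_distrib)
  then have 1: "vge ((\<sigma> ^^ k) unif - unif) (1 / real N + of_int (ramnum k) / real N)"
    using ramnum[OF k] by (auto intro: veq_vge)
  show "vge ((\<sigma> ^^ k) x - x) (r + of_int (ramnum k) / real N)"
    by (rule depth_ge[OF L order_refl KL discr_N unif 1 _ x]) (use ramnum_pos[OF k] in simp)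
qed

lemma shifts_le_ramnum: assumes "shifts k i" "0 < k" "k < N" shows "i \<le> ramnum k"
proof -
  have "vge ((\<sigma> ^^ k) unif - unif) (1 / real N + of_int i / real N)"
    using assms(1) unif unfolding shifts_def by (auto intro: veq_vge)
  from vge_veq_le[OF this ramnum[OF assms(2,3)]]
  have "1 / real N + of_int i / real N \<le> (of_int (ramnum k) + 1) / real N" .
  then have "(1 + of_int i) / real N \<le> (of_int (ramnum k) + 1) / real N" by (simp add: add_divide_distrib)
  then have "1 + of_int i \<le> (of_int (ramnum k) + 1 :: real)" using N_pos by (simp add: divide_le_cancel)
  then show ?thesis by linarith
qed

lemma shifts_mult: "shifts k i \<Longrightarrow> shifts (k * l) i"
proof (induction l)
  case 0
  show ?case by (simp add: shifts_def)
next
  case (Suc l)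
  then have IH: "shifts (k * l) i" by blast
  show ?case unfolding shifts_def
  proof (intro ballI allI impI)
    fix x r assume x: "x \<in> L" "vge x r"
    have 1: "vge ((\<sigma> ^^ (k * l)) x - x) (r + of_int i / real N)" using IH x by (auto simp: shifts_def)
    have "(\<sigma> ^^ (k * l)) x \<in> L" "vge ((\<sigma> ^^ (k * l)) x) r" using x by auto
    then have 2: "vge ((\<sigma> ^^ k) ((\<sigma> ^^ (k * l)) x) - (\<sigma> ^^ (k * l)) x) (r + of_int i / real N)"
      using Suc.prems unfolding shifts_def by blast
    have "(\<sigma> ^^ k) ((\<sigma> ^^ (k * l)) x) = (\<sigma> ^^ (k * Suc l)) x" by (simp add: funpow_add)
    with vge_add[OF 1 2] show "vge ((\<sigma> ^^ (k * Suc l)) x - x) (r + of_int i / real N)" by simp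
  qed
qed

lemma shifts_mod: "shifts (k mod N) i \<longleftrightarrow> shifts k i"
  unfolding shifts_def by (auto simp: pow_mod)

lemma p_power_less: "l < n \<Longrightarrow> 0 < p ^ l \<and> p ^ l < N"
  using p_ge_2 unfolding N_eq by (auto intro!: power_strict_increasing)

text \<open>\<open>brk l\<close> is the break \<open>b\<^sub>l\<^sub>+\<^sub>1\<close>.\<close>

definition brk :: "nat \<Rightarrow> int" where "brk l = ramnum (p ^ l)"

text \<open>\<open>\<sigma> ^^ k\<close> and \<open>\<sigma> ^^ (p ^ l)\<close> are powers of each
  other, and passing to a power cannot lower a ramification number.\<close>

lemma ramnum_level:
  assumes k: "0 < k" "k < N" "k mod N = (p ^ l * r) mod N" "\<not> p dvd r" "l < n"
  shows "ramnum k = brk l"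
proof (rule antisym)
  have pl: "0 < p ^ l" "p ^ l < N" using p_power_less[OF k(5)] by auto
  have k': "k mod N = k" using k(2) by simp
  have "shifts (p ^ l * r) (brk l)" unfolding brk_def by (intro shifts_mult shifts_ramnum pl)
  then have "shifts k (brk l)" using shifts_mod[of "p ^ l * r"] k(3) k' by simp
  then show "brk l \<le> ramnum k" using k by (intro shifts_le_ramnum)
  obtain q where q: "[r * q = 1] (mod p ^ n)" using exp_mult_inv_mod_prime_power[OF prime k(4)] by blast
  have "[k * q = p ^ l * r * q] (mod N)"
    using k(3) by (intro cong_mult) (auto simp: Cong.cong_def)
  also have "[p ^ l * r * q = p ^ l * 1] (mod N)"
    unfolding mult.assoc N_eq by (intro cong_mult q) auto
  finally have "(k * q) mod N = p ^ l" using pl by (simp add: Cong.cong_def)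
  moreover have "shifts (k * q) (ramnum k)" using k by (intro shifts_mult shifts_ramnum)
  ultimately have "shifts (p ^ l) (ramnum k)" using shifts_mod[of "k * q"] by metis
  then show "ramnum k \<le> brk l" unfolding brk_def using pl by (intro shifts_le_ramnum)
qed

lemma brk_Suc: assumes "Suc l < n" shows "brk l \<le> brk (Suc l)"
proof -
  have pl: "0 < p ^ l" "p ^ l < N" "0 < p ^ Suc l" "p ^ Suc l < N"
    using p_power_less[of l] p_power_less[OF assms] assms by auto
  have "shifts (p ^ Suc l) (brk l)" unfolding brk_def power_Suc2 by (intro shifts_mult shifts_ramnum pl)
  then show ?thesis unfolding brk_def[of "Suc l"] using pl by (intro shifts_le_ramnum)
qed

lemma brk_mono: "l \<le> m \<Longrightarrow> m < n \<Longrightarrow> brk l \<le> brk m"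
proof (induction m rule: dec_induct)
  case (step m)
  then show ?case using brk_Suc[of m] by simp
qed simp

lemma level_exists:
  assumes "0 < k" "k < N"
  obtains l r where "l < n" "k = p ^ l * r" "\<not> p dvd r"
proof -
  define l where "l = multiplicity p k"
  obtain r where r: "k = p ^ l * r" "\<not> p dvd r"
    using multiplicity_decompose'[of k p] assms prime p_ge_2 unfolding l_def by (metis not_prime_unit not_less0)
  have "p ^ l \<le> k" using r assms by (cases r) auto
  then have "p ^ l < p ^ n" using assms N_eq by simp
  then have "l < n" using p_ge_2 by (simp add: power_strict_increasing_iff)
  with r that show ?thesis by blast
qed

lemma ramnum_image: "ramnum ` {0<..<N} = brk ` {..<n}"
proof (intro equalityI subsetI)
  fix i assume "i \<in> ramnum ` {0<..<N}"
  then obtain k where k: "0 < k" "k < N" "i = ramnum k" by auto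
  obtain l r where l: "l < n" "k = p ^ l * r" "\<not> p dvd r" using level_exists[OF k(1,2)] .
  then have "i = brk l" using ramnum_level[of k l r] k by simp
  then show "i \<in> brk ` {..<n}" using l by auto
next
  fix i assume "i \<in> brk ` {..<n}"
  then show "i \<in> ramnum ` {0<..<N}" using p_power_less unfolding brk_def by auto
qed

end

lemma strict_mono_enum_unique:
  fixes f g :: "nat \<Rightarrow> 'b::linorder"
  assumes f: "strict_mono_on {1..n} f" and g: "strict_mono_on {1..n} g" and eq: "f ` {1..n} = g ` {1..n}"
    and i: "i \<in> {1..n}"
  shows "f i = g i"
proof -
  have cnt: "card {y \<in> h ` {1..n}. y < h j} = j - 1" if h: "strict_mono_on {1..n} h" and j: "j \<in> {1..n}"
    for h :: "nat \<Rightarrow> 'b" and j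
  proof -
    have less: "h a < h c \<longleftrightarrow> a < c" if "a \<in> {1..n}" "c \<in> {1..n}" for a c
      using h that by (metis linorder_less_linear order_less_asym strict_mono_onD)
    have "{y \<in> h ` {1..n}. y < h j} = h ` {1..<j}" using less[OF _ j] j by auto
    moreover have "inj_on h {1..<j}"
      using h j by (intro inj_on_subset[OF strict_mono_on_imp_inj_on[OF h]]) auto
    ultimately show ?thesis by (simp add: card_image)
  qed
  obtain j where j: "j \<in> {1..n}" "f i = g j" using eq i by blast
  have "i - 1 = j - 1" using cnt[OF f i] cnt[OF g j(1)] eq j(2) by simp
  then have "i = j" using i j(1) by (cases i; cases j) auto
  then show ?thesis using j by simp
qed

lemma strict_mono_of_card:
  fixes f :: "nat \<Rightarrow> 'b::linorder"
  assumes "\<And>i j. 1 \<le> i \<Longrightarrow> i \<le> j \<Longrightarrow> j \<le> n \<Longrightarrow> f i \<le> f j" "card (f ` {1..n}) = n"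
  shows "strict_mono_on {1..n} f"
proof -
  have "inj_on f {1..n}" using assms(2) by (intro eq_card_imp_inj_on) auto
  then show ?thesis
    using assms(1) unfolding strict_mono_on_def by (metis atLeastAtMost_iff inj_onD less_imp_le order_le_less less_irrefl)
qed

context cyc_ram
begin

section \<open>Intermediate fields and descent of the breaks\<close>

definition Fj :: "nat \<Rightarrow> 'a set" where "Fj j = {x \<in> L. (\<sigma> ^^ (p ^ j)) x = x}"

lemma Fj_L: "Fj j \<subseteq> L" and K_Fj: "K \<subseteq> Fj j"
  by (auto simp: Fj_def)

lemma pow_inverse: assumes "x \<in> L" shows "(\<sigma> ^^ k) (inverse x) = inverse ((\<sigma> ^^ k) x)"
proof (cases "x = 0")
  case True
  then show ?thesis using fldD(1)[OF K] by simp
next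
  case False
  then have "(\<sigma> ^^ k) x * (\<sigma> ^^ k) (inverse x) = 1"
    using pow_mult[OF assms fldD(6)[OF L assms], of k] fldD(2)[OF K] by simp
  then show ?thesis by (metis inverse_unique)
qed

lemma fld_Fj: "fld (Fj j)"
  unfolding fld_def
proof (intro conjI ballI)
  show "0 \<in> Fj j" "1 \<in> Fj j" using K_Fj fldD(1,2)[OF K] by auto
  fix x assume x: "x \<in> Fj j"
  then show "inverse x \<in> Fj j" by (auto simp: Fj_def pow_inverse intro: fldD(6)[OF L])
  fix y assume y: "y \<in> Fj j"
  show "x + y \<in> Fj j" "x - y \<in> Fj j" "x * y \<in> Fj j"
    using x y by (auto simp: Fj_def pow_add pow_diff pow_mult intro: fldD(3,4,5)[OF L])
qed

lemma Fj_mult: "x \<in> Fj j \<Longrightarrow> (\<sigma> ^^ (p ^ j * l)) x = x"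
  by (induction l) (auto simp: Fj_def funpow_add)

lemma Fj_mono: "x \<in> Fj i \<Longrightarrow> i \<le> j \<Longrightarrow> x \<in> Fj j"
  using Fj_mult[of x i "p ^ (j - i)"] by (auto simp: Fj_def power_add[symmetric])

text \<open>A relative norm: the factors rotate, and the last one returns to \<open>x\<close> by
  hypothesis. With \<open>a = 1\<close> it serves for norms to \<open>K\<close>, with
  \<open>a = p ^ j\<close> for norms from \<open>Fj (Suc j)\<close> to \<open>Fj j\<close>.\<close>

lemma prod_orbit_fixed:
  assumes x: "x \<in> L" and m: "(\<sigma> ^^ (a * m)) x = x"
  shows "(\<sigma> ^^ a) (\<Prod>i<m. (\<sigma> ^^ (a * i)) x) = (\<Prod>i<m. (\<sigma> ^^ (a * i)) x)"
proof (cases "x = 0")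
  case True
  then show ?thesis using fldD(1)[OF K] by (cases "m = 0") (auto simp: fldD[OF K])
next
  case False
  let ?f = "\<lambda>i. (\<sigma> ^^ (a * i)) x"
  have "?f 0 * (\<Prod>i<m. ?f (Suc i)) = (\<Prod>i<m. ?f i) * ?f m"
    using prod.lessThan_Suc_shift[of ?f m] prod.lessThan_Suc[of ?f m] by simp
  then have "x * (\<Prod>i<m. ?f (Suc i)) = x * (\<Prod>i<m. ?f i)" using m by (simp add: mult.commute)
  then have eq: "(\<Prod>i<m. ?f (Suc i)) = (\<Prod>i<m. ?f i)" using False by simp
  have "(\<sigma> ^^ a) (\<Prod>i<m. ?f i) = (\<Prod>i<m. (\<sigma> ^^ a) (?f i))" using x by (intro pow_prod) auto
  also have "\<dots> = (\<Prod>i<m. ?f (Suc i))" by (simp add: funpow_add)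
  finally show ?thesis using eq by simp
qed

text \<open>The norm of \<open>x\<close> to \<open>K\<close> has value \<open>p ^ j * r\<close>,
  which must be an integer.\<close>

lemma discr_Fj: "discr (Fj j) (p ^ j)"
  unfolding discr_def
proof (intro conjI ballI allI impI)
  show "0 < p ^ j" using p_pos by simp
  fix x r assume x: "x \<in> Fj j" "veq x r"
  have xL: "x \<in> L" using x by (simp add: Fj_def)
  let ?M = "\<Prod>i<p ^ j. (\<sigma> ^^ (1 * i)) x"
  have "?M \<in> L" using xL by (intro fld_prod[OF L]) auto
  moreover have "(\<sigma> ^^ 1) ?M = ?M" using x by (intro prod_orbit_fixed xL) (simp add: Fj_def)
  ultimately have "?M \<in> K" using fixed by simp
  moreover have "veq ?M (\<Sum>i<p ^ j. r)" using x xL by (intro veq_prod) auto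
  ultimately show "\<exists>m::int. real (p ^ j) * r = of_int m" using K_int by fastforce
qed

text \<open>The depths of the powers of \<open>\<sigma>\<close> on \<open>Fj j\<close> in terms of the breaks of \<open>L\<close>; the breaks of \<open>Fj j\<close> are thus the
  first \<open>j\<close> breaks of \<open>L\<close>.\<close>

definition desc :: "nat \<Rightarrow> bool" where
  "desc j \<longleftrightarrow> (\<exists>\<pi>\<in>Fj j. veq \<pi> (1 / real (p ^ j)) \<and>
     (\<forall>l<j. \<forall>r. \<not> p dvd r \<longrightarrow> veq ((\<sigma> ^^ (p ^ l * r)) \<pi> - \<pi>) (1 / real (p ^ j) + of_int (brk l) / real (p ^ j))))"

lemma brk_pos: "l < n \<Longrightarrow> brk l > 0"
  using ramnum_pos[of "p ^ l"] p_power_less[of l] unfolding brk_def by simp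

lemma desc_n: "desc n"
  unfolding desc_def
proof (intro bexI[of _ unif] conjI allI impI)
  show "unif \<in> Fj n" using unif by (simp add: Fj_def N_eq[symmetric] period)
  show "veq unif (1 / real (p ^ n))" using unif by (simp only: N_eq)
  fix l r assume l: "l < n" and r: "\<not> p dvd r"
  define k where "k = (p ^ l * r) mod N"
  have "\<not> N dvd p ^ l * r"
  proof
    assume "N dvd p ^ l * r"
    moreover have "p ^ l * p dvd N" using l unfolding N_eq power_Suc2[symmetric] by (intro le_imp_power_dvd) simp
    ultimately have "p ^ l * p dvd p ^ l * r" by (rule dvd_trans[rotated])
    then show False using r p_pos by simp
  qed
  then have k: "0 < k" "k < N" "k mod N = (p ^ l * r) mod N" using N_pos by (auto simp: k_def dvd_eq_mod_eq_0)
  have "(\<sigma> ^^ (p ^ l * r)) unif = (\<sigma> ^^ k) unif" unfolding k_def using unif by (simp add: pow_mod)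
  then show "veq ((\<sigma> ^^ (p ^ l * r)) unif - unif) (1 / real (p ^ n) + of_int (brk l) / real (p ^ n))"
    using ramnum[OF k(1,2)] ramnum_level[OF k r l] by (simp add: add_divide_distrib N_eq add.commute)
qed

lemma desc_ge:
  assumes "desc j" "l < j" "j \<le> n" "x \<in> Fj j" "vge x t"
  shows "vge ((\<sigma> ^^ (p ^ l * r)) x - x) (t + of_int (brk l) / real (p ^ j))"
proof -
  obtain \<pi> where \<pi>: "\<pi> \<in> Fj j" "veq \<pi> (1 / real (p ^ j))"
    and d: "\<And>l r. l < j \<Longrightarrow> \<not> p dvd r \<Longrightarrow> veq ((\<sigma> ^^ (p ^ l * r)) \<pi> - \<pi>) (1 / real (p ^ j) + of_int (brk l) / real (p ^ j))"
    using assms(1) unfolding desc_def by blast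
  have b: "0 \<le> of_int (brk l) / real (p ^ j)" using brk_pos[of l] assms by simp
  have "\<not> p dvd 1" using p_ge_2 by simp
  from d[OF assms(2) this] have 1: "vge ((\<sigma> ^^ (p ^ l)) x - x) (t + of_int (brk l) / real (p ^ j))"
    if "x \<in> Fj j" "vge x t" for x t
    using depth_ge[OF fld_Fj Fj_L K_Fj discr_Fj \<pi> veq_vge[OF _ order_refl] b that, of "p ^ l"] by simp
  have xL: "x \<in> L" using assms(4) by (simp add: Fj_def)
  have inF: "(\<sigma> ^^ k) x \<in> Fj j" for k
    using assms(4) by (auto simp: Fj_def funpow_add[symmetric, THEN fun_cong, simplified comp_def] add.commute)
       (metis comp_apply funpow_add add.commute)
  show ?thesis
  proof (induction r)
    case (Suc r)
    have "vge ((\<sigma> ^^ (p ^ l * r)) x) t" using assms xL by simp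
    from vge_add[OF 1[OF inF this] Suc] show ?case by (simp add: funpow_add)
  qed simp
qed

lemma desc_eq:
  assumes "desc j" "l < j" "j \<le> n" "x \<in> Fj j" "veq x (of_int m / real (p ^ j))" "\<not> int p dvd m" "\<not> p dvd r"
  shows "veq ((\<sigma> ^^ (p ^ l * r)) x - x) (of_int m / real (p ^ j) + of_int (brk l) / real (p ^ j))"
proof -
  obtain \<pi> where \<pi>: "\<pi> \<in> Fj j" "veq \<pi> (1 / real (p ^ j))"
    and d: "\<And>l r. l < j \<Longrightarrow> \<not> p dvd r \<Longrightarrow> veq ((\<sigma> ^^ (p ^ l * r)) \<pi> - \<pi>) (1 / real (p ^ j) + of_int (brk l) / real (p ^ j))"
    using assms(1) unfolding desc_def by blast
  have b: "0 < of_int (brk l) / real (p ^ j)" using brk_pos[of l] assms p_pos by simp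
  have "p dvd p ^ j" using assms(2) by (intro dvd_power) simp
  from depth_eq[OF fld_Fj Fj_L K_Fj discr_Fj \<pi> d[OF assms(2,7)] b assms(4,5,6) this] show ?thesis .
qed

text \<open>Passing from \<open>Fj (Suc j)\<close> to its subfield \<open>Fj j\<close> of index \<open>p\<close>: the norm of a uniformizer is a
  uniformizer, and the norm of \<open>1 + z\<close> is \<open>1 + z\<^sup>p\<close> up to terms of higher valuation.\<close>

lemma desc_Suc:
  assumes D: "desc (Suc j)" and j: "Suc j \<le> n"
    and gr: "\<And>l. l < j \<Longrightarrow> (int p - 1) * brk l < brk j"
  shows "desc j"
proof -
  let ?q = "real (p ^ Suc j)"
  have q: "?q > 0" "?q = real p * real (p ^ j)" using p_pos by auto
  obtain \<pi> where \<pi>: "\<pi> \<in> Fj (Suc j)" "veq \<pi> (1 / ?q)"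
    and d: "\<And>l r. l < Suc j \<Longrightarrow> \<not> p dvd r \<Longrightarrow> veq ((\<sigma> ^^ (p ^ l * r)) \<pi> - \<pi>) (1 / ?q + of_int (brk l) / ?q)"
    using D unfolding desc_def by blast
  have \<pi>L: "\<pi> \<in> L" using \<pi> by (simp add: Fj_def)
  have \<pi>0: "\<pi> \<noteq> 0" using \<pi>(2) by (rule veq_nz)
  let ?t = "\<lambda>i. \<sigma> ^^ (p ^ j * i)"
  define \<rho> where "\<rho> = (\<Prod>i<p. ?t i \<pi>)"
  have \<rho>L: "\<rho> \<in> L" unfolding \<rho>_def using \<pi>L by (intro fld_prod[OF L]) auto
  have "(\<sigma> ^^ (p ^ j)) \<rho> = \<rho>" unfolding \<rho>_def
    using \<pi> by (intro prod_orbit_fixed \<pi>L) (simp add: Fj_def mult.commute)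
  then have \<rho>F: "\<rho> \<in> Fj j" using \<rho>L by (simp add: Fj_def)
  have "veq \<rho> (\<Sum>i<p. 1 / ?q)" unfolding \<rho>_def using \<pi> \<pi>L by (intro veq_prod) auto
  then have \<rho>v: "veq \<rho> (1 / real (p ^ j))" using p_pos by simp
  then have \<rho>0: "\<rho> \<noteq> 0" by (rule veq_nz)
  have "veq ((\<sigma> ^^ (p ^ l * r)) \<rho> - \<rho>) (1 / real (p ^ j) + of_int (brk l) / real (p ^ j))"
    if l: "l < j" and r: "\<not> p dvd r" for l r
  proof -
    let ?s = "\<sigma> ^^ (p ^ l * r)"
    define w where "w = ?s \<pi> / \<pi>"
    define a where "a = of_int (brk l) / ?q"
    have a0: "0 \<le> a" using brk_pos[of l] l j q by (simp add: a_def)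
    have "veq ((?s \<pi> - \<pi>) / \<pi>) (1 / ?q + of_int (brk l) / ?q - 1 / ?q)"
      using l r by (intro veq_divide d \<pi>) auto
    then have z: "veq (w - 1) a" using \<pi>0 by (simp add: w_def a_def diff_divide_distrib)
    have comm: "?s (?t i \<pi>) = ?t i (?s \<pi>)" for i by (metis add.commute comp_apply funpow_add)
    have sF: "?s \<pi> \<in> Fj (Suc j)" using \<pi>
      by (auto simp: Fj_def) (metis add.commute comp_apply funpow_add)
    have wF: "w - 1 \<in> Fj (Suc j)" "w \<in> L" using sF \<pi> fldD(2)[OF fld_Fj] Fj_L unfolding w_def
      by (auto intro!: fldD(4,8)[OF fld_Fj] fldD(8)[OF L])
    define R where "R = a + of_int (brk j) / ?q"
    have tw: "vge (?t i w - w) R" for i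
    proof -
      have "vge (?t i (w - 1) - (w - 1)) (a + of_int (brk j) / ?q)"
        by (rule desc_ge[OF D _ j wF(1) veq_vge[OF z order_refl]]) simp
      moreover have "?t i (w - 1) = ?t i w - 1" using wF(2) fldD(2)[OF K] by (simp add: pow_diff)
      ultimately show ?thesis by (simp add: R_def)
    qed
    have w0: "vge w 0" using vge_add[OF veq_vge[OF z a0] veq_vge[OF veq_1 order_refl]] by simp
    have tw0: "vge (?t i w) 0" for i using w0 wF(2) by simp
    have "vge ((\<Prod>i<p. ?t i w) - (\<Prod>i<p. w)) ((\<Sum>i<p. 0) + R)"
      by (rule prod_lipschitz) (use tw tw0 w0 in auto)
    then have 1: "vge ((\<Prod>i<p. ?t i w) - w ^ p) R" by simp
    have "w ^ p - 1 = (w - 1) ^ p" using frob_diff[of w 1 1] by simp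
    then have 2: "veq (w ^ p - 1) (real p * a)" using veq_power[OF z, of p] by simp
    \<comment> \<open>This is \<open>gr\<close> divided by \<open>?q\<close>. It makes
      \<open>w ^ p - 1\<close>, of value \<open>p * a\<close>, dominate the difference between the
      norm of \<open>w\<close> and \<open>w ^ p\<close>.\<close>
    have "real p * a < R"
    proof -
      have "(int p - 1) * brk l < brk j" using gr l by blast
      then have "real_of_int ((int p - 1) * brk l) < of_int (brk j)" by (simp only: of_int_less_iff)
      then have "real p * of_int (brk l) < of_int (brk l) + of_int (brk j)" by (simp add: left_diff_distrib)
      then have "real p * of_int (brk l) / ?q < (of_int (brk l) + of_int (brk j)) / ?q" by (rule divide_strict_right_mono[OF _ q(1)])
      then show ?thesis by (simp add: a_def R_def add_divide_distrib)
    qed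
    then have "veq ((w ^ p - 1) + ((\<Prod>i<p. ?t i w) - w ^ p)) (real p * a)" by (intro veq_add_dom[OF 2 1])
    then have 3: "veq ((\<Prod>i<p. ?t i w) - 1) (real p * a)" by simp
    have "?t i w * ?t i \<pi> = ?t i (?s \<pi>)" for i
      using pow_mult[OF wF(2) \<pi>L, of "p ^ j * i"] \<pi>0 by (simp add: w_def)
    then have "(\<Prod>i<p. ?t i w) * \<rho> = (\<Prod>i<p. ?t i (?s \<pi>))" unfolding \<rho>_def by (simp add: prod.distrib[symmetric])
    also have "\<dots> = ?s \<rho>" unfolding \<rho>_def using \<pi>L by (subst pow_prod) (auto simp: comm)
    finally have "?s \<rho> - \<rho> = ((\<Prod>i<p. ?t i w) - 1) * \<rho>" by (simp add: left_diff_distrib)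
    moreover have "veq (((\<Prod>i<p. ?t i w) - 1) * \<rho>) (real p * a + 1 / real (p ^ j))" by (intro veq_mult 3 \<rho>v)
    moreover have "real p * a = of_int (brk l) / real (p ^ j)" using p_pos by (simp add: a_def)
    ultimately show ?thesis by (simp add: add.commute)
  qed
  then show ?thesis unfolding desc_def using \<rho>F \<rho>v by blast
qed

lemma desc_all:
  assumes "\<And>l j. l < j \<Longrightarrow> j < n \<Longrightarrow> (int p - 1) * brk l < brk j" "j \<le> n"
  shows "desc j"
  using assms(2)
proof (induction j rule: inc_induct)
  case base
  show ?case by (rule desc_n)
next
  case (step j)
  show ?case
  proof (rule desc_Suc[OF step.IH])
    show "Suc j \<le> n" using step by simp
    show "(int p - 1) * brk l < brk j" if "l < j" for l using that step by (intro assms(1)) auto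
  qed
qed

text \<open>The Herbrand function on \<open>[0, \<infinity>)\<close>, with \<open>ramnum\<close> the ramification numbers.\<close>

definition herb :: "real \<Rightarrow> real" where
  "herb t = (t + (\<Sum>k\<in>{0<..<N}. min t (of_int (ramnum k)))) / real N"

lemma ramnum_ge_iff:
  assumes k: "0 < k" "k < N" and i: "i < n" and mono: "\<And>l m. l < m \<Longrightarrow> m < n \<Longrightarrow> brk l < brk m"
  shows "brk i \<le> ramnum k \<longleftrightarrow> p ^ i dvd k"
proof -
  obtain l r where l: "l < n" "k = p ^ l * r" "\<not> p dvd r" using level_exists[OF k] .
  have "ramnum k = brk l" using ramnum_level[of k l r] l k by simp
  moreover have "brk i \<le> brk l \<longleftrightarrow> i \<le> l" using mono[of l i] brk_mono[of i l] l(1) i by (meson linorder_not_less)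
  moreover have "p ^ i dvd k \<longleftrightarrow> i \<le> l"
  proof
    assume "p ^ i dvd k"
    show "i \<le> l"
    proof (rule ccontr)
      assume "\<not> i \<le> l"
      then have "p ^ l * p dvd p ^ i" unfolding power_Suc2[symmetric] by (intro le_imp_power_dvd) simp
      with \<open>p ^ i dvd k\<close> have "p ^ l * p dvd p ^ l * r" using l(2) dvd_trans by metis
      then show False using l(3) p_pos by simp
    qed
  next
    assume "i \<le> l"
    then show "p ^ i dvd k" unfolding l(2) by (intro dvd_mult2 le_imp_power_dvd)
  qed
  ultimately show ?thesis by simp
qed

lemma card_multiples: "i \<le> n \<Longrightarrow> card {k \<in> {0<..<N}. p ^ i dvd k} = p ^ (n - i) - 1"
proof -
  assume i: "i \<le> n"
  have N: "N = p ^ i * p ^ (n - i)" unfolding N_eq using i by (simp add: power_add[symmetric])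
  have "{k \<in> {0<..<N}. p ^ i dvd k} = (\<lambda>j. p ^ i * j) ` {0<..<p ^ (n - i)}"
    using p_pos by (auto simp: N elim!: dvdE)
  moreover have "inj_on (\<lambda>j. p ^ i * j) {0<..<p ^ (n - i)}" using p_pos by (auto simp: inj_on_def)
  ultimately show ?thesis by (simp add: card_image)
qed

lemma herb_0: assumes "n \<ge> 1" shows "herb (of_int (brk 0)) = of_int (brk 0)"
proof -
  have "min (of_int (brk 0)) (of_int (ramnum k)) = (of_int (brk 0) :: real)" if "k \<in> {0<..<N}" for k
  proof -
    have k: "0 < k" "k < N" using that by auto
    obtain l r where l: "l < n" "k = p ^ l * r" "\<not> p dvd r" using level_exists[OF k] .
    have "ramnum k = brk l" using ramnum_level[of k l r] l k by simp
    then show ?thesis using brk_mono[of 0 l] l(1) by simp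
  qed
  then have "herb (of_int (brk 0)) = (of_int (brk 0) + real (N - 1) * of_int (brk 0)) / real N"
    by (simp add: herb_def)
  also have "\<dots> = of_int (brk 0)" using N_pos by (simp add: of_nat_diff field_simps)
  finally show ?thesis .
qed

text \<open>Between these breaks the ramification group consists of the exponents divisible by
  \<open>p ^ Suc i\<close>, that is \<open>p ^ (n - Suc i)\<close> out of \<open>p ^ n\<close>,
  which gives the slope.\<close>

lemma herb_Suc:
  assumes i: "Suc i < n" and mono: "\<And>l m. l < m \<Longrightarrow> m < n \<Longrightarrow> brk l < brk m"
  shows "herb (of_int (brk (Suc i))) = herb (of_int (brk i)) + (of_int (brk (Suc i)) - of_int (brk i)) / real (p ^ Suc i)"
proof -
  let ?b = "of_int (brk i) :: real" and ?c = "of_int (brk (Suc i)) :: real"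
  have bc: "brk i < brk (Suc i)" using mono i by simp
  have "min ?c (of_int (ramnum k)) - min ?b (of_int (ramnum k)) = (if p ^ Suc i dvd k then ?c - ?b else 0)"
    if "k \<in> {0<..<N}" for k
  proof -
    have k: "0 < k" "k < N" using that by auto
    obtain l r where l: "l < n" "k = p ^ l * r" "\<not> p dvd r" using level_exists[OF k] .
    have rl: "ramnum k = brk l" using ramnum_level[of k l r] l k by simp
    note iff = ramnum_ge_iff[OF k i mono]
    show ?thesis
    proof (cases "p ^ Suc i dvd k")
      case True
      then have "brk (Suc i) \<le> ramnum k" using iff by simp
      then show ?thesis using True bc by (simp add: min_def)
    next
      case False
      then have "ramnum k < brk (Suc i)" using iff by simp
      then have "\<not> Suc i \<le> l" using brk_mono[of "Suc i" l] rl l(1) by auto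
      then have "ramnum k \<le> brk i" unfolding rl using i by (intro brk_mono) auto
      then show ?thesis using False bc by (simp add: min_def)
    qed
  qed
  then have "(\<Sum>k\<in>{0<..<N}. min ?c (of_int (ramnum k))) - (\<Sum>k\<in>{0<..<N}. min ?b (of_int (ramnum k))) =
     (\<Sum>k\<in>{0<..<N}. if p ^ Suc i dvd k then ?c - ?b else 0)"
    unfolding sum_subtractf[symmetric] by (intro sum.cong refl)
  also have "\<dots> = (\<Sum>k\<in>{k\<in>{0<..<N}. p ^ Suc i dvd k}. ?c - ?b)"
    by (subst sum.inter_filter[symmetric]) auto
  also have "\<dots> = real (p ^ (n - Suc i) - 1) * (?c - ?b)"
    using card_multiples[of "Suc i"] i by (simp only: sum_constant Suc_leI)
  finally have "real N * herb ?c - real N * herb ?b = (?c - ?b) + real (p ^ (n - Suc i) - 1) * (?c - ?b)"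
    using N_pos by (simp add: herb_def del: of_nat_diff)
  also have "real (p ^ (n - Suc i) - 1) = real (p ^ (n - Suc i)) - 1" using p_pos by (simp add: of_nat_diff)
  finally have "real N * (herb ?c - herb ?b) = real (p ^ (n - Suc i)) * (?c - ?b)" by (simp add: algebra_simps)
  moreover have "real N = real (p ^ Suc i) * real (p ^ (n - Suc i))"
    unfolding N_eq of_nat_mult[symmetric] power_add[symmetric] using i by simp
  ultimately have "real (p ^ (n - Suc i)) * (real (p ^ Suc i) * (herb ?c - herb ?b)) = real (p ^ (n - Suc i)) * (?c - ?b)"
    by (simp only: mult_ac)
  then have "real (p ^ Suc i) * (herb ?c - herb ?b) = ?c - ?b" using p_pos by simp
  then have "herb ?c - herb ?b = (?c - ?b) / real (p ^ Suc i)"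
    using p_pos by (intro eq_divide_imp) (auto simp: mult.commute)
  then show ?thesis by linarith
qed

end

section \<open>Artin-Schreier-Witt extensions\<close>

context valued_p
begin

lemma frob_fixed:
  assumes "d ^ p = (d::'a)" shows "\<exists>c<p. d = of_nat c"
proof -
  define Q :: "'a Polynomial.poly" where "Q = Polynomial.monom 1 p - Polynomial.monom 1 1"
  have "Polynomial.coeff Q p = 1" using p_ge_2 by (simp add: Q_def)
  then have Q0: "Q \<noteq> 0" by auto
  have deg: "Polynomial.degree Q \<le> p"
    unfolding Q_def using p_ge_2 by (intro degree_diff_le) (auto intro: order.trans[OF degree_monom_le])
  have root: "Polynomial.poly Q y = y ^ p - y" for y by (simp add: Q_def poly_monom)
  let ?R = "{y. Polynomial.poly Q y = 0}"
  have fin: "finite ?R" using Q0 by (rule poly_roots_finite)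
  have inj: "inj_on (of_nat :: nat \<Rightarrow> 'a) {..<p}"
  proof (rule linorder_inj_onI')
    fix i j assume ij: "i \<in> {..<p}" "j \<in> {..<p}" "i < j"
    have "of_nat (j - i) \<noteq> (0::'a)" using ij by (intro of_nat_char_nz[OF prime char]) auto
    then show "(of_nat i :: 'a) \<noteq> of_nat j" using ij by (auto simp: of_nat_diff)
  qed
  have sub: "of_nat ` {..<p} \<subseteq> ?R"
  proof -
    have "(of_nat c :: 'a) ^ p = of_nat c" for c
    proof (induction c)
      case (Suc c)
      then show ?case using frob_add[of 1 "of_nat c" 1] by simp
    qed (use p_pos in simp)
    then show ?thesis by (auto simp: root)
  qed
  have "card ?R \<le> p" using card_poly_roots_bound[OF Q0] deg by linarith
  moreover have "card (of_nat ` {..<p} :: 'a set) = p" using inj by (simp add: card_image)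
  ultimately have "of_nat ` {..<p} = ?R" using card_subset_eq[OF fin sub] card_mono[OF fin sub] by linarith
  moreover have "d \<in> ?R" using assms by (simp add: root)
  ultimately show ?thesis by auto
qed

end

text \<open>Indices start at \<open>0\<close>, so \<open>brk i\<close> is b_(i+1) and
  \<open>herb (brk i)\<close> is u_(i+1). Generation of \<open>L\<close> by the coordinates is
  expressed by \<open>gen\<close> through what powers of \<open>\<sigma>\<close> fix.\<close>

locale asw = cyc_ram +
  fixes x \<beta> \<omega> \<delta> :: "nat \<Rightarrow> 'a"
  assumes n_pos: "n \<ge> 1"
    and \<beta>_in: "i < n \<Longrightarrow> \<beta> i \<in> K"
    and \<omega>_in: "1 \<le> i \<Longrightarrow> i < n \<Longrightarrow> \<omega> i \<in> K"
    and x_in: "i < n \<Longrightarrow> x i \<in> L"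
    and x_eq: "k < n \<Longrightarrow> x k ^ p = x k + \<beta> k + witt_poly_eval (case_sum x \<beta>) (witt_carry p k)"
    and gen: "(\<And>i. i < n \<Longrightarrow> (\<sigma> ^^ k) (x i) = x i) \<Longrightarrow> y \<in> L \<Longrightarrow> (\<sigma> ^^ k) y = y"
    and reduced: "i < n \<Longrightarrow> vge (\<beta> i) 0 \<or> (\<exists>m::int. veq (\<beta> i) (of_int m) \<and> \<not> int p dvd m)"
    and \<beta>_eq: "1 \<le> i \<Longrightarrow> i < n \<Longrightarrow> \<beta> i = \<beta> 0 * \<omega> i ^ (p ^ (n - 1)) + \<delta> i"
    and \<delta>_less: "1 \<le> i \<Longrightarrow> i < n \<Longrightarrow> v (\<beta> i) < v (\<delta> i)"
    and brk_strict: "l < m \<Longrightarrow> m < n \<Longrightarrow> brk l < brk m"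
    and brk_growth: "Suc i < n \<Longrightarrow> real (p ^ n) * herb (of_int (brk i)) < of_int (brk (Suc i))"
    and brk_\<delta>: "1 \<le> i \<Longrightarrow> i < n \<Longrightarrow> veq (\<delta> i) r \<Longrightarrow> - real (p ^ (n - 1)) * r < of_int (brk i)"
begin

definition C :: "nat \<Rightarrow> 'a" where "C k = witt_poly_eval (case_sum x \<beta>) (witt_carry p k)"

lemma pow_witt_eval:
  assumes P: "P \<in> isobaric p w k" and \<rho>: "\<And>z. witt_idx z < k \<Longrightarrow> \<rho> z \<in> L"
  shows "(\<sigma> ^^ j) (witt_poly_eval \<rho> P) = witt_poly_eval (\<lambda>z. (\<sigma> ^^ j) (\<rho> z)) P"
    and "witt_poly_eval \<rho> P \<in> L"
proof -
  have idx: "\<rho> z \<in> L" if "m \<in> Poly_Mapping.keys P" "z \<in> Poly_Mapping.keys m" for m z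
    using P that \<rho> unfolding isobaric_def by blast
  have int: "of_int c \<in> K" for c
    by (cases c rule: int_cases2) (auto intro: fldD(7,10)[OF K])
  have mon: "witt_mon \<rho> m \<in> L" if "m \<in> Poly_Mapping.keys P" for m
    unfolding witt_mon_def using idx[OF that] by (intro fld_prod[OF L] fldD(9)[OF L])
  have term_in: "of_int (Poly_Mapping.lookup P m) * witt_mon \<rho> m \<in> L" if "m \<in> Poly_Mapping.keys P" for m
    by (rule fldD(5)[OF L inL[OF int] mon[OF that]])
  show "witt_poly_eval \<rho> P \<in> L" unfolding witt_poly_eval_mon by (intro fld_sum[OF L] term_in)
  have "(\<sigma> ^^ j) (witt_mon \<rho> m) = witt_mon (\<lambda>z. (\<sigma> ^^ j) (\<rho> z)) m" if m: "m \<in> Poly_Mapping.keys P" for m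
  proof -
    have "(\<sigma> ^^ j) (witt_mon \<rho> m) = (\<Prod>z\<in>Poly_Mapping.keys m. (\<sigma> ^^ j) (\<rho> z ^ Poly_Mapping.lookup m z))"
      unfolding witt_mon_def by (rule pow_prod) (rule fldD(9)[OF L idx[OF m]])
    also have "\<dots> = witt_mon (\<lambda>z. (\<sigma> ^^ j) (\<rho> z)) m"
      unfolding witt_mon_def by (rule prod.cong[OF refl]) (rule pow_power[OF idx[OF m]])
    finally show ?thesis .
  qed
  then show "(\<sigma> ^^ j) (witt_poly_eval \<rho> P) = witt_poly_eval (\<lambda>z. (\<sigma> ^^ j) (\<rho> z)) P"
    unfolding witt_poly_eval_mon
    by (subst pow_sum[OF term_in]) (auto intro!: sum.cong simp: pow_scale[OF int mon])
qed

lemma C_pow: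
  assumes "k < n"
  shows "(\<sigma> ^^ j) (C k) = witt_poly_eval (case_sum (\<lambda>i. (\<sigma> ^^ j) (x i)) \<beta>) (witt_carry p k)"
proof -
  have iso: "witt_carry p k \<in> isobaric p (p ^ k) k" by (rule witt_carry_isobaric[OF prime])
  have "(\<sigma> ^^ j) (C k) = witt_poly_eval (\<lambda>z. (\<sigma> ^^ j) (case_sum x \<beta> z)) (witt_carry p k)"
    unfolding C_def
  proof (rule pow_witt_eval(1)[OF iso])
    fix z assume "witt_idx z < k"
    then show "case_sum x \<beta> z \<in> L" using assms x_in \<beta>_in by (cases z) auto
  qed
  also have "\<dots> = witt_poly_eval (case_sum (\<lambda>i. (\<sigma> ^^ j) (x i)) \<beta>) (witt_carry p k)"
  proof (rule isobaric_eval_cong[OF iso])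
    fix z assume "witt_idx z < k"
    then show "(\<sigma> ^^ j) (case_sum x \<beta> z) = case_sum (\<lambda>i. (\<sigma> ^^ j) (x i)) \<beta> z"
      using assms \<beta>_in by (cases z) auto
  qed
  finally show ?thesis .
qed

lemma x_eq': "k < n \<Longrightarrow> x k ^ p - x k = \<beta> k + C k"
  using x_eq[of k] by (simp add: C_def)

lemma pow_x_eq:
  assumes "k < n"
  shows "((\<sigma> ^^ j) (x k) - x k) ^ p - ((\<sigma> ^^ j) (x k) - x k) = (\<sigma> ^^ j) (C k) - C k"
proof -
  have CL: "C k \<in> L"
    using x_eq'[OF assms] x_in[OF assms] \<beta>_in[OF assms]
      fldD(4)[OF L fldD(4)[OF L fldD(9)[OF L x_in[OF assms], of p] x_in[OF assms]] inL[OF \<beta>_in[OF assms]]]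
    by simp
  have "(\<sigma> ^^ j) (x k) ^ p - (\<sigma> ^^ j) (x k) = (\<sigma> ^^ j) (x k ^ p - x k)"
    using x_in[OF assms] fldD(9)[OF L x_in[OF assms]] by (simp add: pow_diff pow_power)
  also have "\<dots> = \<beta> k + (\<sigma> ^^ j) (C k)"
    unfolding x_eq'[OF assms] using CL \<beta>_in[OF assms] by (simp add: pow_add)
  finally have 1: "(\<sigma> ^^ j) (x k) ^ p - (\<sigma> ^^ j) (x k) = \<beta> k + (\<sigma> ^^ j) (C k)" .
  have "((\<sigma> ^^ j) (x k) - x k) ^ p = (\<sigma> ^^ j) (x k) ^ p - x k ^ p" using frob_diff[of _ _ 1] by simp
  then have "((\<sigma> ^^ j) (x k) - x k) ^ p - ((\<sigma> ^^ j) (x k) - x k) =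
     ((\<sigma> ^^ j) (x k) ^ p - (\<sigma> ^^ j) (x k)) - (x k ^ p - x k)" by simp
  then show ?thesis unfolding 1 x_eq'[OF assms] by simp
qed

text \<open>The carry involves earlier coordinates only and is therefore fixed, so the displacement
  of \<open>x m\<close> is a root of \<open>X ^ p = X\<close>, an element of the prime field;
  repeating it \<open>p\<close> times gives \<open>0\<close>.\<close>

lemma x_translate:
  assumes m: "m < n" and fixd: "\<And>i. i < m \<Longrightarrow> x i \<in> Fj j"
  shows "\<exists>c<p. (\<sigma> ^^ (p ^ j)) (x m) = x m + of_nat c" and "x m \<in> Fj (Suc j)"
proof -
  let ?d = "(\<sigma> ^^ (p ^ j)) (x m) - x m"
  have "(\<sigma> ^^ (p ^ j)) (C m) = C m"
    unfolding C_pow[OF m] unfolding C_def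
  proof (rule isobaric_eval_cong[OF witt_carry_isobaric[OF prime]])
    fix z assume "witt_idx z < m"
    then show "case_sum (\<lambda>i. (\<sigma> ^^ (p ^ j)) (x i)) \<beta> z = case_sum x \<beta> z" using fixd by (cases z) (auto simp: Fj_def)
  qed
  then have "?d ^ p = ?d" using pow_x_eq[OF m, of "p ^ j"] by simp
  then obtain c where c: "c < p" "?d = of_nat c" using frob_fixed by blast
  then have c2: "(\<sigma> ^^ (p ^ j)) (x m) = x m + of_nat c" by (simp add: algebra_simps)
  then show "\<exists>c<p. (\<sigma> ^^ (p ^ j)) (x m) = x m + of_nat c" using c by blast
  have "(\<sigma> ^^ (p ^ j * l)) (x m) = x m + of_nat l * of_nat c" for l
  proof (induction l)
    case (Suc l)
    have "of_nat l * of_nat c \<in> K" by (intro fldD(5,10)[OF K])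
    have "(\<sigma> ^^ (p ^ j * Suc l)) (x m) = (\<sigma> ^^ (p ^ j)) ((\<sigma> ^^ (p ^ j * l)) (x m))" by (simp add: funpow_add)
    also have "\<dots> = x m + of_nat c + of_nat l * of_nat c"
      unfolding Suc using c2 x_in[OF m] \<open>of_nat l * of_nat c \<in> K\<close> by (simp add: pow_add)
    finally show ?case by (simp add: algebra_simps)
  qed simp
  from this[of p] show "x m \<in> Fj (Suc j)"
    using x_in[OF m] char of_nat_CHAR[where 'a = 'a] by (simp add: Fj_def mult.commute)
qed

lemma x_Fj: "m < n \<Longrightarrow> x m \<in> Fj (Suc m)"
proof (induction m rule: less_induct)
  case (less m)
  show ?case
  proof (rule x_translate(2)[OF less.prems])
    fix i assume "i < m"
    then show "x i \<in> Fj m" using less by (auto intro: Fj_mono[of _ "Suc i"])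
  qed
qed

text \<open>If \<open>\<sigma>\<close> raised to \<open>p\<^sup>l\<close> fixed \<open>x l\<close>, then every \<open>x m\<close>, and with it \<open>L\<close>, would be fixed by a
  nontrivial power of \<open>\<sigma>\<close>.\<close>

lemma x_not_Fj: assumes l: "l < n" shows "x l \<notin> Fj l"
proof
  assume xl: "x l \<in> Fj l"
  have 1: "x m \<in> Fj m" if "l \<le> m" "m < n" for m
    using that
  proof (induction m rule: less_induct)
    case (less m)
    show ?case
    proof (cases "m = l")
      case True
      then show ?thesis using xl by simp
    next
      case False
      then obtain m' where m': "m = Suc m'" "l \<le> m'" using less.prems(1) by (cases m) auto
      have "x i \<in> Fj m'" if "i < m" for i
      proof (cases "i < l")
        case True
        then show ?thesis using x_Fj[of i] m' that less.prems by (auto intro: Fj_mono[of _ "Suc i"])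
      next
        case False
        then have "x i \<in> Fj i" using less.IH[of i] that less.prems by simp
        then show ?thesis using that m' by (auto intro: Fj_mono)
      qed
      then show ?thesis using x_translate(2)[OF less.prems(2), of m'] m' by simp
    qed
  qed
  have "x m \<in> Fj (n - 1)" if "m < n" for m
  proof (cases "m < l")
    case True
    then show ?thesis using x_Fj[OF that] l by (auto intro: Fj_mono[of _ "Suc m"])
  next
    case False
    then show ?thesis using 1[of m] that by (auto intro: Fj_mono[of _ m])
  qed
  then have "(\<sigma> ^^ (p ^ (n - 1))) (x i) = x i" if "i < n" for i
    using that unfolding Fj_def by blast
  then have "(\<sigma> ^^ (p ^ (n - 1))) y = y" if "y \<in> L" for y
    using that by (rule gen)
  moreover have "0 < p ^ (n - 1) \<and> p ^ (n - 1) < N" using n_pos by (intro p_power_less) simp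
  ultimately show False using faithful by blast
qed

lemma shift_exists:
  assumes l: "l < n"
  shows "\<exists>r. \<not> p dvd r \<and> (\<sigma> ^^ (p ^ l * r)) (x l) = x l + 1"
proof -
  have fixd: "x i \<in> Fj l" if "i < l" for i using x_Fj[of i] l that by (auto intro: Fj_mono[of _ "Suc i"])
  obtain c where c: "c < p" "(\<sigma> ^^ (p ^ l)) (x l) = x l + of_nat c" using x_translate(1)[OF l fixd] by blast
  have "c \<noteq> 0"
  proof
    assume "c = 0"
    then have "x l \<in> Fj l" using c(2) x_in[OF l] by (simp add: Fj_def)
    then show False using x_not_Fj[OF l] by blast
  qed
  then have pc: "\<not> p dvd c" using c by (auto dest: dvd_imp_le)
  obtain r where r: "[c * r = 1] (mod p ^ 1)" using exp_mult_inv_mod_prime_power[OF prime pc] by blast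
  have rep: "(\<sigma> ^^ (p ^ l * r)) (x l) = x l + of_nat (c * r)" for r
  proof (induction r)
    case (Suc r)
    have "of_nat (c * r) \<in> K" by (intro fldD(10)[OF K])
    have "(\<sigma> ^^ (p ^ l * Suc r)) (x l) = (\<sigma> ^^ (p ^ l)) ((\<sigma> ^^ (p ^ l * r)) (x l))" by (simp add: funpow_add)
    also have "\<dots> = x l + of_nat c + of_nat (c * r)"
      unfolding Suc using c(2) x_in[OF l] \<open>of_nat (c * r) \<in> K\<close> by (simp only: pow_add inL pow_fix)
    finally show ?case by (simp add: algebra_simps)
  qed simp
  have "(of_nat (c * r) :: 'a) = of_nat 1"
    using r by (subst of_nat_eq_iff_cong_CHAR) (simp add: char)
  then have "(\<sigma> ^^ (p ^ l * r)) (x l) = x l + 1" using rep by simp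
  moreover have "\<not> p dvd r"
  proof
    assume "p dvd r"
    then have "p dvd c * r" by simp
    then have "[c * r = 0] (mod p)" by (simp add: cong_0_iff)
    with r have "[1 = 0] (mod p)" by (metis cong_sym cong_trans power_one_right)
    then show False using p_ge_2 by (simp add: cong_0_iff)
  qed
  ultimately show ?thesis by blast
qed

definition sh :: "nat \<Rightarrow> nat" where
  "sh l = (SOME r. \<not> p dvd r \<and> (\<sigma> ^^ (p ^ l * r)) (x l) = x l + 1)"

definition se :: "nat \<Rightarrow> nat" where "se l = p ^ l * sh l"

lemma sh: "l < n \<Longrightarrow> \<not> p dvd sh l"
  and se_x: "l < n \<Longrightarrow> (\<sigma> ^^ se l) (x l) = x l + 1"
  using someI_ex[OF shift_exists, of l] unfolding sh_def[symmetric] se_def by auto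

lemma se_Fj: "y \<in> Fj l \<Longrightarrow> (\<sigma> ^^ se l) y = y"
  unfolding se_def by (rule Fj_mult)

lemma se_x_less: "i < l \<Longrightarrow> l < n \<Longrightarrow> (\<sigma> ^^ se l) (x i) = x i"
  by (rule se_Fj[OF Fj_mono[OF x_Fj]]) auto

definition om :: "nat \<Rightarrow> 'a" where "om i = (if i = 0 then 1 else \<omega> i)"
definition de :: "nat \<Rightarrow> 'a" where "de i = (if i = 0 then 0 else \<delta> i)"

lemma om_in: "i < n \<Longrightarrow> om i \<in> K"
  using \<omega>_in[of i] fldD(2)[OF K] by (auto simp: om_def)

lemma \<beta>_om: "i < n \<Longrightarrow> \<beta> i = \<beta> 0 * om i ^ (p ^ (n - 1)) + de i"
  using \<beta>_eq[of i] by (auto simp: om_def de_def)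

text \<open>Elimination: the linear combinations \<open>\<Sum>l. T s i l * x l\<close> arise from the \<open>x i\<close> by removing, one after
  another, the terms \<open>\<beta> 0 * om i ^ (p ^ (n - 1))\<close>, \<open>Y 0 * \<dots>\<close>, \<open>Y 1 * \<dots>\<close> from their Artin-Schreier equations.\<close>

fun rho :: "nat \<Rightarrow> nat \<Rightarrow> 'a" where
  "rho 0 i = om i"
| "rho (Suc s) i = (rho s i - rho s i ^ p) / (rho s (Suc s) - rho s (Suc s) ^ p)"

fun T :: "nat \<Rightarrow> nat \<Rightarrow> nat \<Rightarrow> 'a" where
  "T 0 i l = (if i = l then 1 else 0)"
| "T (Suc s) i l = T s i l - rho s i ^ (p ^ (n - 2 - s)) * T s s l"

text \<open>The coefficient of \<open>Y (s - 1)\<close> in the Artin-Schreier equation of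
  \<open>Y s\<close>. Dividing by it in \<open>rho\<close> normalises \<open>rho s s\<close> to
  \<open>1\<close>.\<close>

definition Th :: "nat \<Rightarrow> 'a" where
  "Th s = (rho (s - 1) s - rho (s - 1) s ^ p) ^ (p ^ (n - 1 - s))"

definition Y :: "nat \<Rightarrow> 'a" where "Y j = (\<Sum>l\<le>j. T j j l * x l)"

lemma rho_in: "i < n \<Longrightarrow> s < n \<Longrightarrow> rho s i \<in> K"
proof (induction s arbitrary: i)
  case (Suc s)
  then show ?case by (auto intro!: fldD(4,8,9)[OF K])
qed (use om_in in auto)

lemma T_in: "i < n \<Longrightarrow> s < n \<Longrightarrow> T s i l \<in> K"
  by (induction s arbitrary: i) (auto intro!: fldD(4,5,9)[OF K] rho_in fldD(1,2)[OF K])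

lemma T_upper: "s \<le> i \<Longrightarrow> i < l \<Longrightarrow> T s i l = 0"
  by (induction s arbitrary: i) auto

lemma T_diag: "s \<le> i \<Longrightarrow> T s i i = 1"
  using T_upper by (induction s arbitrary: i) auto

lemma Y_in: assumes "j < n" shows "Y j \<in> Fj (Suc j)"
  unfolding Y_def
proof (intro fld_sum[OF fld_Fj] fldD(5)[OF fld_Fj])
  fix l assume "l \<in> {..j}"
  then show "x l \<in> Fj (Suc j)" using x_Fj[of l] assms by (auto intro: Fj_mono[of _ "Suc l"])
  show "T j j l \<in> Fj (Suc j)" using T_in[OF assms assms] K_Fj by blast
qed

lemma Y_inL: "j < n \<Longrightarrow> Y j \<in> L" using Y_in Fj_L by blast

definition Err :: "nat \<Rightarrow> 'a" where "Err j = (\<Sum>l\<le>j. T j j l ^ p * (de l + C l))"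

section \<open>Values of the elimination coefficients\<close>

context
  fixes a :: "nat \<Rightarrow> real" and j :: nat
  assumes j: "j < n" and a: "\<And>i. i \<le> j \<Longrightarrow> veq (om i) (- a i)" "\<And>i. i < j \<Longrightarrow> a i < a (Suc i)"
begin

lemma a_less: "i < k \<Longrightarrow> k \<le> j \<Longrightarrow> a i < a k"
proof (induction k)
  case (Suc k)
  then show ?case using a(2)[of k] by (cases "i = k") auto
qed simp

lemma a_0: "a 0 = 0"
  using veq_unique[OF a(1)[of 0] veq_1[folded om_def[of 0, simplified]]] by (simp add: om_def)

lemma veq_AS: assumes "veq y t" "t < 0" shows "veq (y - y ^ p) (real p * t)"
proof -
  have "real p * t < 1 * t" using assms(2) p_ge_2 by (intro mult_strict_right_mono_neg) auto
  then have "veq (- (y ^ p) + y) (real p * t)"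
    using assms by (intro veq_add_dom[where s = t]) (auto intro: veq_power veq_vge)
  then show ?thesis by simp
qed

lemma rho_val: "s \<le> i \<Longrightarrow> i \<le> j \<Longrightarrow> veq (rho s i) (- (real (p ^ s) * (a i - a s)))"
  and rho_diag: "s \<le> j \<Longrightarrow> rho s s = 1"
proof -
  have "(\<forall>i. s \<le> i \<longrightarrow> i \<le> j \<longrightarrow> veq (rho s i) (- (real (p ^ s) * (a i - a s)))) \<and> rho s s = 1" if "s \<le> j" for s
    using that
  proof (induction s)
    case 0
    then show ?case using a(1) by (auto simp: a_0 om_def[of 0])
  next
    case (Suc s)
    have num: "veq (rho s i - rho s i ^ p) (real p * - (real (p ^ s) * (a i - a s)))" if i: "s < i" "i \<le> j" for i
      using Suc i a_less[OF i] p_pos by (intro veq_AS) auto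
    have "veq (rho (Suc s) i) (- (real (p ^ Suc s) * (a i - a (Suc s))))" if "Suc s \<le> i" "i \<le> j" for i
    proof -
      have "veq (rho (Suc s) i) (real p * - (real (p ^ s) * (a i - a s)) - real p * - (real (p ^ s) * (a (Suc s) - a s)))"
        unfolding rho.simps using that Suc.prems by (intro veq_divide num) auto
      then show ?thesis by (simp add: algebra_simps)
    qed
    moreover have "rho (Suc s) (Suc s) = 1" using veq_nz[OF num[of "Suc s"]] Suc.prems by simp
    ultimately show ?case by blast
  qed
  then show "s \<le> i \<Longrightarrow> i \<le> j \<Longrightarrow> veq (rho s i) (- (real (p ^ s) * (a i - a s)))" "s \<le> j \<Longrightarrow> rho s s = 1"
    by auto
qed

lemma Th_val: assumes "1 \<le> s" "s \<le> j" shows "veq (Th s) (- (real (p ^ (n - 1)) * (a s - a (s - 1))))"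
proof -
  obtain s' where s': "s = Suc s'" using assms(1) by (cases s) auto
  have "veq (rho s' s - rho s' s ^ p) (real p * - (real (p ^ s') * (a s - a s')))"
    using assms a_less[of s' s] s' p_pos by (intro veq_AS rho_val) auto
  then have "veq (Th s) (real (p ^ (n - 1 - s)) * (real p * - (real (p ^ s') * (a s - a s'))))"
    unfolding Th_def using s' by (intro veq_power) simp
  moreover have "n - 1 = (n - 1 - s) + (1 + s')" using assms j s' by simp
  then have "real (p ^ (n - 1)) = real (p ^ (n - 1 - s)) * (real p * real (p ^ s'))"
    by (metis of_nat_mult power_add power_one_right)
  ultimately show ?thesis using s' by (simp add: mult_ac)
qed

text \<open>The rows of \<open>T\<close> satisfy Artin-Schreier recursions of their own; for
  \<open>i = s = j\<close> the entries \<open>T j j l\<close> solve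
  \<open>z ^ p - z = Th j * T (j - 1) (j - 1) l\<close>, from which \<open>T_val\<close> reads off
  their values.\<close>

lemma T_power:
  assumes "s \<le> i" "i \<le> j"
  shows "T s i l ^ p - T s i l = rho s i ^ (p ^ (n - 1 - s)) * (if s = 0 then 0 else Th s * T (s - 1) (s - 1) l)"
  using assms
proof (induction s arbitrary: i)
  case 0
  then show ?case using p_pos by simp
next
  case (Suc s)
  let ?E = "if s = 0 then 0 else Th s * T (s - 1) (s - 1) l"
  \<comment> \<open>\<open>?c\<close> is the \<open>p\<close>-th root of the coefficient to be
    cancelled, so every elimination uses up one factor \<open>p\<close> of the exponent; starting
    from \<open>p ^ (n - 1)\<close> there is room for \<open>n - 1\<close> eliminations.\<close>
  let ?c = "rho s i ^ (p ^ (n - 2 - s))"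
  have ns: "n - 1 - s = Suc (n - 2 - s)" "n - 1 - Suc s = n - 2 - s" using Suc.prems j by auto
  have cp: "?c ^ p = rho s i ^ (p ^ (n - 1 - s))" unfolding ns(1) by (simp add: power_mult[symmetric] mult.commute)
  have "T (Suc s) i l ^ p = T s i l ^ p - ?c ^ p * T s s l ^ p"
    unfolding T.simps using frob_diff[of "T s i l" "?c * T s s l" 1] by (simp add: power_mult_distrib)
  then have 1: "T (Suc s) i l ^ p - T (Suc s) i l =
      (T s i l ^ p - T s i l) - ?c ^ p * (T s s l ^ p - T s s l) + (?c - ?c ^ p) * T s s l"
    by (simp add: algebra_simps)
  have 2: "T s i l ^ p - T s i l = ?c ^ p * ?E" unfolding cp using Suc by (intro Suc.IH) auto
  have 3: "T s s l ^ p - T s s l = ?E" using Suc.IH[of s] Suc.prems rho_diag[of s] by simp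
  let ?D = "rho s (Suc s) - rho s (Suc s) ^ p"
  have D0: "?D \<noteq> 0"
    using Suc.prems a_less[of s "Suc s"] p_pos
    by (intro veq_nz[OF veq_AS[OF rho_val[of s "Suc s"]]]) auto
  have "?c - ?c ^ p = (rho s i - rho s i ^ p) ^ (p ^ (n - 2 - s))"
    unfolding frob_diff by (simp add: power_mult[symmetric] mult.commute)
  also have "rho s i - rho s i ^ p = rho (Suc s) i * ?D" using D0 by simp
  also have "(rho (Suc s) i * ?D) ^ (p ^ (n - 2 - s)) = rho (Suc s) i ^ (p ^ (n - 1 - Suc s)) * Th (Suc s)"
    unfolding Th_def ns(2) power_mult_distrib by simp
  finally have 4: "?c - ?c ^ p = rho (Suc s) i ^ (p ^ (n - 1 - Suc s)) * Th (Suc s)" .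
  show ?case unfolding 1 2 3 4 by (simp add: algebra_simps)
qed

text \<open>The left side is the coefficient of \<open>\<beta> 0\<close> in the equation of a linear
  form. The first elimination cancels it, and later ones only combine rows in which it is already
  gone.\<close>

lemma T_om:
  assumes "s \<le> i" "i \<le> j"
  shows "(\<Sum>l\<le>j. T s i l ^ p * om l ^ (p ^ (n - 1))) = (if s = 0 then om i ^ (p ^ (n - 1)) else 0)"
proof -
  have "(\<Sum>l\<le>j. T s i l ^ p * om l ^ (p ^ (n - 1))) = rho s i ^ (p ^ (n - 1 - s)) * (if s = 0 then 1 else 0)"
    using assms
  proof (induction s arbitrary: i)
    case 0
    have "(\<Sum>l\<le>j. T 0 i l ^ p * om l ^ (p ^ (n - 1))) = (\<Sum>l\<le>j. if i = l then om l ^ (p ^ (n - 1)) else 0)"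
      using p_pos by (intro sum.cong) auto
    then show ?case using 0 by simp
  next
    case (Suc s)
    let ?c = "rho s i ^ (p ^ (n - 2 - s))"
    have ns: "n - 1 - s = Suc (n - 2 - s)" using Suc.prems j by auto
    have cp: "?c ^ p = rho s i ^ (p ^ (n - 1 - s))" unfolding ns(1) by (simp add: power_mult[symmetric] mult.commute)
    have "T (Suc s) i l ^ p = T s i l ^ p - ?c ^ p * T s s l ^ p" for l
      unfolding T.simps using frob_diff[of "T s i l" "?c * T s s l" 1] by (simp add: power_mult_distrib)
    then have "T (Suc s) i l ^ p * om l ^ (p ^ (n - 1)) =
       T s i l ^ p * om l ^ (p ^ (n - 1)) - ?c ^ p * (T s s l ^ p * om l ^ (p ^ (n - 1)))" for l
      by (simp only: left_diff_distrib mult.assoc)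
    then have "(\<Sum>l\<le>j. T (Suc s) i l ^ p * om l ^ (p ^ (n - 1))) =
       (\<Sum>l\<le>j. T s i l ^ p * om l ^ (p ^ (n - 1))) - ?c ^ p * (\<Sum>l\<le>j. T s s l ^ p * om l ^ (p ^ (n - 1)))"
      by (simp only: sum_subtractf sum_distrib_left)
    also have "\<dots> = 0"
      using Suc.IH[of i] Suc.IH[of s] Suc.prems rho_diag[of s] unfolding cp by simp
    finally show ?case by simp
  qed
  then show ?thesis by simp
qed

lemma T_val:
  assumes "1 \<le> j" "veq (T (j - 1) (j - 1) l) t" "t - real (p ^ (n - 1)) * (a j - a (j - 1)) < 0"
  shows "veq (T j j l) ((t - real (p ^ (n - 1)) * (a j - a (j - 1))) / real p)"
proof (rule artin_schreier_veq)
  show "T j j l ^ p - T j j l = Th j * T (j - 1) (j - 1) l"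
    using T_power[of j j l] rho_diag[of j] assms(1) by simp
  show "veq (Th j * T (j - 1) (j - 1) l) (t - real (p ^ (n - 1)) * (a j - a (j - 1)))"
    using veq_mult[OF Th_val[OF assms(1) order_refl] assms(2)] by (simp add: algebra_simps)
qed (use assms p_ge_2 in auto)

text \<open>After expanding \<open>Y j ^ p\<close>, \<open>T_om\<close> removes the multiples of
  \<open>\<beta> 0\<close> and \<open>T_power\<close> collapses the terms in \<open>x l\<close> to a
  multiple of \<open>Y (j - 1)\<close>; the terms with \<open>\<delta>\<close> and the carries make
  up \<open>Err j\<close>.\<close>

lemma Y_eq:
  assumes "1 \<le> j"
  shows "Y j ^ p - Y j = Th j * Y (j - 1) + Err j"
proof -
  have "Y j ^ p = (\<Sum>l\<le>j. T j j l ^ p * x l ^ p)"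
    unfolding Y_def using frob_sum[of "\<lambda>l. T j j l * x l" "{..j}" 1] by (simp add: power_mult_distrib)
  also have "\<dots> = (\<Sum>l\<le>j. T j j l ^ p * x l + \<beta> 0 * (T j j l ^ p * om l ^ (p ^ (n - 1))) + T j j l ^ p * (de l + C l))"
  proof (intro sum.cong refl)
    fix l assume "l \<in> {..j}"
    then have "l < n" using j by simp
    then have "x l ^ p = x l + (\<beta> 0 * om l ^ (p ^ (n - 1)) + de l) + C l"
      using x_eq[of l] \<beta>_om[of l] by (simp add: C_def)
    then show "T j j l ^ p * x l ^ p = T j j l ^ p * x l + \<beta> 0 * (T j j l ^ p * om l ^ (p ^ (n - 1))) + T j j l ^ p * (de l + C l)"
      by (simp only:) (simp add: algebra_simps)
  qed
  also have "\<dots> = (\<Sum>l\<le>j. T j j l ^ p * x l) + \<beta> 0 * (\<Sum>l\<le>j. T j j l ^ p * om l ^ (p ^ (n - 1))) + Err j"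
    by (simp add: sum.distrib sum_distrib_left Err_def)
  also have "(\<Sum>l\<le>j. T j j l ^ p * om l ^ (p ^ (n - 1))) = 0" using T_om[of j j] assms by simp
  finally have 1: "Y j ^ p - Y j = (\<Sum>l\<le>j. (T j j l ^ p - T j j l) * x l) + Err j"
    unfolding Y_def[of j] by (simp add: left_diff_distrib sum_subtractf)
  have "(\<Sum>l\<le>j. (T j j l ^ p - T j j l) * x l) = Th j * (\<Sum>l\<le>j. T (j - 1) (j - 1) l * x l)"
    unfolding sum_distrib_left using T_power[of j j] rho_diag[of j] assms by (intro sum.cong) auto
  also have "(\<Sum>l\<le>j. T (j - 1) (j - 1) l * x l) = Y (j - 1)"
  proof -
    obtain j' where j': "j = Suc j'" using assms by (cases j) auto
    show ?thesis unfolding Y_def j' using T_upper[of j' j' j] j' by simp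
  qed
  finally show ?thesis unfolding 1 by simp
qed

end

section \<open>Growth of the upper breaks; \<open>U i\<close> is u_(i+1)\<close>

definition U :: "nat \<Rightarrow> real" where "U i = herb (of_int (brk i))"

lemma U_0: "U 0 = of_int (brk 0)"
  unfolding U_def using n_pos by (rule herb_0)

lemma U_Suc: "Suc i < n \<Longrightarrow> U (Suc i) = U i + (of_int (brk (Suc i)) - of_int (brk i)) / real (p ^ Suc i)"
  unfolding U_def by (rule herb_Suc) (auto intro: brk_strict)

lemma U_less_Suc: "Suc i < n \<Longrightarrow> U i < U (Suc i)"
  using U_Suc[of i] brk_strict[of i "Suc i"] p_pos by simp

lemma U_pos: "i < n \<Longrightarrow> 0 < U i"
proof (induction i)
  case 0
  then show ?case using U_0 brk_pos[of 0] by simp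
next
  case (Suc i)
  then show ?case using U_less_Suc[of i] by simp
qed

lemma brk_le_U: "i < n \<Longrightarrow> of_int (brk i) \<le> real (p ^ i) * U i"
proof (induction i)
  case 0
  then show ?case using U_0 by simp
next
  case (Suc i)
  have "real (p ^ Suc i) * U (Suc i) = real (p ^ Suc i) * U i + (of_int (brk (Suc i)) - of_int (brk i))"
    using U_Suc[OF Suc.prems] p_pos by (simp add: distrib_left)
  moreover have "real (p ^ i) * U i \<le> real (p ^ Suc i) * U i"
    using U_pos[of i] Suc.prems p_pos by (intro mult_right_mono) auto
  ultimately show ?case using Suc by simp
qed

lemma growth: "Suc i < n \<Longrightarrow> real (p ^ n) * U i < of_int (brk (Suc i))"
  unfolding U_def by (rule brk_growth)

lemma growth': "1 \<le> j \<Longrightarrow> j < n \<Longrightarrow> real (p ^ Suc j) * U (j - 1) < of_int (brk j)"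
proof -
  assume j: "1 \<le> j" "j < n"
  have "real (p ^ Suc j) * U (j - 1) \<le> real (p ^ n) * U (j - 1)"
  proof (rule mult_right_mono)
    show "real (p ^ Suc j) \<le> real (p ^ n)" unfolding of_nat_le_iff using j p_pos by (intro power_increasing) auto
    show "0 \<le> U (j - 1)" by (rule less_imp_le[OF U_pos]) (use j in simp)
  qed
  also have "\<dots> < of_int (brk j)" using growth[of "j - 1"] j by simp
  finally show ?thesis .
qed

text \<open>Monotonicity of \<open>U i / p ^ i\<close> allows a single slope \<open>A\<close> to
  bound all earlier coordinates proportionally to their weights in the isobaric estimates.\<close>

lemma U_ratio_Suc: "Suc i < n \<Longrightarrow> U i / real (p ^ i) \<le> U (Suc i) / real (p ^ Suc i)"
proof -
  assume i: "Suc i < n"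
  have "real (p ^ Suc i) * (real p * U i) = real (p ^ Suc (Suc i)) * U i" by simp
  also have "\<dots> < of_int (brk (Suc i))" using growth'[of "Suc i"] i by simp
  also have "\<dots> \<le> real (p ^ Suc i) * U (Suc i)" using brk_le_U[OF i] .
  finally have "real p * U i < U (Suc i)" using p_pos by simp
  then have "real p * U i / real (p ^ Suc i) \<le> U (Suc i) / real (p ^ Suc i)"
    by (intro divide_right_mono) auto
  then show ?thesis using p_pos by simp
qed

lemma U_ratio: "i \<le> k \<Longrightarrow> k < n \<Longrightarrow> U i / real (p ^ i) \<le> U k / real (p ^ k)"
proof (induction k rule: dec_induct)
  case (step k)
  then show ?case using U_ratio_Suc[of k] by simp
qed simp

lemma U_diff: "i \<le> k \<Longrightarrow> k < n \<Longrightarrow> (of_int (brk k) - of_int (brk i)) / real (p ^ k) \<le> U k - U i"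
proof (induction k rule: dec_induct)
  case (step k)
  have "(of_int (brk k) - of_int (brk i)) / real (p ^ Suc k) \<le> (of_int (brk k) - of_int (brk i)) / real (p ^ k)"
    using brk_mono[of i k] step p_pos by (intro divide_left_mono) auto
  then have "(of_int (brk (Suc k)) - of_int (brk i)) / real (p ^ Suc k) \<le>
      (of_int (brk k) - of_int (brk i)) / real (p ^ k) + (of_int (brk (Suc k)) - of_int (brk k)) / real (p ^ Suc k)"
    by (simp add: diff_divide_distrib)
  then show ?case using step U_Suc[of k] by simp
qed simp

lemma desc: "j \<le> n \<Longrightarrow> desc j"
proof (rule desc_all)
  fix l j assume lj: "l < j" "j < n"
  have "real p * of_int (brk l) \<le> real p * of_int (brk (j - 1))"
    using lj brk_mono[of l "j - 1"] by (intro mult_left_mono) auto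
  also have "\<dots> \<le> real p * (real (p ^ (j - 1)) * U (j - 1))"
    using brk_le_U[of "j - 1"] lj by (intro mult_left_mono) auto
  also have "\<dots> = real (p ^ j) * U (j - 1)" using lj by (cases j) auto
  also have "\<dots> \<le> real (p ^ Suc j) * U (j - 1)"
  proof (rule mult_right_mono)
    show "real (p ^ j) \<le> real (p ^ Suc j)" unfolding of_nat_le_iff using p_pos by (intro power_increasing) auto
    show "0 \<le> U (j - 1)" by (rule less_imp_le[OF U_pos]) (use lj in simp)
  qed
  also have "\<dots> < of_int (brk j)" using growth'[of j] lj by simp
  finally have "of_int (int p * brk l) < (of_int (brk j) :: real)" by simp
  then have "int p * brk l < brk j" by (simp only: of_int_less_iff)
  then show "(int p - 1) * brk l < brk j" using brk_pos[of l] lj by (simp add: left_diff_distrib)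
qed

text \<open>The valuation of an element moved by \<open>1\<close> detects the break: it is extremal exactly when it is prime to \<open>p\<close>.\<close>

lemma unit_shift_le:
  assumes l: "l < n" and z: "z \<in> Fj (Suc l)" "(\<sigma> ^^ se l) z = z + 1" "vge z t"
  shows "t \<le> - (of_int (brk l) / real (p ^ Suc l))"
proof -
  have "vge ((\<sigma> ^^ (p ^ l * sh l)) z - z) (t + of_int (brk l) / real (p ^ Suc l))"
    using l by (intro desc_ge desc z) auto
  then have "vge 1 (t + of_int (brk l) / real (p ^ Suc l))" using z(2) by (simp add: se_def)
  from vge_veq_le[OF this veq_1] show ?thesis by linarith
qed

lemma unit_shift_eq:
  assumes l: "l < n" and z: "z \<in> Fj (Suc l)" "(\<sigma> ^^ se l) z = z + 1"
    and m: "veq z (of_int m / real (p ^ Suc l))" "\<not> int p dvd m"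
  shows "m = - brk l"
proof -
  have "veq ((\<sigma> ^^ (p ^ l * sh l)) z - z) (of_int m / real (p ^ Suc l) + of_int (brk l) / real (p ^ Suc l))"
    using l by (intro desc_eq desc z m sh) auto
  then have "veq 1 (of_int m / real (p ^ Suc l) + of_int (brk l) / real (p ^ Suc l))" using z(2) by (simp add: se_def)
  from veq_unique[OF this veq_1] have "(of_int m + of_int (brk l)) / real (p ^ Suc l) = 0" by (simp only: add_divide_distrib)
  then have "of_int m + of_int (brk l) = (0::real)" using p_pos by simp
  then show ?thesis by linarith
qed

text \<open>A monomial without variables has weight \<open>0\<close>, whereas the carry at index
  \<open>0\<close> would have weight \<open>p ^ 0 = 1\<close>.\<close>

lemma C_0: "C 0 = 0"
proof -
  have "Poly_Mapping.keys (witt_carry p 0) = {}"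
  proof (rule ccontr)
    assume "Poly_Mapping.keys (witt_carry p 0) \<noteq> {}"
    then obtain m where m: "m \<in> Poly_Mapping.keys (witt_carry p 0)" by blast
    with witt_carry_isobaric[OF prime, of 0] have "witt_wt p m = 1" "Poly_Mapping.keys m = {}"
      by (auto simp: isobaric_def)
    then show False by (simp add: witt_wt_def)
  qed
  then show ?thesis by (simp add: C_def witt_poly_eval_def)
qed

text \<open>In \<open>Y l\<close> the coordinate \<open>x l\<close> has coefficient
  \<open>1\<close>, and the earlier coordinates are fixed.\<close>

lemma se_Y: assumes "l < n" shows "(\<sigma> ^^ se l) (Y l) = Y l + 1"
proof -
  have split: "Y l = (\<Sum>i<l. T l l i * x i) + x l"
    unfolding Y_def by (simp add: lessThan_Suc_atMost[symmetric] T_diag)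
  have inL: "(\<Sum>i<l. T l l i * x i) \<in> L"
    using assms T_in x_in by (intro fld_sum[OF L] fldD(5)[OF L]) auto
  have "(\<sigma> ^^ se l) (\<Sum>i<l. T l l i * x i) = (\<Sum>i<l. (\<sigma> ^^ se l) (T l l i * x i))"
    using assms T_in x_in by (intro pow_sum fldD(5)[OF L]) auto
  also have "\<dots> = (\<Sum>i<l. T l l i * x i)"
    using assms T_in x_in se_x_less by (intro sum.cong refl) (simp add: pow_scale)
  finally show ?thesis unfolding split using inL x_in[OF assms] se_x[OF assms] by (simp add: pow_add)
qed

lemma vge_sum_strict:
  "finite I \<Longrightarrow> (\<And>i. i \<in> I \<Longrightarrow> \<exists>s>r. vge (f i) s) \<Longrightarrow> \<exists>s>r. vge (sum f I) s"
proof (induction I rule: finite_induct)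
  case empty
  show ?case by (intro exI[of _ "r + 1"]) simp
next
  case (insert i I)
  then obtain s t where s: "s > r" "vge (f i) s" "t > r" "vge (sum f I) t" by (metis insertCI)
  then have "vge (f i + sum f I) (min s t)" by (intro vge_add) (auto elim: vge_mono)
  then show ?case using s insert by (intro exI[of _ "min s t"]) auto
qed

text \<open>The joint induction statement. The next step uses all of it: \<open>\<beta>\<close> and
  \<open>x\<close> bound the carry, \<open>om\<close> starts the elimination, \<open>T\<close> and
  \<open>Y\<close> continue it, and primality of the break to \<open>p\<close> carries over to the
  next break.\<close>

definition asw_values :: "nat \<Rightarrow> bool" where
  "asw_values i \<longleftrightarrow> veq (\<beta> i) (- U i) \<and> veq (x i) (- (U i / real p)) \<and> \<not> int p dvd brk i \<and>
     veq (Y i) (- (of_int (brk i) / real (p ^ Suc i))) \<and>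
     (\<forall>l\<le>i. veq (T i i l) ((of_int (brk l) - of_int (brk i)) / real (p ^ Suc i))) \<and>
     veq (om i) (- ((U i - U 0) / real (p ^ (n - 1))))"

lemma AS_neg: assumes "veq y t" "t < 0" shows "veq (y ^ p - y) (real p * t)"
proof -
  have "real p * t < 1 * t" using assms(2) p_ge_2 by (intro mult_strict_right_mono_neg) auto
  then have "veq (y ^ p + - y) (real p * t)"
    using assms by (intro veq_add_dom[where s = t]) (auto intro: veq_power veq_vge)
  then show ?thesis by simp
qed

lemma asw_values_0: "asw_values 0"
proof -
  have n0: "0 < n" using n_pos by simp
  have x0: "x 0 \<in> Fj (Suc 0)" using x_Fj[OF n0] .
  have "x 0 \<noteq> 0"
  proof
    assume "x 0 = 0"
    then have "vge (x 0) 0" by simp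
    from unit_shift_le[OF n0 x0 se_x[OF n0] this] show False using brk_pos[OF n0] p_pos by (simp add: field_simps)
  qed
  then obtain t where t: "veq (x 0) t" by (rule ex_veq)
  from unit_shift_le[OF n0 x0 se_x[OF n0] veq_vge[OF t order_refl]] have "t \<le> - (of_int (brk 0) / real p)" by simp
  moreover have "0 < of_int (brk 0) / real p" using brk_pos[OF n0] p_pos by simp
  ultimately have t0: "t < 0" by linarith
  have "x 0 ^ p - x 0 = \<beta> 0" using x_eq'[OF n0] C_0 by simp
  with AS_neg[OF t t0] have b: "veq (\<beta> 0) (real p * t)" by simp
  have "\<not> vge (\<beta> 0) 0"
  proof
    assume "vge (\<beta> 0) 0"
    from vge_veq_le[OF this b] have "0 \<le> real p * t" .
    then show False using t0 p_pos by (simp add: zero_le_mult_iff)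
  qed
  then obtain m :: int where m: "veq (\<beta> 0) (of_int m)" "\<not> int p dvd m" using reduced[OF n0] by blast
  have "real p * t = of_int m" using veq_unique[OF b m(1)] .
  then have tm: "t = of_int m / real (p ^ Suc 0)" using p_pos by (simp add: field_simps)
  have mb: "m = - brk 0" using unit_shift_eq[OF n0 x0 se_x[OF n0] _ m(2)] t tm by blast
  have Y0: "Y 0 = x 0" by (simp add: Y_def)
  have x0v: "veq (x 0) (- (of_int (brk 0) / real p))" using t tm mb by simp
  then show ?thesis unfolding asw_values_def Y0 U_0 using m mb by (simp add: om_def)
qed

text \<open>With slope \<open>A = U (j - 1) / p ^ (j - 1)\<close> the isobaric estimate at weight
  \<open>p ^ j\<close> yields \<open>p * U (j - 1)\<close>.\<close>

lemma carry_vge: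
  assumes j: "1 \<le> j" "j < n" and IH: "\<And>i. i < j \<Longrightarrow> asw_values i"
  shows "vge (C j) (- (real p * U (j - 1)))"
proof -
  define A where "A = U (j - 1) / real (p ^ (j - 1))"
  have A0: "A > 0" using U_pos[of "j - 1"] j p_pos by (simp add: A_def)
  have "vge (C j) (- A * real (p ^ j))"
    unfolding C_def
  proof (rule isobaric_vge[OF witt_carry_isobaric[OF prime]])
    fix z assume z: "witt_idx z < j"
    define i where "i = witt_idx z"
    have i: "i < j" using z by (simp add: i_def)
    have "U i / real (p ^ i) \<le> A" unfolding A_def using i j by (intro U_ratio) auto
    then have 1: "U i \<le> A * real (p ^ i)" using p_pos by (simp add: pos_divide_le_eq)
    have "0 < U i" using U_pos[of i] i j by simp
    moreover have "real p \<ge> 1" using p_pos by simp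
    ultimately have "U i / real p \<le> U i / 1" by (intro divide_left_mono) auto
    then have 2: "- A * real (p ^ i) \<le> - (U i / real p)" "- A * real (p ^ i) \<le> - U i" using 1 by auto
    have "vge (x i) (- A * real (p ^ i))" "vge (\<beta> i) (- A * real (p ^ i))"
      using IH[OF i] 2 veq_vge unfolding asw_values_def by blast+
    then show "vge (case_sum x \<beta> z) (- A * real (p ^ witt_idx z))"
      by (cases z) (auto simp: i_def)
  qed
  moreover have "A * real (p ^ j) = real p * U (j - 1)" using j p_pos by (cases j) (auto simp: A_def)
  ultimately show ?thesis by simp
qed

text \<open>Reducedness and the pole forced on \<open>\<beta> j\<close> give it a value
  \<open>m\<close> prime to \<open>p\<close>. This \<open>m\<close> determines the values of
  \<open>om j\<close>, \<open>Th j\<close> and \<open>T j j\<close>, and a predicted lower break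
  \<open>bt\<close>. Because \<open>bt\<close> is prime to \<open>p\<close>,
  \<open>unit_shift_eq\<close> for \<open>Y j\<close> yields \<open>bt = b\<close>, and then
  \<open>U j = - m\<close>.\<close>

lemma asw_values_step:
  assumes j: "1 \<le> j" "j < n" and IH: "\<And>i. i < j \<Longrightarrow> asw_values i"
  shows "asw_values j"
proof -
  define P where "P = real p"
  define q where "q = real (p ^ j)"
  define b where "b = (of_int (brk j) :: real)"
  define b' where "b' = (of_int (brk (j - 1)) :: real)"
  define u where "u = U (j - 1)"
  have P: "P \<ge> 2" "P > 0" using p_ge_2 by (auto simp: P_def)
  have q: "q > 0" "real (p ^ Suc j) = P * q" using p_pos by (auto simp: q_def P_def)
  have u: "u > 0" using U_pos[of "j - 1"] j by (simp add: u_def)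
  have b0: "b > 0" using brk_pos[OF j(2)] by (simp add: b_def)
  have gr: "P * q * u < b" using growth'[OF j] unfolding q(2) by (simp add: b_def u_def)
  then have gr': "- (P * u) > - (b / q)" using q by (simp add: field_simps)
  have bq: "0 < b / q" using b0 q by simp
  have carry: "vge (C j) (- (P * u))"
    unfolding P_def u_def using j IH by (intro carry_vge) auto
  note xj = x_Fj[OF j(2)] se_x[OF j(2)]
  \<comment> \<open>\<open>x j\<close> is moved by exactly \<open>1\<close> and hence has a pole of
    at least the order given by the break; the carry is too small to cause it, so
    \<open>\<beta> j\<close> must.\<close>
  have le: "r \<le> - (b / q)" if r: "vge (\<beta> j) r" "r \<le> 0" for r
  proof -
    define r' where "r' = min r (- (P * u))"
    have "r' \<le> 0" using r by (simp add: r'_def)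
    have "vge (\<beta> j + C j) r'" using r carry by (intro vge_add) (auto elim: vge_mono simp: r'_def)
    then have "vge (x j) (r' / P)" unfolding P_def
      using p_ge_2 \<open>r' \<le> 0\<close> by (intro artin_schreier_vge[OF x_eq'[OF j(2)]]) auto
    from unit_shift_le[OF j(2) xj this] have "r' / P \<le> - (b / (P * q))" unfolding q(2) b_def .
    then have "P * (r' / P) \<le> P * - (b / (P * q))" using P by (intro mult_left_mono) auto
    then have "r' \<le> - (b / q)" using P by simp
    then show ?thesis using gr' by (simp add: r'_def min_def split: if_splits)
  qed
  have "\<not> vge (\<beta> j) 0" using le[of 0] bq by auto
  then obtain m :: int where m: "veq (\<beta> j) (of_int m)" "\<not> int p dvd m" using reduced[OF j(2)] by blast
  have "of_int m < (0::real)" using \<open>\<not> vge (\<beta> j) 0\<close> m(1) veq_vge by (meson not_le)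
  then have mle: "of_int m \<le> - (b / q)" using le[OF veq_vge[OF m(1) order_refl]] by simp
  then have mu: "of_int m < - (P * u)" using gr' by linarith
  have "u \<le> P * u" using u P by simp
  then have mu': "of_int m + u < 0" using mu by linarith
  have "veq (\<beta> j + C j) (of_int m)" using m(1) carry mu by (rule veq_add_dom)
  then have xv: "veq (x j) (of_int m / real p)"
    using \<open>of_int m < 0\<close> p_ge_2 by (intro artin_schreier_veq[OF x_eq'[OF j(2)]]) auto
  obtain s where s: "s > of_int m" "vge (\<delta> j) s"
  proof (cases "\<delta> j = 0")
    case True
    show ?thesis by (rule that[of "of_int m + 1"]) (auto simp: True)
  next
    case False
    then obtain s where s: "veq (\<delta> j) s" by (rule ex_veq)
    then show ?thesis using \<delta>_less[OF j] m(1) by (intro that[of s]) (auto simp: veq_def vge_def)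
  qed
  have "veq (\<beta> j + - \<delta> j) (of_int m)" using m(1) s by (intro veq_add_dom[of _ _ _ s]) auto
  moreover have "\<beta> j + - \<delta> j = \<beta> 0 * om j ^ (p ^ (n - 1))" using \<beta>_eq[OF j] j by (simp add: om_def)
  ultimately have bo: "veq (\<beta> 0 * om j ^ (p ^ (n - 1))) (of_int m)" by simp
  have I0: "veq (\<beta> 0) (- U 0)" using IH[of 0] j by (simp add: asw_values_def)
  define Q where "Q = real (p ^ (n - 1))"
  have Q: "Q > 0" using p_pos by (simp add: Q_def)
  have omj: "veq (om j) (- ((- of_int m - U 0) / Q))"
  proof -
    have "om j \<noteq> 0" using veq_nz[OF bo] p_pos by auto
    then obtain w where w: "veq (om j) w" by (rule ex_veq)
    have "- U 0 + Q * w = of_int m"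
      using veq_unique[OF veq_mult[OF I0 veq_power[OF w, of "p ^ (n - 1)"]] bo] by (simp add: Q_def)
    then have "Q * w = of_int m + U 0" by linarith
    then have "w = (of_int m + U 0) / Q" using Q by (simp add: eq_divide_eq mult.commute)
    then have "w = - ((- of_int m - U 0) / Q)" by (simp add: minus_divide_left)
    then show ?thesis using w by simp
  qed
  \<comment> \<open>\<open>U j\<close> is not yet known to equal \<open>- m\<close>, so the
    elimination is run with the value of \<open>om j\<close> expressed through
    \<open>m\<close>.\<close>
  define a where "a = (\<lambda>i. ((if i = j then - of_int m else U i) - U 0) / Q)"
  have a1: "veq (om i) (- a i)" if "i \<le> j" for i
    using that omj IH[of i] by (auto simp: a_def asw_values_def Q_def)
  have a2: "a i < a (Suc i)" if "i < j" for i
  proof -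
    have "(if i = j then - of_int m else U i) - U 0 < (if Suc i = j then - of_int m else U (Suc i)) - U 0"
      using that U_less_Suc[of i] j mu' by (auto simp: u_def)
    then show ?thesis unfolding a_def using Q by (intro divide_strict_right_mono)
  qed
  have da: "real (p ^ (n - 1)) * (a j - a (j - 1)) = - of_int m - u"
  proof -
    have "j - 1 \<noteq> j" using j by simp
    then have "Q * (a j - a (j - 1)) = Q * ((- of_int m - u) / Q)"
      by (simp only: a_def u_def if_True if_False diff_divide_distrib[symmetric]) simp
    then show ?thesis unfolding Q_def[symmetric] using Q by simp
  qed
  have Thv: "veq (Th j) (of_int m + u)"
    using Th_val[OF j(2) a1 a2 j(1) order_refl] da by (simp add: add.commute)
  \<comment> \<open>The lower break that the recursion \<open>U_Suc\<close> would assign to the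
    upper break \<open>- m\<close>.\<close>
  define bt where "bt = b' + q * (- of_int m - u)"
  have Ij: "asw_values (j - 1)" using IH[of "j - 1"] j by simp
  have Sj: "Suc (j - 1) = j" using j by simp
  have Tv: "veq (T j j l) ((of_int (brk l) - bt) / (P * q))" if l: "l < j" for l
  proof -
    define t where "t = (of_int (brk l) - b') / q"
    have t: "veq (T (j - 1) (j - 1) l) t"
      using Ij l unfolding asw_values_def Sj t_def b'_def q_def by auto
    have "brk l \<le> brk (j - 1)" using l j by (intro brk_mono) auto
    then have "t \<le> 0" using q by (simp add: t_def b'_def divide_nonpos_pos)
    then have neg: "t - real (p ^ (n - 1)) * (a j - a (j - 1)) < 0" unfolding da using mu' by linarith
    have "veq (T j j l) ((t - real (p ^ (n - 1)) * (a j - a (j - 1))) / real p)"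
      by (rule T_val[OF j(2) a1 a2 j(1) t neg])
    moreover have "(t - real (p ^ (n - 1)) * (a j - a (j - 1))) / real p = (of_int (brk l) - bt) / (P * q)"
      unfolding da t_def bt_def using q P by (simp add: field_simps P_def[symmetric])
    ultimately show ?thesis by simp
  qed
  have btb': "bt > 0"
    using brk_pos[of "j - 1"] j mu' q unfolding bt_def b'_def by (intro add_pos_pos mult_pos_pos) auto
  \<comment> \<open>The order of \<open>b\<close> and \<open>bt\<close> is still open;
    \<open>Err j\<close> is estimated against the smaller of the two candidate values.\<close>
  define L0 where "L0 = min (- (bt / q)) (- (b / q))"
  \<comment> \<open>The growth condition controls the carry, the hypothesis on the values of
    \<open>\<delta>\<close> controls \<open>de l\<close>. The bound matches the summand
    \<open>brk l / q\<close> in the value of \<open>T j j l ^ p\<close>.\<close>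
  have deC: "\<exists>s > - (of_int (brk l) / q). vge (de l + C l) s" if l: "1 \<le> l" "l \<le> j" for l
  proof -
    have ln: "l < n" using l j by simp
    have bl: "brk l > 0" using brk_pos[OF ln] .
    have l': "l < n" "1 \<le> l" using l j by auto
    have c: "vge (C l) (- (P * U (l - 1)))"
      unfolding P_def using l l' IH by (intro carry_vge) auto
    have c': "- (of_int (brk l) / q) < - (P * U (l - 1))"
    proof -
      have Ul: "0 \<le> U (l - 1)" by (rule less_imp_le[OF U_pos]) (use l' in simp)
      have "real (p ^ Suc j) \<le> real (p ^ n)" unfolding of_nat_le_iff using j p_pos by (intro power_increasing) auto
      then have "P * q * U (l - 1) \<le> real (p ^ n) * U (l - 1)" unfolding q(2) by (rule mult_right_mono) (rule Ul)
      also have "\<dots> < of_int (brk l)" using growth[of "l - 1"] l' by simp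
      finally have "q * (P * U (l - 1)) < of_int (brk l)" by (simp add: mult_ac)
      then show ?thesis using q by (simp add: pos_less_divide_eq mult.commute)
    qed
    have d: "\<exists>s > - (of_int (brk l) / q). vge (\<delta> l) s"
    proof (cases "\<delta> l = 0")
      case True
      then show ?thesis by (intro exI[of _ "- (of_int (brk l) / q) + 1"]) simp
    next
      case False
      then obtain s where s: "veq (\<delta> l) s" by (rule ex_veq)
      have "- Q * s < of_int (brk l)" unfolding Q_def by (rule brk_\<delta>[OF l'(2,1) s])
      have "q \<le> Q" unfolding q_def Q_def of_nat_le_iff using j p_pos by (intro power_increasing) auto
      have "- (of_int (brk l) / q) < s"
      proof (cases "s < 0")
        case True
        have "q * - s \<le> Q * - s" using \<open>q \<le> Q\<close> True by (intro mult_right_mono) auto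
        then have "q * - s < of_int (brk l)" using \<open>- Q * s < of_int (brk l)\<close> by simp
        then have "- s < of_int (brk l) / q" using q by (simp add: pos_less_divide_eq mult.commute)
        then show ?thesis by linarith
      next
        case False
        have "0 < of_int (brk l) / q" using bl q by simp
        with False show ?thesis by linarith
      qed
      then show ?thesis using s veq_vge by blast
    qed
    then obtain s where s: "s > - (of_int (brk l) / q)" "vge (\<delta> l) s" by blast
    have "vge (de l + C l) (min s (- (P * U (l - 1))))"
      using s c l by (intro vge_add) (auto simp: de_def elim: vge_mono)
    then show ?thesis using s(1) c' by (intro exI[of _ "min s (- (P * U (l - 1)))"]) auto
  qed
  have "\<exists>s>L0. vge (T j j l ^ p * (de l + C l)) s" if l: "l \<in> {..j}" for l
  proof -
    consider "l = 0" | "1 \<le> l" "l < j" | "1 \<le> l" "l = j" using l by fastforce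
    then show ?thesis
    proof cases
      case 1
      then show ?thesis by (intro exI[of _ "L0 + 1"]) (simp add: de_def C_0)
    next
      case 2
      then obtain s where s: "s > - (of_int (brk l) / q)" "vge (de l + C l) s" using deC[of l] by auto
      have "vge (T j j l ^ p) (real p * ((of_int (brk l) - bt) / (P * q)))"
        using veq_power[OF Tv[OF 2(2)], of p] by (auto intro: veq_vge)
      moreover have "real p * ((of_int (brk l) - bt) / (P * q)) = of_int (brk l) / q - bt / q"
        unfolding P_def[symmetric] using P by (simp add: diff_divide_distrib right_diff_distrib)
      ultimately have "vge (T j j l ^ p * (de l + C l)) (of_int (brk l) / q - bt / q + s)"
        using s by (intro vge_mult) auto
      moreover have "of_int (brk l) / q - bt / q + s > L0" using s by (simp add: L0_def)
      ultimately show ?thesis by blast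
    next
      case 3
      then obtain s where s: "s > - (of_int (brk l) / q)" "vge (de l + C l) s" using deC[of l] by auto
      have "T j j l ^ p * (de l + C l) = de l + C l" using 3 by (simp add: T_diag)
      moreover have "s > L0" using s 3 by (simp add: L0_def b_def)
      ultimately show ?thesis using s by auto
    qed
  qed
  then have "\<exists>s>L0. vge (Err j) s" unfolding Err_def by (intro vge_sum_strict) auto
  then obtain e where e: "e > L0" "vge (Err j) e" by blast
  have Yv': "veq (Y (j - 1)) (- (b' / q))" using Ij unfolding asw_values_def Sj b'_def q_def by blast
  have "of_int m + u + - (b' / q) = - (bt / q)" using q by (simp add: bt_def field_simps)
  with veq_mult[OF Thv Yv'] have TY: "veq (Th j * Y (j - 1)) (- (bt / q))" by simp
  have Yeq: "Y j ^ p - Y j = Th j * Y (j - 1) + Err j" by (rule Y_eq[OF j(2) a1 a2 j(1)])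
  \<comment> \<open>If \<open>bt\<close> were smaller, the right side of \<open>Yeq\<close> would
    have too small a pole for \<open>Y j\<close> to be moved by exactly \<open>1\<close>.\<close>
  have b_bt: "b \<le> bt"
  proof (rule ccontr)
    assume "\<not> b \<le> bt"
    then have lt: "- (b / q) < - (bt / q)" using q by (simp add: divide_strict_right_mono)
    then have L0: "L0 = - (b / q)" by (simp add: L0_def)
    define s where "s = min (min (- (bt / q)) e) 0"
    have s: "s > - (b / q)" "s \<le> 0" using e lt bq by (auto simp: s_def L0)
    have "vge (Th j * Y (j - 1) + Err j) s" using TY e by (intro vge_add) (auto simp: s_def elim: vge_mono intro: veq_vge)
    then have "vge (Y j) (s / P)" unfolding P_def using s p_ge_2 by (intro artin_schreier_vge[OF Yeq]) auto
    from unit_shift_le[OF j(2) Y_in[OF j(2)] se_Y[OF j(2)] this] have "s / P \<le> - (b / (P * q))" unfolding q(2) b_def .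
    then have "P * (s / P) \<le> P * - (b / (P * q))" using P by (intro mult_left_mono) auto
    then show False using s P by simp
  qed
  then have "L0 = - (bt / q)" using q by (simp add: L0_def divide_right_mono)
  then have "veq (Th j * Y (j - 1) + Err j) (- (bt / q))" using e by (intro veq_add_dom[OF TY e(2)]) simp
  then have "veq (Y j) (- (bt / q) / real p)"
    using btb' q p_ge_2 by (intro artin_schreier_veq[OF Yeq]) auto
  then have Yv: "veq (Y j) (- (bt / (P * q)))" by (simp add: P_def mult.commute)
  obtain m' :: int where m': "- u = of_int m'"
  proof -
    have "veq (\<beta> (j - 1)) (- u)" using Ij unfolding asw_values_def u_def by blast
    moreover have "\<beta> (j - 1) \<in> K" using j by (intro \<beta>_in) simp
    ultimately have "\<exists>m'::int. - u = of_int m'" using K_int by blast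
    then show ?thesis using that by blast
  qed
  \<comment> \<open>\<open>bt\<close> as an integer: \<open>u\<close> is minus the value of
    \<open>\<beta> (j - 1)\<close>, an element of \<open>K\<close>. Modulo \<open>p\<close> it
    agrees with \<open>brk (j - 1)\<close>, hence is prime to \<open>p\<close>.\<close>
  define bi where "bi = brk (j - 1) + int p ^ j * (- m + m')"
  have bi: "bt = of_int bi" using m' by (simp add: bt_def bi_def b'_def q_def)
  have "int p dvd int p ^ j" using j by (intro dvd_power) simp
  moreover have "\<not> int p dvd brk (j - 1)" using Ij by (simp add: asw_values_def)
  ultimately have npd: "\<not> int p dvd bi" unfolding bi_def by (metis dvd_add_left_iff dvd_mult2)
  have "- bi = - brk j"
    by (rule unit_shift_eq[OF j(2) Y_in[OF j(2)] se_Y[OF j(2)]]) (use Yv bi npd q in \<open>simp_all\<close>)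
  then have bij: "bi = brk j" by simp
  then have btb: "bt = b" using bi by (simp add: b_def)
  have "U j = u + (b - b') / q"
    using U_Suc[of "j - 1"] j Sj by (simp add: u_def b_def b'_def q_def)
  moreover have "b - b' = q * (- of_int m - u)" using btb by (simp add: bt_def)
  ultimately have Uj: "U j = - of_int m" using q by simp
  have "veq (T j j l) ((of_int (brk l) - of_int (brk j)) / real (p ^ Suc j))" if "l \<le> j" for l
  proof (cases "l = j")
    case True
    then show ?thesis by (simp add: T_diag)
  next
    case False
    then show ?thesis using Tv[of l] that unfolding q(2) btb b_def by simp
  qed
  moreover have "veq (Y j) (- (of_int (brk j) / real (p ^ Suc j)))" using Yv unfolding btb b_def q(2) .
  moreover have "\<not> int p dvd brk j" using npd bij by simp
  moreover have "veq (\<beta> j) (- U j)" using m(1) Uj by simp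
  moreover have "veq (x j) (- (U j / real p))" using xv Uj by simp
  moreover have "veq (om j) (- ((U j - U 0) / real (p ^ (n - 1))))" using omj Uj unfolding Q_def by simp
  ultimately show ?thesis unfolding asw_values_def by blast
qed

lemma asw_values: "i < n \<Longrightarrow> asw_values i"
proof (induction i rule: less_induct)
  case (less i)
  show ?case
  proof (cases "i = 0")
    case False
    then have "1 \<le> i" by simp
    then show ?thesis
    proof (rule asw_values_step[OF _ less.prems])
      show "asw_values k" if "k < i" for k using less that by simp
    qed
  qed (simp add: asw_values_0)
qed

text \<open>The error terms of \<open>scaffold_data\<close>: \<open>dx i k\<close> satisfies the Artin-Schreier equation of \<open>x k\<close> with the
  increment of the carry \<open>C k\<close> as constant term, and isobaricity bounds that increment.\<close>

definition dx :: "nat \<Rightarrow> nat \<Rightarrow> 'a" where "dx i k = (\<sigma> ^^ se i) (x k) - x k"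

lemma dx_eq: "i < n \<Longrightarrow> dx i i = 1" and dx_less: "k < i \<Longrightarrow> i < n \<Longrightarrow> dx i k = 0"
  by (auto simp: dx_def se_x se_x_less)

text \<open>The relative error \<open>R = A * p ^ i\<close> is dictated by
  \<open>dx i i = 1\<close>: it makes the bound \<open>- A * p ^ m + R\<close> equal to
  \<open>0\<close> at \<open>m = i\<close>. Solving the Artin-Schreier equation divides the
  resulting bound by \<open>p\<close>.\<close>

lemma vge_dx_aux:
  assumes "i < k" "k < n"
  shows "vge (dx i k) (- (U (k - 1) / real (p ^ k)) * (real (p ^ k) - real (p ^ i)))"
  using assms
proof (induction k rule: less_induct)
  case (less k)
  define A where "A = U (k - 1) / real (p ^ (k - 1))"
  have A0: "A > 0" using U_pos[of "k - 1"] less.prems p_pos by (simp add: A_def)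
  have A_ge: "U m / real (p ^ m) \<le> A" if "m < k" for m
    unfolding A_def using that less.prems by (intro U_ratio) auto
  have mono: "real (p ^ i) \<le> real (p ^ m)" if "i \<le> m" for m
    unfolding of_nat_le_iff using that p_pos by (intro power_increasing) auto
  have rel: "A * real (p ^ i) / real p = U (k - 1) / real (p ^ k) * real (p ^ i)"
    "A * real (p ^ k) / real p = U (k - 1) / real (p ^ k) * real (p ^ k)"
  proof -
    have "real (p ^ k) = real (p ^ (k - 1)) * real p" using less.prems by (cases k) auto
    then have "A / real p = U (k - 1) / real (p ^ k)" by (simp add: A_def)
    then show "A * real (p ^ i) / real p = U (k - 1) / real (p ^ k) * real (p ^ i)"
      "A * real (p ^ k) / real p = U (k - 1) / real (p ^ k) * real (p ^ k)"
      by (metis times_divide_eq_left)+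
  qed
  have xb: "vge (x m) (- A * real (p ^ m))" "vge (\<beta> m) (- A * real (p ^ m))" if m: "m < k" for m
  proof -
    have 1: "U m \<le> A * real (p ^ m)" using A_ge[OF m] p_pos by (simp add: pos_divide_le_eq)
    have "0 < U m" using U_pos[of m] m less.prems by simp
    moreover have "real p \<ge> 1" using p_pos by simp
    ultimately have "U m / real p \<le> U m / 1" by (intro divide_left_mono) auto
    then have 2: "- A * real (p ^ m) \<le> - (U m / real p)" "- A * real (p ^ m) \<le> - U m" using 1 by auto
    have "asw_values m" using m less.prems by (intro asw_values) simp
    with 2 veq_vge show "vge (x m) (- A * real (p ^ m))" "vge (\<beta> m) (- A * real (p ^ m))"
      unfolding asw_values_def by blast+
  qed
  have db: "vge (dx i m) (- A * real (p ^ m) + A * real (p ^ i))" if m: "m < k" for m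
  proof -
    consider "m < i" | "m = i" | "i < m" by linarith
    then show ?thesis
    proof cases
      case 1
      then show ?thesis using less.prems by (simp add: dx_less)
    next
      case 2
      then show ?thesis using less.prems by (auto simp: dx_eq intro: veq_vge[OF veq_1])
    next
      case 3
      have "vge (dx i m) (- (U (m - 1) / real (p ^ m)) * (real (p ^ m) - real (p ^ i)))"
        using less.IH[OF m 3] m less.prems by simp
      moreover have "U (m - 1) / real (p ^ m) \<le> A"
      proof -
        have "real (p ^ (m - 1)) \<le> real (p ^ m)" unfolding of_nat_le_iff using p_pos by (intro power_increasing) auto
        then have "U (m - 1) / real (p ^ m) \<le> U (m - 1) / real (p ^ (m - 1))"
          using less_imp_le[OF U_pos[of "m - 1"]] m less.prems p_pos by (intro divide_left_mono) auto
        also have "\<dots> \<le> A" using m by (intro A_ge) simp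
        finally show ?thesis .
      qed
      then have "U (m - 1) / real (p ^ m) * (real (p ^ m) - real (p ^ i)) \<le> A * (real (p ^ m) - real (p ^ i))"
        using mono[of m] 3 by (intro mult_right_mono) auto
      ultimately show ?thesis by (elim vge_mono) (simp add: algebra_simps)
    qed
  qed
  have "vge (witt_poly_eval (case_sum (\<lambda>m. (\<sigma> ^^ se i) (x m)) \<beta>) (witt_carry p k) - witt_poly_eval (case_sum x \<beta>) (witt_carry p k))
     (- A * real (p ^ k) + A * real (p ^ i))"
  proof (rule isobaric_lipschitz[OF witt_carry_isobaric[OF prime]])
    fix z assume z: "witt_idx z < k"
    define m where "m = witt_idx z"
    have m: "m < k" "m < n" using z less.prems by (auto simp: m_def)
    note xb = xb[OF m(1)] and db = db[OF m(1)]
    have sx: "vge ((\<sigma> ^^ se i) (x m)) (- A * real (p ^ m))" using xb x_in[OF m(2)] by simp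
    show "vge (case_sum (\<lambda>m. (\<sigma> ^^ se i) (x m)) \<beta> z) (- A * real (p ^ witt_idx z))"
      using sx xb by (cases z) (auto simp: m_def)
    show "vge (case_sum x \<beta> z) (- A * real (p ^ witt_idx z))"
      using xb by (cases z) (auto simp: m_def)
    show "vge (case_sum (\<lambda>m. (\<sigma> ^^ se i) (x m)) \<beta> z - case_sum x \<beta> z) (- A * real (p ^ witt_idx z) + A * real (p ^ i))"
      using db by (cases z) (auto simp: m_def dx_def)
  qed
  then have "vge ((\<sigma> ^^ se i) (C k) - C k) (- A * real (p ^ k) + A * real (p ^ i))"
    unfolding C_pow[OF less.prems(2)] unfolding C_def .
  moreover have "- A * real (p ^ k) + A * real (p ^ i) \<le> 0" using mono[of k] A0 less.prems by simp
  ultimately have "vge (dx i k) ((- A * real (p ^ k) + A * real (p ^ i)) / real p)"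
    unfolding dx_def using p_ge_2 by (intro artin_schreier_vge[OF pow_x_eq[OF less.prems(2)]]) auto
  moreover have "(- A * real (p ^ k) + A * real (p ^ i)) / real p = - (U (k - 1) / real (p ^ k)) * (real (p ^ k) - real (p ^ i))"
    using rel by (simp only: add_divide_distrib mult_minus_left minus_divide_left[symmetric] right_diff_distrib)
  ultimately show ?case by simp
qed

lemma vge_dx:
  assumes "i < k" "k < n"
  shows "vge (dx i k) (- U (k - 1) + U i / real p)"
proof (rule vge_mono[OF vge_dx_aux[OF assms]])
  have "U i / real (p ^ i) \<le> U (k - 1) / real (p ^ (k - 1))" using assms by (intro U_ratio) auto
  then have "U i / real (p ^ i) * (real (p ^ i) / real p) \<le> U (k - 1) / real (p ^ (k - 1)) * (real (p ^ i) / real p)"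
    by (rule mult_right_mono) simp
  moreover have "real (p ^ k) = real (p ^ (k - 1)) * real p" using assms by (cases k) auto
  ultimately have "U i / real p \<le> U (k - 1) / real (p ^ k) * real (p ^ i)" using p_pos by simp
  then show "- U (k - 1) + U i / real p \<le> - (U (k - 1) / real (p ^ k)) * (real (p ^ k) - real (p ^ i))"
    using p_pos by (simp add: right_diff_distrib)
qed

definition eps :: "nat \<Rightarrow> nat \<Rightarrow> 'a" where "eps i j = (\<Sum>l\<in>{i<..j}. T j j l * dx i l)"

text \<open>The displacement of \<open>x i\<close> is exactly \<open>1\<close> and contributes an
  element of \<open>K\<close>, which truncated powers can undo; the later coordinates contribute the
  error.\<close>

lemma se_Y_greater:
  assumes "i < j" "j < n"
  shows "(\<sigma> ^^ se i) (Y j) = Y j + T j j i + eps i j"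
proof -
  have TL: "T j j l * x l \<in> L" if "l \<in> {..j}" for l using that assms T_in x_in by (intro fldD(5)[OF L]) auto
  have "(\<sigma> ^^ se i) (Y j) = (\<Sum>l\<le>j. (\<sigma> ^^ se i) (T j j l * x l))" unfolding Y_def by (rule pow_sum[OF TL])
  also have "\<dots> = (\<Sum>l\<le>j. T j j l * x l + T j j l * dx i l)"
  proof (intro sum.cong refl)
    fix l assume "l \<in> {..j}"
    then have "(\<sigma> ^^ se i) (T j j l * x l) = T j j l * (\<sigma> ^^ se i) (x l)"
      using assms T_in x_in by (intro pow_scale) auto
    then show "(\<sigma> ^^ se i) (T j j l * x l) = T j j l * x l + T j j l * dx i l"
      by (simp add: dx_def right_diff_distrib)
  qed
  also have "\<dots> = Y j + (\<Sum>l\<le>j. T j j l * dx i l)" by (simp add: sum.distrib Y_def)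
  also have "(\<Sum>l\<le>j. T j j l * dx i l) = (\<Sum>l\<in>insert i {i<..j}. T j j l * dx i l)"
    using assms dx_less by (intro sum.mono_neutral_right) auto
  also have "\<dots> = T j j i + eps i j" using assms dx_eq[of i] by (simp add: eps_def)
  finally show ?thesis by (simp add: add.assoc)
qed

lemma se_Y_less: "j < i \<Longrightarrow> i < n \<Longrightarrow> (\<sigma> ^^ se i) (Y j) = Y j"
  by (rule se_Fj[OF Fj_mono[OF Y_in]]) auto

lemma T_vge: "l \<le> j \<Longrightarrow> j < n \<Longrightarrow> vge (T j j l) ((of_int (brk l) - of_int (brk j)) / real (p ^ Suc j))"
  using asw_values[of j] unfolding asw_values_def by (blast intro: veq_vge)

text \<open>This is where the precision arises. The summand for \<open>l\<close> is governed by
  \<open>brk l / p ^ Suc j - U (l - 1)\<close>, and since \<open>Suc j \<le> n\<close> this is at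
  least \<open>(brk l - p ^ n * U (l - 1)) / p ^ n\<close>.\<close>

lemma eps_vge:
  assumes ij: "i < j" "j < n" and c: "\<And>l. 1 \<le> l \<Longrightarrow> l < n \<Longrightarrow> c \<le> of_int (brk l) - real (p ^ n) * U (l - 1)"
  shows "vge (eps i j) (c / real (p ^ n) + U i / real p - of_int (brk j) / real (p ^ Suc j))"
  unfolding eps_def
proof (rule vge_sum)
  fix l assume l: "l \<in> {i<..j}"
  then have l': "i < l" "l \<le> j" "l < n" using ij by auto
  have "vge (T j j l * dx i l) ((of_int (brk l) - of_int (brk j)) / real (p ^ Suc j) + (- U (l - 1) + U i / real p))"
    using l' ij by (intro vge_mult T_vge vge_dx) auto
  then show "vge (T j j l * dx i l) (c / real (p ^ n) + U i / real p - of_int (brk j) / real (p ^ Suc j))"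
  proof (rule vge_mono)
    have "c \<le> of_int (brk l) - real (p ^ n) * U (l - 1)" using l' by (intro c) auto
    then have "c / real (p ^ n) \<le> (of_int (brk l) - real (p ^ n) * U (l - 1)) / real (p ^ n)"
      by (intro divide_right_mono) auto
    then have "c / real (p ^ n) \<le> of_int (brk l) / real (p ^ n) - U (l - 1)"
      using p_pos by (simp add: diff_divide_distrib)
    also have "of_int (brk l) / real (p ^ n) \<le> of_int (brk l) / real (p ^ Suc j)"
    proof (rule divide_left_mono)
      show "real (p ^ Suc j) \<le> real (p ^ n)" unfolding of_nat_le_iff using ij p_pos by (intro power_increasing) auto
    qed (use brk_pos[OF l'(3)] p_pos in auto)
    finally show "c / real (p ^ n) + U i / real p - of_int (brk j) / real (p ^ Suc j) \<le>
        (of_int (brk l) - of_int (brk j)) / real (p ^ Suc j) + (- U (l - 1) + U i / real p)"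
      by (simp add: diff_divide_distrib)
  qed
qed

lemma brk_not_dvd: "i < n \<Longrightarrow> \<not> int p dvd brk i"
  using asw_values[of i] unfolding asw_values_def by blast

text \<open>The indices of \<open>scaffold_data\<close> run from \<open>1\<close> to \<open>n\<close>.\<close>

lemma scaffold_data:
  assumes c: "0 \<le> c" "\<And>l. 1 \<le> l \<Longrightarrow> l < n \<Longrightarrow> c \<le> of_int (brk l) - real (p ^ n) * U (l - 1)"
    and vals: "\<And>m::int. \<exists>(d::nat \<Rightarrow> int) q::int. (\<forall>i\<in>{1..n}. 0 \<le> d i \<and> d i < int p) \<and>
       of_int m / real N = of_int q - (\<Sum>i=1..n. of_int (d i) * (of_int (brk (i - 1)) / real (p ^ i)))"
  shows "scaffold_data v p K L \<sigma> N n (\<lambda>i. Y (i - 1)) (\<lambda>i. of_int (brk (i - 1)) / real (p ^ i))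
     (\<lambda>i. c / real (p ^ n) + U (i - 1) / real p) (\<lambda>i. se (i - 1)) (\<lambda>i j. T (j - 1) (j - 1) (i - 1))
     (\<lambda>i j. eps (i - 1) (j - 1)) (\<lambda>i j. of_int (brk (i - 1)) / real (p ^ j))"
proof
  fix i assume i: "i \<in> {1..n}"
  have i1: "i - 1 < n" and Si: "Suc (i - 1) = i" using i by auto
  show "Y (i - 1) \<in> L" using i1 by (rule Y_inL)
  show "veq (Y (i - 1)) (- (of_int (brk (i - 1)) / real (p ^ i)))" using asw_values[OF i1] unfolding asw_values_def Si by blast
  show "0 < of_int (brk (i - 1)) / real (p ^ i)" using brk_pos[OF i1] p_pos by simp
  show "of_int (brk (i - 1)) / real (p ^ i) \<le> c / real (p ^ n) + U (i - 1) / real p"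
  proof -
    have "real (p ^ i) = real (p ^ (i - 1)) * real p" using i by (cases i) auto
    then have "of_int (brk (i - 1)) / real (p ^ i) = of_int (brk (i - 1)) / real (p ^ (i - 1)) / real p" by simp
    also have "\<dots> \<le> U (i - 1) / real p"
      using brk_le_U[OF i1] p_pos by (intro divide_right_mono) (auto simp: pos_divide_le_eq mult.commute)
    also have "\<dots> \<le> c / real (p ^ n) + U (i - 1) / real p" using c(1) by simp
    finally show ?thesis .
  qed
  show "(\<sigma> ^^ se (i - 1)) (Y (i - 1)) = Y (i - 1) + 1" using i1 by (rule se_Y)
  fix j assume j: "j \<in> {1..n}"
  have j1: "j - 1 < n" and Sj: "Suc (j - 1) = j" using j by auto
  show "(\<sigma> ^^ se (i - 1)) (Y (j - 1)) = Y (j - 1)" if "j < i"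
    using that i j by (intro se_Y_less) auto
  assume ij: "i < j"
  then have ij': "i - 1 < j - 1" using i by auto
  show "(\<sigma> ^^ se (i - 1)) (Y (j - 1)) = Y (j - 1) + T (j - 1) (j - 1) (i - 1) + eps (i - 1) (j - 1)"
    using ij' j1 by (rule se_Y_greater)
  show "T (j - 1) (j - 1) (i - 1) \<in> K" using j1 by (intro T_in)
  show "vge (T (j - 1) (j - 1) (i - 1)) (of_int (brk (i - 1)) / real (p ^ j) - of_int (brk (j - 1)) / real (p ^ j))"
    using T_vge[of "i - 1" "j - 1"] ij' j1 unfolding Sj diff_divide_distrib by simp
  show "vge (eps (i - 1) (j - 1)) (c / real (p ^ n) + U (i - 1) / real p - of_int (brk (j - 1)) / real (p ^ j))"
    using eps_vge[OF ij' j1 c(2)] unfolding Sj by simp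
  show "0 \<le> of_int (brk (i - 1)) / real (p ^ j)" using brk_pos[OF i1] by simp
  show "of_int (brk (i - 1)) / real (p ^ j) \<le> of_int (brk (j - 1)) / real (p ^ j)"
    using brk_mono[of "i - 1" "j - 1"] ij' j1 by (intro divide_right_mono) auto
  show "c / real (p ^ n) + U (i - 1) / real p \<le> c / real (p ^ n) + U (j - 1) / real p - of_int (brk (j - 1)) / real (p ^ j) +
      of_int (brk (i - 1)) / real (p ^ j)"
  proof -
    have "(of_int (brk (j - 1)) - of_int (brk (i - 1))) / real (p ^ (j - 1)) / real p \<le> (U (j - 1) - U (i - 1)) / real p"
      using ij' j1 by (intro divide_right_mono U_diff) auto
    moreover have "real (p ^ j) = real (p ^ (j - 1)) * real p" using j by (cases j) auto
    ultimately show ?thesis by (simp add: diff_divide_distrib)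
  qed
qed (use vals in blast)

end

section \<open>The Galois group and its ramification filtration\<close>

lemma fld_of_subfield:
  assumes "is_subfield (F :: 'a::field set)" shows "fld F"
proof -
  let ?R = "ring_of_type_algebra :: 'a ring"
  interpret R: field ?R by (rule field_from_type_algebra)
  have ops: "x \<otimes>\<^bsub>?R\<^esub> y = x * y" "x \<oplus>\<^bsub>?R\<^esub> y = x + y" "\<one>\<^bsub>?R\<^esub> = 1" "\<zero>\<^bsub>?R\<^esub> = 0" "carrier ?R = UNIV" for x y
    by (simp_all add: ring_of_type_algebra_def)
  have minus: "\<ominus>\<^bsub>?R\<^esub> x = - x" for x
    using R.l_neg[of x] by (simp add: ops eq_neg_iff_add_eq_0)
  note E = subringE[OF subfieldE(1)[OF assms]]
  have inv: "inverse x \<in> F" if "x \<in> F" for x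
  proof (cases "x = 0")
    case False
    then have x: "x \<in> F - {\<zero>\<^bsub>?R\<^esub>}" using that by (simp add: ops)
    have "x * (inv\<^bsub>?R\<^esub> x) = 1" using R.subfield_m_inv(2)[OF assms x] by (simp add: ops)
    then have "inv\<^bsub>?R\<^esub> x = inverse x" by (metis inverse_unique)
    then show ?thesis using R.subfield_m_inv(1)[OF assms x] by simp
  qed (use that in simp)
  have diff: "x - y \<in> F" if "x \<in> F" "y \<in> F" for x y
    using E(7)[OF that(1) E(5)[OF that(2)]] by (simp add: ops minus)
  show ?thesis
    unfolding fld_def using E(2,3) E(6,7) inv diff by (auto simp: ops)
qed

lemma generate_field_fld:
  assumes "fld (F :: 'a::field set)" "H \<subseteq> F" "x \<in> generate_field ring_of_type_algebra H"
  shows "x \<in> F"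
proof -
  let ?R = "ring_of_type_algebra :: 'a ring"
  interpret R: field ?R by (rule field_from_type_algebra)
  have ops: "x \<otimes>\<^bsub>?R\<^esub> y = x * y" "x \<oplus>\<^bsub>?R\<^esub> y = x + y" "\<one>\<^bsub>?R\<^esub> = 1" "\<zero>\<^bsub>?R\<^esub> = 0" "carrier ?R = UNIV" for x y
    by (simp_all add: ring_of_type_algebra_def)
  show ?thesis using assms(3)
  proof (induction rule: generate_field.induct)
    case (a_inv h)
    have "\<ominus>\<^bsub>?R\<^esub> h = - h" using R.l_neg[of h] by (simp add: ops eq_neg_iff_add_eq_0)
    then show ?case using fldD(7)[OF assms(1)] a_inv by simp
  next
    case (m_inv h)
    have "h \<in> Units ?R" using m_inv(2) R.field_Units by (simp add: ops)
    then have "h * (inv\<^bsub>?R\<^esub> h) = 1" using R.Units_r_inv[of h] by (simp add: ops)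
    then have "inv\<^bsub>?R\<^esub> h = inverse h" by (metis inverse_unique)
    then show ?case using fldD(6)[OF assms(1)] m_inv by simp
  qed (use assms fldD[OF assms(1)] in \<open>auto simp: ops\<close>)
qed

locale gal_setting =
  fixes p n :: nat and K L :: "'a::field set" and v :: "'a \<Rightarrow> ereal"
  assumes prime_p: "Factorial_Ring.prime p" and n_ge: "n \<ge> 1" and char_p: "CHAR('a) = p"
    and local: "local_field v K" and galois: "galois_extension L K"
    and tot_ram: "totally_ramified v L K"
    and cyclic: "galois_group L K \<cong> integer_mod_group (p ^ n)"
begin

definition "Gal = galois_group L K"

lemma Gal_carrier:
  "\<tau> \<in> carrier Gal \<longleftrightarrow> \<tau> \<in> Bij L \<and> (\<forall>x\<in>L. \<forall>y\<in>L. \<tau> (x + y) = \<tau> x + \<tau> y \<and> \<tau> (x * y) = \<tau> x * \<tau> y) \<and> (\<forall>x\<in>K. \<tau> x = x)"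
  by (simp add: Gal_def galois_group_def)

lemma Gal_hom:
  assumes "\<tau> \<in> carrier Gal" "x \<in> L" "y \<in> L"
  shows "\<tau> (x + y) = \<tau> x + \<tau> y" "\<tau> (x * y) = \<tau> x * \<tau> y"
  using assms by (auto simp: Gal_carrier)

lemma KL': "K \<subseteq> L" and fldK: "fld K" and fldL: "fld L"
  using galois by (auto simp: galois_extension_def intro: fld_of_subfield)

lemma Gal_in: "\<tau> \<in> carrier Gal \<Longrightarrow> x \<in> L \<Longrightarrow> \<tau> x \<in> L"
  using Bij_imp_funcset by (force simp: Gal_carrier)

lemma Gal_mult: assumes "\<tau> \<in> carrier Gal" "\<rho> \<in> carrier Gal"
  shows "\<tau> \<otimes>\<^bsub>Gal\<^esub> \<rho> = compose L \<tau> \<rho>" "compose L \<tau> \<rho> \<in> carrier Gal"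
proof -
  have B: "\<tau> \<in> Bij L" "\<rho> \<in> Bij L" using assms by (auto simp: Gal_carrier)
  then show "\<tau> \<otimes>\<^bsub>Gal\<^esub> \<rho> = compose L \<tau> \<rho>" by (simp add: Gal_def galois_group_def BijGroup_def)
  show "compose L \<tau> \<rho> \<in> carrier Gal"
    unfolding Gal_carrier
  proof (intro conjI ballI)
    show "compose L \<tau> \<rho> \<in> Bij L" by (rule compose_Bij[OF B])
    show "compose L \<tau> \<rho> x = x" if "x \<in> K" for x
      using that assms KL' by (auto simp: compose_def Gal_carrier)
    fix x y assume xy: "x \<in> L" "y \<in> L"
    have "x + y \<in> L" "x * y \<in> L" using fldD(3,5)[OF fldL xy] .
    moreover have "\<rho> x \<in> L" "\<rho> y \<in> L" using Gal_in[OF assms(2)] xy by auto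
    ultimately show "compose L \<tau> \<rho> (x + y) = compose L \<tau> \<rho> x + compose L \<tau> \<rho> y"
      "compose L \<tau> \<rho> (x * y) = compose L \<tau> \<rho> x * compose L \<tau> \<rho> y"
      using Gal_hom[OF assms(2) xy] Gal_hom[OF assms(1), of "\<rho> x" "\<rho> y"] xy by (simp_all add: compose_def)
  qed
qed

definition \<phi> where "\<phi> = (SOME h. h \<in> iso Gal (integer_mod_group (p ^ n)))"

lemma \<phi>: "\<phi> \<in> iso Gal (integer_mod_group (p ^ n))"
proof -
  have "\<exists>h. h \<in> iso Gal (integer_mod_group (p ^ n))"
    using cyclic unfolding Gal_def is_iso_def by blast
  then show ?thesis unfolding \<phi>_def by (rule someI_ex)
qed

lemma pn: "p ^ n \<noteq> 0" using prime_gt_0_nat[OF prime_p] by simp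

lemma \<phi>_bij: "bij_betw \<phi> (carrier Gal) {0..<int (p ^ n)}"
  using \<phi> pn by (auto simp: iso_def carrier_integer_mod_group)

lemma \<phi>_mult: "\<tau> \<in> carrier Gal \<Longrightarrow> \<rho> \<in> carrier Gal \<Longrightarrow> \<phi> (compose L \<tau> \<rho>) = (\<phi> \<tau> + \<phi> \<rho>) mod int (p ^ n)"
  using \<phi> Gal_mult(1)[of \<tau> \<rho>, symmetric] by (simp add: iso_def hom_def)

definition g :: "nat \<Rightarrow> 'a \<Rightarrow> 'a" where "g k = inv_into (carrier Gal) \<phi> (int (k mod p ^ n))"

lemma g_in: "g k \<in> carrier Gal" and \<phi>_g: "\<phi> (g k) = int (k mod p ^ n)"
proof -
  have "int (k mod p ^ n) \<in> {0..<int (p ^ n)}" using pn by simp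
  then have "int (k mod p ^ n) \<in> \<phi> ` carrier Gal" using \<phi>_bij by (simp add: bij_betw_def)
  then show "g k \<in> carrier Gal" "\<phi> (g k) = int (k mod p ^ n)"
    unfolding g_def by (rule inv_into_into, rule f_inv_into_f)
qed

lemma g_eqI: "\<tau> \<in> carrier Gal \<Longrightarrow> \<phi> \<tau> = int (k mod p ^ n) \<Longrightarrow> g k = \<tau>"
  using \<phi>_bij g_in[of k] \<phi>_g[of k] unfolding bij_betw_def inj_on_def by simp

lemma id_in: "(\<lambda>x\<in>L. x) \<in> carrier Gal"
  unfolding Gal_carrier
proof (intro conjI ballI)
  fix x y assume xy: "x \<in> L" "y \<in> L"
  have "x + y \<in> L" "x * y \<in> L" using fldD(3,5)[OF fldL xy] .
  then show "(\<lambda>x\<in>L. x) (x + y) = (\<lambda>x\<in>L. x) x + (\<lambda>x\<in>L. x) y" "(\<lambda>x\<in>L. x) (x * y) = (\<lambda>x\<in>L. x) x * (\<lambda>x\<in>L. x) y"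
    using xy by simp_all
qed (use KL' id_Bij in auto)

lemma g_0: "g 0 = (\<lambda>x\<in>L. x)"
proof (rule g_eqI[OF id_in])
  let ?i = "\<lambda>x\<in>L. x"
  have "compose L ?i ?i = ?i" by (auto simp: compose_def)
  then have "\<phi> ?i = (\<phi> ?i + \<phi> ?i) mod int (p ^ n)" using \<phi>_mult[OF id_in id_in] by simp
  moreover have "\<phi> ?i \<in> {0..<int (p ^ n)}" using \<phi>_bij id_in by (auto simp: bij_betw_def)
  ultimately have "(\<phi> ?i + \<phi> ?i) mod int (p ^ n) = (\<phi> ?i + 0) mod int (p ^ n)" by simp
  then have "\<phi> ?i mod int (p ^ n) = 0 mod int (p ^ n)" by (metis cong_add_lcancel Cong.cong_def)
  then show "\<phi> ?i = int (0 mod p ^ n)" using \<open>\<phi> ?i \<in> _\<close> by simp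
qed

definition "sg = g 1"

text \<open>Restricted to \<open>L\<close> because elements of the group are extensional functions;
  composition there corresponds to iteration of \<open>sg\<close>.\<close>

lemma g_pow: "x \<in> L \<Longrightarrow> g k x = (sg ^^ k) x"
proof (induction k)
  case (Suc k)
  have "g (Suc k) = compose L (g 1) (g k)"
  proof (rule g_eqI)
    show "compose L (g 1) (g k) \<in> carrier Gal" by (intro Gal_mult g_in)
    show "\<phi> (compose L (g 1) (g k)) = int (Suc k mod p ^ n)"
      unfolding \<phi>_mult[OF g_in g_in] \<phi>_g by (simp add: zmod_int mod_simps)
  qed
  then show ?case using Suc by (simp add: compose_def sg_def)
qed (simp add: g_0)

lemma carrier_g: "carrier Gal = g ` {..<p ^ n}" and inj_g: "inj_on g {..<p ^ n}"
proof -
  show "inj_on g {..<p ^ n}"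
    by (rule inj_onI) (metis \<phi>_g lessThan_iff mod_less of_nat_eq_iff)
  show "carrier Gal = g ` {..<p ^ n}"
  proof (intro equalityI subsetI)
    fix \<tau> assume \<tau>: "\<tau> \<in> carrier Gal"
    then have r: "\<phi> \<tau> \<in> {0..<int (p ^ n)}" using \<phi>_bij by (auto simp: bij_betw_def)
    then have lt: "nat (\<phi> \<tau>) < p ^ n" by (simp add: nat_less_iff)
    then have "g (nat (\<phi> \<tau>)) = \<tau>" using r by (intro g_eqI \<tau>) simp
    with lt show "\<tau> \<in> g ` {..<p ^ n}" by (metis image_eqI lessThan_iff)
  qed (use g_in in auto)
qed

lemma normal_v: "normalized_on v K" using local by (simp add: local_field_def)

sublocale valued_p v p
  using normal_v prime_p char_p by unfold_locales (auto simp: normalized_on_def)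

sublocale cyc_gal v p K L sg "p ^ n"
proof
  show "fld K" "fld L" "K \<subseteq> L" using fldK fldL KL' .
  have sg: "sg \<in> carrier Gal" unfolding sg_def by (rule g_in)
  show "sg x \<in> L" if "x \<in> L" for x using sg that by (rule Gal_in)
  show "sg (x + y) = sg x + sg y" "sg (x * y) = sg x * sg y" if "x \<in> L" "y \<in> L" for x y
    using sg that by (auto simp: Gal_carrier)
  show "sg x = x" if "x \<in> K" for x using sg that by (auto simp: Gal_carrier)
  show "0 < p ^ n" using pn by simp
  have "g (p ^ n) = g 0" unfolding g_def by simp
  then show "(sg ^^ (p ^ n)) x = x" if "x \<in> L" for x
    using g_pow[OF that, of "p ^ n"] g_pow[OF that, of 0] by simp
  have vals: "v ` (K - {0}) = range (\<lambda>k::int. ereal (of_int k))" using normal_v by (simp add: normalized_on_def)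
  show "\<exists>m::int. r = of_int m" if "x \<in> K" "veq x r" for x r
  proof -
    have "v x \<in> v ` (K - {0})" using that veq_nz by auto
    then show ?thesis using that(2) unfolding vals veq_def by auto
  qed
  have "ereal (of_int 1) \<in> v ` (K - {0})" unfolding vals by (rule rangeI)
  then show "\<exists>w\<in>K. veq w 1" unfolding veq_def by auto
  show "\<exists>y\<in>K. \<exists>s>0. vge (x - y) s" if "x \<in> L" "vge x 0" for x
  proof -
    have "x \<in> int_ring v L" using that by (simp add: int_ring_def vge_def zero_ereal_def)
    then obtain y where y: "y \<in> int_ring v K" "x - y \<in> max_ideal v L"
      using tot_ram unfolding totally_ramified_def by blast
    then have "0 < v (x - y)" by (simp add: max_ideal_def)
    then have "\<exists>s>0. vge (x - y) s"
      using v_not_minf[of "x - y"] unfolding vge_def by (cases "v (x - y)") (auto intro: exI[of _ "1::real"])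
    then show ?thesis using y by (auto simp: int_ring_def)
  qed
  show "complete_field v K" using local by (simp add: local_field_def)
  show "x \<in> K" if "x \<in> L" "sg x = x" for x
  proof -
    have "(sg ^^ k) x = x" for k using that by (induction k) auto
    then have "\<tau> x = x" if "\<tau> \<in> carrier Gal" for \<tau>
      using that g_pow[OF \<open>x \<in> L\<close>] unfolding carrier_g by auto
    then show ?thesis using galois \<open>x \<in> L\<close> unfolding galois_extension_def Gal_def by blast
  qed
  show "\<exists>x\<in>L. (sg ^^ i) x \<noteq> x" if i: "0 < i" "i < p ^ n" for i
  proof (rule ccontr)
    assume "\<not> ?thesis"
    then have "g i x = g 0 x" if "x \<in> L" for x using g_pow[OF that, of i] g_pow[OF that, of 0] that by auto
    moreover have "g i \<in> extensional L" "g 0 \<in> extensional L"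
      using g_in[of i] g_in[of 0] Bij_imp_extensional unfolding Gal_carrier by blast+
    ultimately have gi: "g i = g 0" by (intro extensionalityI) auto
    have "i \<in> {..<p ^ n}" "0 \<in> {..<p ^ n}" using i(2) less_trans[OF i] by (simp_all only: lessThan_iff)
    from inj_onD[OF inj_g gi this] show False using i by simp
  qed
qed

sublocale cyc_ram v p K L sg "p ^ n" n
  by unfold_locales simp

section \<open>The normalised valuation of the extension\<close>

lemma scaled_ge: "ereal r \<le> ereal (real (p ^ n)) * v x \<longleftrightarrow> vge x (r / real (p ^ n))"
  using pn v_not_minf[of x] by (cases "v x") (auto simp: vge_def pos_divide_le_eq mult.commute)

lemma scaled_eq: "ereal (real (p ^ n)) * v x = ereal r \<longleftrightarrow> veq x (r / real (p ^ n))"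
  using pn v_not_minf[of x] by (cases "v x") (auto simp: veq_def eq_divide_eq mult.commute)

lemma valuation_scaled: "valuation (\<lambda>x. ereal (real (p ^ n)) * v x)"
  unfolding valuation_def
proof (intro conjI allI)
  let ?N = "real (p ^ n)"
  have N: "?N > 0" using pn by simp
  show "ereal ?N * v x = \<infinity> \<longleftrightarrow> x = 0" for x
    using N v_eq_inf[of x] v_not_minf[of x] by (cases "v x") auto
  show "ereal ?N * v x \<noteq> -\<infinity>" for x
    using N v_not_minf[of x] by (cases "v x") auto
  show "ereal ?N * v (x * y) = ereal ?N * v x + ereal ?N * v y" for x y
    using N v_not_minf[of x] v_not_minf[of y] unfolding v_mult
    by (cases "v x"; cases "v y") (auto simp: distrib_left)
  show "min (ereal ?N * v x) (ereal ?N * v y) \<le> ereal ?N * v (x + y)" for x y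
  proof -
    have "ereal ?N * min (v x) (v y) \<le> ereal ?N * v (x + y)"
      using N v_add by (intro ereal_mult_left_mono) auto
    moreover have "min (ereal ?N * v x) (ereal ?N * v y) \<le> ereal ?N * min (v x) (v y)"
      by (cases "v x \<le> v y") (auto simp: min_def)
    ultimately show ?thesis by (rule order_trans[rotated])
  qed
qed

text \<open>By \<open>disc\<close> and \<open>unif\<close> the values on \<open>L\<close> are
  exactly the multiples of \<open>1 / p ^ n\<close>. Any other admissible scaling factor is
  \<open>k * p ^ n\<close> with a positive integer \<open>k\<close>, and an element of normalised
  value \<open>1\<close> yields \<open>k * m = 1\<close>.\<close>

lemma normalized_val_L: "normalized_val v L = (\<lambda>x. ereal (real (p ^ n)) * v x)"
  unfolding normalized_val_def
proof (rule the_equality)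
  let ?N = "real (p ^ n)" and ?w = "\<lambda>x. ereal (real (p ^ n)) * v x"
  have N: "?N > 0" using pn by simp
  have range: "?w ` (L - {0}) = range (\<lambda>k::int. ereal (of_int k))"
  proof (intro equalityI subsetI)
    fix y assume "y \<in> ?w ` (L - {0})"
    then obtain x where x: "x \<in> L" "x \<noteq> 0" "y = ?w x" by auto
    obtain r where r: "veq x r" using x(2) by (rule ex_veq)
    then obtain m :: int where "?N * r = of_int m" using disc[OF x(1)] by blast
    then show "y \<in> range (\<lambda>k::int. ereal (of_int k))" using x(3) r by (auto simp: veq_def)
  next
    fix y assume "y \<in> range (\<lambda>k::int. ereal (of_int k))"
    then obtain k :: int where k: "y = ereal (of_int k)" by auto
    have u: "veq (power_int unif k) (of_int k * (1 / ?N))" by (rule veq_power_int[OF unif(2)])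
    then have "?w (power_int unif k) = y" unfolding k scaled_eq by simp
    moreover have "power_int unif k \<in> L - {0}" using fldD(11)[OF L unif(1)] veq_nz[OF u] by auto
    ultimately show "y \<in> ?w ` (L - {0})" by blast
  qed
  show "normalized_on ?w L \<and> (\<exists>c::real. c > 0 \<and> (\<forall>x. ?w x = ereal c * v x))"
    unfolding normalized_on_def using valuation_scaled range N by blast
  fix w assume w: "normalized_on w L \<and> (\<exists>c::real. c > 0 \<and> (\<forall>x. w x = ereal c * v x))"
  then obtain c :: real where c: "c > 0" "\<And>x. w x = ereal c * v x" by blast
  have wr: "w ` (L - {0}) = range (\<lambda>k::int. ereal (of_int k))" using w by (simp add: normalized_on_def)
  have "ereal (of_int 1) \<in> w ` (L - {0})" unfolding wr by (rule rangeI)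
  then obtain x where x0: "ereal (of_int 1) = w x" "x \<in> L - {0}" by (rule imageE)
  then have x: "x \<in> L" "x \<noteq> 0" "w x = ereal 1" by simp_all
  obtain r where r: "veq x r" using x(2) by (rule ex_veq)
  obtain m :: int where m: "?N * r = of_int m" using disc[OF x(1) r] by blast
  have cr: "c * r = 1" using x(3) c(2)[of x] r by (simp add: veq_def one_ereal_def)
  have "w unif \<in> w ` (L - {0})" using unif veq_nz by blast
  then obtain k :: int where k: "w unif = ereal (of_int k)" unfolding wr by auto
  have ck: "c = ?N * of_int k" using k c(2)[of unif] unif(2) N by (simp add: veq_def field_simps)
  have "of_int k * (?N * r) = (1::real)" using cr unfolding ck by (simp add: mult_ac)
  then have "of_int (k * m) = (1::real)" unfolding m by simp
  then have "k * m = 1" by (simp only: of_int_eq_1_iff)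
  moreover have "k > 0" using c(1) N unfolding ck by (simp add: zero_less_mult_iff)
  ultimately have "k = 1" by (metis zmult_eq_1_iff zero_less_one not_less_iff_gr_or_eq neg_0_less_iff_less less_trans)
  then have "c = ?N" using ck by simp
  then show "w = ?w" using c(2) by (intro ext) simp
qed

text \<open>The definition asks for \<open>i + 1\<close> on all integral \<open>x\<close>, while
  displacement only adds the ramification number to the value of \<open>x\<close>. Subtracting a
  constant of \<open>K\<close> first makes the value of \<open>x\<close> at least
  \<open>1 / p ^ n\<close>, which supplies the missing \<open>1\<close>.\<close>

lemma lower_ram_cond:
  assumes "k < p ^ n"
  shows "(\<forall>x\<in>int_ring v L. normalized_val v L (g k x - x) \<ge> ereal (of_int (i + 1))) \<longleftrightarrow> k = 0 \<or> i \<le> ramnum k"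
proof (cases "k = 0")
  case True
  have "vge (g 0 x - x) r" if "x \<in> L" for x r using g_pow[OF that, of 0] by simp
  then show ?thesis unfolding normalized_val_L scaled_ge using True by (auto simp: int_ring_def)
next
  case False
  then have k: "0 < k" "k < p ^ n" using assms by auto
  let ?N = "real (p ^ n)"
  have N: "?N > 0" using pn by simp
  have gp: "g k x - x = (sg ^^ k) x - x" if "x \<in> L" for x using g_pow[OF that] by simp
  show ?thesis
    unfolding normalized_val_L scaled_ge
  proof
    assume "\<forall>x\<in>int_ring v L. vge (g k x - x) (of_int (i + 1) / ?N)"
    moreover have "unif \<in> int_ring v L" using unif by (simp add: int_ring_def veq_def)
    ultimately have "vge ((sg ^^ k) unif - unif) (of_int (i + 1) / ?N)" using gp[OF unif(1)] by metis
    from vge_veq_le[OF this ramnum[OF k]] have "(of_int (i + 1) :: real) \<le> of_int (ramnum k) + 1"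
      using p_pos by (simp add: divide_le_cancel)
    then show "k = 0 \<or> i \<le> ramnum k" by simp
  next
    assume "k = 0 \<or> i \<le> ramnum k"
    then have i: "i \<le> ramnum k" using k by simp
    show "\<forall>x\<in>int_ring v L. vge (g k x - x) (of_int (i + 1) / ?N)"
    proof
      fix x assume "x \<in> int_ring v L"
      then have x: "x \<in> L" "vge x 0" by (auto simp: int_ring_def vge_def zero_ereal_def)
      obtain y s where y: "y \<in> K" "s > 0" "vge (x - y) s" using resid[OF x] by blast
      have xy: "x - y \<in> L" using x y by (intro fldD(4)[OF L]) auto
      have "vge (x - y) (0 + 1 / ?N)" by (rule disc_step[OF discr_N xy y(3,2), of 0]) simp
      then have "vge ((sg ^^ k) (x - y) - (x - y)) (0 + 1 / ?N + of_int (ramnum k) / ?N)"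
        using shifts_ramnum[OF k] xy unfolding shifts_def by blast
      moreover have "(sg ^^ k) (x - y) - (x - y) = g k x - x" using x y gp[OF x(1)] by (simp add: pow_diff)
      moreover have "of_int (i + 1) / ?N \<le> (of_int (ramnum k) + 1) / ?N" using i by (intro divide_right_mono) auto
      ultimately show "vge (g k x - x) (of_int (i + 1) / ?N)"
        by (auto elim!: vge_mono simp: add_divide_distrib)
    qed
  qed
qed

section \<open>Breaks in the lower and the upper numbering\<close>

definition lr :: "real \<Rightarrow> nat set" where "lr t = {k. k < p ^ n \<and> (k = 0 \<or> \<lceil>t\<rceil> \<le> ramnum k)}"

lemma lower_ram_eq: "lower_ram v L K t = g ` lr t"
proof -
  have "lower_ram v L K t = {\<tau> \<in> g ` {..<p ^ n}. \<forall>x\<in>int_ring v L. normalized_val v L (\<tau> x - x) \<ge> ereal (of_int (\<lceil>t\<rceil> + 1))}"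
    unfolding lower_ram_def Gal_def[symmetric] carrier_g ..
  also have "\<dots> = g ` lr t" unfolding lr_def using lower_ram_cond by auto
  finally show ?thesis .
qed

lemma lower_ram_eq_iff: "lower_ram v L K s = lower_ram v L K t \<longleftrightarrow> lr s = lr t"
  unfolding lower_ram_eq using inj_g by (intro inj_on_image_eq_iff) (auto simp: lr_def)

lemma breaks_lower: "breaks (lower_ram v L K) = of_int ` (ramnum ` {0<..<p ^ n})"
proof (intro equalityI subsetI)
  fix t assume "t \<in> breaks (lower_ram v L K)"
  then have t: "t \<ge> -1" "\<And>\<epsilon>. \<epsilon> > 0 \<Longrightarrow> lr (t + \<epsilon>) \<noteq> lr t"
    unfolding breaks_def lower_ram_eq_iff by auto
  have ceil: "t = of_int \<lceil>t\<rceil>"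
  proof (rule ccontr)
    assume "t \<noteq> of_int \<lceil>t\<rceil>"
    then have "of_int \<lceil>t\<rceil> - t > 0" by (metis diff_gt_0_iff_gt le_of_int_ceiling order_le_less)
    from t(2)[OF this] show False by (simp add: lr_def)
  qed
  obtain i where i: "t = of_int i" using ceil by blast
  have "lr (t + 1) \<noteq> lr t" by (rule t(2)) simp
  moreover have "lr (t + 1) \<subseteq> lr t" unfolding lr_def i by auto
  ultimately obtain k where "k \<in> lr t" "k \<notin> lr (t + 1)" by blast
  then have "0 < k" "k < p ^ n" "i \<le> ramnum k" "\<not> i + 1 \<le> ramnum k" unfolding lr_def i by auto
  then have "k \<in> {0<..<p ^ n}" "ramnum k = i" by auto
  then show "t \<in> of_int ` (ramnum ` {0<..<p ^ n})" unfolding i by blast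
next
  fix t :: real assume "t \<in> of_int ` (ramnum ` {0<..<p ^ n})"
  then obtain k where k: "0 < k" "k < p ^ n" "t = of_int (ramnum k)" by auto
  have "lr (t + \<epsilon>) \<noteq> lr t" if "\<epsilon> > 0" for \<epsilon>
  proof -
    have "k \<in> lr t" using k by (simp add: lr_def)
    moreover have "ramnum k < \<lceil>t + \<epsilon>\<rceil>" using that k(3) by (simp add: less_ceiling_iff)
    then have "k \<notin> lr (t + \<epsilon>)" using k by (simp add: lr_def)
    ultimately show ?thesis by blast
  qed
  moreover have "t \<ge> -1" using ramnum_pos[OF k(1,2)] k(3) by simp
  ultimately show "t \<in> breaks (lower_ram v L K)" unfolding breaks_def lower_ram_eq_iff by simp
qed

lemma card_lower_ram: "real (card (lower_ram v L K t)) = 1 + (\<Sum>k\<in>{0<..<p ^ n}. if t \<le> of_int (ramnum k) then 1 else 0)"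
proof -
  have "card (lower_ram v L K t) = card (lr t)"
    unfolding lower_ram_eq using inj_g by (intro card_image) (auto intro: inj_on_subset simp: lr_def)
  moreover have "lr t = insert 0 {k \<in> {0<..<p ^ n}. t \<le> of_int (ramnum k)}"
    using pn unfolding lr_def ceiling_le_iff by auto
  moreover have "card (insert 0 {k \<in> {0<..<p ^ n}. t \<le> of_int (ramnum k)}) = 1 + card {k \<in> {0<..<p ^ n}. t \<le> of_int (ramnum k)}"
    by (subst card_insert_disjoint) auto
  moreover have "real (card {k \<in> {0<..<p ^ n}. t \<le> of_int (ramnum k)}) = (\<Sum>k\<in>{0<..<p ^ n}. if t \<le> of_int (ramnum k) then 1 else 0)"
    by (simp add: sum.If_cases Int_def)
  ultimately show ?thesis by simp
qed

lemma card_lower_ram_0: "real (card (lower_ram v L K 0)) = real (p ^ n)"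
proof -
  have "(\<Sum>k\<in>{0<..<p ^ n}. if 0 \<le> (of_int (ramnum k) :: real) then 1 else 0) = (\<Sum>k\<in>{0<..<p ^ n}. (1::real))"
  proof (intro sum.cong refl)
    fix k assume "k \<in> {0<..<p ^ n}"
    then show "(if 0 \<le> (of_int (ramnum k) :: real) then 1 else 0) = (1::real)" using ramnum_pos[of k] by simp
  qed
  then show ?thesis unfolding card_lower_ram using pn by (simp add: of_nat_diff Suc_leI)
qed

lemma has_integral_step:
  assumes "0 \<le> (u::real)" "0 \<le> r"
  shows "((\<lambda>t. if t \<le> r then 1 else 0) has_integral (min u r)) {0..u}"
proof -
  have "((\<lambda>t::real. 1::real) has_integral (min u r - 0)) {0..min u r}"
    using has_integral_const_real[of "1::real" 0 "min u r"] assms by simp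
  then have "((\<lambda>t. if t \<in> {0..min u r} then 1 else 0) has_integral (min u r)) {0..u}"
    by (subst has_integral_restrict) auto
  then show ?thesis by (rule has_integral_eq[rotated]) auto
qed

text \<open>Sum and integral are exchanged: each exponent \<open>k\<close> contributes the integral
  of a step function that drops to \<open>0\<close> after \<open>ramnum k\<close>.\<close>

lemma herbrand_phi_herb: assumes "0 \<le> u" shows "herbrand_phi v L K u = herb u"
proof (cases "u = 0")
  case True
  have "(\<Sum>k\<in>{0<..<p ^ n}. min 0 (of_int (ramnum k))) = (0::real)"
  proof (intro sum.neutral ballI)
    fix k assume "k \<in> {0<..<p ^ n}"
    then show "min 0 (of_int (ramnum k)) = (0::real)" using ramnum_pos[of k] by simp
  qed
  then show ?thesis using True by (simp add: herbrand_phi_def herb_def)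
next
  case False
  have "((\<lambda>t. (1 + (\<Sum>k\<in>{0<..<p ^ n}. if t \<le> of_int (ramnum k) then 1 else 0)) / real (p ^ n)) has_integral
     (u + (\<Sum>k\<in>{0<..<p ^ n}. min u (of_int (ramnum k)))) / real (p ^ n)) {0..u}"
  proof (intro has_integral_divide has_integral_add has_integral_sum)
    show "((\<lambda>t. 1) has_integral u) {0..u}" using has_integral_const_real[of "1::real" 0 u] assms by simp
    fix k assume "k \<in> {0<..<p ^ n}"
    then show "((\<lambda>t. if t \<le> of_int (ramnum k) then 1 else 0) has_integral min u (of_int (ramnum k))) {0..u}"
      using ramnum_pos[of k] assms by (intro has_integral_step) auto
  qed auto
  then have "integral {0..u} (\<lambda>t. (1 + (\<Sum>k\<in>{0<..<p ^ n}. if t \<le> of_int (ramnum k) then 1 else 0)) / real (p ^ n)) = herb u"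
    unfolding herb_def by (rule integral_unique)
  then show ?thesis using False assms by (simp add: herbrand_phi_def card_lower_ram[symmetric] card_lower_ram_0)
qed

lemma herb_strict: assumes "s \<le> t" shows "herb s + (t - s) / real (p ^ n) \<le> herb t"
proof -
  have "(\<Sum>k\<in>{0<..<p ^ n}. min s (of_int (ramnum k))) \<le> (\<Sum>k\<in>{0<..<p ^ n}. min t (of_int (ramnum k)))"
    using assms by (intro sum_mono) auto
  then have "(s + (\<Sum>k\<in>{0<..<p ^ n}. min s (of_int (ramnum k))) + (t - s)) / real (p ^ n) \<le> herb t"
    unfolding herb_def by (intro divide_right_mono) auto
  then show ?thesis unfolding herb_def[of s] by (simp add: add_divide_distrib diff_divide_distrib)
qed

lemma herb_less: "s < t \<Longrightarrow> herb s < herb t"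
  using herb_strict[of s t] pn by (smt (verit) divide_pos_pos of_nat_0_less_iff gr0I)

lemma herb_zero: "herb 0 = 0"
  using herbrand_phi_herb[of 0] by (simp add: herbrand_phi_def)

lemma herbrand_phi_less: "s < t \<Longrightarrow> herbrand_phi v L K s < herbrand_phi v L K t"
proof -
  assume st: "s < t"
  have neg: "herbrand_phi v L K r = r" if "r \<le> 0" for r using that by (simp add: herbrand_phi_def)
  consider "t \<le> 0" | "s \<le> 0" "0 < t" | "0 < s" by linarith
  then show ?thesis
  proof cases
    case 1
    then show ?thesis using st neg by simp
  next
    case 2
    then have "0 < herb t" using herb_less[of 0 t] herb_zero by simp
    then show ?thesis using 2 neg[of s] herbrand_phi_herb[of t] by simp
  next
    case 3
    then show ?thesis using st herb_less[of s t] herbrand_phi_herb by simp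
  qed
qed

text \<open>Strict monotonicity of the Herbrand function carries jumps over. Equality follows in
  \<open>breaks_enum\<close> by counting, since \<open>u\<close> lists \<open>n\<close> upper breaks
  and the \<open>n\<close> lower breaks have distinct images.\<close>

lemma breaks_upper_subset: "herb ` breaks (lower_ram v L K) \<subseteq> breaks (upper_ram v L K)"
proof
  let ?\<phi> = "herbrand_phi v L K"
  have inj: "inj_on ?\<phi> {-1..}" by (rule linorder_inj_onI') (metis herbrand_phi_less less_irrefl)
  fix y assume "y \<in> herb ` breaks (lower_ram v L K)"
  then obtain t where t: "t \<in> breaks (lower_ram v L K)" "y = herb t" by blast
  obtain k where k: "0 < k" "k < p ^ n" "t = of_int (ramnum k)" using t(1) unfolding breaks_lower by auto
  have t0: "0 < t" using ramnum_pos[OF k(1,2)] k(3) by simp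
  have psi: "herbrand_psi v L K (herb s) = s" if "0 \<le> s" for s
    unfolding herbrand_psi_def using inj that herbrand_phi_herb[OF that, symmetric] by (simp add: inv_into_f_f)
  have "0 < y" using herb_less[OF t0] herb_zero t(2) by simp
  moreover have "upper_ram v L K (y + \<epsilon>) \<noteq> upper_ram v L K y" if e: "\<epsilon> > 0" for \<epsilon>
  proof -
    let ?T = "t + real (p ^ n) * \<epsilon>"
    \<comment> \<open>\<open>herbrand_psi\<close> is an \<open>inv_into\<close>, so its value at
      \<open>y + \<epsilon>\<close> is accessible only through a preimage; the intermediate value
      theorem supplies one, as \<open>herb\<close> has slope at least
      \<open>1 / p ^ n\<close>.\<close>
    have "continuous_on {t..?T} herb" unfolding herb_def[abs_def]
      by (intro continuous_intros continuous_on_min) (use pn in auto)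
    moreover have "y + \<epsilon> \<le> herb ?T" using herb_strict[of t ?T] e p_pos t(2) by simp
    ultimately obtain s where s: "t \<le> s" "herb s = y + \<epsilon>"
      using IVT'[of herb t "y + \<epsilon>" ?T] e t(2) by auto
    have "t < s" using s t(2) e by (cases "s = t") auto
    have "herbrand_psi v L K (y + \<epsilon>) = s" using psi[of s] t0 s by simp
    moreover have "herbrand_psi v L K y = t" using psi[of t] t0 t(2) by simp
    ultimately have "upper_ram v L K (y + \<epsilon>) = lower_ram v L K s" "upper_ram v L K y = lower_ram v L K t"
      unfolding upper_ram_def by (simp_all only:)
    moreover have "lower_ram v L K (t + (s - t)) \<noteq> lower_ram v L K t"
      using t(1) \<open>t < s\<close> unfolding breaks_def by (metis (mono_tags, lifting) diff_gt_0_iff_gt mem_Collect_eq)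
    ultimately show ?thesis by simp
  qed
  ultimately show "y \<in> breaks (upper_ram v L K)" unfolding breaks_def by simp
qed

lemma breaks_enum:
  assumes b: "strict_mono_on {1..n} b" "breaks (lower_ram v L K) = (\<lambda>i. of_int (b i)) ` {1..n}"
    and u: "strict_mono_on {1..n} u" "breaks (upper_ram v L K) = u ` {1..n}"
  shows "\<And>i. i \<in> {1..n} \<Longrightarrow> b i = brk (i - 1)" "\<And>l m. l < m \<Longrightarrow> m < n \<Longrightarrow> brk l < brk m"
    "\<And>i. i \<in> {1..n} \<Longrightarrow> u i = herb (of_int (brk (i - 1)))"
proof -
  have img: "brk ` {..<n} = (\<lambda>i. brk (i - 1)) ` {1..n}"
  proof (intro equalityI subsetI)
    fix y assume "y \<in> brk ` {..<n}"
    then obtain l where "l < n" "y = brk l" by auto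
    then show "y \<in> (\<lambda>i. brk (i - 1)) ` {1..n}" by (intro image_eqI[of _ _ "Suc l"]) auto
  qed auto
  have "(of_int :: int \<Rightarrow> real) ` (b ` {1..n}) = of_int ` (ramnum ` {0<..<p ^ n})"
    using b(2) unfolding breaks_lower image_image by simp
  then have eq: "b ` {1..n} = (\<lambda>i. brk (i - 1)) ` {1..n}"
    unfolding ramnum_image img by (subst (asm) inj_image_eq_iff) (simp_all add: inj_def)
  have inj: "inj_on b {1..n}" using b(1) by (rule strict_mono_on_imp_inj_on)
  have "card ((\<lambda>i. brk (i - 1)) ` {1..n}) = n" using card_image[OF inj] eq by simp
  then have sm: "strict_mono_on {1..n} (\<lambda>i. brk (i - 1))"
    by (intro strict_mono_of_card) (auto intro: brk_mono)
  show bb: "b i = brk (i - 1)" if "i \<in> {1..n}" for i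
    using strict_mono_enum_unique[OF b(1) sm eq that] .
  show mono: "brk l < brk m" if "l < m" "m < n" for l m
    using strict_mono_onD[OF sm, of "Suc l" "Suc m"] that by simp
  let ?U = "\<lambda>i. herb (of_int (brk (i - 1)))"
  have smU: "strict_mono_on {1..n} ?U"
    using sm by (auto simp: strict_mono_on_def intro!: herb_less)
  have sub: "?U ` {1..n} \<subseteq> u ` {1..n}"
    using breaks_upper_subset unfolding u(2)[symmetric] b(2) image_image using bb by auto
  have "card (?U ` {1..n}) = n" "card (u ` {1..n}) = n"
    using card_image[OF strict_mono_on_imp_inj_on[OF smU]] card_image[OF strict_mono_on_imp_inj_on[OF u(1)]] by simp_all
  then have "u ` {1..n} = ?U ` {1..n}" using sub card_subset_eq[of "u ` {1..n}" "?U ` {1..n}"] by simp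
  then show "u i = ?U i" if "i \<in> {1..n}" for i using strict_mono_enum_unique[OF u(1) smU _ that] by blast
qed

end

section \<open>The Galois scaffold\<close>

definition dsum :: "nat \<Rightarrow> nat \<Rightarrow> (nat \<Rightarrow> int) \<Rightarrow> (nat \<Rightarrow> int) \<Rightarrow> int" where
  "dsum p n b d = (\<Sum>k<n. d k * int (p ^ k) * b (n - k))"

lemma digits_unique:
  assumes p: "Factorial_Ring.prime p" and b: "\<And>i. i \<in> {1..n} \<Longrightarrow> \<not> int p dvd b i"
    and d: "\<And>k. k < n \<Longrightarrow> 0 \<le> d k \<and> d k < int p" "\<And>k. k < n \<Longrightarrow> 0 \<le> d' k \<and> d' k < int p"
    and cong: "[dsum p n b d = dsum p n b d'] (mod int (p ^ n))" and k: "k < n"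
  shows "d k = d' k"
  using k
proof (induction k rule: less_induct)
  case (less k)
  let ?t = "\<lambda>l. (d l - d' l) * int (p ^ l) * b (n - l)"
  have pk: "int (p ^ k) > 0" using prime_gt_0_nat[OF p] by simp
  have "int (p ^ n) dvd dsum p n b d - dsum p n b d'" using cong by (simp add: cong_iff_dvd_diff)
  also have "dsum p n b d - dsum p n b d' = sum ?t {..<n}"
    unfolding dsum_def sum_subtractf[symmetric] by (simp add: left_diff_distrib)
  finally have tot: "int (p ^ n) dvd sum ?t {..<n}" .
  have split: "sum ?t {..<n} = ?t k + sum ?t {k<..<n}"
  proof -
    have "{..<n} = {..<k} \<union> insert k {k<..<n}" using less.prems by auto
    moreover have "sum ?t ({..<k} \<union> insert k {k<..<n}) = sum ?t {..<k} + sum ?t (insert k {k<..<n})"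
      by (rule sum.union_disjoint) auto
    moreover have "sum ?t (insert k {k<..<n}) = ?t k + sum ?t {k<..<n}" by (rule sum.insert) auto
    moreover have "sum ?t {..<k} = 0" using less.IH less.prems by (intro sum.neutral) auto
    ultimately show ?thesis by simp
  qed
  have "int (p ^ Suc k) dvd int (p ^ n)" unfolding int_dvd_int_iff using less.prems by (intro le_imp_power_dvd) simp
  then have "int (p ^ Suc k) dvd sum ?t {..<n}" using tot by (rule dvd_trans)
  moreover have "int (p ^ Suc k) dvd sum ?t {k<..<n}"
  proof (intro dvd_sum)
    fix l assume "l \<in> {k<..<n}"
    then have "int (p ^ Suc k) dvd int (p ^ l)" unfolding int_dvd_int_iff by (intro le_imp_power_dvd) simp
    then show "int (p ^ Suc k) dvd ?t l" by (intro dvd_mult2 dvd_mult)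
  qed
  ultimately have "int (p ^ Suc k) dvd ?t k" unfolding split by (simp only: dvd_add_left_iff)
  then have "int (p ^ k) * int p dvd int (p ^ k) * ((d k - d' k) * b (n - k))" by (simp add: mult_ac)
  then have "int p dvd (d k - d' k) * b (n - k)" using pk by (simp only: dvd_mult_cancel_left) auto
  moreover have "\<not> int p dvd b (n - k)" using less.prems by (intro b) auto
  ultimately have "int p dvd d k - d' k" using p by (metis prime_dvd_multD prime_int_nat_transfer prime_nat_int_transfer)
  then have "d k mod int p = d' k mod int p" by (simp only: mod_eq_dvd_iff)
  then show ?case using d(1)[OF less.prems] d(2)[OF less.prems] by simp
qed

lemma digit_bounds: "p > 0 \<Longrightarrow> 0 \<le> int (digit p k s) \<and> int (digit p k s) < int p"
  by (simp add: digit_def)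

lemma scaffold_b_dsum: "scaffold_b p n b s = dsum p n b (\<lambda>k. int (digit p k s))"
  by (simp add: scaffold_b_def dsum_def)

lemma digits_determine:
  assumes "\<And>k. k < n \<Longrightarrow> digit p k s = digit p k s'" shows "s mod p ^ n = s' mod p ^ n"
  using assms
proof (induction n)
  case (Suc n)
  have "m mod p ^ Suc n = p ^ n * digit p n m + m mod p ^ n" for m
    unfolding power_Suc2 digit_def by (rule mod_mult2_eq)
  then show ?case using Suc by simp
qed simp

context
  fixes p n :: nat and b :: "nat \<Rightarrow> int"
  assumes p: "Factorial_Ring.prime p" and b: "\<And>i. i \<in> {1..n} \<Longrightarrow> \<not> int p dvd b i"
begin

lemma pn_pos: "0 < int (p ^ n)" using prime_gt_0_nat[OF p] by simp

lemma residue_mod_less: "residue_mod p n t \<in> {..<p ^ n}"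
  using pn_pos pos_mod_bound[OF pn_pos, of t] by (simp add: residue_mod_def nat_less_iff)

lemma residue_mod_eq_iff: "residue_mod p n s = residue_mod p n t \<longleftrightarrow> [s = t] (mod int (p ^ n))"
  using pos_mod_sign[OF pn_pos, of s] pos_mod_sign[OF pn_pos, of t] by (simp add: residue_mod_def Cong.cong_def eq_nat_nat_iff)

lemma scaffold_b_inj: "inj_on (\<lambda>s. residue_mod p n (- scaffold_b p n b s)) {..<p ^ n}"
proof (rule inj_onI)
  fix s s' assume s: "s \<in> {..<p ^ n}" "s' \<in> {..<p ^ n}"
    and eq: "residue_mod p n (- scaffold_b p n b s) = residue_mod p n (- scaffold_b p n b s')"
  have "[- scaffold_b p n b s = - scaffold_b p n b s'] (mod int (p ^ n))" using eq unfolding residue_mod_eq_iff .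
  then have "[scaffold_b p n b s = scaffold_b p n b s'] (mod int (p ^ n))" by (simp only: cong_minus_minus_iff)
  then have c: "[dsum p n b (\<lambda>k. int (digit p k s)) = dsum p n b (\<lambda>k. int (digit p k s'))] (mod int (p ^ n))"
    by (simp only: scaffold_b_dsum)
  have "int (digit p k s) = int (digit p k s')" if "k < n" for k
    by (rule digits_unique[OF p b _ _ c that]) (use digit_bounds[OF prime_gt_0_nat[OF p]] in auto)
  then have "s mod p ^ n = s' mod p ^ n" by (intro digits_determine) simp
  then show "s = s'" using s by simp
qed

lemma scaffold_a: "[- scaffold_b p n b (scaffold_a p n b t) = t] (mod int (p ^ n))"
proof -
  let ?f = "\<lambda>s. residue_mod p n (- scaffold_b p n b s)"
  have "?f ` {..<p ^ n} = {..<p ^ n}"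
    using residue_mod_less by (intro endo_inj_surj scaffold_b_inj) auto
  then have "residue_mod p n t \<in> ?f ` {..<p ^ n}" using residue_mod_less by simp
  then have "?f (scaffold_a p n b t) = residue_mod p n t" unfolding scaffold_a_def by (rule f_inv_into_f)
  then show ?thesis unfolding residue_mod_eq_iff .
qed

lemma scaffold_a_cong: "[s = t] (mod int (p ^ n)) \<Longrightarrow> scaffold_a p n b s = scaffold_a p n b t"
  unfolding scaffold_a_def residue_mod_eq_iff[symmetric] by (simp only:)

text \<open>Lowering digit \<open>j\<close> raises the negated sum by
  \<open>p ^ j * b (n - j)\<close>, so the lowered digits represent the new residue; they are in
  range because the digit is positive, and \<open>digits_unique\<close> applies.\<close>

lemma scaffold_a_step:
  assumes j: "j < n" and d: "digit p j (scaffold_a p n b t) \<ge> 1" and k: "k < n"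
  shows "int (digit p k (scaffold_a p n b (t + int (p ^ j) * b (n - j)))) =
    int (digit p k (scaffold_a p n b t)) - (if k = j then 1 else 0)"
proof -
  let ?t = "t + int (p ^ j) * b (n - j)"
  let ?d = "\<lambda>k. int (digit p k (scaffold_a p n b t))"
  let ?d1 = "\<lambda>k. ?d k - (if k = j then 1 else 0)"
  have "dsum p n b ?d1 = (\<Sum>k<n. ?d k * int (p ^ k) * b (n - k) - (if k = j then int (p ^ k) * b (n - k) else 0))"
    unfolding dsum_def by (intro sum.cong) (auto simp: algebra_simps)
  also have "\<dots> = dsum p n b ?d - int (p ^ j) * b (n - j)"
    unfolding sum_subtractf dsum_def using j by simp
  finally have d1: "dsum p n b ?d1 = dsum p n b ?d - int (p ^ j) * b (n - j)" .
  have "[- dsum p n b ?d + int (p ^ j) * b (n - j) = ?t] (mod int (p ^ n))"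
    using scaffold_a[of t] unfolding scaffold_b_dsum by (rule cong_add) simp
  then have "[- dsum p n b ?d1 = ?t] (mod int (p ^ n))" unfolding d1 by simp
  moreover have "[- dsum p n b (\<lambda>k. int (digit p k (scaffold_a p n b ?t))) = ?t] (mod int (p ^ n))"
    using scaffold_a[of ?t] unfolding scaffold_b_dsum .
  ultimately have "[- dsum p n b (\<lambda>k. int (digit p k (scaffold_a p n b ?t))) = - dsum p n b ?d1] (mod int (p ^ n))"
    by (rule cong_trans[OF _ cong_sym, rotated])
  then have c: "[dsum p n b (\<lambda>k. int (digit p k (scaffold_a p n b ?t))) = dsum p n b ?d1] (mod int (p ^ n))"
    by (simp only: cong_minus_minus_iff)
  have bd: "0 \<le> ?d l" "?d l < int p" for l using digit_bounds[OF prime_gt_0_nat[OF p]] by blast+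
  have "?d j \<ge> 1" using d by linarith
  then have bd1: "0 \<le> ?d1 l \<and> ?d1 l < int p" for l using bd(1)[of l] bd(2)[of l] by (cases "l = j") simp_all
  show ?thesis
    by (rule digits_unique[OF p b digit_bounds[OF prime_gt_0_nat[OF p]] bd1 c k])
qed

text \<open>Passage from values normalised on \<open>L\<close> to values normalised on
  \<open>K\<close>; digit \<open>n - i\<close> belongs to the \<open>i\<close>-th generator.\<close>

lemma dsum_scaled:
  "of_int (dsum p n b d) / real (p ^ n) = (\<Sum>i=1..n. of_int (d (n - i)) * (of_int (b i) / real (p ^ i)))"
proof -
  have "(\<Sum>i=1..n. of_int (d (n - i)) * (of_int (b i) / real (p ^ i))) = (\<Sum>k<n. of_int (d k) * (of_int (b (n - k)) / real (p ^ (n - k))))"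
    by (rule sum.reindex_bij_witness[of _ "\<lambda>k. n - k" "\<lambda>i. n - i"]) auto
  also have "\<dots> = (\<Sum>k<n. of_int (d k * int (p ^ k) * b (n - k)) / real (p ^ n))"
  proof (intro sum.cong refl)
    fix k assume "k \<in> {..<n}"
    then have "real (p ^ n) = real (p ^ k) * real (p ^ (n - k))"
      unfolding of_nat_mult[symmetric] power_add[symmetric] by simp
    then show "of_int (d k) * (of_int (b (n - k)) / real (p ^ (n - k))) = of_int (d k * int (p ^ k) * b (n - k)) / real (p ^ n)"
      using prime_gt_0_nat[OF p] by simp
  qed
  finally show ?thesis by (simp add: dsum_def sum_divide_distrib)
qed

lemma scaffold_values:
  "\<exists>(d::nat \<Rightarrow> int) q::int. (\<forall>i\<in>{1..n}. 0 \<le> d i \<and> d i < int p) \<and>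
     of_int m / real (p ^ n) = of_int q - (\<Sum>i=1..n. of_int (d i) * (of_int (b i) / real (p ^ i)))"
proof -
  let ?d = "\<lambda>k. int (digit p k (scaffold_a p n b m))"
  obtain q where "m - - scaffold_b p n b (scaffold_a p n b m) = int (p ^ n) * q"
    using cong_sym[OF scaffold_a[of m]] by (auto simp: cong_iff_dvd_diff elim: dvdE)
  then have "m = int (p ^ n) * q - dsum p n b ?d" by (simp add: scaffold_b_dsum)
  then have "of_int m / real (p ^ n) = of_int (int (p ^ n) * q - dsum p n b ?d) / real (p ^ n)" by simp
  also have "\<dots> = of_int q - of_int (dsum p n b ?d) / real (p ^ n)"
    using prime_gt_0_nat[OF p] by (simp add: diff_divide_distrib)
  finally have "of_int m / real (p ^ n) = of_int q - (\<Sum>i=1..n. of_int (?d (n - i)) * (of_int (b i) / real (p ^ i)))"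
    unfolding dsum_scaled .
  then show ?thesis using digit_bounds[OF prime_gt_0_nat[OF p]]
    by (intro exI[of _ "\<lambda>i. ?d (n - i)"] exI[of _ q]) auto
qed

end

text \<open>In characteristic \<open>p\<close> the derivative of \<open>X ^ p - X - a\<close> is the
  unit \<open>-1\<close>, so the polynomial is separable.\<close>

lemma artin_schreier_root:
  fixes K :: "'a::field set" and a :: 'a
  assumes p: "p \<ge> 2" "CHAR('a) = p" and sep: "UNIV_is_separable_closure K"
  shows "\<exists>x. x ^ p = x + a"
proof -
  define f :: "'a Polynomial.poly" where "f = Polynomial.monom 1 p - Polynomial.monom 1 1 - [:a:]"
  have "Polynomial.coeff f p = 1" using p by (simp add: f_def coeff_pCons split: nat.split)
  then have "p \<le> Polynomial.degree f" by (intro le_degree) simp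
  then have deg: "Polynomial.degree f > 0" using p by simp
  have "Polynomial.pderiv f = Polynomial.monom (of_nat p) (p - 1) - 1"
    using p by (simp add: f_def pderiv_diff pderiv_monom pderiv_pCons one_pCons monom_0)
  also have "(of_nat p :: 'a) = 0" using p(2) of_nat_CHAR[where 'a = 'a] by simp
  finally have "Polynomial.pderiv f = - 1" by simp
  then have "is_unit (Polynomial.pderiv f)" by simp
  then have "separable_poly f" unfolding separable_poly_def by (rule is_unit_right_imp_coprime)
  then obtain x where "Polynomial.poly f x = 0"
    using sep[unfolded UNIV_is_separable_closure_def, THEN conjunct2, rule_format, of f] deg by blast
  then have "x ^ p = x + a" by (simp add: f_def poly_monom algebra_simps)
  then show ?thesis by blast
qed

text \<open>The carry at \<open>k\<close> depends on earlier coordinates only, so each coordinate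
  solves an Artin-Schreier equation with known constant term.\<close>

lemma witt_solution_exists:
  fixes K :: "'a::field set" and \<beta> :: "nat \<Rightarrow> 'a"
  assumes p: "Factorial_Ring.prime p" "CHAR('a) = p" and sep: "UNIV_is_separable_closure K"
  shows "\<exists>x. \<forall>k<n. x k ^ p = x k + \<beta> k + witt_poly_eval (case_sum x \<beta>) (witt_carry p k)"
proof (induction n)
  case (Suc n)
  then obtain x where x: "\<And>k. k < n \<Longrightarrow> x k ^ p = x k + \<beta> k + witt_poly_eval (case_sum x \<beta>) (witt_carry p k)" by blast
  let ?C = "\<lambda>x k. witt_poly_eval (case_sum x \<beta>) (witt_carry p k)"
  obtain y where y: "y ^ p = y + (\<beta> n + ?C x n)"
    using artin_schreier_root[OF prime_ge_2_nat[OF p(1)] p(2) sep] by blast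
  have C: "?C (x(n := y)) k = ?C x k" if "k \<le> n" for k
  proof (rule isobaric_eval_cong[OF witt_carry_isobaric[OF p(1)]])
    fix z assume "witt_idx z < k"
    then show "case_sum (x(n := y)) \<beta> z = case_sum x \<beta> z" using that by (cases z) auto
  qed
  have "(x(n := y)) k ^ p = (x(n := y)) k + \<beta> k + ?C (x(n := y)) k" if "k < Suc n" for k
    using that x[of k] y by (cases "k = n") (auto simp: C add.assoc)
  then show ?case by blast
qed simp

context gal_setting
begin

text \<open>In the normalisation of \<open>K\<close>, precision \<open>c\<close> means an error
  \<open>c / p ^ n\<close> beyond the gain \<open>b i / p ^ i\<close> of the \<open>i\<close>-th
  operator; this is the bound imposed on \<open>R\<close>.\<close>

lemma galois_scaffold_of_data:
  assumes data: "scaffold_data v p K L sg (p ^ n) n Y (\<lambda>i. of_int (b i) / real (p ^ i)) R s \<mu> \<epsilon> G"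
    and b: "\<And>i. i \<in> {1..n} \<Longrightarrow> \<not> int p dvd b i"
    and R: "\<And>i. i \<in> {1..n} \<Longrightarrow> real c / real (p ^ n) + of_int (b i) / real (p ^ i) \<le> R i"
  shows "\<exists>\<Psi> lam. galois_scaffold p n v K L b c \<Psi> lam"
proof -
  interpret S: scaffold_data v p K L sg "p ^ n" n Y "\<lambda>i. of_int (b i) / real (p ^ i)" R s \<mu> \<epsilon> G by (rule data)
  let ?N = "real (p ^ n)"
  have N: "?N > 0" using p_pos by simp
  obtain \<Phi> where \<Phi>: "\<And>i. i \<in> {1..n} \<Longrightarrow> S.good i (\<Phi> i)" using S.scaffold_operators by blast
  have \<Phi>KG: "\<Phi> i \<in> KG" "\<Phi> i 1 = 0" if "i \<in> {1..n}" for i using \<Phi>[OF that] unfolding S.good_def by blast+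
  have "\<forall>i\<in>{1..n}. \<exists>a. (\<forall>k. a k \<in> K) \<and> (\<forall>x\<in>L. \<Phi> i x = (\<Sum>k<p ^ n. a k * (sg ^^ k) x))"
    using \<Phi>KG(1) KG_repr by blast
  then obtain a where a: "\<And>i k. i \<in> {1..n} \<Longrightarrow> a i k \<in> K"
    "\<And>i x. i \<in> {1..n} \<Longrightarrow> x \<in> L \<Longrightarrow> \<Phi> i x = (\<Sum>k<p ^ n. a i k * (sg ^^ k) x)" by metis
  \<comment> \<open>\<open>KG_repr\<close> indexes coefficients by exponents of \<open>sg\<close>;
    the enumeration \<open>g\<close> carries them over to group elements.\<close>
  define \<Psi> where "\<Psi> = (\<lambda>i. \<lambda>\<tau>\<in>carrier Gal. a i (inv_into {..<p ^ n} g \<tau>))"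
  have act: "group_ring_act Gal (\<Psi> i) x = \<Phi> i x" if i: "i \<in> {1..n}" and x: "x \<in> L" for i x
  proof -
    have "group_ring_act Gal (\<Psi> i) x = (\<Sum>k<p ^ n. \<Psi> i (g k) * g k x)"
      unfolding group_ring_act_def carrier_g by (simp add: sum.reindex[OF inj_g])
    also have "\<dots> = (\<Sum>k<p ^ n. a i k * (sg ^^ k) x)"
      using g_in x by (intro sum.cong refl) (simp add: \<Psi>_def inv_into_f_f[OF inj_g] g_pow)
    finally show ?thesis using a(2)[OF i x] by simp
  qed
  obtain w where w: "w \<in> K" "veq w 1" using K_unif by blast
  have w0: "w \<noteq> 0" using w(2) by (rule veq_nz)
  define A where "A = scaffold_a p n b"
  \<comment> \<open>On \<open>L\<close>, the product \<open>S.e (D t)\<close> has normalised value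
    \<open>- scaffold_b p n b (A t)\<close>, congruent to \<open>t\<close> modulo
    \<open>p ^ n\<close>; \<open>f t\<close> is the exponent of the uniformizer of \<open>K\<close>
    that makes up the difference.\<close>
  define f where "f t = (t + scaffold_b p n b (A t)) div int (p ^ n)" for t
  define D where "D t i = int (digit p (n - i) (A t))" for t i
  define lam where "lam t = power_int w (f t) * S.e (D t)" for t
  have A_cong: "[- scaffold_b p n b (A t) = t] (mod int (p ^ n))" for t
    unfolding A_def by (rule scaffold_a[OF prime b])
  have f: "of_int (f t) = (of_int t + of_int (scaffold_b p n b (A t))) / ?N" for t
  proof -
    have "int (p ^ n) dvd t - - scaffold_b p n b (A t)"
      using cong_sym[OF A_cong[of t]] by (simp add: cong_iff_dvd_diff)
    then have "f t * int (p ^ n) = t + scaffold_b p n b (A t)" unfolding f_def by simp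
    then have "of_int (f t * int (p ^ n)) = (of_int (t + scaffold_b p n b (A t)) :: real)" by (simp only:)
    then have "of_int (f t) * ?N = of_int t + of_int (scaffold_b p n b (A t))" by simp
    then show ?thesis using N by (simp only: eq_divide_eq) simp
  qed
  have DV: "S.V (D t) = - (of_int (scaffold_b p n b (A t)) / ?N)" for t
  proof -
    have "of_int (dsum p n b (\<lambda>k. int (digit p k (A t)))) / ?N = (\<Sum>i=1..n. of_int (D t i) * (of_int (b i) / real (p ^ i)))"
      unfolding D_def by (rule dsum_scaled[OF prime b])
    then show ?thesis unfolding S.V_def scaffold_b_dsum by (simp only: sum_negf mult_minus_left)
  qed
  have Dval: "S.valid (D t)" "\<And>i. 0 \<le> D t i" for t
    using digit_bounds[OF p_pos] by (auto simp: S.valid_def D_def)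
  have wf: "power_int w (f t) \<in> K" "veq (power_int w (f t)) (of_int (f t))" for t
    using fldD(11)[OF K w(1)] veq_power_int[OF w(2), of "f t"] by auto
  have fV: "of_int (f t) + S.V (D t) = of_int t / ?N" for t
    unfolding f DV by (simp add: add_divide_distrib)
  have lamL: "lam t \<in> L" for t unfolding lam_def by (rule fldD(5)[OF L inL[OF wf(1)] S.e_in])
  have "veq (lam t) (of_int (f t) + S.V (D t))" for t
    unfolding lam_def by (intro veq_mult wf S.veq_e Dval)
  then have lamv: "veq (lam t) (of_int t / ?N)" for t unfolding fV .
  have ratio: "lam t1 * inverse (lam t2) \<in> K" if "[t1 = t2] (mod int (p ^ n))" for t1 t2
  proof -
    have "A t1 = A t2" unfolding A_def by (rule scaffold_a_cong[OF prime b that])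
    then have "D t1 = D t2" by (simp add: D_def[abs_def])
    moreover have "S.e (D t2) \<noteq> 0" using S.veq_e[OF Dval(1,2)] veq_nz by blast
    ultimately have "lam t1 * inverse (lam t2) = power_int w (f t1) * inverse (power_int w (f t2))"
      unfolding lam_def by (simp add: field_simps)
    also have "\<dots> \<in> K" by (rule fldD(5)[OF K wf(1) fldD(6)[OF K wf(1)]])
    finally show ?thesis .
  qed
  have main: "vge (\<Phi> i (lam t) - power_int w (f t) * S.e ((D t)(i := D t i - 1))) ((of_int t + int (p ^ (n - i)) * b i + real c) / ?N)"
    if i: "i \<in> {1..n}" for i t
  proof -
    have "vge (power_int w (f t) * (\<Phi> i (S.e (D t)) - S.e ((D t)(i := D t i - 1)))) (of_int (f t) + (S.V (D t) + R i))"
      using \<Phi>[OF i] Dval(1)[of t] unfolding S.good_def by (intro vge_mult veq_vge[OF wf(2) order_refl]) blast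
    moreover have "power_int w (f t) * (\<Phi> i (S.e (D t)) - S.e ((D t)(i := D t i - 1))) =
       \<Phi> i (lam t) - power_int w (f t) * S.e ((D t)(i := D t i - 1))"
      unfolding lam_def using KG_scale[OF \<Phi>KG(1)[OF i] wf(1) S.e_in] by (simp add: right_diff_distrib)
    moreover have "(of_int t + int (p ^ (n - i)) * b i + real c) / ?N \<le> of_int (f t) + (S.V (D t) + R i)"
    proof -
      have "?N = real (p ^ (n - i)) * real (p ^ i)"
        unfolding of_nat_mult[symmetric] power_add[symmetric] using i by simp
      then have "of_int (int (p ^ (n - i)) * b i) / ?N = of_int (b i) / real (p ^ i)" using p_pos by simp
      then have "(of_int t + int (p ^ (n - i)) * b i + real c) / ?N = of_int t / ?N + (real c / ?N + of_int (b i) / real (p ^ i))"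
        by (simp add: add_divide_distrib)
      also have "\<dots> \<le> of_int t / ?N + R i" using R[OF i] by simp
      finally show ?thesis using fV[of t] by simp
    qed
    ultimately show ?thesis by (simp only: vge_mono)
  qed
  have ideal: "cong_mod x y ((\<lambda>z. lam t * z) ` max_ideal_power (normalized_val v L) L c)"
    if "vge (x - y) ((of_int t + real c) / ?N)" "x \<in> L" "y \<in> L" for x y t
  proof -
    have l0: "lam t \<noteq> 0" using lamv by (rule veq_nz)
    have "vge ((x - y) / lam t) ((of_int t + real c) / ?N - of_int t / ?N)" using that(1) lamv by (rule vge_divide)
    then have "vge ((x - y) / lam t) (real c / ?N)" by (simp add: add_divide_distrib)
    then have "(x - y) / lam t \<in> max_ideal_power (normalized_val v L) L c"
      unfolding max_ideal_power_def normalized_val_L using fldD(8)[OF L fldD(4)[OF L that(2,3)] lamL]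
      by (simp only: scaled_ge mem_Collect_eq)
    then have "lam t * ((x - y) / lam t) \<in> (\<lambda>z. lam t * z) ` max_ideal_power (normalized_val v L) L c" by (rule imageI)
    then show ?thesis unfolding cong_mod_def using l0 by simp
  qed
  have "galois_scaffold p n v K L b c \<Psi> lam"
    unfolding galois_scaffold_def Let_def Gal_def[symmetric]
  proof (intro conjI ballI allI impI)
    show "\<Psi> i \<in> group_ring K Gal" if "i \<in> {1..n}" for i
      unfolding group_ring_def \<Psi>_def using a(1)[OF that] by auto
    show "lam t \<in> L" for t by (rule lamL)
    show "normalized_val v L (lam t) = ereal (of_int t)" for t
      unfolding normalized_val_L scaled_eq by (rule lamv)
    show "lam t1 * inverse (lam t2) \<in> K" if "[t1 = t2] (mod int (p ^ n))" for t1 t2 using that by (rule ratio)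
    show "group_ring_act Gal (\<Psi> i) 1 = 0" if "i \<in> {1..n}" for i
      using act[OF that S.one_in(2)] \<Phi>KG(2)[OF that] by simp
    fix i t assume i: "i \<in> {1..n}"
    let ?t = "t + int (p ^ (n - i)) * b i"
    let ?I = "(\<lambda>z. lam ?t * z) ` max_ideal_power (normalized_val v L) L c"
    \<comment> \<open>For a positive digit the lowered digits are those of \<open>?t\<close> and the
      exponent \<open>f\<close> does not change. The main term is then \<open>lam ?t\<close> itself,
      so the unit can be taken to be \<open>1\<close>.\<close>
    have 1: "cong_mod (group_ring_act Gal (\<Psi> i) (lam t)) (1 * lam ?t) ?I" if d: "digit p (n - i) (A t) \<ge> 1"
    proof -
      have step: "int (digit p k (A ?t)) = int (digit p k (A t)) - (if k = n - i then 1 else 0)" if "k < n" for k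
      proof -
        have ni: "n - i < n" "n - (n - i) = i" using i by auto
        have "1 \<le> digit p (n - i) (scaffold_a p n b t)" using d unfolding A_def .
        from scaffold_a_step[OF prime, of n b, OF b ni(1) this that]
        show ?thesis unfolding ni(2) A_def .
      qed
      have D: "D ?t k = ((D t)(i := D t i - 1)) k" if "k \<in> {1..n}" for k
      proof -
        have "n - k < n" using that by auto
        moreover have "n - k = n - i \<longleftrightarrow> k = i" using that i by auto
        ultimately show ?thesis using step[of "n - k"] by (simp add: D_def)
      qed
      have e: "S.e ((D t)(i := D t i - 1)) = S.e (D ?t)"
        unfolding S.e_def by (rule prod.cong[OF refl]) (simp only: D)
      have "S.V (D ?t) = S.V ((D t)(i := D t i - 1))"
        unfolding S.V_def by (rule sum.cong[OF refl]) (simp only: D)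
      also have "\<dots> = S.V (D t) + of_int (b i) / real (p ^ i)" using S.V_upd[OF i, of "D t" 1] by simp
      finally have V: "S.V (D ?t) = S.V (D t) + of_int (b i) / real (p ^ i)" .
      have "?N = real (p ^ (n - i)) * real (p ^ i)"
        unfolding of_nat_mult[symmetric] power_add[symmetric] using i by simp
      then have "of_int (int (p ^ (n - i)) * b i) / ?N = of_int (b i) / real (p ^ i)" using p_pos by simp
      then have "of_int ?t / ?N = of_int t / ?N + of_int (b i) / real (p ^ i)" by (simp add: add_divide_distrib)
      then have "of_int (f ?t) = (of_int (f t) :: real)" using fV[of t] fV[of ?t] V by linarith
      then have "f ?t = f t" by simp
      then have "power_int w (f t) * S.e ((D t)(i := D t i - 1)) = lam ?t" unfolding e lam_def by simp
      then have "vge (\<Phi> i (lam t) - 1 * lam ?t) ((of_int ?t + real c) / ?N)" using main[OF i, of t] by simp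
      then show ?thesis unfolding act[OF i lamL] using \<Phi>KG(1)[OF i] lamL by (intro ideal) auto
    qed
    have 2: "cong_mod (group_ring_act Gal (\<Psi> i) (lam t)) 0 ?I" if d: "digit p (n - i) (A t) = 0"
    proof -
      \<comment> \<open>Digit \<open>0\<close> becomes index \<open>-1\<close>, where
        \<open>bz\<close> vanishes by definition, so there is no main term.\<close>
      have "bz (Y i) (((D t)(i := D t i - 1)) i) = 0" using d by (simp add: D_def)
      then have "S.e ((D t)(i := D t i - 1)) = 0" unfolding S.e_def using i by (intro prod_zero) auto
      then have "vge (\<Phi> i (lam t) - 0) ((of_int ?t + real c) / ?N)" using main[OF i, of t] by simp
      then show ?thesis unfolding act[OF i lamL] using \<Phi>KG(1)[OF i] lamL fldD(1)[OF L] by (intro ideal) auto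
    qed
    have "v 1 = 0" using veq_1 by (simp add: veq_def zero_ereal_def)
    then show "\<exists>u\<in>K. v u = 0 \<and>
       (1 \<le> digit p (n - i) (scaffold_a p n b t) \<longrightarrow> cong_mod (group_ring_act Gal (\<Psi> i) (lam t)) (u * lam ?t) ?I) \<and>
       (digit p (n - i) (scaffold_a p n b t) = 0 \<longrightarrow> cong_mod (group_ring_act Gal (\<Psi> i) (lam t)) 0 ?I)"
      using 1 2 fldD(2)[OF K] unfolding A_def by (intro bexI[of _ 1]) auto
  qed
  then show ?thesis by blast
qed

end

theorem theorem5p1:
  fixes p n :: nat
    and K L :: "'a::field set"
    and v :: "'a \<Rightarrow> ereal"
    and b :: "nat \<Rightarrow> int"
    and u :: "nat \<Rightarrow> real"
    and \<beta> \<omega> \<delta> :: "nat \<Rightarrow> 'a"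
  assumes "Factorial_Ring.prime p" and "n \<ge> 1"
    and "CHAR('a) = p"
    and "local_field v K"
    and "UNIV_is_separable_closure K"
    and "galois_extension L K"
    and "totally_ramified v L K"
    and "galois_group L K \<cong> integer_mod_group (p ^ n)"
    and "strict_mono_on {1..n} b"
    and "breaks (lower_ram v L K) = (\<lambda>i. of_int (b i)) ` {1..n}"
    and "strict_mono_on {1..n} u"
    and "breaks (upper_ram v L K) = u ` {1..n}"
    and "witt_corresponds p n K L \<beta>"
    and "witt_reduced v p n \<beta>"
    and "\<And>i. i \<in> {1..n - 1} \<Longrightarrow> \<omega> i \<in> K"
    and "\<And>i. i \<in> {1..n - 1} \<Longrightarrow> \<delta> i \<in> K"
    and "\<And>i. i \<in> {1..n - 1} \<Longrightarrow> \<beta> i = \<beta> 0 * \<omega> i ^ (p ^ (n - 1)) + \<delta> i"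
    and "\<And>i. i \<in> {1..n - 1} \<Longrightarrow> v (\<delta> i) > v (\<beta> i)"
    and "\<And>i. i \<in> {1..n - 1} \<Longrightarrow> real_of_int (b (i + 1)) > real (p ^ n) * u i"
    and "\<And>i. i \<in> {1..n - 1} \<Longrightarrow>
           ereal (real_of_int (b (i + 1))) > - (ereal (real (p ^ (n - 1))) * v (\<delta> i))"
  shows "(n \<ge> 2 \<longrightarrow>
            (\<exists>c::nat. real c = Min ((\<lambda>i. real_of_int (b (i + 1)) - real (p ^ n) * u i) ` {1..n - 1}) \<and>
                      c \<ge> 1 \<and> (\<exists>\<Psi> lam. galois_scaffold p n v K L b c \<Psi> lam))) \<and>
         (n = 1 \<longrightarrow> (\<forall>c::nat. c \<ge> 1 \<longrightarrow> (\<exists>\<Psi> lam. galois_scaffold p n v K L b c \<Psi> lam)))"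
proof -
  interpret gal_setting p n K L v
    using assms(1-4,6-8) by unfold_locales
  note en = breaks_enum[OF assms(9,10,11,12)]
  have b1: "b (Suc l) = brk l" if "l < n" for l using en(1)[of "Suc l"] that by simp
  have u1: "u (Suc l) = herb (of_int (brk l))" if "l < n" for l using en(3)[of "Suc l"] that by simp
  obtain x0 where x0: "\<And>k. k < n \<Longrightarrow> x0 k ^ p = x0 k + \<beta> k + witt_poly_eval (case_sum x0 \<beta>) (witt_carry p k)"
    using witt_solution_exists[OF assms(1,3,5)] by metis
  define x where "x = (\<lambda>k\<in>{..<n}. x0 k)"
  have xeq: "x k ^ p = x k + \<beta> k + witt_poly_eval (case_sum x \<beta>) (witt_carry p k)" if "k < n" for k
  proof -
    have "witt_poly_eval (case_sum x \<beta>) (witt_carry p k) = witt_poly_eval (case_sum x0 \<beta>) (witt_carry p k)"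
    proof (rule isobaric_eval_cong[OF witt_carry_isobaric[OF assms(1)]])
      fix z assume "witt_idx z < k"
      then show "case_sum x \<beta> z = case_sum x0 \<beta> z" using that by (cases z) (auto simp: x_def)
    qed
    then show ?thesis using x0[OF that] that by (simp add: x_def)
  qed
  have "x \<in> witt_vecs n UNIV" by (auto simp: witt_vecs_def x_def)
  moreover have "witt_phi p n x = witt_add p n x \<beta>"
  proof
    fix k
    show "witt_phi p n x k = witt_add p n x \<beta> k"
    proof (cases "k < n")
      case True
      then show ?thesis using xeq[OF True] by (simp add: witt_phi_def witt_add_eq)
    qed (simp add: witt_phi_def witt_add_def)
  qed
  \<comment> \<open>\<open>witt_corresponds\<close> quantifies over all solutions; it describes
    \<open>L\<close> because a solution exists over the separably closed field.\<close>
  ultimately have Lgen: "L = generate_field (ring_of_type_algebra :: 'a ring) (K \<union> x ` {..<n})"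
    using assms(13) unfolding witt_corresponds_def by blast
  have \<beta>K: "\<beta> i \<in> K" if "i < n" for i
    using assms(13) that unfolding witt_corresponds_def witt_vecs_def by (auto simp: PiE_iff)
  have xL: "x i \<in> L" if "i < n" for i
    unfolding Lgen using that by (intro generate_field.incl) auto
  interpret asw v p K L sg "p ^ n" n x \<beta> \<omega> \<delta>
  proof
    show "1 \<le> n" by (rule assms(2))
    show "\<beta> i \<in> K" if "i < n" for i using that by (rule \<beta>K)
    show "\<omega> i \<in> K" if "1 \<le> i" "i < n" for i using that by (intro assms(15)) auto
    show "x i \<in> L" if "i < n" for i using that by (rule xL)
    show "x k ^ p = x k + \<beta> k + witt_poly_eval (case_sum x \<beta>) (witt_carry p k)" if "k < n" for k
      using that by (rule xeq)
    \<comment> \<open>The elements fixed by a power of \<open>sg\<close> form a field; containing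
      \<open>K\<close> and the coordinates, it contains \<open>L\<close>.\<close>
    show "(sg ^^ k) y = y" if fx: "\<And>i. i < n \<Longrightarrow> (sg ^^ k) (x i) = x i" and y: "y \<in> L" for k y
    proof -
      let ?F = "{y \<in> L. (sg ^^ k) y = y}"
      have "fld ?F"
        unfolding fld_def
      proof (intro conjI ballI)
        show "0 \<in> ?F" "1 \<in> ?F" using fldD(1,2)[OF K] by auto
        fix z assume z: "z \<in> ?F"
        then show "inverse z \<in> ?F" by (auto simp: pow_inverse intro: fldD(6)[OF L])
        fix z' assume "z' \<in> ?F"
        then show "z + z' \<in> ?F" "z - z' \<in> ?F" "z * z' \<in> ?F"
          using z by (auto simp: pow_add pow_diff pow_mult intro: fldD(3,4,5)[OF L])
      qed
      moreover have "K \<union> x ` {..<n} \<subseteq> ?F" using fx xL by auto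
      ultimately have "y \<in> ?F" using y unfolding Lgen by (rule generate_field_fld)
      then show ?thesis by blast
    qed
    show "vge (\<beta> i) 0 \<or> (\<exists>m::int. veq (\<beta> i) (of_int m) \<and> \<not> int p dvd m)" if "i < n" for i
      using assms(14) that unfolding witt_reduced_def vge_def veq_def by (auto simp: zero_ereal_def)
    show "\<beta> i = \<beta> 0 * \<omega> i ^ p ^ (n - 1) + \<delta> i" if "1 \<le> i" "i < n" for i
      using that by (intro assms(17)) auto
    show "v (\<beta> i) < v (\<delta> i)" if "1 \<le> i" "i < n" for i
      using that by (intro assms(18)) auto
    show "brk l < brk m" if "l < m" "m < n" for l m using that by (rule en(2))
    show "real (p ^ n) * herb (of_int (brk i)) < of_int (brk (Suc i))" if "Suc i < n" for i
      using assms(19)[of "Suc i"] b1[of "Suc i"] u1[of i] that by simp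
    show "- real (p ^ (n - 1)) * r < of_int (brk i)" if "1 \<le> i" "i < n" "veq (\<delta> i) r" for i r
      using assms(20)[of i] b1[of i] that by (auto simp: veq_def)
  qed
  have npd: "\<not> int p dvd b i" if "i \<in> {1..n}" for i
  proof -
    have "i - 1 < n" using that by auto
    then show ?thesis unfolding en(1)[OF that] by (rule brk_not_dvd)
  qed
  have scaff: "\<exists>\<Psi> lam. galois_scaffold p n v K L b c \<Psi> lam"
    if c: "\<And>l. 1 \<le> l \<Longrightarrow> l < n \<Longrightarrow> real c \<le> of_int (brk l) - real (p ^ n) * U (l - 1)" for c :: nat
  proof -
    have B: "of_int (brk (i - 1)) / real (p ^ i) = of_int (b i) / real (p ^ i)" if "i \<in> {1..n}" for i
      using en(1)[OF that] by simp
    have vals: "\<exists>(d::nat \<Rightarrow> int) q::int. (\<forall>i\<in>{1..n}. 0 \<le> d i \<and> d i < int p) \<and>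
       of_int m / real (p ^ n) = of_int q - (\<Sum>i=1..n. of_int (d i) * (of_int (brk (i - 1)) / real (p ^ i)))" for m :: int
    proof (rule scaffold_values[OF prime])
      show "\<not> int p dvd brk (i - 1)" if "i \<in> {1..n}" for i using npd[OF that] en(1)[OF that] by simp
    qed
    \<comment> \<open>\<open>b\<close> is known to agree with \<open>?b\<close> on
      \<open>{1..n}\<close> only. The scaffold is built for \<open>?b\<close> and transferred, as
      its definition evaluates \<open>b\<close> only there.\<close>
    let ?b = "\<lambda>i. brk (i - 1)"
    have "\<exists>\<Psi> lam. galois_scaffold p n v K L ?b c \<Psi> lam"
    proof (rule galois_scaffold_of_data[OF scaffold_data[OF _ c vals]])
      fix i assume i: "i \<in> {1..n}"
      show "\<not> int p dvd brk (i - 1)" using npd[OF i] en(1)[OF i] by simp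
      have "of_int (brk (i - 1)) / real (p ^ i) \<le> U (i - 1) / real p"
      proof -
        have "real (p ^ i) = real (p ^ (i - 1)) * real p" using i by (cases i) auto
        then have "of_int (brk (i - 1)) / real (p ^ i) = of_int (brk (i - 1)) / real (p ^ (i - 1)) / real p" by simp
        also have "\<dots> \<le> U (i - 1) / real p"
          using brk_le_U[of "i - 1"] i p_pos by (intro divide_right_mono) (auto simp: pos_divide_le_eq mult.commute)
        finally show ?thesis .
      qed
      then show "real c / real (p ^ n) + of_int (brk (i - 1)) / real (p ^ i) \<le> real c / real (p ^ n) + U (i - 1) / real p" by simp
    qed auto
    then obtain \<Psi> lam where S: "galois_scaffold p n v K L ?b c \<Psi> lam" by blast
    have sb: "scaffold_b p n ?b = scaffold_b p n b"
    proof
      fix s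
      show "scaffold_b p n ?b s = scaffold_b p n b s"
        unfolding scaffold_b_def by (intro sum.cong refl) (use en(1) in auto)
    qed
    have sa: "scaffold_a p n ?b = scaffold_a p n b" by (intro ext) (simp only: scaffold_a_def sb)
    have "galois_scaffold p n v K L b c \<Psi> lam"
      using S unfolding galois_scaffold_def Let_def sa using en(1) by simp
    then show ?thesis by blast
  qed
  show ?thesis
  proof (intro conjI impI allI)
    assume n: "n \<ge> 2"
    let ?f = "\<lambda>i. real_of_int (b (i + 1)) - real (p ^ n) * u i"
    have ne: "?f ` {1..n - 1} \<noteq> {}" using n by auto
    \<comment> \<open>The precision must be a natural number: \<open>u i\<close> is an integer,
      being minus the value of an element of \<open>K\<close>.\<close>
    have int: "\<exists>m::int. ?f i = of_int m" if "i \<in> {1..n - 1}" for i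
    proof -
      have i: "i - 1 < n" "Suc (i - 1) = i" using that by auto
      have "veq (\<beta> (i - 1)) (- U (i - 1))" using asw_values[OF i(1)] unfolding asw_values_def by blast
      then obtain m :: int where "- U (i - 1) = of_int m" using K_int[OF \<beta>K[OF i(1)]] by blast
      then have "u i = of_int (- m)" using u1[OF i(1)] unfolding i(2) U_def by simp
      then have "?f i = of_int (b (i + 1) - int (p ^ n) * (- m))" by simp
      then show ?thesis by blast
    qed
    have "Min (?f ` {1..n - 1}) \<in> ?f ` {1..n - 1}" using ne by (intro Min_in) auto
    then obtain i where i: "i \<in> {1..n - 1}" "Min (?f ` {1..n - 1}) = ?f i" by blast
    obtain m :: int where m: "?f i = of_int m" using int[OF i(1)] by blast
    have "?f i > 0" using assms(19)[OF i(1)] by simp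
    then have m0: "m > 0" unfolding m by simp
    define c where "c = nat m"
    have c: "real c = Min (?f ` {1..n - 1})" using m0 m i(2) by (simp add: c_def)
    have "real c \<le> of_int (brk l) - real (p ^ n) * U (l - 1)" if l: "1 \<le> l" "l < n" for l
    proof -
      have "real c \<le> ?f l" unfolding c using l by (intro Min_le) auto
      then show ?thesis using b1[OF l(2)] u1[of "l - 1"] l by (simp add: U_def)
    qed
    then have "\<exists>\<Psi> lam. galois_scaffold p n v K L b c \<Psi> lam" by (rule scaff)
    moreover have "c \<ge> 1" using m0 by (simp add: c_def)
    ultimately show "\<exists>c::nat. real c = Min (?f ` {1..n - 1}) \<and> c \<ge> 1 \<and> (\<exists>\<Psi> lam. galois_scaffold p n v K L b c \<Psi> lam)"
      using c by blast
  next
    \<comment> \<open>For \<open>n = 1\<close> the condition in \<open>scaff\<close> ranges over no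
      index, so every \<open>c\<close> is admissible.\<close>
    fix c :: nat assume "n = 1" "c \<ge> 1"
    then show "\<exists>\<Psi> lam. galois_scaffold p n v K L b c \<Psi> lam" by (intro scaff) auto
  qed
qed

end
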